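(* Let $k$ be a field, let $m,n\ge 1$, and write $\underline{x}=x_1,\ldots,x_m$ and $\underline{y}=y_1,\ldots,y_n$. Consider either of the following two cases: (1) $A=k[\underline{x}]$, $B=k[\underline{y}]$ and $R=k[\underline{x},\underline{y}]$ (polynomial rings); (2) $A=k[[\underline{x}]]$, $B=k[[\underline{y}]]$ and $R=k[[\underline{x},\underline{y}]]$ (power series rings). Let $I'\subseteq A$ and $J'\subseteq B$ be ideals (homogeneous in case (1)), and let $\mathcal{I}'=I'R$ and $\mathcal{J}'=J'R$ be the ideals of $R$ they generate. Suppose $\mathcal{I}'\subseteq\langle\underline{x}\rangle^2$ and $\mathcal{J}'\subseteq\langle\underline{y}\rangle^2$. Set $S=A/I'$ and $T=B/J'$, and let $F:=S\times_k T$. Then \[\frac{P_{F}^{R}(t)-P_{R/(\mathcal{I}'+\mathfrak{M}_B)}^{R}(t)-P_{R/(\mathfrak{M}_A+\mathcal{J}')}^{R}(t)+P_{R/\mathfrak{M}_R}^{R}(t)}{P_{\langle\underline{x}\,\underline{y}\rangle}^{R}(t)}=t(1+t)\] and \[\frac{P_{F}^{R}(t)-(1+t)^nP_S^{A}(t)-(1+t)^mP_T^{B}(t)+(1+t)^{m+n}}{\left((1+t)^m-1\right)\left((1+t)^n-1\right)}=\frac{t+1}{t}.\]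
   Context: The fiber product is $S\times_kT=\{(s,t)\in S\times T:\pi_S(s)=\pi_T(t)\}$, where $\pi_S:S\to k$ and $\pi_T:T\to k$ are the natural surjections sending all variables to $0$. It is an $R$-module via the natural surjection $R\to S\times_k T$ induced by the projections $R\to S$ (killing $\underline y$ and $\mathcal I'$) and $R\to T$ (killing $\underline x$ and $\mathcal J'$). In the expressions $R/(\mathcal{I}'+\mathfrak{M}_B)$ and $R/(\mathfrak{M}_A+\mathcal{J}')$, $\mathfrak{M}_A$ and $\mathfrak{M}_B$ denote the ideals $\langle\underline{x}\rangle$ and $\langle\underline{y}\rangle$ of $R$; $\mathfrak{M}_R=\langle\underline{x},\underline{y}\rangle$; and $\langle\underline{x}\,\underline{y}\rangle$ is the ideal of $R$ generated by all products $x_iy_j$, regarded as an $R$-module. For a finitely generated (graded, in the polynomial case) module $M$ over $Q\in\{A,B,R\}$, the Poincaré series is $P_M^Q(t)=\sum_{i\ge0}\beta_i^Q(M)t^i$, where $\beta_i^Q(M)$ is the rank of the $i$-th free module in a minimal (graded) free resolution of $M$ over $Q$. Quotients of series are taken in the field of formal Laurent series in $t$. *)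

theory Defs
  imports
    "HOL-Library.Multiset"
    "HOL-Computational_Algebra.Formal_Laurent_Series"
    "HOL-Algebra.Ideal_Product"
    "HOL-Algebra.QuotRing"
    "HOL-Algebra.Module"
    "HOL-Algebra.Chinese_Remainder"
begin

section \<open>Polynomial and power series rings\<close>

text \<open>
  As in the library theory \<open>Indexed_Polynomials\<close>, a monomial is a multiset of variables (the
  multiplicity of a variable is its exponent, the size is the total degree) and a series is the
  family of its coefficients. The rings on all sets of variables live on one type, so that
  \<open>k[x]\<close> and \<open>k[y]\<close> are literally subrings of \<open>k[x,y]\<close>, and likewise for power series.
\<close>

datatype ring_kind = Polynomials | Power_Series

definition series_carrier :: "ring_kind \<Rightarrow> 'v set \<Rightarrow> ('v multiset \<Rightarrow> 'k::field) set" where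
  "series_carrier c V =
     {f. (\<forall>e. f e \<noteq> 0 \<longrightarrow> set_mset e \<subseteq> V) \<and> (c = Polynomials \<longrightarrow> finite {e. f e \<noteq> 0})}"

definition series_ring :: "ring_kind \<Rightarrow> 'v set \<Rightarrow> ('v multiset \<Rightarrow> 'k::field) ring" where
  "series_ring c V =
     \<lparr>carrier = series_carrier c V,
      mult = (\<lambda>f g e. \<Sum>a | a \<subseteq># e. f a * g (e - a)),
      one = (\<lambda>e. if e = {#} then 1 else 0),
      zero = (\<lambda>e. 0),
      add = (\<lambda>f g e. f e + g e)\<rparr>"

definition variable :: "'v \<Rightarrow> 'v multiset \<Rightarrow> 'k::field" where
  "variable v = (\<lambda>e. if e = {#v#} then 1 else 0)"

definition variable_ideal :: "ring_kind \<Rightarrow> 'v set \<Rightarrow> 'v set \<Rightarrow> ('v multiset \<Rightarrow> 'k::field) set" where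
  "variable_ideal c V U = Idl\<^bsub>series_ring c V\<^esub> (variable ` U)"

text \<open>Substitution of \<open>0\<close> for the variables outside \<open>U\<close>.\<close>

definition kill_outside :: "'v set \<Rightarrow> ('v multiset \<Rightarrow> 'k::field) \<Rightarrow> 'v multiset \<Rightarrow> 'k" where
  "kill_outside U f = (\<lambda>e. if set_mset e \<subseteq> U then f e else 0)"

text \<open>
  The homogeneous elements of degree \<open>d\<close>, together with \<open>0\<close>. Gradings are indexed by the integers
  because the graded pieces of a shifted free module \<open>Q(-s)\<close> are those of \<open>Q\<close> in degrees \<open>d - s\<close>.
\<close>

definition homogeneous_part ::
    "('v multiset \<Rightarrow> 'k::field, 'x) ring_scheme \<Rightarrow> int \<Rightarrow> ('v multiset \<Rightarrow> 'k) set" where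
  "homogeneous_part Q d = {f \<in> carrier Q. \<forall>e. f e \<noteq> 0 \<longrightarrow> int (size e) = d}"

definition homogeneous_ideal ::
    "('v multiset \<Rightarrow> 'k::field) set \<Rightarrow> ('v multiset \<Rightarrow> 'k, 'x) ring_scheme \<Rightarrow> bool" where
  "homogeneous_ideal I Q \<longleftrightarrow> (\<exists>G \<subseteq> (\<Union>d. homogeneous_part Q d). I = Idl\<^bsub>Q\<^esub> G)"


section \<open>Modules\<close>

record ('a, 'b) graded_module = "('a, 'b) module" +
  degree_part :: "int \<Rightarrow> 'b set"

text \<open>
  The module obtained from (the additive group of) \<open>N\<close> by letting scalars act through \<open>h\<close>,
  with graded pieces \<open>gr\<close>. The ring multiplication of \<open>N\<close> is kept but plays no role.
\<close>

definition module_via ::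
    "('a \<Rightarrow> 'b) \<Rightarrow> ('b, 'x) ring_scheme \<Rightarrow> (int \<Rightarrow> 'b set) \<Rightarrow> ('a, 'b) graded_module" where
  "module_via h N gr =
     \<lparr>carrier = carrier N, mult = mult N, one = one N, zero = zero N, add = add N,
      smult = (\<lambda>r x. h r \<otimes>\<^bsub>N\<^esub> x), degree_part = gr\<rparr>"

definition quotient_part ::
    "('v multiset \<Rightarrow> 'k::field) ring \<Rightarrow> ('v multiset \<Rightarrow> 'k) set \<Rightarrow> int \<Rightarrow>
     ('v multiset \<Rightarrow> 'k) set set" where
  "quotient_part Q I d = (\<lambda>f. I +>\<^bsub>Q\<^esub> f) ` homogeneous_part Q d"

definition quotient_module ::
    "('v multiset \<Rightarrow> 'k::field) ring \<Rightarrow> ('v multiset \<Rightarrow> 'k) set \<Rightarrow>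
     ('v multiset \<Rightarrow> 'k, ('v multiset \<Rightarrow> 'k) set) graded_module" where
  "quotient_module Q I = module_via (\<lambda>r. I +>\<^bsub>Q\<^esub> r) (Q Quot I) (quotient_part Q I)"

definition ideal_module ::
    "('v multiset \<Rightarrow> 'k::field) ring \<Rightarrow> ('v multiset \<Rightarrow> 'k) set \<Rightarrow>
     ('v multiset \<Rightarrow> 'k, 'v multiset \<Rightarrow> 'k) graded_module" where
  "ideal_module Q I = module_via (\<lambda>r. r) (Q\<lparr>carrier := I\<rparr>) (\<lambda>d. I \<inter> homogeneous_part Q d)"


section \<open>Fiber products\<close>

text \<open>
  The surjection \<open>Q/I \<rightarrow> k\<close> sending all variables to \<open>0\<close>, where \<open>I\<close> consists of elements without
  constant term: all elements of a coset have the same constant term.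
\<close>

definition residue_map :: "('v multiset \<Rightarrow> 'k::field) set \<Rightarrow> 'k" where
  "residue_map C = the_elem ((\<lambda>f. f {#}) ` C)"

definition fiber_product_ring ::
    "('v multiset \<Rightarrow> 'k::field) set ring \<Rightarrow> ('v multiset \<Rightarrow> 'k) set ring \<Rightarrow>
     (('v multiset \<Rightarrow> 'k) set \<times> ('v multiset \<Rightarrow> 'k) set) ring" where
  "fiber_product_ring S T =
     (RDirProd S T)
       \<lparr>carrier := {(s, t) \<in> carrier S \<times> carrier T. residue_map s = residue_map t}\<rparr>"

text \<open>
  \<open>A/I \<times>\<^sub>k B/J\<close>, for \<open>A\<close> and \<open>B\<close> the rings on the variables \<open>U\<close> and \<open>W\<close>, as a module over the ring
  on the variables \<open>U \<union> W\<close>.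
\<close>

definition fiber_product ::
    "ring_kind \<Rightarrow> 'v set \<Rightarrow> 'v set \<Rightarrow> ('v multiset \<Rightarrow> 'k::field) set \<Rightarrow> ('v multiset \<Rightarrow> 'k) set \<Rightarrow>
     ('v multiset \<Rightarrow> 'k, ('v multiset \<Rightarrow> 'k) set \<times> ('v multiset \<Rightarrow> 'k) set) graded_module" where
  "fiber_product c U W I J =
     (let A = series_ring c U; B = series_ring c W; F = fiber_product_ring (A Quot I) (B Quot J)
      in module_via
           (\<lambda>r. (I +>\<^bsub>A\<^esub> kill_outside U r, J +>\<^bsub>B\<^esub> kill_outside W r))
           F
           (\<lambda>d. carrier F \<inter> (quotient_part A I d \<times> quotient_part B J d)))"


section \<open>Minimal free resolutions and Poincare series\<close>

definition module_homs ::
    "('a, 'x) ring_scheme \<Rightarrow> ('a, 'b, 'y) module_scheme \<Rightarrow> ('a, 'c, 'z) module_scheme \<Rightarrow>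
     ('b \<Rightarrow> 'c) set" where
  "module_homs Q M N =
     {f \<in> hom (add_monoid M) (add_monoid N).
        \<forall>r\<in>carrier Q. \<forall>x\<in>carrier M. f (r \<odot>\<^bsub>M\<^esub> x) = r \<odot>\<^bsub>N\<^esub> f x}"

definition free_module :: "('a, 'x) ring_scheme \<Rightarrow> nat \<Rightarrow> ('a, nat \<Rightarrow> 'a) module" where
  "free_module Q b =
     \<lparr>carrier = {..<b} \<rightarrow>\<^sub>E carrier Q, mult = undefined, one = undefined,
      zero = (\<lambda>l\<in>{..<b}. \<zero>\<^bsub>Q\<^esub>),
      add = (\<lambda>u v. \<lambda>l\<in>{..<b}. u l \<oplus>\<^bsub>Q\<^esub> v l),
      smult = (\<lambda>r v. \<lambda>l\<in>{..<b}. r \<otimes>\<^bsub>Q\<^esub> v l)\<rparr>"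

text \<open>
  An exact complex \<open>\<dots> \<rightarrow> Q\<^sup>b\<^sup>2 \<rightarrow> Q\<^sup>b\<^sup>1 \<rightarrow> Q\<^sup>b\<^sup>0 \<rightarrow> M \<rightarrow> 0\<close> of \<open>Q\<close>-modules with
  augmentation \<open>p\<close> and differentials \<open>\<phi> i\<close>, from the free module of rank \<open>b (i + 1)\<close> to the one of
  rank \<open>b i\<close>.
\<close>

definition free_resolution ::
    "('a, 'x) ring_scheme \<Rightarrow> ('a, 'b, 'y) module_scheme \<Rightarrow> (nat \<Rightarrow> nat) \<Rightarrow>
     ((nat \<Rightarrow> 'a) \<Rightarrow> 'b) \<Rightarrow> (nat \<Rightarrow> (nat \<Rightarrow> 'a) \<Rightarrow> nat \<Rightarrow> 'a) \<Rightarrow> bool" where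
  "free_resolution Q M b p \<phi> \<longleftrightarrow>
     p \<in> module_homs Q (free_module Q (b 0)) M \<and>
     (\<forall>i. \<phi> i \<in> module_homs Q (free_module Q (b (Suc i))) (free_module Q (b i))) \<and>
     p ` carrier (free_module Q (b 0)) = carrier M \<and>
     \<phi> 0 ` carrier (free_module Q (b 1)) = a_kernel (free_module Q (b 0)) M p \<and>
     (\<forall>i. \<phi> (Suc i) ` carrier (free_module Q (b (Suc (Suc i)))) =
          a_kernel (free_module Q (b (Suc i))) (free_module Q (b i)) (\<phi> i))"

text \<open>Minimality with respect to the maximal ideal \<open>\<mm>\<close>: the image of \<open>\<phi> i\<close> lies in \<open>\<mm>Q\<^sup>b\<close>.\<close>

definition minimal_complex ::
    "('a, 'x) ring_scheme \<Rightarrow> 'a set \<Rightarrow> (nat \<Rightarrow> nat) \<Rightarrow>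
     (nat \<Rightarrow> (nat \<Rightarrow> 'a) \<Rightarrow> nat \<Rightarrow> 'a) \<Rightarrow> bool" where
  "minimal_complex Q \<mm> b \<phi> \<longleftrightarrow>
     (\<forall>i. \<phi> i ` carrier (free_module Q (b (Suc i))) \<subseteq> {..<b i} \<rightarrow>\<^sub>E \<mm>)"

text \<open>
  The degree \<open>d\<close> piece of the graded free module \<open>Q(-s 0) \<oplus> \<dots> \<oplus> Q(-s (b - 1))\<close>, whose \<open>l\<close>-th basis
  element has degree \<open>s l\<close>.
\<close>

definition free_part ::
    "('v multiset \<Rightarrow> 'k::field) ring \<Rightarrow> nat \<Rightarrow> (nat \<Rightarrow> int) \<Rightarrow> int \<Rightarrow>
     (nat \<Rightarrow> 'v multiset \<Rightarrow> 'k) set" where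
  "free_part Q b s d = (\<Pi>\<^sub>E l\<in>{..<b}. homogeneous_part Q (d - s l))"

text \<open>All maps preserve degrees when the \<open>i\<close>-th free module carries the shifts \<open>s i\<close>.\<close>

definition graded_complex ::
    "('v multiset \<Rightarrow> 'k::field) ring \<Rightarrow> ('v multiset \<Rightarrow> 'k, 'b) graded_module \<Rightarrow> (nat \<Rightarrow> nat) \<Rightarrow>
     (nat \<Rightarrow> nat \<Rightarrow> int) \<Rightarrow> ((nat \<Rightarrow> 'v multiset \<Rightarrow> 'k) \<Rightarrow> 'b) \<Rightarrow>
     (nat \<Rightarrow> (nat \<Rightarrow> 'v multiset \<Rightarrow> 'k) \<Rightarrow> nat \<Rightarrow> 'v multiset \<Rightarrow> 'k) \<Rightarrow> bool" where
  "graded_complex Q M b s p \<phi> \<longleftrightarrow>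
     (\<forall>d. p ` free_part Q (b 0) (s 0) d \<subseteq> degree_part M d) \<and>
     (\<forall>i d. \<phi> i ` free_part Q (b (Suc i)) (s (Suc i)) d \<subseteq> free_part Q (b i) (s i) d)"

definition minimal_free_resolution ::
    "ring_kind \<Rightarrow> 'v set \<Rightarrow> ('v multiset \<Rightarrow> 'k::field, 'b) graded_module \<Rightarrow> (nat \<Rightarrow> nat) \<Rightarrow>
     ((nat \<Rightarrow> 'v multiset \<Rightarrow> 'k) \<Rightarrow> 'b) \<Rightarrow>
     (nat \<Rightarrow> (nat \<Rightarrow> 'v multiset \<Rightarrow> 'k) \<Rightarrow> nat \<Rightarrow> 'v multiset \<Rightarrow> 'k) \<Rightarrow> bool" where
  "minimal_free_resolution c V M b p \<phi> \<longleftrightarrow>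
     (let Q = series_ring c V in
      free_resolution Q M b p \<phi> \<and>
      minimal_complex Q (variable_ideal c V V) b \<phi> \<and>
      (c = Polynomials \<longrightarrow> (\<exists>s. graded_complex Q M b s p \<phi>)))"

definition betti ::
    "ring_kind \<Rightarrow> 'v set \<Rightarrow> ('v multiset \<Rightarrow> 'k::field, 'b) graded_module \<Rightarrow> nat \<Rightarrow> nat" where
  "betti c V M i = (THE r. \<exists>b p \<phi>. minimal_free_resolution c V M b p \<phi> \<and> b i = r)"

definition poincare_series ::
    "ring_kind \<Rightarrow> 'v set \<Rightarrow> ('v multiset \<Rightarrow> 'k::field, 'b) graded_module \<Rightarrow> rat fls" where
  "poincare_series c V M = fps_to_fls (Abs_fps (\<lambda>i. of_nat (betti c V M i)))"


section \<open>The two sets of variables\<close>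

datatype var = X nat | Y nat

end

theory Submission
  imports
    Defs
    "HOL-Library.Function_Algebras"
    "HOL-Library.Multiset_Order"
    "HOL-Library.Product_Lexorder"
begin

text \<open>
  Let \<open>Q\<close> be the ring of polynomials or power series on a finite set \<open>V\<close> of variables. The Koszul
  complex \<open>K(Q)\<close> on the variables resolves \<open>k\<close>, so \<open>Tor\<^sub>j(k, Q/I)\<close>, whose dimension is the \<open>j\<close>-th Betti
  number of \<open>Q/I\<close>, is the homology of \<open>K(Q/I)\<close>. Lifted to chains with entries in \<open>Q\<close>, this homology is
  \<open>P\<^sub>j/N\<^sub>j\<close>, where \<open>P\<^sub>j\<close> consists of the chains \<open>z\<close> in \<open>K\<^sub>j(Q)\<close> with \<open>d z\<close> in \<open>K(I)\<close>, and
  \<open>N\<^sub>j = K\<^sub>j(I) + d K\<^sub>j\<^sub>+\<^sub>1(Q)\<close>. Theorem \<open>betti_koszul\<close> identifies \<open>dim P\<^sub>j/N\<^sub>j\<close> with the Betti number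
  for every minimal resolution; the equality is obtained by shifting along the syzygies of the
  resolution. Since Betti numbers are specified by a definite description, a minimal resolution also has
  to exist (\<open>minimal_resolution_exists\<close>): submodules of free modules are finitely generated by a division
  algorithm with lowest leading terms, which serves polynomials and power series alike, and a least set
  of (homogeneous) generators gives syzygies without constant terms.

  All modules of the theorem except \<open>\<langle>xy\<rangle>\<close> are cyclic over \<open>R\<close>, hence quotients \<open>R/I\<close>. With
  \<open>I\<^sub>S = {f. f(x, 0) \<in> I'}\<close> and \<open>I\<^sub>T = {f. f(0, y) \<in> J'}\<close> one has \<open>I\<^sub>S = I'R + \<langle>y\<rangle>\<close>,
  \<open>I\<^sub>T = \<langle>x\<rangle> + J'R\<close> and \<open>F = R/(I\<^sub>S \<inter> I\<^sub>T)\<close>. A variable that acts as zero doubles the Koszul complex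
  (\<open>add_variable\<close>), so the Poincare series of \<open>R/I\<^sub>S\<close> is \<open>(1 + t)\<^sup>n\<close> times that of \<open>S\<close> over \<open>A\<close>;
  the same argument gives \<open>(1 + t)\<^sup>m\<^sup>+\<^sup>n\<close> for \<open>R/\<langle>x, y\<rangle> = k\<close>.

  The core is \<open>qdim_fiber\<close>. Write \<open>P\<^sub>S, N\<^sub>S, P\<^sub>T, N\<^sub>T, P\<^sub>F, N\<^sub>F\<close> for the spaces above belonging to
  \<open>I\<^sub>S, I\<^sub>T, I\<^sub>S \<inter> I\<^sub>T\<close>. Then \<open>P\<^sub>F = P\<^sub>S \<inter> P\<^sub>T\<close>, and in degree \<open>j > 0\<close> the quotient \<open>P\<^sub>F/N\<^sub>F\<close> has two
  layers. The upper one, \<open>P\<^sub>F/(N\<^sub>S \<inter> N\<^sub>T)\<close>, has dimension \<open>s\<^sub>j - (n choose j) + t\<^sub>j - (m choose j)\<close> with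
  \<open>s\<^sub>j = dim P\<^sub>S/N\<^sub>S\<close> and \<open>t\<^sub>j = dim P\<^sub>T/N\<^sub>T\<close>: since \<open>I'\<close> has no terms of degree below \<open>2\<close>, a constant term of a
  chain in \<open>P\<^sub>S\<close> can only sit at a set of \<open>y\<close>-variables, and a chain \<open>z\<close> without constant terms is the sum of
  \<open>z(x, 0)\<close>, which has entries in \<open>I\<^sub>T\<close>, and \<open>z - z(x, 0)\<close>, which has entries in \<open>I\<^sub>S\<close>. The lower one,
  \<open>(N\<^sub>S \<inter> N\<^sub>T)/N\<^sub>F\<close>, is isomorphic by a connecting map to \<open>K\<^sub>j\<^sub>+\<^sub>1(R)/(P\<^sub>S + P\<^sub>T)\<close>, which only sees constant
  terms at the sets of \<open>j + 1\<close> variables that meet both \<open>x\<close> and \<open>y\<close>. If \<open>q\<^sub>j\<close> denotes the number of such sets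
  with \<open>j\<close> elements, then \<open>q\<close> has generating function \<open>((1 + t)\<^sup>m - 1)((1 + t)\<^sup>n - 1)\<close>, and summing over \<open>j\<close>
  gives the second identity.

  For \<open>I' = J' = 0\<close> the module \<open>F\<close> becomes \<open>R/\<langle>xy\<rangle>\<close>, with Betti numbers \<open>q\<^sub>j\<^sub>+\<^sub>1\<close> for \<open>j > 0\<close>. A minimal
  resolution of \<open>\<langle>xy\<rangle>\<close> is one of \<open>R/\<langle>xy\<rangle>\<close> without its first term (\<open>betti_ideal_module\<close>), so the
  Poincare series of \<open>\<langle>xy\<rangle>\<close> times \<open>t\<^sup>2\<close> is the generating function of \<open>q\<close>, and the first identity follows.
\<close>

section \<open>Dimensions of quotient spaces\<close>

text \<open>
  Chains have type \<open>'s \<Rightarrow> 'i \<Rightarrow> 'k\<close>: in a Koszul complex the first index is a set of variables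
  and the second one indexes the coefficients of an entry.
\<close>

definition csc :: "'k::field \<Rightarrow> ('s \<Rightarrow> 'i \<Rightarrow> 'k) \<Rightarrow> 's \<Rightarrow> 'i \<Rightarrow> 'k" where
  "csc c z = (\<lambda>\<sigma> i. c * z \<sigma> i)"

lemma csc_apply: "csc c z \<sigma> i = c * z \<sigma> i"
  by (simp add: csc_def)

\<comment> \<open>Equations between chains are kept at the level of functions; their entries are compared only on demand.\<close>
declare plus_fun_apply [simp del] zero_fun_apply [simp del] minus_apply [simp del] uminus_apply [simp del]

lemmas pointwise = plus_fun_apply zero_fun_apply minus_apply uminus_apply csc_apply

lemma csc_simps:
  "csc c (z + w) = csc c z + csc c w" "csc c (z - w) = csc c z - csc c w"
  "csc (c + d) z = csc c z + csc d z" "csc (c - d) z = csc c z - csc d z"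
  "csc c (csc d z) = csc (c * d) z" "csc 0 z = 0" "csc c 0 = 0" "csc 1 z = z"
  "csc (- c) z = - csc c z" "csc c (- z) = - csc c z"
  by (auto simp: fun_eq_iff pointwise algebra_simps)

lemma sum_fun_apply: "sum f S x = (\<Sum>i\<in>S. f i x)"
  for f :: "'a \<Rightarrow> 'b \<Rightarrow> 'c::comm_monoid_add"
  by (induction S rule: infinite_finite_induct) (simp_all add: pointwise)

lemma csc_sum: "csc c (sum f S) = (\<Sum>i\<in>S. csc c (f i))"
  by (simp add: pointwise fun_eq_iff sum_fun_apply sum_distrib_left)

lemma csc_sum_left: "csc (sum f S) z = (\<Sum>i\<in>S. csc (f i) z)"
  by (simp add: pointwise fun_eq_iff sum_fun_apply sum_distrib_right)

definition ksub :: "('s \<Rightarrow> 'i \<Rightarrow> 'k::field) set \<Rightarrow> bool" where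
  "ksub U \<longleftrightarrow> 0 \<in> U \<and> (\<forall>u\<in>U. \<forall>v\<in>U. u + v \<in> U) \<and> (\<forall>c. \<forall>u\<in>U. csc c u \<in> U)"

lemma ksubI:
  assumes "0 \<in> U" "\<And>u v. u \<in> U \<Longrightarrow> v \<in> U \<Longrightarrow> u + v \<in> U" "\<And>c u. u \<in> U \<Longrightarrow> csc c u \<in> U"
  shows "ksub U"
  using assms by (auto simp: ksub_def)

lemma ksub_0: "ksub U \<Longrightarrow> 0 \<in> U" by (simp add: ksub_def)
lemma ksub_add: "ksub U \<Longrightarrow> u \<in> U \<Longrightarrow> v \<in> U \<Longrightarrow> u + v \<in> U" by (simp add: ksub_def)
lemma ksub_csc: "ksub U \<Longrightarrow> u \<in> U \<Longrightarrow> csc c u \<in> U" by (simp add: ksub_def)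
lemma ksub_neg: "ksub U \<Longrightarrow> u \<in> U \<Longrightarrow> - u \<in> U"
  using ksub_csc[of U u "-1"] by (simp add: csc_simps)
lemma ksub_diff: "ksub U \<Longrightarrow> u \<in> U \<Longrightarrow> v \<in> U \<Longrightarrow> u - v \<in> U"
  using ksub_add[of U u "- v"] ksub_neg[of U v] by simp
lemma ksub_sum: "ksub U \<Longrightarrow> (\<And>i. i \<in> S \<Longrightarrow> f i \<in> U) \<Longrightarrow> sum f S \<in> U"
  by (induction S rule: infinite_finite_induct) (auto intro: ksub_0 ksub_add)
lemma ksub_Int: "ksub U \<Longrightarrow> ksub W \<Longrightarrow> ksub (U \<inter> W)"
  by (auto simp: ksub_def)
lemma ksub_add_iff: "ksub U \<Longrightarrow> v \<in> U \<Longrightarrow> u + v \<in> U \<longleftrightarrow> u \<in> U"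
  using ksub_add[of U u v] ksub_diff[of U "u + v" v] by auto

definition klin :: "('s \<Rightarrow> 'i \<Rightarrow> 'k::field) set \<Rightarrow> (('s \<Rightarrow> 'i \<Rightarrow> 'k) \<Rightarrow> ('t \<Rightarrow> 'j \<Rightarrow> 'k)) \<Rightarrow> bool" where
  "klin U f \<longleftrightarrow> (\<forall>u\<in>U. \<forall>v\<in>U. f (u + v) = f u + f v) \<and> (\<forall>c. \<forall>u\<in>U. f (csc c u) = csc c (f u))"

lemma klin_0: "klin U f \<Longrightarrow> ksub U \<Longrightarrow> f 0 = 0"
  unfolding klin_def using csc_simps(6)[of 0] csc_simps(6) ksub_0 by metis

lemma klin_add: "klin U f \<Longrightarrow> u \<in> U \<Longrightarrow> v \<in> U \<Longrightarrow> f (u + v) = f u + f v"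
  by (simp add: klin_def)

lemma klin_csc: "klin U f \<Longrightarrow> u \<in> U \<Longrightarrow> f (csc c u) = csc c (f u)"
  by (simp add: klin_def)

lemma klin_diff: "klin U f \<Longrightarrow> ksub U \<Longrightarrow> u \<in> U \<Longrightarrow> v \<in> U \<Longrightarrow> f (u - v) = f u - f v"
  using klin_add[of U f u "csc (-1) v"] klin_csc[of U f v "-1"] ksub_neg[of U v]
  by (simp add: csc_simps)

lemma klin_sum:
  assumes f: "klin U f" and U: "ksub U" and g: "\<And>i. i \<in> S \<Longrightarrow> g i \<in> U"
  shows "f (sum g S) = (\<Sum>i\<in>S. f (g i))"
proof (cases "finite S")
  case True
  from True g show ?thesis
  proof (induction S rule: finite_induct)
    case empty
    show "f (sum g {}) = (\<Sum>i\<in>{}. f (g i))" using klin_0[OF f U] by simp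
  next
    case (insert x F)
    have "f (g x + sum g F) = f (g x) + f (sum g F)"
      using insert.prems U by (intro klin_add[OF f] ksub_sum) auto
    with insert.hyps insert.IH insert.prems show "f (sum g (insert x F)) = (\<Sum>i\<in>insert x F. f (g i))" by simp
  qed
qed (use klin_0[OF f U] in simp)

definition lcomb :: "nat \<Rightarrow> (nat \<Rightarrow> 'k::field) \<Rightarrow> (nat \<Rightarrow> 's \<Rightarrow> 'i \<Rightarrow> 'k) \<Rightarrow> 's \<Rightarrow> 'i \<Rightarrow> 'k" where
  "lcomb n c e = (\<Sum>i<n. csc (c i) (e i))"

lemma lcomb_in: "ksub U \<Longrightarrow> (\<And>i. i < n \<Longrightarrow> e i \<in> U) \<Longrightarrow> lcomb n c e \<in> U"
  by (auto simp: lcomb_def intro!: ksub_sum ksub_csc)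

lemma lcomb_cong: "(\<And>i. i < n \<Longrightarrow> c i = d i) \<Longrightarrow> (\<And>i. i < n \<Longrightarrow> e i = e' i) \<Longrightarrow> lcomb n c e = lcomb n d e'"
  by (auto simp: lcomb_def)

lemma klin_lcomb: "klin U f \<Longrightarrow> ksub U \<Longrightarrow> (\<And>i. i < n \<Longrightarrow> e i \<in> U) \<Longrightarrow> f (lcomb n c e) = lcomb n c (\<lambda>i. f (e i))"
  unfolding lcomb_def by (subst klin_sum[of U f]) (auto simp: ksub_csc klin_csc intro!: sum.cong)

definition indep_mod :: "('s \<Rightarrow> 'i \<Rightarrow> 'k::field) set \<Rightarrow> nat \<Rightarrow> (nat \<Rightarrow> 's \<Rightarrow> 'i \<Rightarrow> 'k) \<Rightarrow> bool" where
  "indep_mod W n e \<longleftrightarrow> (\<forall>c. lcomb n c e \<in> W \<longrightarrow> (\<forall>i<n. c i = 0))"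

definition span_mod :: "('s \<Rightarrow> 'i \<Rightarrow> 'k::field) set \<Rightarrow> ('s \<Rightarrow> 'i \<Rightarrow> 'k) set \<Rightarrow> nat \<Rightarrow> (nat \<Rightarrow> 's \<Rightarrow> 'i \<Rightarrow> 'k) \<Rightarrow> bool" where
  "span_mod U W n e \<longleftrightarrow> (\<forall>i<n. e i \<in> U) \<and> (\<forall>u\<in>U. \<exists>c. u - lcomb n c e \<in> W)"

text \<open>
  The dimension of \<open>U/(U \<inter> W)\<close>. It is a relation, because the spaces are usually not known to be of finite
  codimension in advance; \<open>W\<close> need not lie in \<open>U\<close>, which allows \<open>U\<close> to vary modulo a fixed \<open>W\<close>.
\<close>

definition qdim :: "('s \<Rightarrow> 'i \<Rightarrow> 'k::field) set \<Rightarrow> ('s \<Rightarrow> 'i \<Rightarrow> 'k) set \<Rightarrow> nat \<Rightarrow> bool" where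
  "qdim U W n \<longleftrightarrow> (\<exists>e. span_mod U W n e \<and> indep_mod W n e)"

text \<open>
  Elimination of one unknown with the help of the last equation, by induction on the number of equations.
\<close>

lemma nontrivial_solution:
  fixes A :: "nat \<Rightarrow> nat \<Rightarrow> 'k::field"
  assumes "n < m"
  shows "\<exists>c. (\<exists>i<m. c i \<noteq> 0) \<and> (\<forall>j<n. (\<Sum>i<m. c i * A i j) = 0)"
  using assms
proof (induction n arbitrary: m A)
  case 0
  then show ?case by (auto intro!: exI[of _ "\<lambda>_. 1"])
next
  case (Suc n)
  obtain m' where m': "m = Suc m'" "n < m'" using Suc.prems by (cases m) auto
  show ?case
  proof (cases "\<forall>i<m. A i n = 0")
    case True
    from Suc.IH[of m A] Suc.prems obtain c where "\<exists>i<m. c i \<noteq> 0" "\<forall>j<n. (\<Sum>i<m. c i * A i j) = 0" by auto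
    with True show ?thesis by (intro exI[of _ c]) (auto simp: less_Suc_eq)
  next
    case False
    then obtain p where p: "p < m" "A p n \<noteq> 0" by auto
    \<comment> \<open>Row \<open>p\<close> is swapped with the last one and used to clear the column \<open>n\<close>.\<close>
    define q where "q i = (if i = p then m' else i)" for i
    define B where "B i j = A (q i) j - A (q i) n / A p n * A p j" for i j
    from Suc.IH[OF m'(2), of B] obtain c where c: "\<exists>i<m'. c i \<noteq> 0" "\<forall>j<n. (\<Sum>i<m'. c i * B i j) = 0" by auto
    define S where "S = (\<Sum>i<m'. c i * A (q i) n / A p n)"
    define d where "d i = (if i = p then - S else if i = m' then c p else c i)" for i
    have bij: "(\<Sum>i<m. d i * A i j) = (\<Sum>i<m'. c i * A (q i) j) - S * A p j" for j
    proof -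
      have "(\<Sum>i<m. d i * A i j) = d p * A p j + (\<Sum>i\<in>{..<m}-{p}. d i * A i j)"
        using p by (subst sum.remove[of _ p]) auto
      also have "(\<Sum>i\<in>{..<m}-{p}. d i * A i j) = (\<Sum>i<m'. c i * A (q i) j)"
        by (rule sum.reindex_bij_witness[of _ q "\<lambda>i. if i = m' then p else i"])
           (use p m' in \<open>auto simp: q_def d_def split: if_splits\<close>)
      finally show ?thesis by (simp add: d_def)
    qed
    have eqB: "(\<Sum>i<m'. c i * B i j) = (\<Sum>i<m'. c i * A (q i) j) - S * A p j" for j
      by (simp add: B_def S_def algebra_simps sum_subtractf sum_distrib_left sum_distrib_right)
    have "(\<Sum>i<m. d i * A i j) = 0" if "j < Suc n" for j
    proof (cases "j = n")
      case True
      have "(\<Sum>i<m. d i * A i n) = (\<Sum>i<m'. c i * B i n)" by (simp only: bij eqB)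
      also have "\<dots> = 0" using p by (intro sum.neutral) (auto simp: B_def)
      finally show ?thesis using True by simp
    next
      case False
      with that have "j < n" by simp
      with c(2) show ?thesis by (simp add: bij eqB)
    qed
    moreover have "\<exists>i<m. d i \<noteq> 0"
    proof -
      from c(1) obtain i where i: "i < m'" "c i \<noteq> 0" by auto
      then have "d (q i) \<noteq> 0" "q i < m" using m' p by (auto simp: d_def q_def split: if_splits)
      then show ?thesis by auto
    qed
    ultimately show ?thesis by blast
  qed
qed

lemma indep_le_span:
  assumes W: "ksub W" and f: "span_mod U W n f" and e: "indep_mod W m e" and eU: "\<And>i. i < m \<Longrightarrow> e i \<in> U"
  shows "m \<le> n"
proof (rule ccontr)
  assume "\<not> m \<le> n"
  then have "n < m" by simp
  have "\<forall>i. \<exists>A. i < m \<longrightarrow> e i - lcomb n A f \<in> W" using f eU by (auto simp: span_mod_def)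
  then obtain A where A: "\<And>i. i < m \<Longrightarrow> e i - lcomb n (A i) f \<in> W" by metis
  from nontrivial_solution[OF \<open>n < m\<close>, of A] obtain c where
    c: "\<exists>i<m. c i \<noteq> 0" "\<forall>j<n. (\<Sum>i<m. c i * A i j) = 0" by auto
  have "(\<Sum>i<m. csc (c i) (e i - lcomb n (A i) f)) \<in> W"
    using A W by (auto intro!: ksub_sum ksub_csc)
  also have "(\<Sum>i<m. csc (c i) (e i - lcomb n (A i) f)) = lcomb m c e - (\<Sum>i<m. csc (c i) (lcomb n (A i) f))"
    by (simp add: csc_simps sum_subtractf lcomb_def)
  also have "(\<Sum>i<m. csc (c i) (lcomb n (A i) f)) = (\<Sum>j<n. csc (\<Sum>i<m. c i * A i j) (f j))"
    by (simp add: lcomb_def csc_sum csc_simps csc_sum_left) (rule sum.swap)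
  also have "\<dots> = 0" using c by (simp add: csc_simps)
  finally show False using e c by (auto simp: indep_mod_def)
qed

lemma qdim_unique: "ksub W \<Longrightarrow> qdim U W n \<Longrightarrow> qdim U W m \<Longrightarrow> n = m"
  by (rule antisym; auto simp: qdim_def intro!: indep_le_span[of W U] dest: span_mod_def[THEN iffD1])

text \<open>
  The linear map \<open>f\<close> induces an isomorphism \<open>U/W \<rightarrow> U'/W'\<close>. That \<open>f\<close> is onto only modulo \<open>W'\<close> is what the
  second isomorphism theorem requires: there \<open>f\<close> is the inclusion of a subspace.
\<close>

lemma qdim_image_mod:
  assumes f: "klin U f" and U: "ksub U" and W': "ksub W'" and into: "f ` U \<subseteq> U'"
    and onto: "\<And>u'. u' \<in> U' \<Longrightarrow> \<exists>u\<in>U. u' - f u \<in> W'"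
    and W: "\<And>u. u \<in> U \<Longrightarrow> u \<in> W \<longleftrightarrow> f u \<in> W'"
  shows "qdim U W n \<longleftrightarrow> qdim U' W' n"
proof -
  \<comment> \<open>Bases correspond as soon as \<open>e' i\<close> and \<open>f (e i)\<close> agree modulo \<open>W'\<close>, in both directions.\<close>
  have key: "(span_mod U W n e \<and> indep_mod W n e) \<longleftrightarrow> (span_mod U' W' n e' \<and> indep_mod W' n e')"
    if e: "\<And>i. i < n \<Longrightarrow> e i \<in> U" and e': "\<And>i. i < n \<Longrightarrow> e' i \<in> U'" and ee: "\<And>i. i < n \<Longrightarrow> e' i - f (e i) \<in> W'" for e e'
  proof -
    have lc: "lcomb n c e \<in> U" "f (lcomb n c e) = lcomb n c (\<lambda>i. f (e i))" for c
      using e f U by (auto intro: lcomb_in klin_lcomb)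
    have d: "lcomb n c e' - f (lcomb n c e) \<in> W'" for c
    proof -
      have "lcomb n c e' - lcomb n c (\<lambda>i. f (e i)) = lcomb n c (\<lambda>i. e' i - f (e i))"
        by (simp add: lcomb_def sum_subtractf csc_simps)
      then show ?thesis using lcomb_in[OF W' ee] by (simp add: lc)
    qed
    have diff: "u - lcomb n c e \<in> W \<longleftrightarrow> u' - lcomb n c e' \<in> W'" if u: "u \<in> U" "u' - f u \<in> W'" for u u' c
    proof -
      have "u - lcomb n c e \<in> W \<longleftrightarrow> f u - f (lcomb n c e) \<in> W'"
        using W[OF ksub_diff[OF U u(1) lc(1)]] klin_diff[OF f U u(1) lc(1)] by simp
      moreover have "u' - lcomb n c e' = (f u - f (lcomb n c e)) + ((u' - f u) - (lcomb n c e' - f (lcomb n c e)))" by simp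
      ultimately show ?thesis using ksub_add_iff[OF W' ksub_diff[OF W' u(2) d]] by metis
    qed
    have ind: "lcomb n c e \<in> W \<longleftrightarrow> lcomb n c e' \<in> W'" for c
      using W[OF lc(1), of c] ksub_add_iff[OF W' d, of "f (lcomb n c e)" c] by simp
    have "(\<forall>u\<in>U. \<exists>c. u - lcomb n c e \<in> W) \<longleftrightarrow> (\<forall>u'\<in>U'. \<exists>c. u' - lcomb n c e' \<in> W')"
    proof
      assume *: "\<forall>u\<in>U. \<exists>c. u - lcomb n c e \<in> W"
      show "\<forall>u'\<in>U'. \<exists>c. u' - lcomb n c e' \<in> W'"
      proof
        fix u' assume "u' \<in> U'"
        then obtain u where u: "u \<in> U" "u' - f u \<in> W'" using onto by blast
        then show "\<exists>c. u' - lcomb n c e' \<in> W'" using * diff by blast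
      qed
    next
      assume *: "\<forall>u'\<in>U'. \<exists>c. u' - lcomb n c e' \<in> W'"
      show "\<forall>u\<in>U. \<exists>c. u - lcomb n c e \<in> W"
      proof
        fix u assume u: "u \<in> U"
        then have "f u \<in> U'" "f u - f u \<in> W'" using into ksub_0[OF W'] by auto
        then show "\<exists>c. u - lcomb n c e \<in> W" using * diff[OF u] by blast
      qed
    qed
    then show ?thesis using e e' ind by (simp add: span_mod_def indep_mod_def)
  qed
  show ?thesis
  proof
    assume "qdim U W n"
    then obtain e where e: "span_mod U W n e" "indep_mod W n e" by (auto simp: qdim_def)
    then have eU: "\<And>i. i < n \<Longrightarrow> e i \<in> U" by (simp add: span_mod_def)
    have "span_mod U' W' n (\<lambda>i. f (e i)) \<and> indep_mod W' n (\<lambda>i. f (e i))"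
      using key[of e "\<lambda>i. f (e i)"] e eU into ksub_0[OF W'] by auto
    then show "qdim U' W' n" by (auto simp: qdim_def)
  next
    assume "qdim U' W' n"
    then obtain e' where e': "span_mod U' W' n e'" "indep_mod W' n e'" by (auto simp: qdim_def)
    then have eU': "\<And>i. i < n \<Longrightarrow> e' i \<in> U'" by (simp add: span_mod_def)
    then have "\<forall>i. \<exists>u. i < n \<longrightarrow> u \<in> U \<and> e' i - f u \<in> W'" using onto by blast
    then obtain e where "\<And>i. i < n \<Longrightarrow> e i \<in> U \<and> e' i - f (e i) \<in> W'" by metis
    then have "span_mod U W n e \<and> indep_mod W n e" using key[of e e'] e' eU' by auto
    then show "qdim U W n" by (auto simp: qdim_def)
  qed
qed

lemma qdim_image:
  assumes "klin U f" "ksub U" "ksub W'" "f ` U = U'" "\<And>u. u \<in> U \<Longrightarrow> u \<in> W \<longleftrightarrow> f u \<in> W'"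
  shows "qdim U W n \<longleftrightarrow> qdim U' W' n"
proof (rule qdim_image_mod[OF assms(1-3) _ _ assms(5)])
  fix u' assume "u' \<in> U'"
  then obtain u where u: "u \<in> U" "f u = u'" using assms(4) by blast
  then have "u' - f u \<in> W'" using ksub_0[OF assms(3)] by simp
  with u(1) show "\<exists>u\<in>U. u' - f u \<in> W'" by blast
qed (use assms(4) in auto)

lemma qdim_trans:
  assumes W: "ksub W" and V: "ksub V" "W \<subseteq> V" "V \<subseteq> U" and a: "qdim U V a" and b: "qdim V W b"
  shows "qdim U W (a + b)"
proof -
  obtain e where e: "span_mod U V a e" "indep_mod V a e" using a by (auto simp: qdim_def)
  obtain f where f: "span_mod V W b f" "indep_mod W b f" using b by (auto simp: qdim_def)
  define g where "g i = (if i < a then e i else f (i - a))" for i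
  have split: "lcomb (a + b) c g = lcomb a c e + lcomb b (\<lambda>i. c (a + i)) f" for c
  proof -
    have "lcomb (a + b) c g = (\<Sum>i<a. csc (c i) (g i)) + (\<Sum>i=a..<a+b. csc (c i) (g i))"
      unfolding lcomb_def by (subst sum.atLeastLessThan_concat[of 0 a "a+b", simplified lessThan_atLeast0[symmetric], symmetric]) auto
    also have "(\<Sum>i=a..<a+b. csc (c i) (g i)) = lcomb b (\<lambda>i. c (a + i)) f"
      unfolding lcomb_def by (rule sum.reindex_bij_witness[of _ "\<lambda>i. a + i" "\<lambda>i. i - a"]) (auto simp: g_def)
    finally show ?thesis by (simp add: lcomb_def g_def)
  qed
  have fX: "lcomb b c f \<in> V" for c using f V by (auto simp: span_mod_def intro: lcomb_in)
  have "span_mod U W (a + b) g"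
    unfolding span_mod_def
  proof (intro conjI ballI allI impI)
    fix i assume "i < a + b" then show "g i \<in> U" using e f V by (auto simp: g_def span_mod_def)
  next
    fix u assume "u \<in> U"
    then obtain c where c: "u - lcomb a c e \<in> V" using e by (auto simp: span_mod_def)
    then obtain d where d: "u - lcomb a c e - lcomb b d f \<in> W" using f by (auto simp: span_mod_def)
    define h where "h i = (if i < a then c i else d (i - a))" for i
    have "lcomb (a + b) h g = lcomb a c e + lcomb b d f"
      unfolding split by (intro arg_cong2[of _ _ _ _ "(+)"] lcomb_cong) (auto simp: h_def)
    with d show "\<exists>c. u - lcomb (a + b) c g \<in> W" by (intro exI[of _ h]) (simp add: algebra_simps)
  qed
  moreover have "indep_mod W (a + b) g"
    unfolding indep_mod_def
  proof (intro allI impI)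
    fix c i assume c: "lcomb (a + b) c g \<in> W" and i: "i < a + b"
    have "lcomb a c e \<in> V" using ksub_diff[OF V(1) subsetD[OF V(2) c] fX[of "\<lambda>i. c (a + i)"]] by (simp add: split)
    then have z: "\<And>i. i < a \<Longrightarrow> c i = 0" using e by (auto simp: indep_mod_def)
    then have "lcomb a c e = 0" by (simp add: lcomb_def csc_simps)
    with c have "\<And>i. i < b \<Longrightarrow> c (a + i) = 0" using f(2) by (auto simp: split indep_mod_def)
    with z i show "c i = 0" by (metis add_diff_inverse_nat nat_add_left_cancel_less)
  qed
  ultimately show ?thesis by (auto simp: qdim_def)
qed

lemma qdim_refl: "ksub U \<Longrightarrow> qdim U U 0"
  by (auto simp: qdim_def span_mod_def indep_mod_def lcomb_def)

lemma qdim_subspace: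
  assumes W: "ksub W" and V: "ksub V" "V \<subseteq> U" and n: "qdim U W n"
  shows "\<exists>b. qdim V W b"
proof -
  obtain f where f: "span_mod U W n f" using n by (auto simp: qdim_def)
  define P where "P m \<longleftrightarrow> (\<exists>e. (\<forall>i<m. e i \<in> V) \<and> indep_mod W m e)" for m
  have "P 0" by (auto simp: P_def indep_mod_def)
  moreover have bound: "m \<le> n" if "P m" for m
    using that V indep_le_span[OF W f, of m] by (auto simp: P_def)
  ultimately obtain m where m: "P m" "\<And>k. P k \<Longrightarrow> k \<le> m"
    using Greatest_le_nat[of P _ n] GreatestI_nat[of P 0 n] by metis
  then obtain e where e: "\<And>i. i < m \<Longrightarrow> e i \<in> V" "indep_mod W m e" by (auto simp: P_def)
  have "\<exists>c. u - lcomb m c e \<in> W" if u: "u \<in> V" for u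
  proof (rule ccontr)
    assume no: "\<nexists>c. u - lcomb m c e \<in> W"
    have Suc: "lcomb (Suc m) c (e(m := u)) = lcomb m c e + csc (c m) u" for c
      by (simp add: lcomb_def)
    have "indep_mod W (Suc m) (e(m := u))"
      unfolding indep_mod_def
    proof (intro allI impI)
      fix c i assume c: "lcomb (Suc m) c (e(m := u)) \<in> W" and i: "i < Suc m"
      have "c m = 0"
      proof (rule ccontr)
        assume "c m \<noteq> 0"
        then have "csc (inverse (c m)) (lcomb (Suc m) c (e(m := u))) = u - lcomb m (\<lambda>i. - c i / c m) e"
          unfolding Suc by (simp add: csc_simps lcomb_def csc_sum sum_negf divide_inverse mult.commute)
        with no ksub_csc[OF W c] show False by metis
      qed
      with c have "lcomb m c e \<in> W" by (simp add: Suc csc_simps)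
      with e \<open>c m = 0\<close> i show "c i = 0" by (auto simp: indep_mod_def less_Suc_eq)
    qed
    then have "P (Suc m)" unfolding P_def using e u by (intro exI[of _ "e(m := u)"]) auto
    with m(2) show False by fastforce
  qed
  with e show ?thesis unfolding qdim_def span_mod_def by (intro exI[of _ m] exI[of _ e]) auto
qed

text \<open>
  A family of functionals with a dual family of vectors cuts out a subspace whose codimension is their
  number. This computes every dimension that comes from reading off constant terms.
\<close>

lemma qdim_dual_basis:
  fixes lam :: "'x \<Rightarrow> ('s \<Rightarrow> 'i \<Rightarrow> 'k::field) \<Rightarrow> 'k"
  assumes S: "finite S" and U: "ksub U"
    and add: "\<And>s u v. s \<in> S \<Longrightarrow> lam s (u + v) = lam s u + lam s v"
    and scale: "\<And>s c u. s \<in> S \<Longrightarrow> lam s (csc c u) = c * lam s u"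
    and e: "\<And>s. s \<in> S \<Longrightarrow> e s \<in> U" and dual: "\<And>s t. s \<in> S \<Longrightarrow> t \<in> S \<Longrightarrow> lam t (e s) = (if s = t then 1 else 0)"
  shows "qdim U {u \<in> U. \<forall>s\<in>S. lam s u = 0} (card S)"
proof -
  obtain h where h: "bij_betw h {..<card S} S" using ex_bij_betw_nat_finite[OF S] by (auto simp: lessThan_atLeast0)
  have hS: "\<And>i. i < card S \<Longrightarrow> h i \<in> S" using h by (auto simp: bij_betw_def)
  have hinj: "\<And>i j. i < card S \<Longrightarrow> j < card S \<Longrightarrow> h i = h j \<longleftrightarrow> i = j"
    using h by (auto simp: bij_betw_def inj_on_def)
  have sum: "lam s (sum f A) = (\<Sum>i\<in>A. lam s (f i))" if "s \<in> S" "finite A" for s f and A :: "nat set"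
    using that(2) add[OF that(1)] scale[OF that(1), of 0 0] by (induction A) (simp_all add: csc_simps)
  have lam: "lam (h j) (lcomb (card S) c (\<lambda>i. e (h i))) = c j" if "j < card S" for j c
    using that by (simp add: lcomb_def sum scale dual hS hinj if_distrib[of "\<lambda>x. _ * x"] cong: if_cong)
  have lamd: "lam s (u - v) = lam s u - lam s v" if "s \<in> S" for s u v
    using add[OF that, of u "csc (-1) v"] scale[OF that, of "-1" v] by (simp add: csc_simps)
  have img: "\<And>s. s \<in> S \<Longrightarrow> \<exists>j<card S. s = h j" using h by (fastforce simp: bij_betw_def)
  have "span_mod U {u \<in> U. \<forall>s\<in>S. lam s u = 0} (card S) (\<lambda>i. e (h i))"
    unfolding span_mod_def
  proof (intro conjI allI impI ballI)
    fix u assume u: "u \<in> U"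
    have "u - lcomb (card S) (\<lambda>i. lam (h i) u) (\<lambda>i. e (h i)) \<in> U"
      using u U e hS by (auto intro!: ksub_diff lcomb_in)
    moreover have "lam s (u - lcomb (card S) (\<lambda>i. lam (h i) u) (\<lambda>i. e (h i))) = 0" if "s \<in> S" for s
      using img[OF that] that by (auto simp: lamd lam)
    ultimately show "\<exists>c. u - lcomb (card S) c (\<lambda>i. e (h i)) \<in> {u \<in> U. \<forall>s\<in>S. lam s u = 0}" by auto
  qed (use e hS in auto)
  moreover have "indep_mod {u \<in> U. \<forall>s\<in>S. lam s u = 0} (card S) (\<lambda>i. e (h i))"
    unfolding indep_mod_def using lam hS by (metis (mono_tags, lifting) mem_Collect_eq)
  ultimately show ?thesis by (auto simp: qdim_def)
qed

section \<open>Koszul complexes of commuting operators\<close>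

definition fsc :: "'k::field \<Rightarrow> ('i \<Rightarrow> 'k) \<Rightarrow> 'i \<Rightarrow> 'k" where
  "fsc c f = (\<lambda>i. c * f i)"

lemma fsc_apply: "fsc c f i = c * f i"
  by (simp add: fsc_def)

lemma csc_fsc: "csc c z \<sigma> = fsc c (z \<sigma>)"
  by (simp add: csc_def fsc_def)

lemma fsc_simps: "fsc c (f + g) = fsc c f + fsc c g" "fsc 0 f = 0" "fsc c 0 = 0" "fsc 1 f = f" "fsc (-1) f = - f"
   "fsc c (- f) = - fsc c f"
  by (auto simp: fsc_def fun_eq_iff pointwise algebra_simps)

lemma chain_eq_iff: "z = w \<longleftrightarrow> (\<forall>\<sigma>. z \<sigma> = w \<sigma>)" for z w :: "'s \<Rightarrow> 'i \<Rightarrow> 'k"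
  by auto

lemma zero_chain_apply: "(0 :: 's \<Rightarrow> 'i \<Rightarrow> 'k::zero) \<sigma> = 0"
  by (simp add: zero_fun_apply)

text \<open>
  The Koszul differential: \<open>z \<sigma>\<close> is the coefficient of the wedge product of the variables in \<open>\<sigma>\<close>, and
  \<open>m v\<close> is the action of the variable \<open>v\<close>. The recursion along the list presents the complex on
  \<open>v # vs\<close> as the mapping cone of \<open>m v\<close> on the complex on \<open>vs\<close>, so that signs need no counting of positions.
\<close>

primrec kd :: "('v \<Rightarrow> ('i \<Rightarrow> 'k) \<Rightarrow> 'i \<Rightarrow> 'k::field) \<Rightarrow> 'v list \<Rightarrow> ('v set \<Rightarrow> 'i \<Rightarrow> 'k) \<Rightarrow> 'v set \<Rightarrow> 'i \<Rightarrow> 'k" where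
  "kd m [] z = (\<lambda>\<tau>. 0)"
| "kd m (v # vs) z = (\<lambda>\<tau>. if v \<in> \<tau> then - kd m vs (\<lambda>\<rho>. z (insert v \<rho>)) (\<tau> - {v})
                          else kd m vs z \<tau> + m v (z (insert v \<tau>)))"

definition chains :: "'v list \<Rightarrow> ('i \<Rightarrow> 'k::field) set \<Rightarrow> nat \<Rightarrow> ('v set \<Rightarrow> 'i \<Rightarrow> 'k) set" where
  "chains vs D j = {z. \<forall>\<sigma>. z \<sigma> \<in> D \<and> (z \<sigma> \<noteq> 0 \<longrightarrow> \<sigma> \<subseteq> set vs \<and> card \<sigma> = j)}"

lemma chainsI: "(\<And>\<sigma>. z \<sigma> \<in> D) \<Longrightarrow> (\<And>\<sigma>. z \<sigma> \<noteq> 0 \<Longrightarrow> \<sigma> \<subseteq> set vs \<and> card \<sigma> = j) \<Longrightarrow> z \<in> chains vs D j"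
  by (auto simp: chains_def)

lemma chainsD: "z \<in> chains vs D j \<Longrightarrow> z \<sigma> \<in> D"
  "z \<in> chains vs D j \<Longrightarrow> \<not> (\<sigma> \<subseteq> set vs \<and> card \<sigma> = j) \<Longrightarrow> z \<sigma> = 0"
  by (auto simp: chains_def)

lemma chains_nonzero:
  assumes "z \<in> chains vs D j" "z \<sigma> \<noteq> 0"
  shows "\<sigma> \<subseteq> set vs" "card \<sigma> = j" "finite \<sigma>"
proof -
  show "\<sigma> \<subseteq> set vs" "card \<sigma> = j" using assms chainsD(2) by metis+
  then show "finite \<sigma>" using finite_subset[OF _ finite_set] by blast
qed

lemma chains_mono: "D \<subseteq> E \<Longrightarrow> chains vs D j \<subseteq> chains vs E j"
  by (auto simp: chains_def)

text \<open>
  Subspaces of the coefficient space, as \<open>ksub\<close> for chains.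
\<close>

definition vsub :: "('i \<Rightarrow> 'k::field) set \<Rightarrow> bool" where
  "vsub D \<longleftrightarrow> 0 \<in> D \<and> (\<forall>f\<in>D. \<forall>g\<in>D. f + g \<in> D) \<and> (\<forall>c. \<forall>f\<in>D. fsc c f \<in> D)"

lemma vsubI: "0 \<in> D \<Longrightarrow> (\<And>f g. f \<in> D \<Longrightarrow> g \<in> D \<Longrightarrow> f + g \<in> D) \<Longrightarrow> (\<And>c f. f \<in> D \<Longrightarrow> fsc c f \<in> D) \<Longrightarrow> vsub D"
  by (auto simp: vsub_def)

lemma vsub_0: "vsub D \<Longrightarrow> 0 \<in> D"
  and vsub_add: "vsub D \<Longrightarrow> f \<in> D \<Longrightarrow> g \<in> D \<Longrightarrow> f + g \<in> D"
  and vsub_fsc: "vsub D \<Longrightarrow> f \<in> D \<Longrightarrow> fsc c f \<in> D"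
  by (auto simp: vsub_def)

lemma vsub_neg: "vsub D \<Longrightarrow> f \<in> D \<Longrightarrow> - f \<in> D"
  using vsub_fsc[of D f "-1"] by (simp add: fsc_simps)

lemma vsub_diff: "vsub D \<Longrightarrow> f \<in> D \<Longrightarrow> g \<in> D \<Longrightarrow> f - g \<in> D"
  using vsub_add[of D f "- g"] vsub_neg[of D g] by simp

lemma vsub_neg_iff: "vsub D \<Longrightarrow> - f \<in> D \<longleftrightarrow> f \<in> D"
  using vsub_neg[of D f] vsub_neg[of D "- f"] by auto

lemma ksub_chains: assumes "vsub D" shows "ksub (chains vs D j)"
proof (rule ksubI)
  show "0 \<in> chains vs D j" using assms by (auto simp: chains_def vsub_0 pointwise)
next
  fix u v assume u: "u \<in> chains vs D j" and v: "v \<in> chains vs D j"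
  show "u + v \<in> chains vs D j"
  proof (rule chainsI)
    show "(u + v) \<sigma> \<in> D" for \<sigma> using u v assms by (simp add: pointwise chainsD(1) vsub_add)
    show "\<sigma> \<subseteq> set vs \<and> card \<sigma> = j" if "(u + v) \<sigma> \<noteq> 0" for \<sigma>
      using that chainsD(2)[OF u, of \<sigma>] chainsD(2)[OF v, of \<sigma>] by (metis add_0 plus_fun_apply)
  qed
next
  fix c u assume u: "u \<in> chains vs D j"
  show "csc c u \<in> chains vs D j"
  proof (rule chainsI)
    show "csc c u \<sigma> \<in> D" for \<sigma> using u assms by (simp add: csc_fsc chainsD(1) vsub_fsc)
    show "\<sigma> \<subseteq> set vs \<and> card \<sigma> = j" if "csc c u \<sigma> \<noteq> 0" for \<sigma>
      using that chainsD(2)[OF u, of \<sigma>] by (metis csc_fsc fsc_simps(3))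
  qed
qed

lemma chains_0_iff: "z \<in> chains vs D 0 \<longleftrightarrow> z {} \<in> D \<and> 0 \<in> D \<and> (\<forall>\<sigma>. \<sigma> \<noteq> {} \<longrightarrow> z \<sigma> = 0)"
proof
  assume z: "z \<in> chains vs D 0"
  have nz: "z \<sigma> = 0" if "\<sigma> \<noteq> {}" for \<sigma>
  proof (rule chainsD(2)[OF z], rule notI)
    assume *: "\<sigma> \<subseteq> set vs \<and> card \<sigma> = 0"
    then have "finite \<sigma>" using finite_subset[OF _ finite_set] by blast
    with * that show False by simp
  qed
  moreover have "0 \<in> D" using chainsD(1)[OF z, of "{undefined}"] nz[of "{undefined}"] by simp
  ultimately show "z {} \<in> D \<and> 0 \<in> D \<and> (\<forall>\<sigma>. \<sigma> \<noteq> {} \<longrightarrow> z \<sigma> = 0)"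
    using chainsD(1)[OF z] by blast
next
  assume *: "z {} \<in> D \<and> 0 \<in> D \<and> (\<forall>\<sigma>. \<sigma> \<noteq> {} \<longrightarrow> z \<sigma> = 0)"
  show "z \<in> chains vs D 0"
  proof (rule chainsI)
    show "z \<sigma> \<in> D" for \<sigma> using * by (cases "\<sigma> = {}") auto
    show "\<sigma> \<subseteq> set vs \<and> card \<sigma> = 0" if "z \<sigma> \<noteq> 0" for \<sigma> using * that by (cases "\<sigma> = {}") auto
  qed
qed

lemma chains_0_eqI: "y \<in> chains vs D 0 \<Longrightarrow> z \<in> chains vs E 0 \<Longrightarrow> y {} = z {} \<Longrightarrow> y = z"
  by (rule ext, rename_tac \<sigma>, case_tac "\<sigma> = {}") (simp_all add: chains_0_iff)

text \<open>
  The two halves of the mapping cone: the coefficients at the sets without \<open>v\<close> and at the sets with \<open>v\<close>.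
\<close>

definition join :: "'v \<Rightarrow> ('v set \<Rightarrow> 'i \<Rightarrow> 'k::field) \<Rightarrow> ('v set \<Rightarrow> 'i \<Rightarrow> 'k) \<Rightarrow> 'v set \<Rightarrow> 'i \<Rightarrow> 'k" where
  "join v a b = (\<lambda>\<sigma>. if v \<in> \<sigma> then b (\<sigma> - {v}) else a \<sigma>)"

definition part0 :: "'v \<Rightarrow> ('v set \<Rightarrow> 'i \<Rightarrow> 'k::field) \<Rightarrow> 'v set \<Rightarrow> 'i \<Rightarrow> 'k" where
  "part0 v z = (\<lambda>\<sigma>. if v \<in> \<sigma> then 0 else z \<sigma>)"

definition part1 :: "'v \<Rightarrow> ('v set \<Rightarrow> 'i \<Rightarrow> 'k::field) \<Rightarrow> 'v set \<Rightarrow> 'i \<Rightarrow> 'k" where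
  "part1 v z = (\<lambda>\<sigma>. if v \<in> \<sigma> then 0 else z (insert v \<sigma>))"

lemma join_parts: "join v (part0 v z) (part1 v z) = z"
  by (auto simp: join_def part0_def part1_def fun_eq_iff insert_absorb)

lemma part0_chains: "0 \<in> D \<Longrightarrow> z \<in> chains (v # vs) D j \<Longrightarrow> part0 v z \<in> chains vs D j"
  by (auto simp: chains_def part0_def)

lemma part1_chains: "0 \<in> D \<Longrightarrow> z \<in> chains (v # vs) D (Suc j) \<Longrightarrow> part1 v z \<in> chains vs D j"
proof (rule chainsI)
  assume z: "z \<in> chains (v # vs) D (Suc j)" and "0 \<in> D"
  then show "part1 v z \<sigma> \<in> D" for \<sigma> by (auto simp: chains_def part1_def)
  fix \<sigma> assume "part1 v z \<sigma> \<noteq> 0"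
  then have "v \<notin> \<sigma>" "z (insert v \<sigma>) \<noteq> 0" by (auto simp: part1_def split: if_splits)
  then have "insert v \<sigma> \<subseteq> set (v # vs)" "card (insert v \<sigma>) = Suc j" "finite \<sigma>"
    using chains_nonzero[OF z, of "insert v \<sigma>"] by simp_all
  then show "\<sigma> \<subseteq> set vs \<and> card \<sigma> = j" using \<open>v \<notin> \<sigma>\<close> by auto
qed

lemma join_chains:
  assumes v: "v \<notin> set vs" and a: "a \<in> chains vs D (Suc j)" and b: "b \<in> chains vs D j"
  shows "join v a b \<in> chains (v # vs) D (Suc j)"
proof (rule chainsI)
  show "join v a b \<sigma> \<in> D" for \<sigma> using a b by (auto simp: join_def chains_def)
  fix \<sigma> assume nz: "join v a b \<sigma> \<noteq> 0"
  show "\<sigma> \<subseteq> set (v # vs) \<and> card \<sigma> = Suc j"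
  proof (cases "v \<in> \<sigma>")
    case True
    with nz have "b (\<sigma> - {v}) \<noteq> 0" by (simp add: join_def)
    then have "\<sigma> - {v} \<subseteq> set vs" "card (\<sigma> - {v}) = j" "finite \<sigma>"
      using chains_nonzero[OF b, of "\<sigma> - {v}"] by simp_all
    with True card_Suc_Diff1[of \<sigma> v] show ?thesis by auto
  next
    case False
    with nz have "a \<sigma> \<noteq> 0" by (simp add: join_def)
    then show ?thesis using chains_nonzero[OF a, of \<sigma>] by auto
  qed
qed

lemma part_join:
  assumes "v \<notin> set vs" "a \<in> chains vs D i" "b \<in> chains vs D j"
  shows "part0 v (join v a b) = a" "part1 v (join v a b) = b"
proof -
  have "a \<sigma> = 0" "b \<sigma> = 0" if "v \<in> \<sigma>" for \<sigma> using assms that by (auto intro!: chainsD(2))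
  then show "part0 v (join v a b) = a" "part1 v (join v a b) = b"
    by (auto simp: part0_def part1_def join_def fun_eq_iff)
qed

text \<open>
  Commutation and linearity are all that the Koszul complex needs of the action of the variables. The
  locale is applied to series and to vectors of series.
\<close>

locale commuting_operators =
  fixes m :: "'v \<Rightarrow> ('i \<Rightarrow> 'k::field) \<Rightarrow> 'i \<Rightarrow> 'k"
  assumes m_add: "m v (f + g) = m v f + m v g"
    and m_fsc: "m v (fsc c f) = fsc c (m v f)"
    and m_comm: "m u (m v f) = m v (m u f)"
begin

lemma m_0: "m v 0 = 0" using m_fsc[of v 0 0] by (simp add: fsc_simps)
lemma m_neg: "m v (- f) = - m v f" using m_fsc[of v "-1" f] by (simp add: fsc_simps)

lemma kd_cong: "distinct vs \<Longrightarrow> (\<And>u. u \<in> set vs \<Longrightarrow> u \<notin> \<tau> \<Longrightarrow> z (insert u \<tau>) = w (insert u \<tau>)) \<Longrightarrow> kd m vs z \<tau> = kd m vs w \<tau>"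
proof (induction vs arbitrary: z w \<tau>)
  case (Cons v vs)
  show ?case
  proof (cases "v \<in> \<tau>")
    case True
    have "kd m vs (\<lambda>\<rho>. z (insert v \<rho>)) (\<tau> - {v}) = kd m vs (\<lambda>\<rho>. w (insert v \<rho>)) (\<tau> - {v})"
    proof (rule Cons.IH)
      fix u assume u: "u \<in> set vs" "u \<notin> \<tau> - {v}"
      then have "insert v (insert u (\<tau> - {v})) = insert u \<tau>" "u \<notin> \<tau>" using True Cons.prems(1) by auto
      then show "z (insert v (insert u (\<tau> - {v}))) = w (insert v (insert u (\<tau> - {v})))"
        using Cons.prems(2)[of u] u by simp
    qed (use Cons.prems in simp)
    then show ?thesis using True by simp
  next
    case False
    have "kd m vs z \<tau> = kd m vs w \<tau>" using Cons.prems by (intro Cons.IH) auto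
    with False Cons.prems(2)[of v] show ?thesis by simp
  qed
qed simp

lemma kd_add: "kd m vs (z + w) = kd m vs z + kd m vs w"
proof (induction vs arbitrary: z w)
  case (Cons v vs)
  have "kd m vs (\<lambda>\<rho>. (z + w) (insert v \<rho>)) = kd m vs (\<lambda>\<rho>. z (insert v \<rho>)) + kd m vs (\<lambda>\<rho>. w (insert v \<rho>))"
    using Cons.IH[of "\<lambda>\<rho>. z (insert v \<rho>)" "\<lambda>\<rho>. w (insert v \<rho>)"] by (simp add: plus_fun_def)
  then show ?case unfolding kd.simps Cons.IH
    by (intro ext) (simp add: pointwise m_add)
qed (simp add: fun_eq_iff pointwise)

lemma kd_csc: "kd m vs (csc c z) = csc c (kd m vs z)"
proof (induction vs arbitrary: z)
  case (Cons v vs)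
  have "kd m vs (\<lambda>\<rho>. csc c z (insert v \<rho>)) = csc c (kd m vs (\<lambda>\<rho>. z (insert v \<rho>)))"
    using Cons.IH[of "\<lambda>\<rho>. z (insert v \<rho>)"] by (simp add: csc_def)
  then show ?case unfolding kd.simps Cons.IH
    by (intro ext) (simp add: csc_fsc m_fsc fsc_simps)
qed (simp add: fun_eq_iff pointwise)

lemma kd_zero: "kd m vs 0 = 0" using kd_csc[of vs 0 0] by (simp add: csc_simps)
lemma kd_neg: "kd m vs (- z) = - kd m vs z" using kd_csc[of vs "-1" z] by (simp add: csc_simps)
lemma kd_diff: "kd m vs (z - w) = kd m vs z - kd m vs w" using kd_add[of vs z "- w"] by (simp add: kd_neg)

lemma klin_kd: "klin U (kd m vs)"
  by (simp add: klin_def kd_add kd_csc)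

lemma kd_m: "kd m vs (\<lambda>\<sigma>. m u (z \<sigma>)) \<tau> = m u (kd m vs z \<tau>)"
  by (induction vs arbitrary: z \<tau>) (simp_all add: m_0 m_neg m_add m_comm)

lemma kd_kd: "distinct vs \<Longrightarrow> kd m vs (kd m vs z) \<tau> = 0"
proof (induction vs arbitrary: z \<tau>)
  case (Cons v vs)
  have d: "distinct vs" "v \<notin> set vs" using Cons.prems by auto
  show ?case
  proof (cases "v \<in> \<tau>")
    case True
    have "kd m vs (\<lambda>\<rho>. kd m (v # vs) z (insert v \<rho>)) (\<tau> - {v}) = kd m vs (- kd m vs (\<lambda>\<rho>. z (insert v \<rho>))) (\<tau> - {v})"
    proof (rule kd_cong[OF d(1)])
      fix u assume "u \<in> set vs" "u \<notin> \<tau> - {v}"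
      then have "insert u (\<tau> - {v}) - {v} = insert u (\<tau> - {v})" using d by auto
      then show "kd m (v # vs) z (insert v (insert u (\<tau> - {v}))) = (- kd m vs (\<lambda>\<rho>. z (insert v \<rho>))) (insert u (\<tau> - {v}))"
        by (simp add: uminus_apply)
    qed
    also have "\<dots> = 0" by (simp add: kd_neg uminus_apply Cons.IH[OF d(1)])
    finally show ?thesis using True by simp
  next
    case False
    have "kd m vs (kd m (v # vs) z) \<tau> = kd m vs (kd m vs z + (\<lambda>\<rho>. m v (z (insert v \<rho>)))) \<tau>"
      using False d by (intro kd_cong) (auto simp: plus_fun_apply)
    also have "\<dots> = m v (kd m vs (\<lambda>\<rho>. z (insert v \<rho>)) \<tau>)"
      by (simp add: kd_add plus_fun_apply Cons.IH[OF d(1)] kd_m)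
    finally show ?thesis using False by (simp add: m_neg)
  qed
qed simp

text \<open>
  The formula of the mapping cone, on which all arguments that add one variable rest.
\<close>

lemma kd_join:
  assumes d: "distinct (v # vs)"
  shows "kd m (v # vs) (join v a b) = join v (kd m vs a + (\<lambda>\<tau>. m v (b \<tau>))) (- kd m vs b)"
proof
  fix \<tau>
  have v: "v \<notin> set vs" "distinct vs" using d by auto
  show "kd m (v # vs) (join v a b) \<tau> = join v (kd m vs a + (\<lambda>\<tau>. m v (b \<tau>))) (- kd m vs b) \<tau>"
  proof (cases "v \<in> \<tau>")
    case True
    have "kd m vs (\<lambda>\<rho>. join v a b (insert v \<rho>)) (\<tau> - {v}) = kd m vs b (\<tau> - {v})"
    proof (rule kd_cong[OF v(2)])
      fix u assume "u \<in> set vs" "u \<notin> \<tau> - {v}"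
      then have "insert u (\<tau> - {v}) - {v} = insert u (\<tau> - {v})" using v by auto
      then show "join v a b (insert v (insert u (\<tau> - {v}))) = b (insert u (\<tau> - {v}))"
        by (simp add: join_def)
    qed
    with True show ?thesis by (simp add: join_def uminus_apply)
  next
    case False
    have "kd m vs (join v a b) \<tau> = kd m vs a \<tau>"
      using False v by (intro kd_cong) (auto simp: join_def)
    with False show ?thesis by (simp add: join_def plus_fun_apply)
  qed
qed

definition opsub :: "'v list \<Rightarrow> ('i \<Rightarrow> 'k) set \<Rightarrow> bool" where
  "opsub vs D \<longleftrightarrow> vsub D \<and> (\<forall>v\<in>set vs. \<forall>f\<in>D. m v f \<in> D)"

lemma kd_in: "opsub vs D \<Longrightarrow> (\<And>\<sigma>. z \<sigma> \<in> D) \<Longrightarrow> kd m vs z \<tau> \<in> D"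
  by (induction vs arbitrary: z \<tau>) (auto simp: opsub_def vsub_0 vsub_neg vsub_add)

lemma kd_nonzero:
  assumes "distinct vs" "kd m vs z \<tau> \<noteq> 0"
  shows "\<exists>u\<in>set vs - \<tau>. z (insert u \<tau>) \<noteq> 0"
proof (rule ccontr)
  assume "\<not> ?thesis"
  then have "kd m vs z \<tau> = kd m vs 0 \<tau>" using assms(1) by (intro kd_cong) (auto simp: pointwise)
  with assms(2) show False by (simp add: kd_zero pointwise)
qed

lemma kd_support:
  assumes vs: "distinct vs" and z: "z \<in> chains vs D (Suc j)" and nz: "kd m vs z \<tau> \<noteq> 0"
  shows "\<tau> \<subseteq> set vs \<and> card \<tau> = j"
proof -
  obtain u where u: "u \<in> set vs" "u \<notin> \<tau>" "z (insert u \<tau>) \<noteq> 0" using kd_nonzero[OF vs nz] by blast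
  then have "insert u \<tau> \<subseteq> set vs" "card (insert u \<tau>) = Suc j" "finite \<tau>"
    using chains_nonzero[OF z, of "insert u \<tau>"] by simp_all
  then show ?thesis using u by auto
qed

lemma kd_chainsI:
  assumes vs: "distinct vs" and z: "z \<in> chains vs D (Suc j)" and E: "\<And>\<tau>. kd m vs z \<tau> \<in> E"
  shows "kd m vs z \<in> chains vs E j"
  using kd_support[OF vs z] E by (intro chainsI)

lemma kd_chains:
  assumes "distinct vs" "opsub vs D" "z \<in> chains vs D (Suc j)"
  shows "kd m vs z \<in> chains vs D j"
  using assms chainsD(1)[OF assms(3)] by (intro kd_chainsI kd_in) auto

lemma kd_chains_0:
  assumes vs: "distinct vs" and z: "z \<in> chains vs D 0"
  shows "kd m vs z = 0"
proof (rule ext, rule ccontr)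
  fix \<tau> assume "kd m vs z \<tau> \<noteq> 0 \<tau>"
  then obtain u where "z (insert u \<tau>) \<noteq> 0" using kd_nonzero[OF vs, of z \<tau>] by (auto simp: pointwise)
  then show False using z[unfolded chains_0_iff] by (metis insert_not_empty)
qed

definition cyc :: "'v list \<Rightarrow> ('i \<Rightarrow> 'k) set \<Rightarrow> nat \<Rightarrow> ('v set \<Rightarrow> 'i \<Rightarrow> 'k) set" where
  "cyc vs D j = {z \<in> chains vs D j. kd m vs z = 0}"

definition bnd :: "'v list \<Rightarrow> ('i \<Rightarrow> 'k) set \<Rightarrow> nat \<Rightarrow> ('v set \<Rightarrow> 'i \<Rightarrow> 'k) set" where
  "bnd vs D j = kd m vs ` chains vs D (Suc j)"

text \<open>
  The boundaries in degree \<open>0\<close>, read as coefficients: the span of the images of the operators.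
\<close>

definition bnd0 :: "'v list \<Rightarrow> ('i \<Rightarrow> 'k) set \<Rightarrow> ('i \<Rightarrow> 'k) set" where
  "bnd0 vs D = (\<lambda>w. kd m vs w {}) ` chains vs D 1"

text \<open>
  Exactness in all positive degrees; in degree \<open>0\<close> the homology is \<open>D\<close> modulo \<open>bnd0 vs D\<close>.
\<close>

definition acyclic_on :: "'v list \<Rightarrow> ('i \<Rightarrow> 'k) set \<Rightarrow> bool" where
  "acyclic_on vs D \<longleftrightarrow> (\<forall>j. cyc vs D (Suc j) \<subseteq> bnd vs D (Suc j))"

lemma acyclicD:
  assumes "acyclic_on vs D" "z \<in> chains vs D (Suc j)" "kd m vs z = 0"
  obtains w where "w \<in> chains vs D (Suc (Suc j))" "kd m vs w = z"
proof -
  have "z \<in> cyc vs D (Suc j)" using assms by (simp add: cyc_def)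
  then have "z \<in> bnd vs D (Suc j)" using assms(1) unfolding acyclic_on_def by blast
  then show ?thesis using that unfolding bnd_def by blast
qed

lemma bndI: "w \<in> chains vs D (Suc j) \<Longrightarrow> kd m vs w = z \<Longrightarrow> z \<in> bnd vs D j"
  unfolding bnd_def by blast

lemma bnd0I: "w \<in> chains vs D 1 \<Longrightarrow> kd m vs w {} = f \<Longrightarrow> f \<in> bnd0 vs D"
  unfolding bnd0_def by blast

lemma bnd0E:
  assumes "f \<in> bnd0 vs D"
  obtains w where "w \<in> chains vs D 1" "kd m vs w {} = f"
  using assms unfolding bnd0_def by blast

lemma acyclic_Nil: "acyclic_on [] D"
proof -
  have "z \<in> bnd [] D (Suc j)" if z: "z \<in> chains [] D (Suc j)" for z j
  proof -
    have 0: "z \<sigma> = 0" for \<sigma> by (rule chainsD(2)[OF z]) auto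
    then have "0 \<in> D" using chainsD(1)[OF z, of "{}"] by simp
    then have "0 \<in> chains [] D (Suc (Suc j))" by (intro chainsI) (simp_all add: zero_fun_apply)
    moreover have "kd m [] 0 = z" using 0 by (simp add: fun_eq_iff zero_fun_apply)
    ultimately show ?thesis by (rule bndI)
  qed
  then show ?thesis by (auto simp: acyclic_on_def cyc_def)
qed

text \<open>
  Adding an operator that is injective modulo the images of the previous ones preserves acyclicity: this is
  the step from a regular sequence to an exact Koszul complex.
\<close>

lemma acyclic_Cons:
  assumes d: "distinct (v # vs)" and D: "opsub (v # vs) D" and ac: "acyclic_on vs D"
    and reg: "\<And>f. f \<in> D \<Longrightarrow> m v f \<in> bnd0 vs D \<Longrightarrow> f \<in> bnd0 vs D"
  shows "acyclic_on (v # vs) D"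
  unfolding acyclic_on_def
proof (intro allI subsetI)
  fix j z assume "z \<in> cyc (v # vs) D (Suc j)"
  then have z: "z \<in> chains (v # vs) D (Suc j)" and dz: "kd m (v # vs) z = 0" by (auto simp: cyc_def)
  have v: "v \<notin> set vs" "distinct vs" using d by auto
  have D': "opsub vs D" "vsub D" "0 \<in> D" using D by (auto simp: opsub_def vsub_0)
  have mv: "m v f \<in> D" if "f \<in> D" for f using D that by (auto simp: opsub_def)
  define a where "a = part0 v z"
  define b where "b = part1 v z"
  have a: "a \<in> chains vs D (Suc j)" and b: "b \<in> chains vs D j"
    using part0_chains[OF D'(3) z] part1_chains[OF D'(3) z] by (simp_all add: a_def b_def)
  have zj: "z = join v a b" by (simp add: a_def b_def join_parts)
  have mvc: "(\<lambda>\<tau>. m v (w \<tau>)) \<in> chains vs D i" if "w \<in> chains vs D i" for w i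
    using that mv chains_nonzero[OF that] by (intro chainsI) (metis chainsD(1), metis m_0)
  have "join v (kd m vs a + (\<lambda>\<tau>. m v (b \<tau>))) (- kd m vs b) = 0" using dz kd_join[OF d] zj by metis
  then have *: "(if v \<in> \<tau> then - kd m vs b (\<tau> - {v}) else kd m vs a \<tau> + m v (b \<tau>)) = 0" for \<tau>
    by (drule_tac fun_cong[of _ _ \<tau>]) (simp add: join_def plus_fun_apply zero_fun_apply uminus_apply split: if_splits)
  have kb: "kd m vs b = 0"
  proof (rule ext, rule ccontr)
    fix \<tau> assume nz: "kd m vs b \<tau> \<noteq> 0 \<tau>"
    then obtain u where u: "u \<in> set vs" "b (insert u \<tau>) \<noteq> 0" using kd_nonzero[OF v(2), of b \<tau>] by (auto simp: pointwise)
    then have "v \<notin> \<tau>" using chainsD(2)[OF b, of "insert u \<tau>"] v by auto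
    then show False using *[of "insert v \<tau>"] nz by (simp add: pointwise)
  qed
  have ka: "kd m vs a + (\<lambda>\<tau>. m v (b \<tau>)) = 0"
  proof (rule ext)
    fix \<tau> show "(kd m vs a + (\<lambda>\<tau>. m v (b \<tau>))) \<tau> = 0 \<tau>"
    proof (cases "v \<in> \<tau>")
      case True
      then have "b \<tau> = 0" using chainsD(2)[OF b, of \<tau>] v by auto
      moreover have "kd m vs a \<tau> = 0" using kd_support[OF v(2) a, of \<tau>] True v by auto
      ultimately show ?thesis by (simp add: plus_fun_apply zero_fun_apply m_0)
    qed (use *[of \<tau>] in \<open>simp add: plus_fun_apply zero_fun_apply\<close>)
  qed
  \<comment> \<open>The upper half \<open>b\<close> of a cycle is a cycle. In degree \<open>0\<close> it is a boundary by regularity of \<open>m v\<close>,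
    because \<open>m v b\<close> is the boundary of \<open>- a\<close>.\<close>
  have "\<exists>b'\<in>chains vs D (Suc j). kd m vs b' = b"
  proof (cases j)
    case 0
    have "kd m vs (- a) {} = m v (b {})" using fun_cong[OF ka, of "{}"]
      by (simp add: kd_neg plus_fun_apply uminus_apply zero_chain_apply eq_neg_iff_add_eq_0 neg_eq_iff_add_eq_0)
    moreover have "- a \<in> chains vs D 1" using a 0 ksub_neg[OF ksub_chains[OF D'(2)]] by auto
    ultimately have "m v (b {}) \<in> bnd0 vs D" by (intro bnd0I)
    then have "b {} \<in> bnd0 vs D" using reg chainsD(1)[OF b] by blast
    then obtain b' where b': "b' \<in> chains vs D 1" "kd m vs b' {} = b {}" by (rule bnd0E)
    have "kd m vs b' \<in> chains vs D 0" using kd_chains[OF v(2) D'(1)] b' by simp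
    then have "kd m vs b' = b" using b b'(2) 0 by (auto intro: chains_0_eqI)
    with b' 0 show ?thesis by auto
  next
    case (Suc i)
    then show ?thesis using acyclicD[OF ac, of b i] b kb by blast
  qed
  then obtain b' where b': "b' \<in> chains vs D (Suc j)" "kd m vs b' = b" by blast
  \<comment> \<open>Subtracting the boundary that accounts for \<open>b\<close> leaves a cycle of the complex on \<open>vs\<close>.\<close>
  define a' where "a' = a + (\<lambda>\<tau>. m v (b' \<tau>))"
  have "a' \<in> chains vs D (Suc j)" unfolding a'_def
    using a mvc[OF b'(1)] ksub_chains[OF D'(2)] by (intro ksub_add)
  moreover have "kd m vs (\<lambda>\<tau>. m v (b' \<tau>)) = (\<lambda>\<tau>. m v (b \<tau>))" by (rule ext) (simp add: kd_m b')
  then have "kd m vs a' = 0" using ka by (simp add: a'_def kd_add)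
  ultimately obtain w where w: "w \<in> chains vs D (Suc (Suc j))" "kd m vs w = a'"
    using acyclicD[OF ac] by blast
  have "kd m (v # vs) (join v w (- b')) = join v (a' + (\<lambda>\<tau>. m v ((- b') \<tau>))) (- kd m vs (- b'))"
    by (simp only: kd_join[OF d] w)
  also have "a' + (\<lambda>\<tau>. m v ((- b') \<tau>)) = a"
    by (rule ext) (simp add: a'_def plus_fun_apply uminus_apply m_neg)
  also have "- kd m vs (- b') = b" by (simp add: kd_neg b')
  finally have "kd m (v # vs) (join v w (- b')) = z" by (simp add: zj)
  moreover have "join v w (- b') \<in> chains (v # vs) D (Suc (Suc j))"
    using w b' ksub_neg[OF ksub_chains[OF D'(2)]] v by (intro join_chains) auto
  ultimately show "z \<in> bnd (v # vs) D (Suc j)" by (intro bndI)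
qed

text \<open>
  The cycles and boundaries of the Koszul complex of \<open>D/I\<close>, lifted to chains with entries in \<open>D\<close>. In this
  form quotients never have to be formed.
\<close>

definition relcyc :: "'v list \<Rightarrow> ('i \<Rightarrow> 'k) set \<Rightarrow> ('i \<Rightarrow> 'k) set \<Rightarrow> nat \<Rightarrow> ('v set \<Rightarrow> 'i \<Rightarrow> 'k) set" where
  "relcyc vs D I j = {z \<in> chains vs D j. \<forall>\<tau>. kd m vs z \<tau> \<in> I}"

definition relbnd :: "'v list \<Rightarrow> ('i \<Rightarrow> 'k) set \<Rightarrow> ('i \<Rightarrow> 'k) set \<Rightarrow> nat \<Rightarrow> ('v set \<Rightarrow> 'i \<Rightarrow> 'k) set" where
  "relbnd vs D I j = {u + kd m vs w |u w. u \<in> chains vs I j \<and> w \<in> chains vs D (Suc j)}"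

lemma ksub_bnd:
  assumes "vsub D" shows "ksub (bnd vs D j)"
proof (rule ksubI)
  note k = ksub_chains[OF assms, of vs "Suc j"]
  show "0 \<in> bnd vs D j" unfolding bnd_def using ksub_0[OF k] kd_zero by (metis image_eqI)
  show "u + v \<in> bnd vs D j" if "u \<in> bnd vs D j" "v \<in> bnd vs D j" for u v
    using that ksub_add[OF k] kd_add unfolding bnd_def image_iff by metis
  show "csc c u \<in> bnd vs D j" if "u \<in> bnd vs D j" for c u
    using that ksub_csc[OF k] kd_csc unfolding bnd_def image_iff by metis
qed

lemma ksub_relcyc:
  assumes "vsub D" "vsub I" shows "ksub (relcyc vs D I j)"
proof (rule ksubI)
  note k = ksub_chains[OF assms(1), of vs j]
  show "0 \<in> relcyc vs D I j" using ksub_0[OF k] vsub_0[OF assms(2)] by (simp add: relcyc_def kd_zero zero_chain_apply)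
  show "u + v \<in> relcyc vs D I j" if "u \<in> relcyc vs D I j" "v \<in> relcyc vs D I j" for u v
    using that ksub_add[OF k] vsub_add[OF assms(2)] by (simp add: relcyc_def kd_add plus_fun_apply)
  show "csc c u \<in> relcyc vs D I j" if "u \<in> relcyc vs D I j" for c u
    using that ksub_csc[OF k] vsub_fsc[OF assms(2)] by (simp add: relcyc_def kd_csc csc_fsc)
qed

lemma relbndI: "u \<in> chains vs I j \<Longrightarrow> w \<in> chains vs D (Suc j) \<Longrightarrow> u + kd m vs w \<in> relbnd vs D I j"
  by (auto simp: relbnd_def)

lemma ksub_relbnd:
  assumes "vsub D" "vsub I"
  shows "ksub (relbnd vs D I j)"
proof (rule ksubI)
  note k = ksub_chains[OF assms(1), of vs "Suc j"] ksub_chains[OF assms(2), of vs j]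
  show "0 \<in> relbnd vs D I j" using relbndI[OF ksub_0[OF k(2)] ksub_0[OF k(1)]] by (simp add: kd_zero)
  fix x y assume "x \<in> relbnd vs D I j" "y \<in> relbnd vs D I j"
  then obtain u w u' w' where *: "u \<in> chains vs I j" "w \<in> chains vs D (Suc j)" "u' \<in> chains vs I j" "w' \<in> chains vs D (Suc j)"
    "x = u + kd m vs w" "y = u' + kd m vs w'" by (auto simp: relbnd_def)
  have "(u + u') + kd m vs (w + w') \<in> relbnd vs D I j" using * k by (intro relbndI ksub_add)
  then show "x + y \<in> relbnd vs D I j" using * by (simp add: kd_add algebra_simps)
next
  note k = ksub_chains[OF assms(1), of vs "Suc j"] ksub_chains[OF assms(2), of vs j]
  fix c x assume "x \<in> relbnd vs D I j"
  then obtain u w where *: "u \<in> chains vs I j" "w \<in> chains vs D (Suc j)" "x = u + kd m vs w" by (auto simp: relbnd_def)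
  have "csc c u + kd m vs (csc c w) \<in> relbnd vs D I j" using * k by (intro relbndI ksub_csc)
  then show "csc c x \<in> relbnd vs D I j" using * by (simp add: kd_csc csc_simps)
qed

lemma relbnd_sub_relcyc:
  assumes vs: "distinct vs" and D: "opsub vs D" and I: "opsub vs I" "I \<subseteq> D"
  shows "relbnd vs D I j \<subseteq> relcyc vs D I j"
proof
  fix x assume "x \<in> relbnd vs D I j"
  then obtain u w where *: "u \<in> chains vs I j" "w \<in> chains vs D (Suc j)" "x = u + kd m vs w" by (auto simp: relbnd_def)
  have "u \<in> chains vs D j" using chains_mono[OF I(2)] * by auto
  then have "x \<in> chains vs D j" using * kd_chains[OF vs D] D by (auto simp: opsub_def intro: ksub_add[OF ksub_chains])
  moreover have "kd m vs x \<tau> \<in> I" for \<tau>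
    using kd_in[OF I(1) chainsD(1)[OF *(1)]] by (simp add: * kd_add plus_fun_apply kd_kd[OF vs])
  ultimately show "x \<in> relcyc vs D I j" by (simp add: relcyc_def)
qed

text \<open>
  The long exact sequence of \<open>0 \<rightarrow> K(I) \<rightarrow> K(D) \<rightarrow> K(D/I) \<rightarrow> 0\<close>: as \<open>K(D)\<close> is acyclic, the differential
  induces \<open>H\<^sub>i\<^sub>+\<^sub>1(D/I) \<cong> H\<^sub>i(I)\<close>. For \<open>i = 0\<close> the assumption \<open>I0\<close> says that \<open>I\<close> maps to zero in \<open>H\<^sub>0(D)\<close>.
\<close>

lemma qdim_connecting:
  assumes vs: "distinct vs" and D: "opsub vs D" and I: "opsub vs I" "I \<subseteq> D" and ac: "acyclic_on vs D"
    and I0: "i = 0 \<Longrightarrow> I \<subseteq> bnd0 vs D"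
  shows "qdim (relcyc vs D I (Suc i)) (relbnd vs D I (Suc i)) n \<longleftrightarrow> qdim (cyc vs I i) (bnd vs I i) n"
proof (rule qdim_image[where f = "kd m vs"])
  have VD: "vsub D" "vsub I" using D I by (auto simp: opsub_def)
  show "klin (relcyc vs D I (Suc i)) (kd m vs)" by (rule klin_kd)
  show "ksub (relcyc vs D I (Suc i))" using VD by (rule ksub_relcyc)
  show "ksub (bnd vs I i)" using VD by (intro ksub_bnd)
  show "kd m vs ` relcyc vs D I (Suc i) = cyc vs I i"
  proof
    show "kd m vs ` relcyc vs D I (Suc i) \<subseteq> cyc vs I i"
      by (auto simp: relcyc_def cyc_def kd_kd[OF vs] fun_eq_iff zero_fun_apply intro: kd_chainsI[OF vs])
    show "cyc vs I i \<subseteq> kd m vs ` relcyc vs D I (Suc i)"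
    proof
      fix z assume "z \<in> cyc vs I i"
      then have z: "z \<in> chains vs I i" "kd m vs z = 0" by (auto simp: cyc_def)
      have zD: "z \<in> chains vs D i" using z chains_mono[OF I(2)] by auto
      have "\<exists>y\<in>chains vs D (Suc i). kd m vs y = z"
      proof (cases i)
        case 0
        have "z {} \<in> bnd0 vs D" using I0[OF 0] chainsD(1)[OF z(1)] by auto
        then obtain y where y: "y \<in> chains vs D 1" "kd m vs y {} = z {}" by (rule bnd0E)
        have "kd m vs y \<in> chains vs D 0" using kd_chains[OF vs D] y by simp
        then have "kd m vs y = z" using zD y(2) 0 by (auto intro: chains_0_eqI)
        with y 0 show ?thesis by auto
      next
        case (Suc j)
        then show ?thesis using acyclicD[OF ac, of z j] zD z by blast
      qed
      then obtain y where y: "y \<in> chains vs D (Suc i)" "kd m vs y = z" by blast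
      then have "y \<in> relcyc vs D I (Suc i)" using chainsD(1)[OF z(1)] by (auto simp: relcyc_def)
      with y show "z \<in> kd m vs ` relcyc vs D I (Suc i)" by blast
    qed
  qed
  fix y assume y: "y \<in> relcyc vs D I (Suc i)"
  show "y \<in> relbnd vs D I (Suc i) \<longleftrightarrow> kd m vs y \<in> bnd vs I i"
  proof
    assume "y \<in> relbnd vs D I (Suc i)"
    then obtain u w where *: "u \<in> chains vs I (Suc i)" "y = u + kd m vs w" by (auto simp: relbnd_def)
    have "kd m vs y = kd m vs u" by (rule ext) (simp add: * kd_add plus_fun_apply kd_kd[OF vs])
    with * show "kd m vs y \<in> bnd vs I i" by (auto simp: bnd_def)
  next
    assume "kd m vs y \<in> bnd vs I i"
    then obtain u where u: "u \<in> chains vs I (Suc i)" "kd m vs y = kd m vs u" by (auto simp: bnd_def)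
    have "y - u \<in> chains vs D (Suc i)" using y u chains_mono[OF I(2)] ksub_chains[OF VD(1)]
      by (intro ksub_diff) (auto simp: relcyc_def)
    moreover have "kd m vs (y - u) = 0" by (simp add: kd_diff u)
    ultimately obtain w where "w \<in> chains vs D (Suc (Suc i))" "kd m vs w = y - u"
      using acyclicD[OF ac] by blast
    then show "y \<in> relbnd vs D I (Suc i)" using relbndI[OF u(1), of w D] by simp
  qed
qed

end

text \<open>
  Koszul homology of \<open>D/I\<close> is that of the image \<open>Z\<close> of a map on \<open>D\<close> with kernel \<open>I\<close>. The two sides may
  carry different operators, since the map may lead from series to vectors of series.
\<close>

lemma qdim_quotient_map:
  fixes m1 :: "'v \<Rightarrow> ('i \<Rightarrow> 'k::field) \<Rightarrow> 'i \<Rightarrow> 'k" and m2 :: "'v \<Rightarrow> ('j \<Rightarrow> 'k) \<Rightarrow> 'j \<Rightarrow> 'k"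
  assumes "commuting_operators m1" "commuting_operators m2"
    and vs: "distinct vs" and D: "commuting_operators.opsub m1 vs D"
    and add: "\<And>f g. f \<in> D \<Longrightarrow> g \<in> D \<Longrightarrow> \<Phi> (f + g) = \<Phi> f + \<Phi> g"
    and fsc: "\<And>c f. f \<in> D \<Longrightarrow> \<Phi> (fsc c f) = fsc c (\<Phi> f)"
    and ops: "\<And>v f. v \<in> set vs \<Longrightarrow> f \<in> D \<Longrightarrow> \<Phi> (m1 v f) = m2 v (\<Phi> f)"
    and Z: "Z = \<Phi> ` D" and I: "I = {f \<in> D. \<Phi> f = 0}"
  shows "qdim (commuting_operators.relcyc m1 vs D I j) (commuting_operators.relbnd m1 vs D I j) n \<longleftrightarrow>
         qdim (commuting_operators.cyc m2 vs Z j) (commuting_operators.bnd m2 vs Z j) n"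
proof -
  interpret a: commuting_operators m1 by fact
  interpret b: commuting_operators m2 by fact
  have VD: "vsub D" using D by (simp add: a.opsub_def)
  have \<Phi>0: "\<Phi> 0 = 0" using fsc[OF vsub_0[OF VD], of 0] by (simp add: fsc_simps)
  have \<Phi>neg: "\<Phi> (- f) = - \<Phi> f" if "f \<in> D" for f using fsc[OF that, of "-1"] by (simp add: fsc_simps)
  have I': "a.opsub vs I" "I \<subseteq> D"
    using D by (auto simp: a.opsub_def I vsub_def \<Phi>0 add fsc ops fsc_simps b.m_0)
  define F where "F y = (\<lambda>\<sigma>. \<Phi> (y \<sigma>))" for y :: "'v set \<Rightarrow> 'i \<Rightarrow> 'k"
  have comm: "\<Phi> (kd m1 ws z \<tau>) = kd m2 ws (F z) \<tau>" if "\<And>\<sigma>. z \<sigma> \<in> D" "set ws \<subseteq> set vs" for ws z \<tau>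
    using that
  proof (induction ws arbitrary: z \<tau>)
    case (Cons v ws)
    have ws: "a.opsub ws D" using D Cons.prems by (auto simp: a.opsub_def)
    have in1: "kd m1 ws (\<lambda>\<rho>. z (insert v \<rho>)) \<rho> \<in> D" for \<rho> by (rule a.kd_in[OF ws]) (rule Cons.prems)
    have in2: "kd m1 ws z \<rho> \<in> D" for \<rho> by (rule a.kd_in[OF ws]) (rule Cons.prems)
    have in3: "m1 v (z \<rho>) \<in> D" for \<rho> using D Cons.prems by (auto simp: a.opsub_def)
    have IH: "\<Phi> (kd m1 ws (\<lambda>\<rho>. z (insert v \<rho>)) \<rho>) = kd m2 ws (F (\<lambda>\<rho>. z (insert v \<rho>))) \<rho>"
      "\<Phi> (kd m1 ws z \<rho>) = kd m2 ws (F z) \<rho>" for \<rho>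
      using Cons.prems by (intro Cons.IH; auto)+
    show ?case using Cons.prems
      by (auto simp: \<Phi>neg in1 in2 in3 add IH ops F_def)
  qed (simp add: \<Phi>0)
  have F_chains: "F y \<in> chains vs Z i" if "y \<in> chains vs D i" for y i
  proof (rule chainsI)
    show "F y \<sigma> \<in> Z" for \<sigma> using chainsD(1)[OF that] by (auto simp: F_def Z)
    show "\<sigma> \<subseteq> set vs \<and> card \<sigma> = i" if "F y \<sigma> \<noteq> 0" for \<sigma>
      using chainsD(2)[OF \<open>y \<in> chains vs D i\<close>, of \<sigma>] that \<Phi>0 unfolding F_def by metis
  qed
  have lift: "\<exists>y\<in>chains vs D i. F y = z" if z: "z \<in> chains vs Z i" for z i
  proof -
    have "\<forall>\<sigma>. \<exists>f\<in>D. \<Phi> f = z \<sigma> \<and> (z \<sigma> = 0 \<longrightarrow> f = 0)"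
    proof
      fix \<sigma> show "\<exists>f\<in>D. \<Phi> f = z \<sigma> \<and> (z \<sigma> = 0 \<longrightarrow> f = 0)"
        using chainsD(1)[OF z, of \<sigma>] \<Phi>0 vsub_0[OF VD] by (cases "z \<sigma> = 0") (auto simp: Z)
    qed
    then obtain y where y: "\<And>\<sigma>. y \<sigma> \<in> D" "\<And>\<sigma>. \<Phi> (y \<sigma>) = z \<sigma>" "\<And>\<sigma>. z \<sigma> = 0 \<Longrightarrow> y \<sigma> = 0" by metis
    have "y \<in> chains vs D i" using y chains_nonzero[OF z] by (intro chainsI) metis+
    moreover have "F y = z" using y by (auto simp: F_def)
    ultimately show ?thesis by blast
  qed
  have Fk: "F (kd m1 vs y) = kd m2 vs (F y)" if "y \<in> chains vs D i" for y i
    using comm[of y vs] chainsD(1)[OF that] by (auto simp: F_def)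
  have F_add: "F (y + w) = F y + F w" if "y \<in> chains vs D i" "w \<in> chains vs D i" for y w i
    using chainsD(1)[OF that(1)] chainsD(1)[OF that(2)] by (auto simp: F_def chain_eq_iff plus_fun_apply add)
  have F_csc: "F (csc c y) = csc c (F y)" if "y \<in> chains vs D i" for y i c
    using chainsD(1)[OF that(1)] by (auto simp: F_def chain_eq_iff csc_fsc fsc)
  have mem: "y \<in> relcyc' \<longleftrightarrow> kd m2 vs (F y) = 0" if y: "y \<in> chains vs D j" and [simp]: "relcyc' = a.relcyc vs D I j" for y relcyc'
    using y comm[of y vs] chainsD(1)[OF y] a.kd_in[OF D chainsD(1)[OF y]]
    by (auto simp: a.relcyc_def I chain_eq_iff zero_chain_apply)
  show ?thesis
  proof (rule qdim_image[where f = F])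
    show "klin (a.relcyc vs D I j) F"
      unfolding klin_def using F_add[of _ j] F_csc[of _ j] by (auto simp: a.relcyc_def)
    show "ksub (a.relcyc vs D I j)" using VD I' by (intro a.ksub_relcyc) (auto simp: a.opsub_def)
    have "vsub Z"
    proof (rule vsubI)
      show "0 \<in> Z" unfolding Z using vsub_0[OF VD] \<Phi>0 by force
      show "f + g \<in> Z" if "f \<in> Z" "g \<in> Z" for f g
        using that vsub_add[OF VD] unfolding Z image_iff by (metis add)
      show "fsc x f \<in> Z" if "f \<in> Z" for x f
        using that vsub_fsc[OF VD] unfolding Z image_iff by (metis fsc)
    qed
    then show "ksub (b.bnd vs Z j)" by (rule b.ksub_bnd)
    show "F ` a.relcyc vs D I j = b.cyc vs Z j"
    proof
      show "F ` a.relcyc vs D I j \<subseteq> b.cyc vs Z j"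
      proof (rule image_subsetI)
        fix y assume y: "y \<in> a.relcyc vs D I j"
        then have "y \<in> chains vs D j" by (simp add: a.relcyc_def)
        with y mem[OF this refl] F_chains show "F y \<in> b.cyc vs Z j" by (simp add: b.cyc_def)
      qed
      show "b.cyc vs Z j \<subseteq> F ` a.relcyc vs D I j"
      proof
        fix z assume z: "z \<in> b.cyc vs Z j"
        then obtain y where y: "y \<in> chains vs D j" "F y = z" using lift[of z j] by (auto simp: b.cyc_def)
        then have "y \<in> a.relcyc vs D I j" using mem[OF y(1) refl] z by (simp add: b.cyc_def)
        with y show "z \<in> F ` a.relcyc vs D I j" by blast
      qed
    qed
    fix y assume "y \<in> a.relcyc vs D I j"
    then have y: "y \<in> chains vs D j" by (simp add: a.relcyc_def)
    show "y \<in> a.relbnd vs D I j \<longleftrightarrow> F y \<in> b.bnd vs Z j"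
    proof
      assume "y \<in> a.relbnd vs D I j"
      then obtain u w where *: "u \<in> chains vs I j" "w \<in> chains vs D (Suc j)" "y = u + kd m1 vs w" by (auto simp: a.relbnd_def)
      have "F u = 0" using chainsD(1)[OF *(1)] by (auto simp: F_def I chain_eq_iff zero_chain_apply)
      moreover have "u \<in> chains vs D j" using * chains_mono[OF I'(2)] by auto
      ultimately have "F y = kd m2 vs (F w)" using * F_add Fk a.kd_chains[OF vs D *(2)] by simp
      then show "F y \<in> b.bnd vs Z j" using F_chains[OF *(2)] by (auto simp: b.bnd_def)
    next
      assume "F y \<in> b.bnd vs Z j"
      then obtain z where z: "z \<in> chains vs Z (Suc j)" "F y = kd m2 vs z" by (auto simp: b.bnd_def)
      then obtain w where w: "w \<in> chains vs D (Suc j)" "F w = z" using lift by blast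
      have kw: "kd m1 vs w \<in> chains vs D j" by (rule a.kd_chains[OF vs D w(1)])
      have d: "y - kd m1 vs w \<in> chains vs D j" using y kw ksub_chains[OF VD] by (intro ksub_diff)
      have "F y = F (y - kd m1 vs w) + F (kd m1 vs w)" using F_add[OF d kw] by simp
      then have "F (y - kd m1 vs w) = 0" using Fk[OF w(1)] w z by simp
      then have "y - kd m1 vs w \<in> chains vs I j"
        using d by (auto simp: chains_def I F_def chain_eq_iff zero_chain_apply)
      then show "y \<in> a.relbnd vs D I j" using a.relbndI[OF _ w(1), of "y - kd m1 vs w" I] by simp
    qed
  qed
qed

section \<open>Polynomials and power series\<close>

lemma vsub_sum: "vsub D \<Longrightarrow> (\<And>i. i \<in> S \<Longrightarrow> f i \<in> D) \<Longrightarrow> sum f S \<in> D"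
  by (induction S rule: infinite_finite_induct) (auto simp: vsub_0 vsub_add)

lemma finite_submultisets [simp]: "finite {a. a \<subseteq># e}"
proof (induction e)
  case (add x e)
  have "{a. a \<subseteq># add_mset x e} \<subseteq> {a. a \<subseteq># e} \<union> add_mset x ` {a. a \<subseteq># e}"
  proof
    fix a assume a: "a \<in> {a. a \<subseteq># add_mset x e}"
    show "a \<in> {a. a \<subseteq># e} \<union> add_mset x ` {a. a \<subseteq># e}"
    proof (cases "x \<in># a")
      case True
      then obtain b where "a = add_mset x b" by (metis insert_DiffM)
      with a show ?thesis by auto
    next
      case False
      with a have "a \<subseteq># e" by (metis mem_Collect_eq diff_single_trivial subset_eq_diff_conv add_mset_remove_trivial add_mset_add_single)
      then show ?thesis by auto
    qed
  qed
  with add show ?case by (meson finite_Un finite_imageI finite_subset)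
qed simp

definition conv :: "('v multiset \<Rightarrow> 'k::field) \<Rightarrow> ('v multiset \<Rightarrow> 'k) \<Rightarrow> 'v multiset \<Rightarrow> 'k" where
  "conv f g = (\<lambda>e. \<Sum>a | a \<subseteq># e. f a * g (e - a))"

definition cst :: "'k::field \<Rightarrow> 'v multiset \<Rightarrow> 'k" where
  "cst c = (\<lambda>e. if e = {#} then c else 0)"

lemma subset_mset_via_count: "a \<subseteq># e \<longleftrightarrow> (\<forall>v. count a v \<le> count e v)"
  by (simp add: subseteq_mset_def)

lemma diff_diff_mset: "a \<subseteq># e \<Longrightarrow> e - (e - a) = a"
  by (auto simp: multiset_eq_iff subset_mset_via_count)

lemma conv_comm: "conv f g = conv g f"
proof
  fix e show "conv f g e = conv g f e"
    unfolding conv_def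
    by (rule sum.reindex_bij_witness[of _ "\<lambda>a. e - a" "\<lambda>a. e - a"])
       (auto simp: diff_diff_mset mult.commute)
qed

lemma conv_add: "conv f (g + h) = conv f g + conv f h" "conv (f + g) h = conv f h + conv g h"
  by (auto simp: conv_def fun_eq_iff pointwise algebra_simps sum.distrib)

lemma conv_sum: "conv f (sum g S) = (\<Sum>i\<in>S. conv f (g i))"
  by (auto simp: conv_def fun_eq_iff sum_fun_apply sum_distrib_left intro: sum.swap)

lemma conv_0: "conv f 0 = 0" "conv 0 f = 0"
  by (auto simp: conv_def fun_eq_iff pointwise)

lemma conv_neg: "conv f (- g) = - conv f g" "conv (- f) g = - conv f g"
  by (auto simp: conv_def fun_eq_iff pointwise sum_negf)

lemma conv_diff: "conv f (g - h) = conv f g - conv f h" "conv (f - g) h = conv f h - conv g h"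
  by (auto simp: conv_def fun_eq_iff pointwise algebra_simps sum_subtractf)

lemma conv_cst: "conv (cst c) f = fsc c f"
proof
  fix e
  have "conv (cst c) f e = (\<Sum>a | a \<subseteq># e. if a = {#} then c * f e else 0)"
    unfolding conv_def cst_def by (intro sum.cong) auto
  then show "conv (cst c) f e = fsc c f e" by (simp add: fsc_def)
qed

lemma conv_assoc: "conv (conv f g) h = conv f (conv g h)"
proof
  fix e
  have "conv (conv f g) h e = (\<Sum>(a, b) \<in> (SIGMA a:{a. a \<subseteq># e}. {b. b \<subseteq># a}). f b * g (a - b) * h (e - a))"
    unfolding conv_def by (subst sum.Sigma[symmetric]) (auto simp: sum_distrib_right)
  also have "\<dots> = (\<Sum>(b, d) \<in> (SIGMA b:{b. b \<subseteq># e}. {d. d \<subseteq># e - b}). f b * (g d * h (e - b - d)))"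
    by (rule sum.reindex_bij_witness[of _ "\<lambda>(b, d). (b + d, b)" "\<lambda>(a, b). (b, a - b)"],
        auto simp: mult.assoc subset_mset_via_count diff_le_mono le_diff_conv2 add.commute multiset_eq_iff)
       (meson order_trans)
  also have "\<dots> = conv f (conv g h) e"
    unfolding conv_def by (subst sum.Sigma[symmetric]) (auto simp: sum_distrib_left)
  finally show "conv (conv f g) h e = conv f (conv g h) e" .
qed

lemma conv_nonzero: "conv f g e \<noteq> 0 \<Longrightarrow> \<exists>a. a \<subseteq># e \<and> f a \<noteq> 0 \<and> g (e - a) \<noteq> 0"
  unfolding conv_def by (elim sum.not_neutral_contains_not_neutral) auto

lemma carrierD: "f \<in> series_carrier c V \<Longrightarrow> f e \<noteq> 0 \<Longrightarrow> set_mset e \<subseteq> V"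
  "f \<in> series_carrier c V \<Longrightarrow> c = Polynomials \<Longrightarrow> finite {e. f e \<noteq> 0}"
  by (auto simp: series_carrier_def)

lemma carrierI: "(\<And>e. f e \<noteq> 0 \<Longrightarrow> set_mset e \<subseteq> V) \<Longrightarrow> (c = Polynomials \<Longrightarrow> finite {e. f e \<noteq> 0}) \<Longrightarrow> f \<in> series_carrier c V"
  by (auto simp: series_carrier_def)

lemma carrier_supp_mono:
  assumes "f \<in> series_carrier c V" "\<And>e. g e \<noteq> 0 \<Longrightarrow> f e \<noteq> 0"
  shows "g \<in> series_carrier c V"
proof (rule carrierI)
  show "set_mset e \<subseteq> V" if "g e \<noteq> 0" for e using assms that carrierD(1) by metis
  show "finite {e. g e \<noteq> 0}" if "c = Polynomials"
    by (rule finite_subset[OF _ carrierD(2)[OF assms(1) that]]) (use assms(2) in auto)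
qed

lemma carrier_mono: "V \<subseteq> W \<Longrightarrow> series_carrier c V \<subseteq> series_carrier c W"
  by (auto simp: series_carrier_def)

lemma conv_carrier:
  assumes f: "f \<in> series_carrier c V" and g: "g \<in> series_carrier c V"
  shows "conv f g \<in> series_carrier c V"
proof (rule carrierI)
  fix e assume "conv f g e \<noteq> 0"
  then obtain a where a: "a \<subseteq># e" "f a \<noteq> 0" "g (e - a) \<noteq> 0" using conv_nonzero by blast
  then have "e = a + (e - a)" by simp
  then have "set_mset e = set_mset a \<union> set_mset (e - a)" by (metis set_mset_union)
  with a f g show "set_mset e \<subseteq> V" using carrierD(1) by (metis Un_least)
next
  assume "c = Polynomials"
  then have fin: "finite ((\<lambda>(a, b). a + b) ` ({e. f e \<noteq> 0} \<times> {e. g e \<noteq> 0}))"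
    using carrierD(2)[OF f] carrierD(2)[OF g] by simp
  show "finite {e. conv f g e \<noteq> 0}"
  proof (rule finite_subset[OF _ fin], rule subsetI)
    fix e assume "e \<in> {e. conv f g e \<noteq> 0}"
    then obtain a where a: "a \<subseteq># e" "f a \<noteq> 0" "g (e - a) \<noteq> 0" using conv_nonzero by blast
    then have "e = (\<lambda>(a, b). a + b) (a, e - a)" by simp
    with a show "e \<in> (\<lambda>(a, b). a + b) ` ({e. f e \<noteq> 0} \<times> {e. g e \<noteq> 0})" by blast
  qed
qed

lemma vsub_carrier: "vsub (series_carrier c V)"
proof (rule vsubI)
  show "0 \<in> series_carrier c V" by (auto simp: series_carrier_def pointwise)
next
  fix f g :: "'a multiset \<Rightarrow> 'b"
  assume f: "f \<in> series_carrier c V" and g: "g \<in> series_carrier c V"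
  have sub: "{e. (f + g) e \<noteq> 0} \<subseteq> {e. f e \<noteq> 0} \<union> {e. g e \<noteq> 0}" by (auto simp: pointwise)
  show "f + g \<in> series_carrier c V"
  proof (rule carrierI)
    fix e assume "(f + g) e \<noteq> 0"
    then have "f e \<noteq> 0 \<or> g e \<noteq> 0" using sub by blast
    then show "set_mset e \<subseteq> V" using f g carrierD(1) by metis
  next
    assume "c = Polynomials"
    then show "finite {e. (f + g) e \<noteq> 0}"
      using finite_subset[OF sub] carrierD(2)[OF f] carrierD(2)[OF g] by simp
  qed
next
  fix d and f :: "'a multiset \<Rightarrow> 'b"
  assume "f \<in> series_carrier c V"
  then show "fsc d f \<in> series_carrier c V" by (rule carrier_supp_mono) (auto simp: fsc_apply)
qed

lemma cst_carrier: "cst a \<in> series_carrier c V"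
proof (rule carrierI)
  show "set_mset e \<subseteq> V" if "cst a e \<noteq> 0" for e using that by (auto simp: cst_def split: if_splits)
  show "finite {e. cst a e \<noteq> 0}" by (rule finite_subset[of _ "{{#}}"]) (auto simp: cst_def split: if_splits)
qed

lemma variable_carrier: "v \<in> V \<Longrightarrow> variable v \<in> series_carrier c V"
proof (rule carrierI)
  show "set_mset e \<subseteq> V" if "variable v e \<noteq> 0" "v \<in> V" for e using that by (auto simp: variable_def split: if_splits)
  show "finite {e. variable v e \<noteq> 0}" by (rule finite_subset[of _ "{{#v#}}"]) (auto simp: variable_def split: if_splits)
qed

lemma series_ring_simps [simp]:
  "carrier (series_ring c V) = series_carrier c V"
  "f \<otimes>\<^bsub>series_ring c V\<^esub> g = conv f g"
  "\<one>\<^bsub>series_ring c V\<^esub> = cst 1"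
  "\<zero>\<^bsub>series_ring c V\<^esub> = 0"
  "f \<oplus>\<^bsub>series_ring c V\<^esub> g = f + g"
  by (simp_all add: series_ring_def conv_def cst_def zero_fun_def plus_fun_def)

lemma cring_series: "cring (series_ring c V)"
proof (rule cringI)
  note V = vsub_carrier
  show "abelian_group (series_ring c V)"
  proof (rule abelian_groupI)
    fix f assume "f \<in> carrier (series_ring c V)"
    then show "\<exists>g\<in>carrier (series_ring c V). g \<oplus>\<^bsub>series_ring c V\<^esub> f = \<zero>\<^bsub>series_ring c V\<^esub>"
      using vsub_neg[OF V] by (intro bexI[of _ "- f"]) auto
  qed (auto simp: vsub_add[OF V] vsub_0[OF V] add_ac)
  show "comm_monoid (series_ring c V)"
    by (rule comm_monoidI) (auto simp: conv_carrier cst_carrier conv_assoc conv_cst fsc_simps intro: conv_comm)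
qed (simp add: conv_add)

lemma series_ring_minus [simp]:
  assumes "f \<in> series_carrier c V"
  shows "\<ominus>\<^bsub>series_ring c V\<^esub> f = - f"
proof -
  interpret cring "series_ring c V" by (rule cring_series)
  show ?thesis using minus_equality[of "- f" f] assms vsub_neg[OF vsub_carrier, of f c V] by simp
qed

text \<open>
  Multiplication by a variable, by \<open>conv_variable\<close> below.
\<close>

definition shift :: "'v \<Rightarrow> ('v multiset \<Rightarrow> 'k::field) \<Rightarrow> 'v multiset \<Rightarrow> 'k" where
  "shift v f = (\<lambda>e. if v \<in># e then f (e - {#v#}) else 0)"

lemma conv_variable: "conv (variable v) f = shift v f"
proof
  fix e
  have "conv (variable v) f e = (\<Sum>a | a \<subseteq># e. if a = {#v#} then f (e - {#v#}) else 0)"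
    unfolding conv_def variable_def by (intro sum.cong) auto
  also have "\<dots> = shift v f e" by (simp add: shift_def)
  finally show "conv (variable v) f e = shift v f e" .
qed

interpretation sh: commuting_operators shift
proof
  fix u v and f g :: "'a multiset \<Rightarrow> 'b::field" and c
  show "shift v (f + g) = shift v f + shift v g" by (auto simp: shift_def fun_eq_iff pointwise)
  show "shift v (fsc c f) = fsc c (shift v f)" by (auto simp: shift_def fun_eq_iff fsc_apply)
  show "shift u (shift v f) = shift v (shift u f)"
    by (simp add: conv_variable[symmetric] conv_assoc[symmetric] conv_comm[of "variable u" "variable v"])
qed

lemma shift_carrier: "v \<in> V \<Longrightarrow> f \<in> series_carrier c V \<Longrightarrow> shift v f \<in> series_carrier c V"
  by (simp flip: conv_variable add: conv_carrier variable_carrier)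

lemma opsub_carrier: "set vs \<subseteq> V \<Longrightarrow> sh.opsub vs (series_carrier c V)"
  by (auto simp: sh.opsub_def vsub_carrier shift_carrier)

lemma ideal_vsub:
  assumes "ideal I (series_ring c V)" shows "vsub I"
proof -
  interpret ideal I "series_ring c V" by fact
  show ?thesis
  proof (rule vsubI)
    show "0 \<in> I" using additive_subgroup.zero_closed[OF ideal.axioms(1)[OF assms]] by simp
    show "f + g \<in> I" if "f \<in> I" "g \<in> I" for f g
      using additive_subgroup.a_closed[OF ideal.axioms(1)[OF assms] that] by simp
    show "fsc d f \<in> I" if "f \<in> I" for d f using I_l_closed[OF that, of "cst d"] by (simp add: cst_carrier conv_cst)
  qed
qed

lemma ideal_opsub:
  assumes "ideal I (series_ring c V)" "set vs \<subseteq> V" shows "sh.opsub vs I"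
proof -
  interpret ideal I "series_ring c V" by fact
  have "shift v f \<in> I" if "v \<in> set vs" "f \<in> I" for v f
    using I_l_closed[OF that(2), of "variable v"] that assms(2) by (auto simp: variable_carrier conv_variable)
  then show ?thesis using ideal_vsub[OF assms(1)] by (auto simp: sh.opsub_def)
qed

section \<open>The variables as a regular sequence\<close>

text \<open>
  Each monomial of \<open>f\<close> is charged to one of the variables in \<open>U\<close> that divide it. The supports do not grow,
  so that the cofactors inherit conditions on the monomials of \<open>f\<close>.
\<close>

lemma decompose_support:
  assumes U: "finite U" "U \<subseteq> V" and f: "f \<in> series_carrier c V" and meet: "\<And>e. f e \<noteq> 0 \<Longrightarrow> set_mset e \<inter> U \<noteq> {}"
  obtains g where "\<And>u. u \<in> U \<Longrightarrow> g u \<in> series_carrier c V" "\<And>u e. u \<in> U \<Longrightarrow> g u e \<noteq> 0 \<Longrightarrow> f (add_mset u e) \<noteq> 0"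
    "f = (\<Sum>u\<in>U. shift u (g u))"
proof -
  define ch where "ch e = (SOME u. u \<in> set_mset e \<inter> U)" for e
  have ch: "ch e \<in> set_mset e \<inter> U" if "set_mset e \<inter> U \<noteq> {}" for e
    using someI_ex[of "\<lambda>u. u \<in> set_mset e \<inter> U"] that unfolding ch_def by blast
  define g where "g u e = (if ch (add_mset u e) = u then f (add_mset u e) else 0)" for u e
  have "g u \<in> series_carrier c V" for u
  proof (rule carrierI)
    show "set_mset e \<subseteq> V" if "g u e \<noteq> 0" for e using carrierD(1)[OF f, of "add_mset u e"] that by (auto simp: g_def split: if_splits)
    assume c: "c = Polynomials"
    have "{e. g u e \<noteq> 0} \<subseteq> (\<lambda>e. e - {#u#}) ` {e. f e \<noteq> 0}"
    proof
      fix e assume "e \<in> {e. g u e \<noteq> 0}"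
      then have "f (add_mset u e) \<noteq> 0" by (auto simp: g_def split: if_splits)
      then show "e \<in> (\<lambda>e. e - {#u#}) ` {e. f e \<noteq> 0}" by (intro image_eqI[of _ _ "add_mset u e"]) auto
    qed
    then show "finite {e. g u e \<noteq> 0}" using carrierD(2)[OF f c] finite_surj by blast
  qed
  moreover have "f (add_mset u e) \<noteq> 0" if "g u e \<noteq> 0" for u e using that by (auto simp: g_def split: if_splits)
  moreover have "f = (\<Sum>u\<in>U. shift u (g u))"
  proof
    fix e
    have "(\<Sum>u\<in>U. shift u (g u)) e = (\<Sum>u\<in>U. if u \<in># e \<and> ch e = u then f e else 0)"
      unfolding sum_fun_apply by (intro sum.cong) (auto simp: shift_def g_def)
    also have "\<dots> = f e"
    proof (cases "f e = 0")
      case False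
      then have "ch e \<in># e" "ch e \<in> U" using ch[OF meet] by auto
      then have "(\<Sum>u\<in>U. if u \<in># e \<and> ch e = u then f e else 0) = (\<Sum>u\<in>U. if u = ch e then f e else 0)"
        by (intro sum.cong) auto
      with U \<open>ch e \<in> U\<close> show ?thesis by simp
    qed (simp cong: if_cong)
    finally show "f e = (\<Sum>u\<in>U. shift u (g u)) e" by simp
  qed
  ultimately show ?thesis using that by blast
qed

lemma meets_ideal:
  assumes "U \<subseteq> V"
  shows "ideal {f \<in> series_carrier c V. \<forall>e. f e \<noteq> 0 \<longrightarrow> set_mset e \<inter> U \<noteq> {}}
           (series_ring c V :: ('v multiset \<Rightarrow> 'k::field) ring)" (is "ideal ?M ?R")
proof -
  interpret R: cring ?R by (rule cring_series)
  note V = vsub_carrier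
  have vM: "vsub ?M"
  proof (rule vsubI)
    show "f + g \<in> ?M" if "f \<in> ?M" "g \<in> ?M" for f g
      using that by (auto simp: vsub_add[OF V]) (metis add.right_neutral plus_fun_apply)
  qed (auto simp: vsub_0[OF V] vsub_fsc[OF V] pointwise fsc_apply)
  have mult: "conv x f \<in> ?M" if f: "f \<in> ?M" and x: "x \<in> series_carrier c V" for x f
  proof -
    have "set_mset e \<inter> U \<noteq> {}" if "conv x f e \<noteq> 0" for e
    proof -
      obtain a where a: "a \<subseteq># e" "f (e - a) \<noteq> 0" using conv_nonzero[OF \<open>conv x f e \<noteq> 0\<close>] by blast
      then have "set_mset (e - a) \<inter> U \<noteq> {}" using f by auto
      then show ?thesis by (auto dest: in_diffD)
    qed
    then show ?thesis using f x by (auto simp: conv_carrier)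
  qed
  show ?thesis
  proof (rule idealI)
    show "subgroup ?M (add_monoid ?R)"
    proof (rule R.add.subgroupI)
      show "?M \<noteq> {}" using vsub_0[OF vM] by blast
      fix f g assume f: "f \<in> ?M" and g: "g \<in> ?M"
      show "\<ominus>\<^bsub>?R\<^esub> f \<in> ?M" using vsub_neg[OF vM f] f by simp
      show "f \<oplus>\<^bsub>?R\<^esub> g \<in> ?M" using vsub_add[OF vM f g] by simp
    qed auto
    fix f x assume "f \<in> ?M" "x \<in> carrier ?R"
    then show "x \<otimes>\<^bsub>?R\<^esub> f \<in> ?M" "f \<otimes>\<^bsub>?R\<^esub> x \<in> ?M" using mult conv_comm[of f x] by auto
  qed (rule R.ring_axioms)
qed

text \<open>
  Ideals generated by variables are determined by supports, for polynomials as for power series.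
\<close>

lemma variable_ideal_eq:
  assumes U: "finite U" "U \<subseteq> V"
  shows "variable_ideal c V U = {f :: 'v multiset \<Rightarrow> 'k::field. f \<in> series_carrier c V \<and> (\<forall>e. f e \<noteq> 0 \<longrightarrow> set_mset e \<inter> U \<noteq> {})}" (is "_ = ?M")
proof
  let ?R = "series_ring c V :: ('v multiset \<Rightarrow> 'k) ring"
  interpret R: cring ?R by (rule cring_series)
  have vars: "variable ` U \<subseteq> carrier ?R" using U by (auto simp: variable_carrier)
  show "variable_ideal c V U \<subseteq> ?M" unfolding variable_ideal_def
  proof (rule R.genideal_minimal[OF meets_ideal[OF U(2)]], rule image_subsetI)
    fix u assume u: "u \<in> U"
    then have "variable u \<in> series_carrier c V" using U by (intro variable_carrier) auto
    then show "variable u \<in> ?M" using u by (auto simp: variable_def[of u])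
  qed
  show "?M \<subseteq> variable_ideal c V U"
  proof
    fix f assume f: "f \<in> ?M"
    then obtain g where g: "\<And>u. u \<in> U \<Longrightarrow> g u \<in> series_carrier c V" "f = (\<Sum>u\<in>U. shift u (g u))"
      using decompose_support[OF U, of f c] by auto
    have I: "ideal (variable_ideal c V U) ?R" unfolding variable_ideal_def by (rule R.genideal_ideal[OF vars])
    have "shift u (g u) \<in> variable_ideal c V U" if "u \<in> U" for u
    proof -
      have "(variable u :: 'v multiset \<Rightarrow> 'k) \<in> variable_ideal c V U"
        unfolding variable_ideal_def by (rule subsetD[OF R.genideal_self[OF vars]]) (use that in blast)
      from ideal.I_r_closed[OF I this, of "g u"] g(1)[OF that] show ?thesis by (simp add: conv_variable)
    qed
    then show "f \<in> variable_ideal c V U" unfolding g(2)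
      by (rule vsub_sum[OF ideal_vsub[OF I]])
  qed
qed

lemma maximal_ideal_eq:
  assumes "finite V"
  shows "variable_ideal c V V = {f \<in> series_carrier c V. f {#} = 0}"
proof -
  have "(\<forall>e. f e \<noteq> 0 \<longrightarrow> set_mset e \<inter> V \<noteq> {}) \<longleftrightarrow> f {#} = 0" if f: "f \<in> series_carrier c V" for f :: "'a multiset \<Rightarrow> 'b"
  proof
    assume z: "f {#} = 0"
    show "\<forall>e. f e \<noteq> 0 \<longrightarrow> set_mset e \<inter> V \<noteq> {}"
    proof (intro allI impI)
      fix e assume e: "f e \<noteq> 0"
      with z have "e \<noteq> {#}" by auto
      with carrierD(1)[OF f e] show "set_mset e \<inter> V \<noteq> {}" by auto
    qed
  qed auto
  then show ?thesis using variable_ideal_eq[OF assms, of V c] by auto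
qed

lemma (in commuting_operators) kd_empty: "distinct vs \<Longrightarrow> kd m vs w {} = (\<Sum>u\<in>set vs. m u (w {u}))"
  by (induction vs) (simp_all add: add.commute)

lemma (in commuting_operators) bnd0_eq:
  assumes vs: "distinct vs" and D: "vsub D"
  shows "bnd0 vs D = {f. \<exists>g. (\<forall>u\<in>set vs. g u \<in> D) \<and> f = (\<Sum>u\<in>set vs. m u (g u))}"
proof (intro Set.set_eqI iffI)
  fix f assume "f \<in> bnd0 vs D"
  then obtain w where w: "w \<in> chains vs D 1" "kd m vs w {} = f" by (rule bnd0E)
  then show "f \<in> {f. \<exists>g. (\<forall>u\<in>set vs. g u \<in> D) \<and> f = (\<Sum>u\<in>set vs. m u (g u))}"
    using kd_empty[OF vs, of w] chainsD(1)[OF w(1)] by (intro CollectI exI[of _ "\<lambda>u. w {u}"]) auto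
next
  fix f assume "f \<in> {f. \<exists>g. (\<forall>u\<in>set vs. g u \<in> D) \<and> f = (\<Sum>u\<in>set vs. m u (g u))}"
  then obtain g where g: "\<And>u. u \<in> set vs \<Longrightarrow> g u \<in> D" "f = (\<Sum>u\<in>set vs. m u (g u))" by auto
  define w where "w \<sigma> = (if \<exists>u\<in>set vs. \<sigma> = {u} then g (the_elem \<sigma>) else 0)" for \<sigma>
  have "w \<in> chains vs D 1"
    using g(1) vsub_0[OF D] by (intro chainsI) (auto simp: w_def split: if_splits)
  moreover have "kd m vs w {} = f" unfolding kd_empty[OF vs] g(2) by (intro sum.cong) (auto simp: w_def)
  ultimately show "f \<in> bnd0 vs D" by (rule bnd0I)
qed

lemma bnd0_carrier:
  assumes vs: "distinct vs" "set vs \<subseteq> V"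
  shows "sh.bnd0 vs (series_carrier c V) = {f \<in> series_carrier c V. \<forall>e. f e \<noteq> 0 \<longrightarrow> set_mset e \<inter> set vs \<noteq> {}}"
proof (intro Set.set_eqI iffI)
  fix f :: "'a multiset \<Rightarrow> 'b" assume "f \<in> sh.bnd0 vs (series_carrier c V)"
  then obtain g where g: "\<And>u. u \<in> set vs \<Longrightarrow> g u \<in> series_carrier c V" "f = (\<Sum>u\<in>set vs. shift u (g u))"
    unfolding sh.bnd0_eq[OF vs(1) vsub_carrier] by blast
  have v: "vsub {f \<in> series_carrier c V. \<forall>e. f e \<noteq> 0 \<longrightarrow> set_mset e \<inter> set vs \<noteq> {}}" (is "vsub ?M")
    using ideal_vsub[OF meets_ideal[OF vs(2)]] .
  have "shift u (g u) \<in> ?M" if "u \<in> set vs" for u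
    using shift_carrier[of u V "g u" c] g(1)[OF that] that vs(2) by (auto simp: shift_def split: if_splits)
  then show "f \<in> ?M" unfolding g(2)
    by (rule vsub_sum[OF v])
next
  fix f :: "'a multiset \<Rightarrow> 'b" assume "f \<in> {f \<in> series_carrier c V. \<forall>e. f e \<noteq> 0 \<longrightarrow> set_mset e \<inter> set vs \<noteq> {}}"
  then obtain g where "\<And>u. u \<in> set vs \<Longrightarrow> g u \<in> series_carrier c V" "f = (\<Sum>u\<in>set vs. shift u (g u))"
    using decompose_support[OF finite_set vs(2), of f c] by auto
  then show "f \<in> sh.bnd0 vs (series_carrier c V)"
    unfolding sh.bnd0_eq[OF vs(1) vsub_carrier] by blast
qed

text \<open>
  The variables form a regular sequence: if every monomial of \<open>v f\<close> is divisible by a variable in \<open>vs\<close>,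
  then so is every monomial of \<open>f\<close>, because \<open>v\<close> is not in \<open>vs\<close>.
\<close>

lemma acyclic_carrier:
  assumes "distinct vs" "set vs \<subseteq> V"
  shows "sh.acyclic_on vs (series_carrier c V :: ('v multiset \<Rightarrow> 'k::field) set)"
  using assms
proof (induction vs)
  case (Cons v vs)
  then have d: "distinct vs" "set vs \<subseteq> V" "v \<notin> set vs" by auto
  show ?case
  proof (rule sh.acyclic_Cons[OF Cons.prems(1) opsub_carrier[OF Cons.prems(2)]])
    show "sh.acyclic_on vs (series_carrier c V :: ('v multiset \<Rightarrow> 'k) set)" using Cons.IH d by blast
    fix f :: "'v multiset \<Rightarrow> 'k" assume f: "f \<in> series_carrier c V" "shift v f \<in> sh.bnd0 vs (series_carrier c V)"
    have "set_mset e \<inter> set vs \<noteq> {}" if "f e \<noteq> 0" for e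
    proof -
      have "shift v f (add_mset v e) \<noteq> 0" using that by (simp add: shift_def)
      then have "set_mset (add_mset v e) \<inter> set vs \<noteq> {}" using f(2) unfolding bnd0_carrier[OF d(1,2)] by blast
      with d(3) show ?thesis by auto
    qed
    with f(1) show "f \<in> sh.bnd0 vs (series_carrier c V)" unfolding bnd0_carrier[OF d(1,2)] by blast
  qed
qed (rule sh.acyclic_Nil)

text \<open>
  By \<open>betti_koszul\<close> below, this says that \<open>n\<close> is the \<open>j\<close>-th Betti number of the quotient of the
  ring on the variables \<open>V\<close> by \<open>I\<close>, when \<open>vs\<close> enumerates \<open>V\<close>.
\<close>

abbreviation koszul_dim :: "ring_kind \<Rightarrow> 'v list \<Rightarrow> 'v set \<Rightarrow> ('v multiset \<Rightarrow> 'k::field) set \<Rightarrow> nat \<Rightarrow> nat \<Rightarrow> bool" where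
  "koszul_dim c vs V I j n \<equiv>
     qdim (sh.relcyc vs (series_carrier c V) I j) (sh.relbnd vs (series_carrier c V) I j) n"

section \<open>Betti numbers as dimensions of Koszul homology\<close>

text \<open>
  Vectors of series are again families of coefficients, indexed by a position and a monomial, so that the
  results on Koszul complexes apply to free modules. The functions \<open>flat\<close> and \<open>unflat\<close> translate to and
  from the extensional functions that form a \<open>free_module\<close>.
\<close>

definition slot :: "nat \<Rightarrow> (nat \<times> 'v multiset \<Rightarrow> 'k) \<Rightarrow> 'v multiset \<Rightarrow> 'k" where
  "slot l w = (\<lambda>e. w (l, e))"

lemma slot_eqI: "(\<And>l. slot l w = slot l w') \<Longrightarrow> w = w'"
  by (auto simp: slot_def fun_eq_iff)

lemma slot_simps: "slot l (w + w') = slot l w + slot l w'" "slot l (fsc c w) = fsc c (slot l w)" "slot l 0 = 0"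
  "slot l (w - w') = slot l w - slot l w'" "slot l (- w) = - slot l w"
  by (auto simp: slot_def fun_eq_iff pointwise fsc_apply)

definition shiftb :: "'v \<Rightarrow> (nat \<times> 'v multiset \<Rightarrow> 'k::field) \<Rightarrow> nat \<times> 'v multiset \<Rightarrow> 'k" where
  "shiftb v w = (\<lambda>(l, e). shift v (slot l w) e)"

lemma slot_shiftb: "slot l (shiftb v w) = shift v (slot l w)"
  by (auto simp: slot_def shiftb_def)

interpretation sb: commuting_operators shiftb
  by standard (auto intro!: slot_eqI simp: slot_simps slot_shiftb sh.m_add sh.m_fsc sh.m_comm)

definition FQ :: "ring_kind \<Rightarrow> 'v set \<Rightarrow> nat \<Rightarrow> (nat \<times> 'v multiset \<Rightarrow> 'k::field) set" where
  "FQ c V b = {w. \<forall>l. slot l w \<in> series_carrier c V \<and> (b \<le> l \<longrightarrow> slot l w = 0)}"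

definition flat :: "nat \<Rightarrow> (nat \<Rightarrow> 'v multiset \<Rightarrow> 'k::field) \<Rightarrow> nat \<times> 'v multiset \<Rightarrow> 'k" where
  "flat b u = (\<lambda>(l, e). if l < b then u l e else 0)"

definition unflat :: "nat \<Rightarrow> (nat \<times> 'v multiset \<Rightarrow> 'k::field) \<Rightarrow> nat \<Rightarrow> 'v multiset \<Rightarrow> 'k" where
  "unflat b w = (\<lambda>l\<in>{..<b}. slot l w)"

lemma slot_flat: "slot l (flat b u) = (if l < b then u l else 0)"
  by (auto simp: slot_def flat_def pointwise)

abbreviation free :: "ring_kind \<Rightarrow> 'v set \<Rightarrow> nat \<Rightarrow> ('v multiset \<Rightarrow> 'k::field, nat \<Rightarrow> 'v multiset \<Rightarrow> 'k) module" where
  "free c V b \<equiv> free_module (series_ring c V) b"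

lemma free_module_simps [simp]:
  "carrier (free_module Q b) = {..<b} \<rightarrow>\<^sub>E carrier Q"
  "zero (free_module Q b) = (\<lambda>l\<in>{..<b}. \<zero>\<^bsub>Q\<^esub>)"
  "add (free_module Q b) = (\<lambda>u v. \<lambda>l\<in>{..<b}. u l \<oplus>\<^bsub>Q\<^esub> v l)"
  "smult (free_module Q b) = (\<lambda>r v. \<lambda>l\<in>{..<b}. r \<otimes>\<^bsub>Q\<^esub> v l)"
  by (simp_all add: free_module_def)

lemma flat_FQ: "u \<in> {..<b} \<rightarrow>\<^sub>E series_carrier c V \<Longrightarrow> flat b u \<in> FQ c V b"
  using vsub_0[OF vsub_carrier] by (auto simp: FQ_def slot_flat)

lemma unflat_carrier: "w \<in> FQ c V b \<Longrightarrow> unflat b w \<in> {..<b} \<rightarrow>\<^sub>E series_carrier c V"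
  by (auto simp: FQ_def unflat_def)

lemma flat_unflat: "w \<in> FQ c V b \<Longrightarrow> flat b (unflat b w) = w"
  by (auto intro!: slot_eqI simp: FQ_def slot_flat unflat_def)

lemma unflat_flat: "u \<in> {..<b} \<rightarrow>\<^sub>E A \<Longrightarrow> unflat b (flat b u) = u"
  by (rule ext) (auto simp: unflat_def slot_flat restrict_def PiE_def extensional_def)

lemma flat_add: "flat b (\<lambda>l\<in>{..<b}. u l + v l) = flat b u + flat b v"
  by (auto intro!: slot_eqI simp: slot_flat slot_simps)

lemma flat_cst: "flat b (\<lambda>l\<in>{..<b}. conv (cst a) (u l)) = fsc a (flat b u)"
  by (auto intro!: slot_eqI simp: slot_flat slot_simps conv_cst fsc_simps)

lemma flat_shift: "flat b (\<lambda>l\<in>{..<b}. conv (variable v) (u l)) = shiftb v (flat b u)"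
  by (auto intro!: slot_eqI simp: slot_flat slot_shiftb conv_variable sh.m_0)

lemma unflat_add: "unflat b (w + w') = (\<lambda>l\<in>{..<b}. unflat b w l + unflat b w' l)"
  by (auto simp: unflat_def slot_simps)

lemma unflat_fsc: "unflat b (fsc a w) = (\<lambda>l\<in>{..<b}. conv (cst a) (unflat b w l))"
  by (auto simp: unflat_def slot_simps conv_cst)

lemma unflat_shiftb: "unflat b (shiftb v w) = (\<lambda>l\<in>{..<b}. conv (variable v) (unflat b w l))"
  by (auto simp: unflat_def slot_shiftb conv_variable)

lemma flat_eq_0: "u \<in> {..<b} \<rightarrow>\<^sub>E A \<Longrightarrow> flat b u = 0 \<longleftrightarrow> u = (\<lambda>l\<in>{..<b}. 0)"
proof
  assume u: "u \<in> {..<b} \<rightarrow>\<^sub>E A" "flat b u = 0"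
  have "unflat b (flat b u) = (\<lambda>l\<in>{..<b}. 0)" unfolding u(2) by (simp add: unflat_def slot_simps)
  then show "u = (\<lambda>l\<in>{..<b}. 0)" using unflat_flat[OF u(1)] by simp
next
  assume "u = (\<lambda>l\<in>{..<b}. 0)"
  then show "flat b u = 0" by (intro slot_eqI) (simp add: slot_flat slot_simps)
qed

lemma vsub_FQ: "vsub (FQ c V b)"
  by (auto intro!: vsubI simp: FQ_def slot_simps fsc_simps vsub_0[OF vsub_carrier] vsub_add[OF vsub_carrier] vsub_fsc[OF vsub_carrier])

lemma opsub_FQ: "set vs \<subseteq> V \<Longrightarrow> sb.opsub vs (FQ c V b)"
  by (auto simp: sb.opsub_def vsub_FQ) (auto simp: FQ_def slot_shiftb shift_carrier sh.m_0)

lemma slot_kd: "slot l (kd shiftb vs z \<tau>) = kd shift vs (\<lambda>\<sigma>. slot l (z \<sigma>)) \<tau>"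
  by (induction vs arbitrary: z \<tau>) (auto simp: slot_simps slot_shiftb)

definition unslot :: "(nat \<Rightarrow> 's \<Rightarrow> 'v multiset \<Rightarrow> 'k) \<Rightarrow> 's \<Rightarrow> nat \<times> 'v multiset \<Rightarrow> 'k" where
  "unslot y = (\<lambda>\<sigma> (l, e). y l \<sigma> e)"

lemma slot_unslot: "slot l (unslot y \<sigma>) = y l \<sigma>"
  by (simp add: slot_def unslot_def)

lemma unslot_chains:
  assumes "\<And>l. l < b \<Longrightarrow> y l \<in> chains vs (series_carrier c V) j" "\<And>l \<sigma>. b \<le> l \<Longrightarrow> y l \<sigma> = 0"
  shows "unslot y \<in> chains vs (FQ c V b) j"
proof (rule chainsI)
  fix \<sigma>
  have "y l \<sigma> \<in> series_carrier c V" for l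
    using assms chainsD(1)[OF assms(1), of l \<sigma>] vsub_0[OF vsub_carrier] by (cases "l < b") auto
  then show "unslot y \<sigma> \<in> FQ c V b" using assms(2) by (auto simp: FQ_def slot_unslot)
  assume "unslot y \<sigma> \<noteq> 0"
  then obtain l where l: "y l \<sigma> \<noteq> 0" by (metis slot_eqI slot_simps(3) slot_unslot)
  then have "l < b" using assms(2) not_le by metis
  with l show "\<sigma> \<subseteq> set vs \<and> card \<sigma> = j" using chains_nonzero[OF assms(1)] by blast
qed

lemma slot_chains: "z \<in> chains vs (FQ c V b) j \<Longrightarrow> (\<lambda>\<sigma>. slot l (z \<sigma>)) \<in> chains vs (series_carrier c V) j"
proof (rule chainsI)
  assume z: "z \<in> chains vs (FQ c V b) j"
  show "slot l (z \<sigma>) \<in> series_carrier c V" for \<sigma> using chainsD(1)[OF z] by (auto simp: FQ_def)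
  show "\<sigma> \<subseteq> set vs \<and> card \<sigma> = j" if "slot l (z \<sigma>) \<noteq> 0" for \<sigma>
    using chains_nonzero[OF z, of \<sigma>] that slot_simps(3) by metis
qed

lemma acyclic_FQ:
  assumes vs: "distinct vs" "set vs \<subseteq> V"
  shows "sb.acyclic_on vs (FQ c V b :: (nat \<times> 'v multiset \<Rightarrow> 'k::field) set)"
  unfolding sb.acyclic_on_def
proof (intro allI subsetI)
  fix j and z :: "'v set \<Rightarrow> nat \<times> 'v multiset \<Rightarrow> 'k"
  assume "z \<in> sb.cyc vs (FQ c V b) (Suc j)"
  then have z: "z \<in> chains vs (FQ c V b) (Suc j)" "kd shiftb vs z = 0" by (auto simp: sb.cyc_def)
  have "\<exists>y\<in>chains vs (series_carrier c V) (Suc (Suc j)). kd shift vs y = (\<lambda>\<sigma>. slot l (z \<sigma>))" for l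
  proof -
    have "kd shift vs (\<lambda>\<sigma>. slot l (z \<sigma>)) = 0"
      by (rule ext) (simp add: slot_kd[symmetric] z(2) zero_chain_apply slot_simps)
    then show ?thesis using sh.acyclicD[OF acyclic_carrier[OF vs] slot_chains[OF z(1)]] by blast
  qed
  then obtain y where y: "\<And>l. y l \<in> chains vs (series_carrier c V) (Suc (Suc j))" "\<And>l. kd shift vs (y l) = (\<lambda>\<sigma>. slot l (z \<sigma>))" by metis
  define y' where "y' l = (if l < b then y l else 0)" for l
  have y': "unslot y' \<in> chains vs (FQ c V b) (Suc (Suc j))"
    using y(1) by (intro unslot_chains) (auto simp: y'_def zero_chain_apply)
  moreover have "kd shiftb vs (unslot y') = z"
  proof (rule ext, rule slot_eqI)
    fix \<tau> l
    have "slot l (kd shiftb vs (unslot y') \<tau>) = kd shift vs (y' l) \<tau>"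
      by (simp add: slot_kd slot_unslot)
    also have "\<dots> = slot l (z \<tau>)"
    proof (cases "l < b")
      case False
      have "z \<tau> \<in> FQ c V b" using chainsD(1)[OF z(1)] .
      then have "slot l (z \<tau>) = 0" using False by (simp add: FQ_def)
      then show ?thesis using False by (simp add: y'_def sh.kd_zero zero_chain_apply)
    qed (simp add: y'_def y)
    finally show "slot l (kd shiftb vs (unslot y') \<tau>) = slot l (z \<tau>)" .
  qed
  ultimately show "z \<in> sb.bnd vs (FQ c V b) (Suc j)" by (rule sb.bndI)
qed

lemma bnd0_maximal:
  assumes vs: "distinct vs" "set vs = V"
  shows "sh.bnd0 vs (series_carrier c V) = {f :: 'v multiset \<Rightarrow> 'k::field. f \<in> series_carrier c V \<and> f {#} = 0}"
proof -
  have V: "finite V" using vs by auto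
  have "set vs \<subseteq> V" using vs by simp
  then have "sh.bnd0 vs (series_carrier c V) = (variable_ideal c V V :: ('v multiset \<Rightarrow> 'k) set)"
    unfolding variable_ideal_eq[OF V subset_refl] using bnd0_carrier[OF vs(1), where 'b='k] vs(2) by simp
  then show ?thesis unfolding maximal_ideal_eq[OF V] .
qed

lemma bnd0_FQ:
  assumes vs: "distinct vs" "set vs = V"
  shows "sb.bnd0 vs (FQ c V b :: (nat \<times> 'v multiset \<Rightarrow> 'k::field) set) = {w \<in> FQ c V b. \<forall>l. slot l w {#} = 0}"
proof (intro Set.set_eqI iffI)
  note m = bnd0_maximal[OF vs]
  fix w :: "nat \<times> 'v multiset \<Rightarrow> 'k"
  {
    assume "w \<in> sb.bnd0 vs (FQ c V b)"
    then obtain z where z: "z \<in> chains vs (FQ c V b) 1" "kd shiftb vs z {} = w" by (rule sb.bnd0E)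
    have "w \<in> FQ c V b" using sb.kd_in[OF opsub_FQ, of vs V z c b] chainsD(1)[OF z(1)] vs z(2) by auto
    moreover have "slot l w \<in> sh.bnd0 vs (series_carrier c V)" for l
      using slot_chains[OF z(1), of l] z(2) slot_kd[of l vs z "{}"] by (intro sh.bnd0I) auto
    ultimately show "w \<in> {w \<in> FQ c V b. \<forall>l. slot l w {#} = 0}" unfolding m by auto
  }
  assume w: "w \<in> {w \<in> FQ c V b. \<forall>l. slot l w {#} = 0}"
  have "slot l w \<in> sh.bnd0 vs (series_carrier c V)" for l unfolding m using w by (auto simp: FQ_def)
  then have "\<exists>y\<in>chains vs (series_carrier c V) 1. kd shift vs y {} = slot l w" for l by (metis sh.bnd0E)
  then obtain y where y: "\<And>l. y l \<in> chains vs (series_carrier c V) 1" "\<And>l. kd shift vs (y l) {} = slot l w" by metis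
  define y' where "y' l = (if l < b then y l else 0)" for l
  have "unslot y' \<in> chains vs (FQ c V b) 1"
    using y(1) by (intro unslot_chains) (auto simp: y'_def zero_chain_apply)
  moreover have "kd shiftb vs (unslot y') {} = w"
  proof (rule slot_eqI)
    fix l
    have "slot l (kd shiftb vs (unslot y') {}) = kd shift vs (y' l) {}" by (simp add: slot_kd slot_unslot)
    also have "\<dots> = slot l w" using w y by (auto simp: y'_def FQ_def sh.kd_zero zero_chain_apply)
    finally show "slot l (kd shiftb vs (unslot y') {}) = slot l w" .
  qed
  ultimately show "w \<in> sb.bnd0 vs (FQ c V b)" by (rule sb.bnd0I)
qed

text \<open>
  In degree \<open>0\<close> Koszul homology is \<open>Q\<^sup>b/(\<mm>Q\<^sup>b + Z)\<close>, which is \<open>k\<^sup>b\<close> when \<open>Z\<close> lies in \<open>\<mm>Q\<^sup>b\<close>. The constant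
  terms of the entries are the coordinates.
\<close>

lemma qdim_FQ_0:
  fixes Z :: "(nat \<times> 'v multiset \<Rightarrow> 'k::field) set"
  assumes vs: "distinct vs" "set vs = V" and Z: "vsub Z" "Z \<subseteq> FQ c V b" "\<And>w l. w \<in> Z \<Longrightarrow> slot l w {#} = 0"
  shows "qdim (sb.relcyc vs (FQ c V b) Z 0) (sb.relbnd vs (FQ c V b) Z 0) b"
proof -
  define lam where "lam l z = slot l (z {}) {#}" for l and z :: "'v set \<Rightarrow> nat \<times> 'v multiset \<Rightarrow> 'k"
  define E :: "nat \<Rightarrow> 'v set \<Rightarrow> nat \<times> 'v multiset \<Rightarrow> 'k" where "E l = (\<lambda>\<sigma> (j, e). if \<sigma> = {} \<and> j = l \<and> e = {#} then 1 else 0)" for l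

  let ?U = "chains vs (FQ c V b :: (nat \<times> 'v multiset \<Rightarrow> 'k) set) 0"
  have slotE: "slot j (E l {}) = (if j = l then cst 1 else 0)" for j l
    by (auto simp: E_def slot_def cst_def fun_eq_iff pointwise)
  have "qdim ?U {u \<in> ?U. \<forall>l\<in>{..<b}. lam l u = 0} (card {..<b})"
  proof (rule qdim_dual_basis[where e = E])
    show "ksub ?U" by (rule ksub_chains[OF vsub_FQ])
    show "E l \<in> ?U" if "l \<in> {..<b}" for l
    proof -
      have "E l {} \<in> FQ c V b" using that cst_carrier vsub_0[OF vsub_carrier, of c V] by (auto simp: FQ_def slotE)
      moreover have "E l \<sigma> = 0" if "\<sigma> \<noteq> {}" for \<sigma> using that by (auto simp: E_def fun_eq_iff pointwise)
      ultimately show ?thesis using vsub_0[OF vsub_FQ] by (auto simp: chains_0_iff)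
    qed
    show "lam t (E s) = (if s = t then 1 else 0)" for s t by (auto simp: lam_def slotE cst_def pointwise)
  qed (auto simp: lam_def slot_simps plus_fun_apply csc_fsc fsc_apply)
  moreover have "kd shiftb vs u = 0" if "u \<in> ?U" for u by (rule sb.kd_chains_0[OF vs(1) that])
  then have "sb.relcyc vs (FQ c V b) Z 0 = ?U"
    using vsub_0[OF Z(1)] by (auto simp: sb.relcyc_def zero_chain_apply)
  moreover have "sb.relbnd vs (FQ c V b) Z 0 = {u \<in> ?U. \<forall>l\<in>{..<b}. lam l u = 0}"
  proof (intro Set.set_eqI iffI)
    fix z :: "'v set \<Rightarrow> nat \<times> 'v multiset \<Rightarrow> 'k"
    assume "z \<in> sb.relbnd vs (FQ c V b) Z 0"
    then obtain u w where uw: "u \<in> chains vs Z 0" "w \<in> chains vs (FQ c V b) (Suc 0)" "z = u + kd shiftb vs w"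
      by (auto simp: sb.relbnd_def)
    have "u \<in> ?U" "kd shiftb vs w \<in> ?U"
      using chains_mono[OF Z(2)] uw(1) sb.kd_chains[OF vs(1) opsub_FQ uw(2)] vs by auto
    then have "z \<in> ?U" using uw ksub_add[OF ksub_chains[OF vsub_FQ]] by blast
    moreover have "kd shiftb vs w {} \<in> sb.bnd0 vs (FQ c V b)" using uw(2) by (intro sb.bnd0I) auto
    then have "slot l (kd shiftb vs w {}) {#} = 0" for l unfolding bnd0_FQ[OF vs] by blast
    then have "lam l z = 0" for l using Z(3)[OF chainsD(1)[OF uw(1)]]
      by (simp add: lam_def uw(3) plus_fun_apply slot_simps)
    ultimately show "z \<in> {u \<in> ?U. \<forall>l\<in>{..<b}. lam l u = 0}" by blast
  next
    fix z :: "'v set \<Rightarrow> nat \<times> 'v multiset \<Rightarrow> 'k"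
    assume z: "z \<in> {u \<in> ?U. \<forall>l\<in>{..<b}. lam l u = 0}"
    then have zF: "z {} \<in> FQ c V b" by (auto intro: chainsD(1))
    have "slot l (z {}) {#} = 0" for l
      using z zF by (cases "l < b") (auto simp: lam_def FQ_def pointwise)
    with zF have "z {} \<in> sb.bnd0 vs (FQ c V b)" unfolding bnd0_FQ[OF vs] by blast
    then obtain w where w: "w \<in> chains vs (FQ c V b) 1" "kd shiftb vs w {} = z {}" by (rule sb.bnd0E)
    have "kd shiftb vs w \<in> ?U" using sb.kd_chains[OF vs(1) opsub_FQ, of V w c b 0] w vs by auto
    then have "kd shiftb vs w = z" using z w by (auto intro: chains_0_eqI)
    then show "z \<in> sb.relbnd vs (FQ c V b) Z 0"
      using sb.relbndI[OF ksub_0[OF ksub_chains[OF Z(1)]], of w vs "FQ c V b" 0 ] w by simp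
  qed
  ultimately show ?thesis by simp
qed

lemma free_resolution_exact:
  assumes "free_resolution Q M b p \<phi>"
  shows "p \<in> module_homs Q (free_module Q (b 0)) M" "\<phi> i \<in> module_homs Q (free_module Q (b (Suc i))) (free_module Q (b i))"
    "p ` carrier (free_module Q (b 0)) = carrier M"
    "\<phi> 0 ` carrier (free_module Q (b 1)) = a_kernel (free_module Q (b 0)) M p"
    "\<phi> (Suc i) ` carrier (free_module Q (b (Suc (Suc i)))) = a_kernel (free_module Q (b (Suc i))) (free_module Q (b i)) (\<phi> i)"
  using assms unfolding free_resolution_def by blast+

lemma module_homs_free:
  assumes "f \<in> module_homs Q (free_module Q b) N"
  shows "u \<in> {..<b} \<rightarrow>\<^sub>E carrier Q \<Longrightarrow> f u \<in> carrier N"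
    "u \<in> {..<b} \<rightarrow>\<^sub>E carrier Q \<Longrightarrow> v \<in> {..<b} \<rightarrow>\<^sub>E carrier Q \<Longrightarrow> f (\<lambda>l\<in>{..<b}. u l \<oplus>\<^bsub>Q\<^esub> v l) = f u \<oplus>\<^bsub>N\<^esub> f v"
    "r \<in> carrier Q \<Longrightarrow> u \<in> {..<b} \<rightarrow>\<^sub>E carrier Q \<Longrightarrow> f (\<lambda>l\<in>{..<b}. r \<otimes>\<^bsub>Q\<^esub> u l) = r \<odot>\<^bsub>N\<^esub> f u"
  using assms by (auto simp: module_homs_def hom_def)

text \<open>
  Let \<open>Z i\<close> be the \<open>i\<close>-th syzygy module. Then \<open>Z i\<close> is \<open>Q\<^sup>b/Z (i + 1)\<close> with \<open>b\<close> the rank in degree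
  \<open>i + 1\<close>, so the connecting map lowers the homological degree while raising \<open>i\<close>, and
  \<open>H\<^sub>j(Z i) = H\<^sub>0(Z (i + j))\<close>. By minimality the latter has as dimension the rank in degree \<open>i + j + 1\<close>.
\<close>

theorem resolution_koszul:
  fixes M :: "('v multiset \<Rightarrow> 'k::field, 'b, 'z) module_scheme"
  assumes vs: "distinct vs" "set vs = V"
    and res: "free_resolution (series_ring c V) M b p \<phi>"
    and min: "minimal_complex (series_ring c V) (variable_ideal c V V) b \<phi>"
  shows "qdim (sb.cyc vs (flat (b 0) ` a_kernel (free c V (b 0)) M p) i)
              (sb.bnd vs (flat (b 0) ` a_kernel (free c V (b 0)) M p) i) (b (Suc i))"
proof -
  note ex = free_resolution_exact[OF res]
  have V: "finite V" using vs by auto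
  define Z where "Z i = (case i of 0 \<Rightarrow> flat (b 0) ` a_kernel (free c V (b 0)) M p
     | Suc i \<Rightarrow> flat (b (Suc i)) ` a_kernel (free c V (b (Suc i))) (free c V (b i)) (\<phi> i))" for i
  define \<Phi> where "\<Phi> i w = flat (b i) (\<phi> i (unflat (b (Suc i)) w))" for i w
  have ZI: "Z i = \<Phi> i ` FQ c V (b (Suc i))" for i
  proof -
    have "Z i = flat (b i) ` (\<phi> i ` ({..<b (Suc i)} \<rightarrow>\<^sub>E series_carrier c V))"
      using ex(4) ex(5)[of "i - 1"] by (cases i) (simp_all add: Z_def)
    also have "\<dots> = \<Phi> i ` FQ c V (b (Suc i))"
    proof (intro equalityI subsetI)
      fix x assume "x \<in> flat (b i) ` (\<phi> i ` ({..<b (Suc i)} \<rightarrow>\<^sub>E series_carrier c V))"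
      then obtain u where u: "u \<in> {..<b (Suc i)} \<rightarrow>\<^sub>E series_carrier c V" "x = flat (b i) (\<phi> i u)" by blast
      then have "x = \<Phi> i (flat (b (Suc i)) u)" by (simp add: \<Phi>_def unflat_flat)
      then show "x \<in> \<Phi> i ` FQ c V (b (Suc i))" using flat_FQ[OF u(1)] by blast
    next
      fix x assume "x \<in> \<Phi> i ` FQ c V (b (Suc i))"
      then show "x \<in> flat (b i) ` (\<phi> i ` ({..<b (Suc i)} \<rightarrow>\<^sub>E series_carrier c V))"
        using unflat_carrier by (fastforce simp: \<Phi>_def)
    qed
    finally show ?thesis .
  qed
  have hom: "\<phi> i u \<in> {..<b i} \<rightarrow>\<^sub>E series_carrier c V" if "u \<in> {..<b (Suc i)} \<rightarrow>\<^sub>E series_carrier c V" for i u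
    using module_homs_free(1)[OF ex(2)[of i]] that by simp
  have ZK: "Z (Suc i) = {w \<in> FQ c V (b (Suc i)). \<Phi> i w = 0}" for i
  proof (intro equalityI subsetI)
    fix x assume "x \<in> Z (Suc i)"
    then obtain u where u: "u \<in> {..<b (Suc i)} \<rightarrow>\<^sub>E series_carrier c V" "\<phi> i u = (\<lambda>l\<in>{..<b i}. 0)" "x = flat (b (Suc i)) u"
      by (auto simp: Z_def a_kernel_def')
    then show "x \<in> {w \<in> FQ c V (b (Suc i)). \<Phi> i w = 0}"
      using flat_FQ[OF u(1)] hom[OF u(1)] by (auto simp: \<Phi>_def unflat_flat flat_eq_0)
  next
    fix x assume x: "x \<in> {w \<in> FQ c V (b (Suc i)). \<Phi> i w = 0}"
    then have *: "unflat (b (Suc i)) x \<in> {..<b (Suc i)} \<rightarrow>\<^sub>E series_carrier c V" using unflat_carrier by blast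
    then have "\<phi> i (unflat (b (Suc i)) x) = (\<lambda>l\<in>{..<b i}. 0)" using x flat_eq_0[OF hom[OF *]] by (simp add: \<Phi>_def)
    with * have "unflat (b (Suc i)) x \<in> a_kernel (free c V (b (Suc i))) (free c V (b i)) (\<phi> i)"
      by (simp add: a_kernel_def')
    moreover have "x = flat (b (Suc i)) (unflat (b (Suc i)) x)" using x by (simp add: flat_unflat[of x c V])
    ultimately show "x \<in> Z (Suc i)" by (auto simp: Z_def)
  qed
  have Zm: "slot l w {#} = 0" if w: "w \<in> Z i" for i l w
  proof -
    obtain u where u: "u \<in> {..<b (Suc i)} \<rightarrow>\<^sub>E series_carrier c V" "w = flat (b i) (\<phi> i u)"
      using w unflat_carrier unfolding ZI \<Phi>_def by blast
    have "\<phi> i u \<in> {..<b i} \<rightarrow>\<^sub>E variable_ideal c V V" using min u(1) unfolding minimal_complex_def by auto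
    then show ?thesis unfolding maximal_ideal_eq[OF V] u(2) by (auto simp: slot_flat pointwise PiE_def Pi_def)
  qed
  note D = opsub_FQ[of vs V c] vs
  have add: "\<Phi> i (f + g) = \<Phi> i f + \<Phi> i g" if "f \<in> FQ c V (b (Suc i))" "g \<in> FQ c V (b (Suc i))" for i f g
    using module_homs_free(2)[OF ex(2)[of i], of "unflat (b (Suc i)) f" "unflat (b (Suc i)) g"]
      unflat_carrier[OF that(1)] unflat_carrier[OF that(2)] by (simp add: \<Phi>_def unflat_add flat_add)
  have fsc: "\<Phi> i (fsc a f) = fsc a (\<Phi> i f)" if "f \<in> FQ c V (b (Suc i))" for i f a
    using module_homs_free(3)[OF ex(2)[of i], of "cst a" "unflat (b (Suc i)) f"]
      unflat_carrier[OF that] by (simp add: \<Phi>_def unflat_fsc flat_cst cst_carrier)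
  have ops: "\<Phi> i (shiftb v f) = shiftb v (\<Phi> i f)" if "v \<in> set vs" "f \<in> FQ c V (b (Suc i))" for i f v
    using module_homs_free(3)[OF ex(2)[of i], of "variable v" "unflat (b (Suc i)) f"] that vs
      unflat_carrier[OF that(2)] by (simp add: \<Phi>_def unflat_shiftb flat_shift variable_carrier)
  have quot: "qdim (sb.relcyc vs (FQ c V (b (Suc i))) (Z (Suc i)) j) (sb.relbnd vs (FQ c V (b (Suc i))) (Z (Suc i)) j) n \<longleftrightarrow>
      qdim (sb.cyc vs (Z i) j) (sb.bnd vs (Z i) j) n" for i j n
    by (rule qdim_quotient_map[OF sb.commuting_operators_axioms sb.commuting_operators_axioms vs(1) opsub_FQ[of vs V c] add fsc ops ZI ZK])
       (use vs in auto)
  have ZF: "Z (Suc i) \<subseteq> FQ c V (b (Suc i))" for i unfolding ZK by blast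
  have op0: "0 \<in> FQ c V b'" for b' using vsub_0[OF vsub_FQ] .
  have Zop: "sb.opsub vs (Z (Suc i))" for i
  proof -
    have "\<Phi> i 0 = 0" using fsc[OF op0, of i 0] by (simp add: fsc_simps)
    then show ?thesis unfolding ZK using opsub_FQ[of vs V c "b (Suc i)"] vs
      by (auto simp: sb.opsub_def vsub_def add fsc ops fsc_simps sb.m_0)
  qed
  have "qdim (sb.cyc vs (Z i) j) (sb.bnd vs (Z i) j) (b (Suc (i + j)))" for i j
  proof (induction j arbitrary: i)
    case 0
    show ?case
      unfolding quot[symmetric] using qdim_FQ_0[OF vs _ ZF Zm] Zop[of i] by (simp add: sb.opsub_def)
  next
    case (Suc j)
    have "qdim (sb.cyc vs (Z (Suc i)) j) (sb.bnd vs (Z (Suc i)) j) (b (Suc (Suc i + j)))" by (rule Suc.IH)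
    then have "qdim (sb.relcyc vs (FQ c V (b (Suc i))) (Z (Suc i)) (Suc j)) (sb.relbnd vs (FQ c V (b (Suc i))) (Z (Suc i)) (Suc j)) (b (Suc (Suc i + j)))"
      using ZF Zm vs
      by (subst sb.qdim_connecting[OF vs(1) opsub_FQ Zop ZF acyclic_FQ]) (auto simp: bnd0_FQ)
    then show ?case unfolding quot by simp
  qed
  from this[of 0 i] show ?thesis by (simp add: Z_def)
qed

definition unit_chain :: "'v set \<Rightarrow> 'v set \<Rightarrow> 'v multiset \<Rightarrow> 'k::field" where
  "unit_chain \<sigma> = (\<lambda>\<tau>. if \<tau> = \<sigma> then cst 1 else 0)"

lemma unit_chain_chains: "\<sigma> \<subseteq> set vs \<Longrightarrow> card \<sigma> = j \<Longrightarrow> unit_chain \<sigma> \<in> chains vs (series_carrier c V) j"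
  by (rule chainsI) (auto simp: unit_chain_def cst_carrier vsub_0[OF vsub_carrier] split: if_splits)

lemma qdim_constants:
  assumes S: "finite S" and U: "ksub U" and E: "\<And>\<sigma>. \<sigma> \<in> S \<Longrightarrow> unit_chain \<sigma> \<in> U"
  shows "qdim U {z \<in> U. \<forall>\<sigma>\<in>S. z \<sigma> {#} = 0} (card S)"
  by (rule qdim_dual_basis[where e = unit_chain and lam = "\<lambda>\<sigma> z. z \<sigma> {#}", OF S U])
     (use E in \<open>auto simp: unit_chain_def cst_def plus_fun_apply csc_apply zero_fun_apply\<close>)

lemma relbnd_0_carrier:
  assumes vs: "distinct vs" "set vs = V" and I: "I \<subseteq> series_carrier c V" "\<forall>f\<in>I. f {#} = 0" "0 \<in> I" "vsub I"
  shows "sh.relbnd vs (series_carrier c V) I 0 = {z \<in> chains vs (series_carrier c V) 0. \<forall>\<sigma>\<in>{{}}. z \<sigma> {#} = 0}" (is "_ = ?R")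
proof (intro Set.set_eqI iffI)
  note m = bnd0_maximal[OF vs]
  fix z
  {
    assume "z \<in> sh.relbnd vs (series_carrier c V) I 0"
    then obtain u w where uw: "u \<in> chains vs I 0" "w \<in> chains vs (series_carrier c V) (Suc 0)" "z = u + kd shift vs w"
      by (auto simp: sh.relbnd_def)
    have "u \<in> chains vs (series_carrier c V) 0" "kd shift vs w \<in> chains vs (series_carrier c V) 0"
      using chains_mono[OF I(1)] uw(1) sh.kd_chains[OF vs(1) opsub_carrier uw(2)] vs by auto
    then have "z \<in> chains vs (series_carrier c V) 0" using uw ksub_add[OF ksub_chains[OF vsub_carrier]] by blast
    moreover have "kd shift vs w {} \<in> sh.bnd0 vs (series_carrier c V)" using uw(2) by (intro sh.bnd0I) auto
    then have "z {} {#} = 0" unfolding m using bspec[OF I(2) chainsD(1)[OF uw(1)]]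
      by (simp add: uw(3) plus_fun_apply)
    ultimately show "z \<in> ?R" by auto
  }
  assume z: "z \<in> ?R"
  then have "z {} \<in> sh.bnd0 vs (series_carrier c V)" unfolding m by (auto intro: chainsD(1))
  then obtain w where w: "w \<in> chains vs (series_carrier c V) 1" "kd shift vs w {} = z {}" by (rule sh.bnd0E)
  have "kd shift vs w \<in> chains vs (series_carrier c V) 0" using sh.kd_chains[OF vs(1) opsub_carrier, of V w c 0] w vs by auto
  then have "kd shift vs w = z" using z w by (auto intro: chains_0_eqI)
  then show "z \<in> sh.relbnd vs (series_carrier c V) I 0"
    using sh.relbndI[OF ksub_0[OF ksub_chains[OF I(4)]], of w vs "series_carrier c V" 0] w by simp
qed

text \<open>
  A cyclic module has \<open>0\<close>-th Betti number \<open>1\<close>.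
\<close>

lemma qdim_rel_0:
  fixes I :: "('v multiset \<Rightarrow> 'k::field) set"
  assumes vs: "distinct vs" "set vs = V" and I: "I \<subseteq> series_carrier c V" "\<forall>f\<in>I. f {#} = 0" "vsub I"
  shows "koszul_dim c vs V I 0 1"
proof -
  let ?C = "chains vs (series_carrier c V :: ('v multiset \<Rightarrow> 'k) set) 0"
  have "kd shift vs u = 0" if "u \<in> ?C" for u by (rule sh.kd_chains_0[OF vs(1) that])
  then have "sh.relcyc vs (series_carrier c V) I 0 = ?C"
    using vsub_0[OF I(3)] by (auto simp: sh.relcyc_def zero_chain_apply)
  moreover have "qdim ?C {z \<in> ?C. \<forall>\<sigma>\<in>{{}}. z \<sigma> {#} = 0} (card {{} :: 'v set})"
    by (rule qdim_constants) (auto intro: ksub_chains vsub_carrier unit_chain_chains)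
  ultimately show ?thesis using relbnd_0_carrier[OF vs I(1,2) vsub_0[OF I(3)] I(3)] by simp
qed

text \<open>
  The map \<open>\<pi>\<close> identifies \<open>M\<close> with the quotient of the ring by \<open>I\<close>.
\<close>

definition presents :: "ring_kind \<Rightarrow> 'v set \<Rightarrow> ('v multiset \<Rightarrow> 'k::field) set \<Rightarrow> (('v multiset \<Rightarrow> 'k) \<Rightarrow> 'b) \<Rightarrow>
    ('v multiset \<Rightarrow> 'k, 'b, 'z) module_scheme \<Rightarrow> bool" where
  "presents c V I \<pi> M \<longleftrightarrow> ideal I (series_ring c V) \<and> \<pi> ` series_carrier c V = carrier M \<and>
     (\<forall>f\<in>series_carrier c V. \<forall>g\<in>series_carrier c V. \<pi> (f + g) = \<pi> f \<oplus>\<^bsub>M\<^esub> \<pi> g \<and> \<pi> (conv f g) = f \<odot>\<^bsub>M\<^esub> \<pi> g) \<and>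
     (\<forall>f\<in>series_carrier c V. \<pi> f = \<zero>\<^bsub>M\<^esub> \<longleftrightarrow> f \<in> I)"

lemma ideal_subset: "ideal I (series_ring c V) \<Longrightarrow> I \<subseteq> series_carrier c V"
  using additive_subgroup.a_subset[OF ideal.axioms(1)] by fastforce

lemma presents_eq:
  assumes P: "presents c V I \<pi> M" and f: "f \<in> series_carrier c V" and g: "g \<in> series_carrier c V"
  shows "\<pi> f = \<pi> g \<longleftrightarrow> f - g \<in> I"
proof
  have add: "\<And>f g. f \<in> series_carrier c V \<Longrightarrow> g \<in> series_carrier c V \<Longrightarrow> \<pi> (f + g) = \<pi> f \<oplus>\<^bsub>M\<^esub> \<pi> g"
    and ker: "\<And>f. f \<in> series_carrier c V \<Longrightarrow> \<pi> f = \<zero>\<^bsub>M\<^esub> \<longleftrightarrow> f \<in> I" and I: "vsub I"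
    using P ideal_vsub unfolding presents_def by blast+
  note C = vsub_carrier[of c V]
  have ng: "- g \<in> series_carrier c V" and fg: "f - g \<in> series_carrier c V"
    using vsub_neg[OF vsub_carrier g] vsub_diff[OF vsub_carrier f g] .
  have z: "\<pi> 0 = \<zero>\<^bsub>M\<^esub>" using ker vsub_0[OF I] vsub_0[OF vsub_carrier] by blast
  {
    assume "\<pi> f = \<pi> g"
    then have "\<pi> (f + - g) = \<pi> (g + - g)" using add[OF f ng] add[OF g ng] by simp
    then have "\<pi> (f - g) = \<zero>\<^bsub>M\<^esub>" using z by simp
    then show "f - g \<in> I" using ker[OF fg] by simp
  }
  assume "f - g \<in> I"
  then have "\<pi> (f - g) = \<pi> 0" using ker[OF fg] z by simp
  then have "\<pi> (f - g + g) = \<pi> (0 + g)" using add[OF fg g] add[OF vsub_0[OF vsub_carrier] g] by simp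
  then show "\<pi> f = \<pi> g" by simp
qed

text \<open>
  A minimal resolution of a cyclic module starts with \<open>Q \<rightarrow> Q/I\<close>, up to multiplication by an element that is
  invertible modulo \<open>I\<close>. Lift the generator of \<open>M\<close> to a vector \<open>u\<close>, and let the basis vector \<open>e j\<close> be
  mapped to the class of \<open>w j\<close>. Then \<open>e j - w j u\<close> lies in the kernel, hence in \<open>\<mm>Q\<^sup>b\<close>: modulo \<open>\<mm>\<close> the
  identity matrix has entries \<open>w j * u l\<close>, that is, rank at most one.
\<close>

lemma presented_resolution_start:
  fixes M :: "('v multiset \<Rightarrow> 'k::field, 'b, 'z) module_scheme"
  assumes V: "finite V" and P: "presents c V I \<pi> M" and I0: "\<forall>f\<in>I. f {#} = 0"
    and res: "free_resolution (series_ring c V) M b p \<phi>"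
    and min: "minimal_complex (series_ring c V) (variable_ideal c V V) b \<phi>"
  shows "b 0 = 1" "a_kernel (free c V (b 0)) M p = {u \<in> {..<1::nat} \<rightarrow>\<^sub>E series_carrier c V. u 0 \<in> I}"
proof -
  let ?C = "series_carrier c V :: ('v multiset \<Rightarrow> 'k) set"
  note ex = free_resolution_exact[OF res]
  note C0 = vsub_0[OF vsub_carrier] and C1 = cst_carrier[of 1]
  have onto: "\<pi> ` ?C = carrier M" and add: "\<And>f g. f \<in> ?C \<Longrightarrow> g \<in> ?C \<Longrightarrow> \<pi> (f + g) = \<pi> f \<oplus>\<^bsub>M\<^esub> \<pi> g"
    and smult: "\<And>f g. f \<in> ?C \<Longrightarrow> g \<in> ?C \<Longrightarrow> \<pi> (conv f g) = f \<odot>\<^bsub>M\<^esub> \<pi> g"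
    and ker: "\<And>f. f \<in> ?C \<Longrightarrow> \<pi> f = \<zero>\<^bsub>M\<^esub> \<longleftrightarrow> f \<in> I" and I: "ideal I (series_ring c V)"
    using P unfolding presents_def by blast+
  have vI: "vsub I" using ideal_vsub[OF I] .
  have IC: "I \<subseteq> ?C" using ideal_subset[OF I] .
  have kmin: "u l {#} = 0" if "u \<in> a_kernel (free c V (b 0)) M p" "l < b 0" for u l
  proof -
    have "u \<in> {..<b 0} \<rightarrow>\<^sub>E variable_ideal c V V" using that(1) min unfolding ex(4)[symmetric] minimal_complex_def by auto
    then show ?thesis using that(2) unfolding maximal_ideal_eq[OF V] by auto
  qed
  define e where "e j = (\<lambda>l\<in>{..<b 0}. if l = j then cst 1 else (0 :: 'v multiset \<Rightarrow> 'k))" for j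
  have e: "e j \<in> {..<b 0} \<rightarrow>\<^sub>E ?C" for j using C0 C1 by (auto simp: e_def)
  have "p (e j) \<in> carrier M" for j using module_homs_free(1)[OF ex(1)] e by simp
  then have "\<exists>w\<in>?C. p (e j) = \<pi> w" for j unfolding onto[symmetric] by blast
  then obtain w where w: "\<And>j. w j \<in> ?C" "\<And>j. p (e j) = \<pi> (w j)" by metis
  have "\<pi> (cst 1) \<in> carrier M" using onto C1 by blast
  then have "\<pi> (cst 1) \<in> p ` ({..<b 0} \<rightarrow>\<^sub>E ?C)" using ex(3) by simp
  then obtain u where u: "u \<in> {..<b 0} \<rightarrow>\<^sub>E ?C" "p u = \<pi> (cst 1)" by auto
  have sm: "p (\<lambda>l\<in>{..<b 0}. conv r (x l)) = \<pi> (conv r f)" if "r \<in> ?C" "x \<in> {..<b 0} \<rightarrow>\<^sub>E ?C" "p x = \<pi> f" "f \<in> ?C" for r x f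
    using module_homs_free(3)[OF ex(1), of r x] that smult by simp
  have smC: "(\<lambda>l\<in>{..<b 0}. conv r (x l)) \<in> {..<b 0} \<rightarrow>\<^sub>E ?C" if "r \<in> ?C" "x \<in> {..<b 0} \<rightarrow>\<^sub>E ?C" for r x
    using that by (auto simp: PiE_def Pi_def conv_carrier)
  have pos: "b 0 \<noteq> 0"
  proof
    assume "b 0 = 0"
    then have "(\<lambda>l\<in>{..<b 0}. conv 0 (u l)) = u" using u by auto
    then have "\<pi> (cst 1) = \<pi> (conv 0 (cst 1))" using sm[OF C0 u C1] u by simp
    then have "cst 1 - 0 \<in> I" using presents_eq[OF P C1 C0] by (simp add: conv_0)
    then show False using I0 by (force simp: cst_def)
  qed
  \<comment> \<open>The matrix identity modulo the maximal ideal.\<close>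
  have key: "(if l = j then 1 else 0) = w j {#} * u l {#}" if "l < b 0" "j < b 0" for l j
  proof -
    define x where "x = (\<lambda>l\<in>{..<b 0}. e j l + (\<lambda>l\<in>{..<b 0}. conv (- w j) (u l)) l)"
    have nw: "- w j \<in> ?C" using w vsub_neg[OF vsub_carrier] by blast
    have xC: "x \<in> {..<b 0} \<rightarrow>\<^sub>E ?C" unfolding x_def using e[of j] smC[OF nw u(1)] by (auto simp: PiE_def Pi_def vsub_add[OF vsub_carrier])
    have "p x = p (e j) \<oplus>\<^bsub>M\<^esub> p (\<lambda>l\<in>{..<b 0}. conv (- w j) (u l))"
      unfolding x_def using module_homs_free(2)[OF ex(1), of "e j" "\<lambda>l\<in>{..<b 0}. conv (- w j) (u l)"] e smC[OF nw u(1)] by simp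
    also have "\<dots> = \<pi> (w j + conv (- w j) (cst 1))"
      using sm[OF nw u C1] add[OF w(1) conv_carrier[OF nw C1]] w by simp
    also have "w j + conv (- w j) (cst 1) = 0" by (simp add: conv_comm[of _ "cst 1"] conv_cst fsc_simps)
    also have "\<pi> 0 = \<zero>\<^bsub>M\<^esub>" using ker[OF C0] vsub_0[OF vI] by simp
    finally have "x \<in> a_kernel (free c V (b 0)) M p" using xC by (simp add: a_kernel_def')
    from kmin[OF this that(1)] have "e j l {#} + conv (- w j) (u l) {#} = 0" using that by (simp add: x_def plus_fun_apply)
    moreover have "conv (- w j) (u l) {#} = - (w j {#} * u l {#})" by (simp add: conv_def uminus_apply)
    moreover have "e j l {#} = (if l = j then 1 else 0)" using that by (simp add: e_def cst_def zero_fun_apply)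
    ultimately show ?thesis by simp
  qed
  show b0: "b 0 = 1"
  proof (rule ccontr)
    assume "b 0 \<noteq> 1"
    with pos have "0 < b 0" "1 < b 0" by auto
    with key[of 0 0] key[of 1 0] key[of 1 1] show False by auto
  qed
  have ue: "x = (\<lambda>l\<in>{..<b 0}. conv (x 0) (e 0 l))" if "x \<in> {..<b 0} \<rightarrow>\<^sub>E ?C" for x
    using that b0 by (auto simp: e_def conv_comm[of _ "cst 1"] conv_cst fsc_simps PiE_def extensional_def fun_eq_iff)
  have px: "p x = \<pi> (conv (x 0) (w 0))" if "x \<in> {..<b 0} \<rightarrow>\<^sub>E ?C" for x
  proof -
    have "x 0 \<in> ?C" using that b0 by auto
    from sm[OF this e w(2) w(1), of 0] ue[OF that] show ?thesis by simp
  qed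
  have u0: "u 0 \<in> ?C" using u b0 by auto
  have uw: "conv (u 0) (w 0) - cst 1 \<in> I"
    using px[OF u(1)] u(2) presents_eq[OF P conv_carrier[OF u0 w(1)[of 0]] C1] by simp
  show "a_kernel (free c V (b 0)) M p = {u \<in> {..<1::nat} \<rightarrow>\<^sub>E ?C. u 0 \<in> I}"
  proof (intro Set.set_eqI iffI)
    fix x assume "x \<in> a_kernel (free c V (b 0)) M p"
    then have x: "x \<in> {..<b 0} \<rightarrow>\<^sub>E ?C" "p x = \<zero>\<^bsub>M\<^esub>" by (auto simp: a_kernel_def')
    have x0: "x 0 \<in> ?C" using x b0 by auto
    have "conv (x 0) (w 0) \<in> I" using px[OF x(1)] x(2) ker[OF conv_carrier[OF x0 w(1)[of 0]]] by simp
    from ideal.I_l_closed[OF I this, of "u 0"] u0 have "conv (u 0) (conv (x 0) (w 0)) \<in> I" by simp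
    moreover from ideal.I_l_closed[OF I uw, of "x 0"] x0 have "conv (x 0) (conv (u 0) (w 0)) - x 0 \<in> I"
      by (simp add: conv_diff conv_comm[of _ "cst 1"] conv_cst fsc_simps)
    moreover have "conv (x 0) (conv (u 0) (w 0)) = conv (u 0) (conv (x 0) (w 0))"
      using conv_assoc[of "x 0" "u 0" "w 0"] conv_assoc[of "u 0" "x 0" "w 0"] conv_comm[of "x 0" "u 0"] by simp
    ultimately have "x 0 \<in> I" using vsub_diff[OF vI, of "conv (x 0) (conv (u 0) (w 0))" "conv (x 0) (conv (u 0) (w 0)) - x 0"] by simp
    with x b0 show "x \<in> {u \<in> {..<1::nat} \<rightarrow>\<^sub>E ?C. u 0 \<in> I}" by auto
  next
    fix x assume x: "x \<in> {u \<in> {..<1::nat} \<rightarrow>\<^sub>E ?C. u 0 \<in> I}"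
    then have "conv (x 0) (w 0) \<in> I" using ideal.I_r_closed[OF I, of "x 0" "w 0"] w(1) by simp
    moreover have xC: "x \<in> {..<b 0} \<rightarrow>\<^sub>E ?C" using x b0 by simp
    ultimately have "p x = \<zero>\<^bsub>M\<^esub>" using px[OF xC] ker IC by auto
    with xC show "x \<in> a_kernel (free c V (b 0)) M p" by (simp add: a_kernel_def')
  qed
qed

text \<open>
  The first syzygy module is a copy of \<open>I\<close>, so \<open>resolution_koszul\<close> computes \<open>H\<^sub>i(I)\<close>, and one more
  connecting map leads to \<open>H\<^sub>i\<^sub>+\<^sub>1(Q/I)\<close>.
\<close>

theorem presented_betti_koszul:
  fixes M :: "('v multiset \<Rightarrow> 'k::field, 'b, 'z) module_scheme"
  assumes vs: "distinct vs" "set vs = V" and P: "presents c V I \<pi> M" and I0: "\<forall>f\<in>I. f {#} = 0"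
    and res: "free_resolution (series_ring c V) M b p \<phi>"
    and min: "minimal_complex (series_ring c V) (variable_ideal c V V) b \<phi>"
  shows "koszul_dim c vs V I j (b j)"
proof -
  have V: "finite V" using vs by auto
  have I: "ideal I (series_ring c V)" using P by (simp add: presents_def)
  note IC = ideal_subset[OF I] and vI = ideal_vsub[OF I]
  have Iop: "sh.opsub vs I" using ideal_opsub[OF I] vs by simp
  have start: "b 0 = 1" "a_kernel (free c V (b 0)) M p = {u \<in> {..<1::nat} \<rightarrow>\<^sub>E series_carrier c V. u 0 \<in> I}"
    using presented_resolution_start[OF V P I0 res min] by blast+
  show ?thesis
  proof (cases j)
    case 0
    then show ?thesis using qdim_rel_0[OF vs IC I0 vI] start(1) by simp
  next
    case (Suc i)
    define emb where "emb f = (\<lambda>(l::nat, e). if l = 0 then f e else 0)" for f :: "'v multiset \<Rightarrow> 'k"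
    have slot_emb: "slot l (emb f) = (if l = 0 then f else 0)" for l f
      by (auto simp: slot_def emb_def pointwise)
    define Z where "Z = flat (b 0) ` a_kernel (free c V (b 0)) M p"
    have Z: "Z = emb ` I"
    proof (intro equalityI subsetI)
      fix x assume "x \<in> Z"
      then obtain u where "u 0 \<in> I" "x = flat 1 u" using start by (auto simp: Z_def)
      then show "x \<in> emb ` I" by (intro image_eqI[of _ _ "u 0"] slot_eqI) (auto simp: slot_flat slot_emb)
    next
      fix x assume "x \<in> emb ` I"
      then obtain f where f: "f \<in> I" "x = emb f" by auto
      have "(\<lambda>l\<in>{..<1::nat}. f) \<in> {u \<in> {..<1::nat} \<rightarrow>\<^sub>E series_carrier c V. u 0 \<in> I}" using f IC by auto
      moreover have "x = flat (b 0) (\<lambda>l\<in>{..<1}. f)" using start(1) f by (intro slot_eqI) (auto simp: slot_flat slot_emb)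
      ultimately show "x \<in> Z" unfolding Z_def start(2) by blast
    qed
    have inj: "emb f = 0 \<longleftrightarrow> f = 0" for f
    proof
      assume "emb f = 0"
      then show "f = 0" using slot_emb[of 0 f] by (simp add: slot_simps)
    qed (auto intro!: slot_eqI simp: slot_emb slot_simps)
    have "qdim (sb.cyc vs Z i) (sb.bnd vs Z i) (b (Suc i))"
      unfolding Z_def by (rule resolution_koszul[OF vs res min])
    then have "qdim (sh.relcyc vs I {0} i) (sh.relbnd vs I {0} i) (b (Suc i))"
      by (subst qdim_quotient_map[OF sh.commuting_operators_axioms sb.commuting_operators_axioms vs(1) Iop _ _ _ Z])
         (auto intro!: slot_eqI simp: slot_emb slot_simps slot_shiftb fsc_simps sh.m_0 inj vsub_0[OF vI])
    moreover have "sh.relcyc vs I {0} i = sh.cyc vs I i"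
      by (auto simp: sh.relcyc_def sh.cyc_def chain_eq_iff zero_chain_apply)
    moreover have "sh.relbnd vs I {0} i = sh.bnd vs I i"
    proof -
      have "u = 0" if "u \<in> chains vs {0} i" for u using chainsD(1)[OF that] by (simp add: chain_eq_iff zero_chain_apply)
      moreover have "0 \<in> chains vs {0} i" by (auto simp: chains_def zero_chain_apply)
      ultimately show ?thesis by (force simp: sh.relbnd_def sh.bnd_def)
    qed
    ultimately have *: "qdim (sh.cyc vs I i) (sh.bnd vs I i) (b (Suc i))" by simp
    have Ib: "I \<subseteq> sh.bnd0 vs (series_carrier c V)"
      unfolding bnd0_maximal[OF vs] using IC I0 by blast
    show ?thesis unfolding Suc
      using * vs by (subst sh.qdim_connecting[OF vs(1) opsub_carrier Iop IC acyclic_carrier Ib]) auto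
  qed
qed

section \<open>Finite generation of submodules of free modules\<close>

lemma nat_seq_mono_subseq:
  fixes f :: "nat \<Rightarrow> nat"
  shows "\<exists>r::nat \<Rightarrow> nat. strict_mono r \<and> (\<forall>i j. i \<le> j \<longrightarrow> f (r i) \<le> f (r j))"
proof -
  define P where "P x \<longleftrightarrow> (\<forall>k\<ge>x. f x \<le> f k)" for x
  have ex: "\<exists>y\<ge>n. P y" for n
  proof -
    obtain y where y: "y \<ge> n" "\<And>k. k \<ge> n \<Longrightarrow> f y \<le> f k"
      using ex_has_least_nat[of "\<lambda>k. k \<ge> n" n f] by auto
    then have "P y" by (auto simp: P_def)
    with y show ?thesis by blast
  qed
  have "\<exists>r. \<forall>n. P (r n) \<and> r n < r (Suc n)"
  proof (rule dependent_nat_choice)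
    show "\<exists>x. P x" using ex[of 0] by blast
    show "\<exists>y. P y \<and> x < y" for x using ex[of "Suc x"] by (auto simp: Suc_le_eq)
  qed
  then obtain r where r: "\<And>n. P (r n)" "\<And>n. r n < r (Suc n)" by blast
  have sm: "strict_mono r" using r(2) by (simp add: strict_mono_Suc_iff)
  then have "f (r i) \<le> f (r j)" if "i \<le> j" for i j using r(1)[of i] that by (auto simp: P_def strict_mono_less_eq)
  with sm show ?thesis by blast
qed

lemma mset_seq_mono_subseq:
  fixes f :: "nat \<Rightarrow> 'v multiset"
  assumes "finite V"
  shows "\<exists>r::nat \<Rightarrow> nat. strict_mono r \<and> (\<forall>v\<in>V. \<forall>i j. i \<le> j \<longrightarrow> count (f (r i)) v \<le> count (f (r j)) v)"
  using assms
proof (induction V)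
  case empty
  then show ?case by (auto intro!: exI[of _ id] strict_mono_id)
next
  case (insert v V)
  then obtain r :: "nat \<Rightarrow> nat"
    where r: "strict_mono r" "\<forall>u\<in>V. \<forall>i j. i \<le> j \<longrightarrow> count (f (r i)) u \<le> count (f (r j)) u" by (elim exE conjE)
  obtain q :: "nat \<Rightarrow> nat"
    where q: "strict_mono q" "\<forall>i j. i \<le> j \<longrightarrow> count (f (r (q i))) v \<le> count (f (r (q j))) v"
    using nat_seq_mono_subseq[of "\<lambda>n. count (f (r n)) v"] by (elim exE conjE)
  have "strict_mono (\<lambda>i. r (q i))" using r(1) q(1) by (simp add: strict_mono_def)
  moreover have "q i \<le> q j" if "i \<le> j" for i j using q(1) that by (simp add: strict_mono_less_eq)
  ultimately show ?case using r(2) q(2) by (intro exI[of _ "\<lambda>i. r (q i)"]) auto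
qed

text \<open>
  The minimal elements of \<open>A\<close> suffice. Infinitely many of them would contain a sequence that increases in
  every variable, against minimality.
\<close>

lemma dickson:
  assumes V: "finite V" and A: "\<And>e. e \<in> A \<Longrightarrow> set_mset e \<subseteq> V"
  shows "\<exists>A0\<subseteq>A. finite A0 \<and> (\<forall>e\<in>A. \<exists>e0\<in>A0. e0 \<subseteq># e)"
proof -
  define A0 where "A0 = {e\<in>A. \<forall>d\<in>A. d \<subseteq># e \<longrightarrow> d = e}"
  have "finite A0"
  proof (rule ccontr)
    assume "infinite A0"
    then obtain f :: "nat \<Rightarrow> 'a multiset" where f: "inj f" "range f \<subseteq> A0" using infinite_countable_subset by blast
    obtain r :: "nat \<Rightarrow> nat"
      where r: "strict_mono r" "\<forall>v\<in>V. \<forall>i j. i \<le> j \<longrightarrow> count (f (r i)) v \<le> count (f (r j)) v"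
      using mset_seq_mono_subseq[OF V, of f] by (elim exE conjE)
    have "count (f (r 0)) v \<le> count (f (r 1)) v" for v
    proof (cases "v \<in> V")
      case False
      have "f (r 0) \<in> A" using f(2) by (auto simp: A0_def)
      then have "v \<notin># f (r 0)" using A False by blast
      then show ?thesis by (simp add: not_in_iff)
    qed (use r(2) in auto)
    then have "f (r 0) \<subseteq># f (r 1)" by (simp add: subset_mset_via_count)
    moreover have "f (r 0) \<in> A" "f (r 1) \<in> A0" using f(2) by (auto simp: A0_def)
    ultimately have "f (r 0) = f (r 1)" by (auto simp: A0_def)
    then have "r 0 = r 1" using f(1) by (auto dest: injD)
    with r(1) show False by (metis strict_mono_less zero_less_one less_irrefl)
  qed
  moreover have "\<exists>e0\<in>A0. e0 \<subseteq># e" if "e \<in> A" for e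
    using that
  proof (induction "size e" arbitrary: e rule: less_induct)
    case less
    show ?case
    proof (cases "e \<in> A0")
      case False
      then obtain d where d: "d \<in> A" "d \<subseteq># e" "d \<noteq> e" using less.prems by (auto simp: A0_def)
      then have "size d < size e" by (simp add: mset_subset_size subset_mset.le_neq_trans)
      with less.hyps d obtain e0 where "e0 \<in> A0" "e0 \<subseteq># d" by blast
      with d show ?thesis using subset_mset.order_trans by blast
    qed auto
  qed
  ultimately show ?thesis by (intro exI[of _ A0]) (auto simp: A0_def)
qed

definition mulb :: "('v multiset \<Rightarrow> 'k::field) \<Rightarrow> (nat \<times> 'v multiset \<Rightarrow> 'k) \<Rightarrow> nat \<times> 'v multiset \<Rightarrow> 'k" where
  "mulb f w = (\<lambda>(l, e). conv f (slot l w) e)"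

lemma slot_mulb: "slot l (mulb f w) = conv f (slot l w)"
  by (auto simp: slot_def mulb_def)

lemma slot_sum: "slot l (sum f S) = (\<Sum>i\<in>S. slot l (f i))"
  by (auto simp: slot_def sum_fun_apply)

lemma mulb_simps: "mulb f (w + w') = mulb f w + mulb f w'" "mulb (f + g) w = mulb f w + mulb g w"
  "mulb f 0 = 0" "mulb 0 w = 0" "mulb f (mulb g w) = mulb (conv f g) w" "mulb (cst a) w = fsc a w"
  "mulb (- f) w = - mulb f w" "mulb f (- w) = - mulb f w" "mulb (f - g) w = mulb f w - mulb g w"
  by (rule slot_eqI; simp add: slot_mulb slot_simps conv_add conv_0 conv_assoc conv_cst conv_neg conv_diff)+

lemma mulb_sum: "mulb f (sum g S) = (\<Sum>i\<in>S. mulb f (g i))"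
  by (rule slot_eqI) (simp add: slot_mulb slot_sum conv_sum)

lemma mulb_FQ: "f \<in> series_carrier c V \<Longrightarrow> w \<in> FQ c V b \<Longrightarrow> mulb f w \<in> FQ c V b"
  by (auto simp: FQ_def slot_mulb conv_carrier conv_0)

text \<open>
  The component of degree \<open>d\<close> when the basis vector at position \<open>l\<close> has degree \<open>s l\<close>.
\<close>

definition gr :: "(nat \<Rightarrow> int) \<Rightarrow> int \<Rightarrow> (nat \<times> 'v multiset \<Rightarrow> 'k::field) \<Rightarrow> nat \<times> 'v multiset \<Rightarrow> 'k" where
  "gr s d w = (\<lambda>(l, e). if int (size e) + s l = d then w (l, e) else 0)"

lemma gr_simps: "gr s d (w + w') = gr s d w + gr s d w'" "gr s d 0 = 0" "gr s d (fsc a w) = fsc a (gr s d w)"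
  "gr s d (w - w') = gr s d w - gr s d w'" "gr s d (- w) = - gr s d w" "gr s d (gr s d w) = gr s d w"
  by (auto simp: gr_def fun_eq_iff pointwise fsc_apply)

lemma gr_sum: "gr s d (sum f S) = (\<Sum>i\<in>S. gr s d (f i))"
  by (auto simp: gr_def fun_eq_iff sum_fun_apply)

lemma gr_FQ: "w \<in> FQ c V b \<Longrightarrow> gr s d w \<in> FQ c V b"
proof -
  assume w: "w \<in> FQ c V b"
  have "slot l (gr s d w) e \<noteq> 0 \<Longrightarrow> slot l w e \<noteq> 0" for l e by (auto simp: slot_def gr_def split: if_splits)
  then have "slot l (gr s d w) \<in> series_carrier c V" for l
    by (rule carrier_supp_mono[of "slot l w", rotated]) (use w in \<open>auto simp: FQ_def\<close>)
  moreover have "slot l (gr s d w) = 0" if "b \<le> l" for l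
    using w that by (auto simp: FQ_def slot_def gr_def fun_eq_iff pointwise)
  ultimately show ?thesis by (auto simp: FQ_def)
qed

lemma gr_eqD: "gr s d w = w \<Longrightarrow> w (l, e) \<noteq> 0 \<Longrightarrow> int (size e) + s l = d"
  by (auto simp: gr_def fun_eq_iff split: if_splits)

lemma gr_eqI: "(\<And>l e. w (l, e) \<noteq> 0 \<Longrightarrow> int (size e) + s l = d) \<Longrightarrow> gr s d w = w"
  by (auto simp: gr_def fun_eq_iff split: if_splits)

definition hcomp :: "int \<Rightarrow> ('v multiset \<Rightarrow> 'k::field) \<Rightarrow> 'v multiset \<Rightarrow> 'k" where
  "hcomp d f = (\<lambda>e. if int (size e) = d then f e else 0)"

lemma hcomp_carrier: "f \<in> series_carrier c V \<Longrightarrow> hcomp d f \<in> series_carrier c V"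
  by (erule carrier_supp_mono) (auto simp: hcomp_def split: if_splits)

text \<open>
  Multiplication by a homogeneous vector turns components of a series into components of the product.
\<close>

lemma gr_mulb:
  assumes g: "gr s d' g = g"
  shows "gr s d (mulb f g) = mulb (hcomp (d - d') f) g"
proof (rule ext, clarify)
  fix l e
  have "(if int (size e) + s l = d then f a * g (l, e - a) else 0) = hcomp (d - d') f a * g (l, e - a)" if "a \<subseteq># e" for a
  proof (cases "g (l, e - a) = 0")
    case False
    then have "int (size (e - a)) + s l = d'" using gr_eqD[OF g] by blast
    moreover have "size e = size a + size (e - a)" using that by (metis size_union subset_mset.add_diff_inverse)
    ultimately show ?thesis by (auto simp: hcomp_def)
  qed simp
  then have "(\<Sum>a | a \<subseteq># e. if int (size e) + s l = d then f a * g (l, e - a) else 0) = mulb (hcomp (d - d') f) g (l, e)"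
    by (simp add: mulb_def conv_def slot_def)
  then show "gr s d (mulb f g) (l, e) = mulb (hcomp (d - d') f) g (l, e)"
    by (cases "int (size e) + s l = d") (simp_all add: gr_def mulb_def conv_def slot_def)
qed

text \<open>
  Only polynomials are graded. With this condition void for power series, both cases share one development.
\<close>

definition homogeneous_vec :: "ring_kind \<Rightarrow> (nat \<Rightarrow> int) \<Rightarrow> (nat \<times> 'v multiset \<Rightarrow> 'k::field) \<Rightarrow> bool" where
  "homogeneous_vec c s w \<longleftrightarrow> (c = Polynomials \<longrightarrow> (\<exists>d. gr s d w = w))"

definition submod :: "ring_kind \<Rightarrow> 'v set \<Rightarrow> nat \<Rightarrow> (nat \<Rightarrow> int) \<Rightarrow> (nat \<times> 'v multiset \<Rightarrow> 'k::field) set \<Rightarrow> bool" where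
  "submod c V b s Z \<longleftrightarrow> Z \<subseteq> FQ c V b \<and> vsub Z \<and> (\<forall>f\<in>series_carrier c V. \<forall>w\<in>Z. mulb f w \<in> Z) \<and>
     (c = Polynomials \<longrightarrow> (\<forall>w\<in>Z. \<forall>d. gr s d w \<in> Z))"

definition gens :: "ring_kind \<Rightarrow> 'v set \<Rightarrow> (nat \<times> 'v multiset \<Rightarrow> 'k::field) set \<Rightarrow> (nat \<times> 'v multiset \<Rightarrow> 'k) set" where
  "gens c V G = {\<Sum>g\<in>G. mulb (q g) g |q. \<forall>g. q g \<in> series_carrier c V}"

lemma gensI: "(\<And>g. g \<in> G \<Longrightarrow> q g \<in> series_carrier c V) \<Longrightarrow> (\<Sum>g\<in>G. mulb (q g) g) \<in> gens c V G"
  unfolding gens_def using vsub_0[OF vsub_carrier, of c V]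
  by (intro CollectI exI[of _ "\<lambda>g. if g \<in> G then q g else 0"] conjI sum.cong) auto

lemma mulb_gens: "f \<in> series_carrier c V \<Longrightarrow> x \<in> gens c V G \<Longrightarrow> mulb f x \<in> gens c V G"
proof -
  assume f: "f \<in> series_carrier c V" and "x \<in> gens c V G"
  then obtain q where q: "\<And>g. q g \<in> series_carrier c V" "x = (\<Sum>g\<in>G. mulb (q g) g)" by (auto simp: gens_def)
  have "(\<Sum>g\<in>G. mulb (conv f (q g)) g) \<in> gens c V G" using f q by (intro gensI conv_carrier)
  then show ?thesis by (simp add: q mulb_sum mulb_simps)
qed

lemma vsub_gens: "vsub (gens c V G)"
proof (rule vsubI)
  show "0 \<in> gens c V G" using gensI[of G "\<lambda>_. 0" c V] by (simp add: mulb_simps vsub_0[OF vsub_carrier])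
next
  fix x y assume "x \<in> gens c V G" "y \<in> gens c V G"
  then obtain q q' where q: "\<And>g. q g \<in> series_carrier c V" "\<And>g. q' g \<in> series_carrier c V"
    "x = (\<Sum>g\<in>G. mulb (q g) g)" "y = (\<Sum>g\<in>G. mulb (q' g) g)" by (auto simp: gens_def)
  have "(\<Sum>g\<in>G. mulb (q g + q' g) g) \<in> gens c V G" using q by (intro gensI vsub_add[OF vsub_carrier])
  then show "x + y \<in> gens c V G" by (simp add: q mulb_simps sum.distrib)
next
  fix a x assume "x \<in> gens c V G"
  from mulb_gens[OF cst_carrier this, of a] show "fsc a x \<in> gens c V G" by (simp add: mulb_simps)
qed

lemma gens_subset: "submod c V b s Z \<Longrightarrow> G \<subseteq> Z \<Longrightarrow> gens c V G \<subseteq> Z"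
  by (auto simp: gens_def submod_def intro!: vsub_sum)

lemma gens_base: "finite G \<Longrightarrow> g \<in> G \<Longrightarrow> g \<in> gens c V G"
proof -
  assume G: "finite G" "g \<in> G"
  have "(\<Sum>h\<in>G. mulb (if h = g then cst 1 else 0) h) \<in> gens c V G"
    by (rule gensI) (auto simp: cst_carrier vsub_0[OF vsub_carrier])
  also have "(\<Sum>h\<in>G. mulb (if h = g then cst 1 else 0) h) = (\<Sum>h\<in>G. if h = g then g else 0)"
    by (intro sum.cong) (auto simp: mulb_simps fsc_simps)
  finally show ?thesis using G by simp
qed

lemma gens_trans:
  assumes "G \<subseteq> gens c V H" shows "gens c V G \<subseteq> gens c V H"
proof
  fix x assume "x \<in> gens c V G"
  then obtain q where q: "\<And>g. q g \<in> series_carrier c V" "x = (\<Sum>g\<in>G. mulb (q g) g)" by (auto simp: gens_def)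
  have "mulb (q g) g \<in> gens c V H" if "g \<in> G" for g using assms that q mulb_gens by blast
  then show "x \<in> gens c V H" unfolding q(2) by (rule vsub_sum[OF vsub_gens])
qed

lemma gr_decompose:
  assumes w: "w \<in> FQ Polynomials V b"
  shows "\<exists>D. finite D \<and> w = (\<Sum>d\<in>D. gr s d w)"
proof -
  define P where "P = {p. w p \<noteq> 0}"
  have "P \<subseteq> (\<Union>l\<in>{..<b}. Pair l ` {e. slot l w e \<noteq> 0})"
  proof
    fix p assume "p \<in> P"
    then obtain l e where p: "p = (l, e)" "slot l w e \<noteq> 0" by (cases p) (auto simp: P_def slot_def)
    then have "l < b" using w by (force simp: FQ_def pointwise not_le[symmetric])
    with p show "p \<in> (\<Union>l\<in>{..<b}. Pair l ` {e. slot l w e \<noteq> 0})" by auto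
  qed
  moreover have "finite {e. slot l w e \<noteq> 0}" for l using w carrierD(2)[of "slot l w" Polynomials V] by (auto simp: FQ_def)
  then have "finite (\<Union>l\<in>{..<b}. Pair l ` {e. slot l w e \<noteq> 0})" by simp
  ultimately have P: "finite P" by (rule finite_subset)
  define D where "D = (\<lambda>(l, e). int (size e) + s l) ` P"
  have D: "finite D" using P by (simp add: D_def)
  have "w = (\<Sum>d\<in>D. gr s d w)"
  proof (rule ext, clarify)
    fix l e
    have "(\<Sum>d\<in>D. gr s d w) (l, e) = (\<Sum>d\<in>D. if d = int (size e) + s l then w (l, e) else 0)"
      unfolding sum_fun_apply by (intro sum.cong) (auto simp: gr_def)
    also have "\<dots> = w (l, e)" using D by (force simp: D_def P_def)
    finally show "w (l, e) = (\<Sum>d\<in>D. gr s d w) (l, e)" by simp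
  qed
  with D show ?thesis by blast
qed

text \<open>
  Terms of vectors are compared by degree first, and by the multiset order on exponents and the position to
  break ties. Leading terms are the lowest ones, as power series require. For polynomials the algorithm below is
  run on homogeneous vectors only, where finitely many terms occur.
\<close>

locale term_order =
  fixes c :: ring_kind and V :: "'v set" and b :: nat and s :: "nat \<Rightarrow> int" and \<iota> :: "'v \<Rightarrow> nat"
  assumes V: "finite V" and \<iota>: "inj_on \<iota> V"
begin

definition P :: "(nat \<times> 'v multiset) set" where
  "P = {(l, e). l < b \<and> set_mset e \<subseteq> V}"

definition key :: "nat \<times> 'v multiset \<Rightarrow> int \<times> nat multiset \<times> nat" where
  "key = (\<lambda>(l, e). (int (size e) + s l, image_mset \<iota> e, l))"

lemma key_inj: "p \<in> P \<Longrightarrow> q \<in> P \<Longrightarrow> key p = key q \<Longrightarrow> p = q"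
proof -
  assume p: "p \<in> P" "q \<in> P" "key p = key q"
  obtain l e l' e' where pq: "p = (l, e)" "q = (l', e')" by (cases p, cases q) auto
  have *: "image_mset (inv_into V \<iota>) (image_mset \<iota> d) = d" if "set_mset d \<subseteq> V" for d
  proof -
    have "image_mset (inv_into V \<iota> \<circ> \<iota>) d = image_mset id d"
      using that by (intro image_mset_cong) (auto simp: inv_into_f_f[OF \<iota>])
    then show ?thesis by (simp add: multiset.map_comp)
  qed
  have "image_mset \<iota> e = image_mset \<iota> e'" "l = l'" using p pq by (auto simp: key_def)
  moreover have "set_mset e \<subseteq> V" "set_mset e' \<subseteq> V" using p pq by (auto simp: P_def)
  ultimately have "e = e'" using *[of e] *[of e'] by metis
  with \<open>l = l'\<close> pq show ?thesis by simp
qed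

lemma key_less_shift: "key (l, e) < key (l', e') \<Longrightarrow> key (l, e + a) < key (l', e' + a)"
  by (auto simp: key_def)

definition R :: "((nat \<times> 'v multiset) \<times> (nat \<times> 'v multiset)) set" where
  "R = {(p, q). p \<in> P \<and> q \<in> P \<and> key p < key q}"

text \<open>
  As degree comes first, only finitely many terms lie below a given one; hence the order admits recursion.
\<close>

lemma finite_below: "finite {p \<in> P. key p < key q}"
proof -
  obtain l' e' where q: "q = (l', e')" by (cases q)
  define D where "D = int (size e') + s l'"
  have "{p \<in> P. key p < key q} \<subseteq> (\<Union>l\<in>{..<b}. \<Union>n\<in>{..nat (D - s l)}. Pair l ` {e. set_mset e \<subseteq> V \<and> size e = n})"
  proof
    fix p assume p: "p \<in> {p \<in> P. key p < key q}"
    obtain l e where le: "p = (l, e)" by (cases p)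
    have "int (size e) + s l \<le> D" using p q le by (auto simp: key_def D_def)
    then have "size e \<le> nat (D - s l)" by linarith
    then show "p \<in> (\<Union>l\<in>{..<b}. \<Union>n\<in>{..nat (D - s l)}. Pair l ` {e. set_mset e \<subseteq> V \<and> size e = n})"
      using p le by (auto simp: P_def)
  qed
  moreover have "finite (\<Union>l\<in>{..<b}. \<Union>n\<in>{..nat (D - s l)}. Pair l ` {e. set_mset e \<subseteq> V \<and> size e = n})"
    by (intro finite_UN_I finite_imageI) (auto intro: finite_multisets_of_size[OF V, unfolded multisets_of_size_def])
  ultimately show ?thesis by (rule finite_subset)
qed

lemma wf_R: "wf R"
proof (rule wf_subset[OF wf_measure[of "\<lambda>q. card {p \<in> P. key p < key q}"]], clarify)
  fix l e l' e' assume "((l, e), (l', e')) \<in> R"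
  then have "{p \<in> P. key p < key (l, e)} \<subset> {p \<in> P. key p < key (l', e')}" by (force simp: R_def)
  then show "((l, e), (l', e')) \<in> measure (\<lambda>q. card {p \<in> P. key p < key q})"
    using psubset_card_mono[OF finite_below] by simp
qed

definition is_lead :: "(nat \<times> 'v multiset \<Rightarrow> 'k::field) \<Rightarrow> nat \<times> 'v multiset \<Rightarrow> bool" where
  "is_lead w p \<longleftrightarrow> w p \<noteq> 0 \<and> (\<forall>q. w q \<noteq> 0 \<longrightarrow> q = p \<or> key p < key q)"

lemma FQ_support: "w \<in> FQ c V b \<Longrightarrow> w p \<noteq> 0 \<Longrightarrow> p \<in> P"
proof -
  assume w: "w \<in> FQ c V b" "w p \<noteq> 0"
  obtain l e where p: "p = (l, e)" by (cases p)
  have "slot l w e \<noteq> 0" using w p by (simp add: slot_def)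
  moreover have "slot l w \<in> series_carrier c V" "b \<le> l \<longrightarrow> slot l w = 0" using w by (auto simp: FQ_def)
  ultimately show ?thesis using carrierD(1) p by (fastforce simp: P_def pointwise not_le[symmetric])
qed

lemma lead_exists:
  assumes w: "w \<in> FQ c V b" "w \<noteq> 0"
  shows "\<exists>p\<in>P. is_lead w p"
proof -
  have "\<exists>q. q \<in> {q. w q \<noteq> 0}"
  proof (rule ccontr)
    assume "\<not> ?thesis"
    then have "w = 0" by (simp add: fun_eq_iff zero_fun_apply)
    with w(2) show False by simp
  qed
  then obtain q where q: "q \<in> {q. w q \<noteq> 0}" by (rule exE)
  have "\<exists>p. p \<in> {q. w q \<noteq> 0} \<and> (\<forall>y. (y, p) \<in> R \<longrightarrow> y \<notin> {q. w q \<noteq> 0})"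
    by (rule wfE_min[OF wf_R q], rule exI, rule conjI, assumption, simp)
  then obtain p where p: "w p \<noteq> 0" "\<forall>q. (q, p) \<in> R \<longrightarrow> w q = 0" by auto
  have pP: "p \<in> P" using FQ_support[OF w(1) p(1)] .
  have "q = p \<or> key p < key q" if q: "w q \<noteq> 0" for q
  proof -
    have "q \<in> P" using FQ_support[OF w(1) q] .
    then have "(q, p) \<in> R" if "key q < key p" using that pP by (simp add: R_def)
    then have "\<not> key q < key p" using p(2) q by blast
    then show ?thesis using key_inj[OF \<open>q \<in> P\<close> pP] by force
  qed
  with p pP show ?thesis by (auto simp: is_lead_def)
qed

definition leads :: "(nat \<times> 'v multiset \<Rightarrow> 'k::field) set \<Rightarrow> (nat \<times> 'v multiset) set" where
  "leads Z = {p \<in> P. \<exists>z\<in>Z. homogeneous_vec c s z \<and> is_lead z p}"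

lemma dickson_leads: "\<exists>L0\<subseteq>leads Z. finite L0 \<and> (\<forall>(l, e)\<in>leads Z. \<exists>e0. (l, e0) \<in> L0 \<and> e0 \<subseteq># e)"
proof -
  have "\<exists>A0\<subseteq>{e. (l, e) \<in> leads Z}. finite A0 \<and> (\<forall>e\<in>{e. (l, e) \<in> leads Z}. \<exists>e0\<in>A0. e0 \<subseteq># e)" for l
    by (rule dickson[OF V]) (auto simp: leads_def P_def)
  then obtain A0 where A0: "\<And>l. A0 l \<subseteq> {e. (l, e) \<in> leads Z}" "\<And>l. finite (A0 l)"
    "\<And>l e. (l, e) \<in> leads Z \<Longrightarrow> \<exists>e0\<in>A0 l. e0 \<subseteq># e" by (metis mem_Collect_eq)
  have "(SIGMA l:{..<b}. A0 l) \<subseteq> leads Z" using A0(1) by auto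
  moreover have "finite (SIGMA l:{..<b}. A0 l)" using A0(2) by auto
  moreover have "\<forall>(l, e)\<in>leads Z. \<exists>e0. (l, e0) \<in> (SIGMA l:{..<b}. A0 l) \<and> e0 \<subseteq># e"
  proof (clarify)
    fix l e assume le: "(l, e) \<in> leads Z"
    obtain e0 where "e0 \<in> A0 l" "e0 \<subseteq># e" using A0(3)[OF le] by (rule bexE)
    moreover have "l < b" using le by (simp add: leads_def P_def)
    ultimately show "\<exists>e0. (l, e0) \<in> (SIGMA l:{..<b}. A0 l) \<and> e0 \<subseteq># e" by (intro exI[of _ e0]) simp
  qed
  ultimately show ?thesis by (intro exI[of _ "SIGMA l:{..<b}. A0 l"] conjI)
qed

text \<open>
  The coefficients \<open>cc\<close> are found by recursion along the term order. Every term \<open>\<nu>\<close> in \<open>leads Z\<close> is assigned a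
  divisor \<open>\<gamma> \<nu>\<close> in \<open>L0\<close>, and \<open>cc \<nu>\<close> is the coefficient that the multiple of \<open>h (\<gamma> \<nu>)\<close> with leading term \<open>\<nu>\<close>
  must get in order to match \<open>z\<close> at \<open>\<nu>\<close>, given the multiples with smaller leading terms. The sum \<open>S\<close> of all these multiples then
  agrees with \<open>z\<close> on \<open>leads Z\<close>. As \<open>z - S\<close> lies in \<open>Z\<close>, its leading term would be in \<open>leads Z\<close>; so it is \<open>0\<close>.
\<close>

lemma division:
  fixes Z :: "(nat \<times> 'v multiset \<Rightarrow> 'k::field) set"
  assumes Z: "submod c V b s Z"
    and L0: "finite L0" "\<And>l e. (l, e) \<in> leads Z \<Longrightarrow> \<exists>e0. (l, e0) \<in> L0 \<and> e0 \<subseteq># e"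
    and h: "\<And>p. p \<in> L0 \<Longrightarrow> h p \<in> Z \<and> homogeneous_vec c s (h p) \<and> is_lead (h p) p \<and> h p p = 1 \<and> p \<in> P"
    and z: "z \<in> Z" "homogeneous_vec c s z"
  shows "\<exists>q. (\<forall>p. q p \<in> series_carrier c V) \<and> z = (\<Sum>p\<in>L0. mulb (q p) (h p))"
proof -
  let ?L = "leads Z"
  have ZF: "Z \<subseteq> FQ c V b" and vZ: "vsub Z" and mZ: "\<And>f w. f \<in> series_carrier c V \<Longrightarrow> w \<in> Z \<Longrightarrow> mulb f w \<in> Z"
    using Z by (auto simp: submod_def)
  define \<gamma> where "\<gamma> \<mu> = (SOME p. p \<in> L0 \<and> fst p = fst \<mu> \<and> snd p \<subseteq># snd \<mu>)" for \<mu>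
  have \<gamma>: "\<gamma> \<mu> \<in> L0 \<and> fst (\<gamma> \<mu>) = fst \<mu> \<and> snd (\<gamma> \<mu>) \<subseteq># snd \<mu>" if "\<mu> \<in> ?L" for \<mu>
  proof -
    have "\<exists>p. p \<in> L0 \<and> fst p = fst \<mu> \<and> snd p \<subseteq># snd \<mu>" using L0(2)[of "fst \<mu>" "snd \<mu>"] that by fastforce
    then show ?thesis unfolding \<gamma>_def by (rule someI_ex)
  qed
  define pos where "pos p a = (fst p, snd p + a)" for p :: "nat \<times> 'v multiset" and a
  \<comment> \<open>The contribution at \<open>\<nu>\<close> of the multiple whose leading term is \<open>pos p a\<close>. The condition that this term
    precedes \<open>\<nu>\<close> makes the recursion well-founded.\<close>
  define A where "A cc \<nu> p a = (if pos p a \<in> ?L \<and> \<gamma> (pos p a) = p \<and> (pos p a, \<nu>) \<in> R then cc (pos p a) * h p (fst \<nu>, snd \<nu> - a) else 0)"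
    for cc :: "nat \<times> 'v multiset \<Rightarrow> 'k" and \<nu> p a
  define F where "F cc \<nu> = z \<nu> - (\<Sum>p\<in>L0. \<Sum>a | a \<subseteq># snd \<nu>. A cc \<nu> p a)" for cc \<nu>
  define cc where "cc = wfrec R F"
  have cc: "cc \<nu> = F cc \<nu>" for \<nu>
  proof -
    have "A (cut cc R \<nu>) \<nu> p a = A cc \<nu> p a" for p a by (simp add: A_def cut_apply)
    then have "F (cut cc R \<nu>) \<nu> = F cc \<nu>" by (simp add: F_def)
    then show ?thesis unfolding cc_def using wfrec[OF wf_R, of F \<nu>] by simp
  qed
  define q where "q p a = (if p \<in> L0 \<and> pos p a \<in> ?L \<and> \<gamma> (pos p a) = p then cc (pos p a) else 0)" for p a
  define S where "S = (\<Sum>p\<in>L0. mulb (q p) (h p))"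
  have S: "S \<nu> = (\<Sum>p\<in>L0. \<Sum>a | a \<subseteq># snd \<nu>. q p a * h p (fst \<nu>, snd \<nu> - a))" for \<nu>
    by (cases \<nu>) (simp add: S_def sum_fun_apply mulb_def conv_def slot_def)
  have term_le: "pos p a = \<nu> \<or> (pos p a, \<nu>) \<in> R"
    if "p \<in> L0" "a \<subseteq># snd \<nu>" "h p (fst \<nu>, snd \<nu> - a) \<noteq> 0" "set_mset a \<subseteq> V" for p a \<nu>
  proof -
    have hp: "is_lead (h p) p" "h p \<in> FQ c V b" "p \<in> P" using h[OF that(1)] ZF by auto
    have eq: "snd \<nu> - a + a = snd \<nu>" using that(2) by simp
    have mem: "(fst \<nu>, snd \<nu> - a) \<in> P" using FQ_support[OF hp(2) that(3)] .
    have \<nu>P: "\<nu> \<in> P"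
    proof -
      have "set_mset (snd \<nu>) = set_mset (snd \<nu> - a) \<union> set_mset a" by (metis eq set_mset_union)
      then show ?thesis using mem that(4) by (cases \<nu>) (auto simp: P_def)
    qed
    have pP: "pos p a \<in> P" using hp(3) that(4) by (cases p) (auto simp: P_def pos_def)
    have "(fst \<nu>, snd \<nu> - a) = p \<or> key p < key (fst \<nu>, snd \<nu> - a)" using hp(1) that(3) by (auto simp: is_lead_def)
    then show ?thesis
    proof
      assume "(fst \<nu>, snd \<nu> - a) = p"
      then have "pos p a = \<nu>" using eq by (auto simp: pos_def)
      then show ?thesis ..
    next
      assume "key p < key (fst \<nu>, snd \<nu> - a)"
      then have "key (fst p, snd p + a) < key (fst \<nu>, snd \<nu> - a + a)" by (intro key_less_shift) simp
      then show ?thesis using pP \<nu>P by (simp add: eq pos_def R_def)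
    qed
  qed
  have posV: "set_mset a \<subseteq> V" if "pos p a \<in> ?L" for p a using that by (auto simp: leads_def P_def pos_def)
  have Rirr: "(\<nu>, \<nu>) \<notin> R" for \<nu> by (simp add: R_def)
  have Sz: "S \<nu> = z \<nu>" if \<nu>: "\<nu> \<in> ?L" for \<nu>
  proof -
    define B where "B p a = (if pos p a = \<nu> \<and> \<gamma> \<nu> = p then cc \<nu> else 0)" for p a
    have T: "q p a * h p (fst \<nu>, snd \<nu> - a) = A cc \<nu> p a + B p a" if "p \<in> L0" "a \<subseteq># snd \<nu>" for p a
    proof (cases "pos p a \<in> ?L \<and> \<gamma> (pos p a) = p")
      case False
      then show ?thesis using \<nu> by (auto simp: q_def A_def B_def)
    next
      case True
      show ?thesis
      proof (cases "pos p a = \<nu>")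
        case eq: True
        then have "(fst \<nu>, snd \<nu> - a) = p" by (auto simp: pos_def)
        then show ?thesis using True eq that(1) h[OF that(1)] Rirr by (simp add: q_def A_def B_def)
      next
        case False
        then have "B p a = 0" by (simp add: B_def)
        moreover have "h p (fst \<nu>, snd \<nu> - a) = 0 \<or> (pos p a, \<nu>) \<in> R" using term_le[OF that _ posV] True False by blast
        ultimately show ?thesis using True that(1) by (auto simp: q_def A_def)
      qed
    qed
    have g: "\<gamma> \<nu> \<in> L0" "fst (\<gamma> \<nu>) = fst \<nu>" "snd (\<gamma> \<nu>) \<subseteq># snd \<nu>" using \<gamma>[OF \<nu>] by auto
    have "(\<Sum>a | a \<subseteq># snd \<nu>. B p a) = (if p = \<gamma> \<nu> then cc \<nu> else 0)" for p
    proof (cases "p = \<gamma> \<nu>")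
      case True
      have "B p a = (if a = snd \<nu> - snd p then cc \<nu> else 0)" if "a \<subseteq># snd \<nu>" for a
      proof -
        have "snd p + a = snd \<nu> \<longleftrightarrow> a = snd \<nu> - snd p" using g(3) True by (metis add_diff_cancel_left' subset_mset.add_diff_inverse)
        then show ?thesis using g(2) True by (cases \<nu>) (auto simp: B_def pos_def)
      qed
      then have "(\<Sum>a | a \<subseteq># snd \<nu>. B p a) = (\<Sum>a | a \<subseteq># snd \<nu>. if a = snd \<nu> - snd p then cc \<nu> else 0)"
        by (intro sum.cong) auto
      then show ?thesis using True by simp
    qed (auto simp: B_def)
    then have "(\<Sum>p\<in>L0. \<Sum>a | a \<subseteq># snd \<nu>. B p a) = cc \<nu>" using L0(1) g(1) by simp
    moreover have "S \<nu> = (\<Sum>p\<in>L0. \<Sum>a | a \<subseteq># snd \<nu>. A cc \<nu> p a) + (\<Sum>p\<in>L0. \<Sum>a | a \<subseteq># snd \<nu>. B p a)"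
      unfolding S sum.distrib[symmetric] using T by (intro sum.cong refl) auto
    ultimately show ?thesis using cc[of \<nu>] by (simp add: F_def)
  qed
  \<comment> \<open>In the graded case the coefficients live in the degree of \<open>z\<close>, so each cofactor is a polynomial.\<close>
  have homog: "int (size (snd \<mu>)) + s (fst \<mu>) = d"
    if c: "c = Polynomials" and d: "gr s d z = z" and \<mu>: "cc \<mu> \<noteq> 0" for \<mu> d
    using \<mu>
  proof (induction \<mu> rule: wf_induct_rule[OF wf_R])
    case (1 \<nu>)
    show ?case
    proof (cases "z \<nu> = 0")
      case False
      then show ?thesis using gr_eqD[OF d, of "fst \<nu>" "snd \<nu>"] by simp
    next
      case True
      then have "(\<Sum>p\<in>L0. \<Sum>a | a \<subseteq># snd \<nu>. A cc \<nu> p a) \<noteq> 0" using 1 cc[of \<nu>] by (auto simp: F_def)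
      then obtain p where p: "p \<in> L0" "(\<Sum>a | a \<subseteq># snd \<nu>. A cc \<nu> p a) \<noteq> 0" by (rule sum.not_neutral_contains_not_neutral)
      from p(2) obtain a where a: "a \<in> {a. a \<subseteq># snd \<nu>}" "A cc \<nu> p a \<noteq> 0" by (rule sum.not_neutral_contains_not_neutral)
      then have *: "(pos p a, \<nu>) \<in> R" "cc (pos p a) \<noteq> 0" "h p (fst \<nu>, snd \<nu> - a) \<noteq> 0" by (auto simp: A_def split: if_splits)
      have d1: "int (size (snd (pos p a))) + s (fst (pos p a)) = d" using 1(1)[OF *(1,2)] .
      obtain d' where d': "gr s d' (h p) = h p" using h[OF p(1)] c by (auto simp: homogeneous_vec_def)
      have "h p p \<noteq> 0" using h[OF p(1)] by simp
      then have "int (size (snd p)) + s (fst p) = d'" using gr_eqD[OF d', of "fst p" "snd p"] by simp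
      moreover have "int (size (snd \<nu> - a)) + s (fst \<nu>) = d'" using gr_eqD[OF d' *(3)] .
      moreover have "size (snd \<nu>) = size (snd \<nu> - a) + size a" using a(1) by (metis mem_Collect_eq size_union subset_mset.diff_add)
      ultimately show ?thesis using d1 by (simp add: pos_def)
    qed
  qed
  have qC: "q p \<in> series_carrier c V" for p
  proof (rule carrierI)
    show "set_mset a \<subseteq> V" if "q p a \<noteq> 0" for a using that posV by (auto simp: q_def split: if_splits)
    assume c: "c = Polynomials"
    then obtain d where d: "gr s d z = z" using z(2) by (auto simp: homogeneous_vec_def)
    have "{a. q p a \<noteq> 0} \<subseteq> {a. set_mset a \<subseteq> V \<and> size a = nat (d - s (fst p) - int (size (snd p)))}"
    proof clarify
      fix a assume "q p a \<noteq> 0"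
      then have *: "pos p a \<in> ?L" "cc (pos p a) \<noteq> 0" by (auto simp: q_def split: if_splits)
      from homog[OF c d *(2)] have "size a = nat (d - s (fst p) - int (size (snd p)))" by (simp add: pos_def)
      with posV[OF *(1)] show "set_mset a \<subseteq> V \<and> size a = nat (d - s (fst p) - int (size (snd p)))" by blast
    qed
    then show "finite {a. q p a \<noteq> 0}" by (rule finite_subset[OF _ finite_multisets_of_size[OF V, unfolded multisets_of_size_def]])
  qed
  have SZ: "S \<in> Z" unfolding S_def by (rule vsub_sum[OF vZ]) (use h mZ qC in blast)
  have "z - S = 0"
  proof (rule ccontr)
    assume nz: "z - S \<noteq> 0"
    have dZ: "z - S \<in> Z" by (rule vsub_diff[OF vZ z(1) SZ])
    have "homogeneous_vec c s (z - S)" unfolding homogeneous_vec_def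
    proof
      assume c: "c = Polynomials"
      then obtain d where d: "gr s d z = z" using z(2) by (auto simp: homogeneous_vec_def)
      have "gr s d (mulb (q p) (h p)) = mulb (q p) (h p)" if p: "p \<in> L0" for p
      proof -
        obtain d' where d': "gr s d' (h p) = h p" using h[OF p] c by (auto simp: homogeneous_vec_def)
        have "h p p \<noteq> 0" using h[OF p] by simp
        then have dp: "int (size (snd p)) + s (fst p) = d'" using gr_eqD[OF d', of "fst p" "snd p"] by simp
        have "hcomp (d - d') (q p) = q p"
        proof
          fix a show "hcomp (d - d') (q p) a = q p a"
          proof (cases "q p a = 0")
            case False
            then have "cc (pos p a) \<noteq> 0" by (auto simp: q_def split: if_splits)
            from homog[OF c d this] dp show ?thesis by (simp add: hcomp_def pos_def)
          qed (simp add: hcomp_def)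
        qed
        then show ?thesis by (simp add: gr_mulb[OF d'])
      qed
      then have "gr s d S = S" by (simp add: S_def gr_sum)
      with d show "\<exists>d. gr s d (z - S) = z - S" by (intro exI[of _ d]) (simp add: gr_simps)
    qed
    moreover obtain p where p: "p \<in> P" "is_lead (z - S) p" using lead_exists[OF _ nz] dZ ZF by blast
    ultimately have "p \<in> ?L" using dZ by (auto simp: leads_def)
    then have "(z - S) p = 0" using Sz by (simp add: minus_apply)
    with p(2) show False by (simp add: is_lead_def)
  qed
  then have "z = S" by simp
  with qC show ?thesis by (auto simp: S_def)
qed

end

text \<open>
  By Dickson's lemma finitely many leading terms divide all the others, and by \<open>division\<close> the corresponding
  vectors generate. A polynomial vector is first split into homogeneous components.
\<close>

theorem finitely_generated:
  fixes Z :: "(nat \<times> 'v multiset \<Rightarrow> 'k::field) set"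
  assumes V: "finite V" and Z: "submod c V b s Z"
  shows "\<exists>G. finite G \<and> G \<subseteq> Z \<and> (\<forall>g\<in>G. homogeneous_vec c s g) \<and> Z = gens c V G"
proof -
  obtain \<iota> :: "'v \<Rightarrow> nat" where \<iota>: "inj_on \<iota> V" using finite_imp_inj_to_nat_seg[OF V] by blast
  interpret term_order c V b s \<iota> by standard fact+
  have ZF: "Z \<subseteq> FQ c V b" and vZ: "vsub Z" using Z by (auto simp: submod_def)
  obtain L0 where L0': "L0 \<subseteq> leads Z" "finite L0" "\<forall>(l, e)\<in>leads Z. \<exists>e0. (l, e0) \<in> L0 \<and> e0 \<subseteq># e"
    using dickson_leads[of Z] by (elim exE conjE)
  then have L0: "L0 \<subseteq> leads Z" "finite L0" "\<And>l e. (l, e) \<in> leads Z \<Longrightarrow> \<exists>e0. (l, e0) \<in> L0 \<and> e0 \<subseteq># e"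
    by auto
  have "\<exists>w. w \<in> Z \<and> homogeneous_vec c s w \<and> is_lead w p \<and> w p = 1 \<and> p \<in> P" if p0: "p \<in> L0" for p
  proof -
    obtain w where w: "w \<in> Z" "homogeneous_vec c s w" "is_lead w p" "p \<in> P" using p0 L0(1) by (auto simp: leads_def)
    then have "w p \<noteq> 0" by (simp add: is_lead_def)
    have "homogeneous_vec c s (fsc (inverse (w p)) w)" using w(2) gr_simps(3) unfolding homogeneous_vec_def by metis
    moreover have "is_lead (fsc (inverse (w p)) w) p" using w(3) by (simp add: is_lead_def fsc_apply)
    ultimately show ?thesis using w vsub_fsc[OF vZ w(1), of "inverse (w p)"] \<open>w p \<noteq> 0\<close>
      by (intro exI[of _ "fsc (inverse (w p)) w"]) (simp add: fsc_apply)
  qed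
  then have "\<forall>p\<in>L0. \<exists>w. w \<in> Z \<and> homogeneous_vec c s w \<and> is_lead w p \<and> w p = 1 \<and> p \<in> P" by (intro ballI)
  then have "\<exists>h. \<forall>p\<in>L0. h p \<in> Z \<and> homogeneous_vec c s (h p) \<and> is_lead (h p) p \<and> h p p = 1 \<and> p \<in> P" by (rule bchoice)
  then obtain h where h': "\<forall>p\<in>L0. h p \<in> Z \<and> homogeneous_vec c s (h p) \<and> is_lead (h p) p \<and> h p p = 1 \<and> p \<in> P" by (rule exE)
  then have h: "\<And>p. p \<in> L0 \<Longrightarrow> h p \<in> Z \<and> homogeneous_vec c s (h p) \<and> is_lead (h p) p \<and> h p p = 1 \<and> p \<in> P" by (rule bspec)
  define G where "G = h ` L0"
  have G: "finite G" "G \<subseteq> Z" "\<forall>g\<in>G. homogeneous_vec c s g" using h L0 by (auto simp: G_def)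
  have adm_in: "z \<in> gens c V G" if z: "z \<in> Z" "homogeneous_vec c s z" for z
  proof -
    have "\<exists>q. (\<forall>p. q p \<in> series_carrier c V) \<and> z = (\<Sum>p\<in>L0. mulb (q p) (h p))"
      by (rule division[OF Z L0(2,3) h z])
    then obtain q where q: "\<And>p. q p \<in> series_carrier c V" "z = (\<Sum>p\<in>L0. mulb (q p) (h p))"
      by auto
    have "mulb (q p) (h p) \<in> gens c V G" if "p \<in> L0" for p
      using mulb_gens[OF q(1) gens_base[OF G(1)]] that by (auto simp: G_def)
    then show ?thesis unfolding q(2) by (rule vsub_sum[OF vsub_gens])
  qed
  have "Z \<subseteq> gens c V G"
  proof
    fix z assume z: "z \<in> Z"
    show "z \<in> gens c V G"
    proof (cases "c = Polynomials")
      case True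
      then obtain D where D: "z = (\<Sum>d\<in>D. gr s d z)" using gr_decompose[of z V b s] z ZF by auto
      have "homogeneous_vec c s (gr s d z)" for d unfolding homogeneous_vec_def using gr_simps(6) by blast
      then have "gr s d z \<in> gens c V G" for d
        using True z Z by (intro adm_in) (auto simp: submod_def)
      then have "(\<Sum>d\<in>D. gr s d z) \<in> gens c V G" by (rule vsub_sum[OF vsub_gens])
      then show ?thesis using D by simp
    qed (use adm_in z in \<open>auto simp: homogeneous_vec_def\<close>)
  qed
  with gens_subset[OF Z G(2)] G show ?thesis by blast
qed

section \<open>Existence of minimal free resolutions\<close>

text \<open>
  The coefficients of the inverse are computed by recursion on the exponent.
\<close>

lemma power_series_inverse:
  fixes f :: "'v multiset \<Rightarrow> 'k::field"
  assumes f: "f \<in> series_carrier Power_Series V" and f0: "f {#} \<noteq> 0"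
  shows "\<exists>r\<in>series_carrier Power_Series V. conv r f = cst 1"
proof -
  define R where "R = {(a, e). a \<subset># (e :: 'v multiset)}"
  have wf: "wf R" unfolding R_def
    by (rule wf_subset[OF wf_measure[of size]]) (auto simp: mset_subset_size)
  define F where "F r e = ((if e = {#} then 1 else 0) - (\<Sum>a | a \<subseteq># e \<and> a \<noteq> e. r a * f (e - a))) / f {#}" for r e
  define r where "r = wfrec R F"
  have r: "r e = F r e" for e
  proof -
    have "F (cut r R e) e = F r e" unfolding F_def
      by (intro arg_cong2[where f = "(/)"] arg_cong2[where f = "(-)"] sum.cong refl) (auto simp: cut_apply R_def subset_mset.less_le)
    then show ?thesis unfolding r_def using wfrec[OF wf, of F e] by simp
  qed
  have "r \<in> series_carrier Power_Series V"
  proof (rule carrierI)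
    fix e assume "r e \<noteq> 0"
    then show "set_mset e \<subseteq> V"
    proof (induction e rule: wf_induct_rule[OF wf])
      case (1 e)
      show ?case
      proof (cases "e = {#}")
        case False
        then have "(\<Sum>a | a \<subseteq># e \<and> a \<noteq> e. r a * f (e - a)) \<noteq> 0" using 1(2) r[of e] by (auto simp: F_def)
        then obtain a where a: "a \<in> {a. a \<subseteq># e \<and> a \<noteq> e}" "r a * f (e - a) \<noteq> 0" by (rule sum.not_neutral_contains_not_neutral)
        then have "set_mset a \<subseteq> V" using 1(1)[of a] by (auto simp: R_def subset_mset.less_le)
        moreover have "set_mset (e - a) \<subseteq> V" using carrierD(1)[OF f, of "e - a"] a by auto
        moreover have "set_mset e = set_mset a \<union> set_mset (e - a)" using a(1) by (metis mem_Collect_eq set_mset_union subset_mset.add_diff_inverse)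
        ultimately show ?thesis by blast
      qed simp
    qed
  qed simp
  moreover have "conv r f = cst 1"
  proof
    fix e :: "'v multiset"
    have "{a. a \<subseteq># (e :: 'v multiset)} = insert e {a. a \<subseteq># e \<and> a \<noteq> e}" by auto
    moreover have "finite {a. a \<subseteq># e \<and> a \<noteq> e}" by (rule finite_subset[OF _ finite_submultisets[of e]]) auto
    ultimately have "conv r f e = r e * f {#} + (\<Sum>a | a \<subseteq># e \<and> a \<noteq> e. r a * f (e - a))"
      unfolding conv_def by simp
    also have "\<dots> = cst 1 e" using f0 r[of e] by (simp add: F_def cst_def)
    finally show "conv r f e = cst 1 e" .
  qed
  ultimately show ?thesis by blast
qed

definition const_free :: "(nat \<times> 'v multiset \<Rightarrow> 'k::field) set \<Rightarrow> bool" where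
  "const_free Z \<longleftrightarrow> (\<forall>w\<in>Z. \<forall>l. slot l w {#} = 0)"

text \<open>
  \<open>\<Psi>\<close> maps \<open>Q\<^sup>r\<close> onto \<open>Z\<close> with kernel \<open>Z'\<close>, and respects degrees for the shifts \<open>s'\<close> and \<open>s\<close>. Linearity is asked
  for all families of coefficients, which saves membership conditions.
\<close>

definition cover :: "ring_kind \<Rightarrow> 'v set \<Rightarrow> nat \<Rightarrow> (nat \<Rightarrow> int) \<Rightarrow> (nat \<times> 'v multiset \<Rightarrow> 'k::field) set \<Rightarrow>
    nat \<Rightarrow> (nat \<Rightarrow> int) \<Rightarrow> (nat \<times> 'v multiset \<Rightarrow> 'k) set \<Rightarrow> ((nat \<times> 'v multiset \<Rightarrow> 'k) \<Rightarrow> (nat \<times> 'v multiset \<Rightarrow> 'k)) \<Rightarrow> bool" where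
  "cover c V b s Z r s' Z' \<Psi> \<longleftrightarrow>
     (\<forall>w w'. \<Psi> (w + w') = \<Psi> w + \<Psi> w') \<and> (\<forall>f w. \<Psi> (mulb f w) = mulb f (\<Psi> w)) \<and>
     \<Psi> ` FQ c V r = Z \<and> Z' = {w \<in> FQ c V r. \<Psi> w = 0} \<and>
     (c = Polynomials \<longrightarrow> (\<forall>d w. \<Psi> (gr s' d w) = gr s d (\<Psi> w)))"

lemma submod_kernel:
  assumes cov: "cover c V b s Z r s' Z' \<Psi>"
  shows "submod c V r s' Z'"
proof -
  have add: "\<And>w w'. \<Psi> (w + w') = \<Psi> w + \<Psi> w'" and mul: "\<And>f w. \<Psi> (mulb f w) = mulb f (\<Psi> w)"
    and Z': "Z' = {w \<in> FQ c V r. \<Psi> w = 0}"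
    and gr: "\<And>d w. c = Polynomials \<Longrightarrow> \<Psi> (gr s' d w) = gr s d (\<Psi> w)"
    using cov by (auto simp: cover_def)
  have z: "\<Psi> 0 = 0" using mul[of 0 0] by (simp add: mulb_simps)
  have fsc: "\<Psi> (fsc a w) = fsc a (\<Psi> w)" for a w using mul[of "cst a" w] by (simp add: mulb_simps)
  have "vsub Z'" unfolding Z' by (rule vsubI)
    (auto simp: z add fsc fsc_simps vsub_0[OF vsub_FQ] vsub_add[OF vsub_FQ] vsub_fsc[OF vsub_FQ])
  then show ?thesis
    by (auto simp: submod_def Z' mul mulb_FQ mulb_simps gr gr_FQ gr_simps)
qed

text \<open>
  Take a generating set of least cardinality. A relation whose \<open>j\<close>-th entry has a constant term can be made into
  one with \<open>j\<close>-th entry \<open>1\<close>, by passing to a homogeneous component or by inverting a power series. It expresses the \<open>j\<close>-th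
  generator by the others, against the choice.
\<close>

lemma minimal_cover:
  fixes Z :: "(nat \<times> 'v multiset \<Rightarrow> 'k::field) set"
  assumes V: "finite V" and Z: "submod c V b s Z"
  shows "\<exists>r s' Z' \<Psi>. cover c V b s Z r s' Z' \<Psi> \<and> const_free Z'"
proof -
  define good where "good G \<longleftrightarrow> finite G \<and> G \<subseteq> Z \<and> (\<forall>g\<in>G. homogeneous_vec c s g) \<and> Z = gens c V G" for G
  have "\<exists>G. good G" unfolding good_def by (rule finitely_generated[OF V Z])
  then obtain G where G: "good G" and Gmin: "\<And>H. good H \<Longrightarrow> card G \<le> card H"
    using ex_has_least_nat[of good _ card] by auto
  have GZ: "finite G" "G \<subseteq> Z" "\<And>g. g \<in> G \<Longrightarrow> homogeneous_vec c s g" "Z = gens c V G" using G by (auto simp: good_def)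
  define r where "r = card G"
  obtain \<eta> where \<eta>: "bij_betw \<eta> {..<r} G" using ex_bij_betw_nat_finite[OF GZ(1)] by (auto simp: lessThan_atLeast0 r_def)
  have \<eta>G: "\<eta> j \<in> G" if "j < r" for j using \<eta> that by (auto simp: bij_betw_def)
  define s' where "s' j = (SOME d. gr s d (\<eta> j) = \<eta> j)" for j
  have s': "gr s (s' j) (\<eta> j) = \<eta> j" if "j < r" "c = Polynomials" for j
  proof -
    have "\<exists>d. gr s d (\<eta> j) = \<eta> j" using GZ(3)[OF \<eta>G[OF that(1)]] that(2) by (auto simp: homogeneous_vec_def)
    then show ?thesis unfolding s'_def by (rule someI_ex)
  qed
  define \<Psi> where "\<Psi> w = (\<Sum>j<r. mulb (slot j w) (\<eta> j))" for w :: "nat \<times> 'v multiset \<Rightarrow> 'k"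
  define Z' where "Z' = {w \<in> FQ c V r. \<Psi> w = 0}"
  have hslot: "hcomp (d - s' j) (slot j w) = slot j (gr s' d w)" for d j w
    by (auto simp: hcomp_def slot_def gr_def fun_eq_iff)
  have cov: "cover c V b s Z r s' Z' \<Psi>"
    unfolding cover_def
  proof (intro conjI allI impI)
    show "\<Psi> (w + w') = \<Psi> w + \<Psi> w'" for w w' by (simp add: \<Psi>_def slot_simps mulb_simps sum.distrib)
    show "\<Psi> (mulb f w) = mulb f (\<Psi> w)" for f w by (simp add: \<Psi>_def slot_mulb mulb_sum mulb_simps)
    show "\<Psi> ` FQ c V r = Z"
    proof (intro equalityI subsetI)
      fix x assume "x \<in> \<Psi> ` FQ c V r"
      then obtain w where w: "w \<in> FQ c V r" "x = \<Psi> w" by blast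
      have "mulb (slot j w) (\<eta> j) \<in> Z" if "j < r" for j
        using Z \<eta>G[OF that] GZ(2) w(1) by (auto simp: submod_def FQ_def)
      then show "x \<in> Z" unfolding w(2) \<Psi>_def using Z by (intro vsub_sum) (auto simp: submod_def)
    next
      fix x assume "x \<in> Z"
      then obtain q where q: "\<And>g. q g \<in> series_carrier c V" "x = (\<Sum>g\<in>G. mulb (q g) g)" unfolding GZ(4) by (auto simp: gens_def)
      define w where "w = flat r (\<lambda>j. q (\<eta> j))"
      have sw: "slot j w = (if j < r then q (\<eta> j) else 0)" for j by (simp add: w_def slot_flat)
      have "x = (\<Sum>j<r. mulb (q (\<eta> j)) (\<eta> j))" unfolding q(2) using sum.reindex_bij_betw[OF \<eta>, of "\<lambda>g. mulb (q g) g"] by simp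
      also have "\<dots> = \<Psi> w" unfolding \<Psi>_def by (intro sum.cong) (auto simp: sw)
      finally have "x = \<Psi> w" .
      moreover have "w \<in> FQ c V r" using q(1) by (auto simp: FQ_def sw vsub_0[OF vsub_carrier])
      ultimately show "x \<in> \<Psi> ` FQ c V r" by blast
    qed
    show "\<Psi> (gr s' d w) = gr s d (\<Psi> w)" if "c = Polynomials" for d w
      unfolding \<Psi>_def gr_sum by (intro sum.cong refl) (simp add: gr_mulb[OF s'[OF _ that]] hslot)
  qed (rule Z'_def)
  have "const_free Z'"
  proof (rule ccontr)
    assume "\<not> const_free Z'"
    then obtain w j where w: "w \<in> Z'" "slot j w {#} \<noteq> 0" by (auto simp: const_free_def)
    have sub': "submod c V r s' Z'" by (rule submod_kernel[OF cov])
    have j: "j < r" using w by (auto simp: Z'_def FQ_def pointwise not_le[symmetric])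
    have "\<exists>w\<in>Z'. \<exists>f\<in>series_carrier c V. conv f (slot j w) = cst 1"
    proof (cases c)
      case Polynomials
      define w' where "w' = gr s' (s' j) w"
      have "w' \<in> Z'" using sub' Polynomials w(1) by (auto simp: submod_def w'_def)
      moreover have "slot j w' = cst (slot j w {#})"
        by (auto simp: w'_def slot_def gr_def cst_def fun_eq_iff)
      then have "conv (cst (inverse (slot j w {#}))) (slot j w') = cst 1"
        using w(2) by (simp add: conv_cst) (auto simp: fsc_def cst_def fun_eq_iff)
      ultimately show ?thesis using cst_carrier by blast
    next
      case Power_Series
      have "slot j w \<in> series_carrier Power_Series V" using w(1) Power_Series by (auto simp: Z'_def FQ_def)
      from power_series_inverse[OF this w(2)] w(1) Power_Series show ?thesis by blast
    qed
    then obtain u f where u: "u \<in> Z'" "f \<in> series_carrier c V" "conv f (slot j u) = cst 1" by blast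
    define x where "x = mulb f u"
    have x: "x \<in> Z'" using sub' u by (auto simp: submod_def x_def)
    have xj: "slot j x = cst 1" by (simp add: x_def slot_mulb u(3))
    define H where "H = G - {\<eta> j}"
    have "(\<Sum>i<r. mulb (slot i x) (\<eta> i)) = 0" using x by (simp add: Z'_def \<Psi>_def)
    then have "mulb (slot j x) (\<eta> j) + (\<Sum>i\<in>{..<r} - {j}. mulb (slot i x) (\<eta> i)) = 0"
      using j sum.remove[of "{..<r}" j "\<lambda>i. mulb (slot i x) (\<eta> i)"] by simp
    then have "\<eta> j = - (\<Sum>i\<in>{..<r} - {j}. mulb (slot i x) (\<eta> i))"
      by (simp add: xj mulb_simps fsc_simps eq_neg_iff_add_eq_0)
    moreover have "mulb (slot i x) (\<eta> i) \<in> gens c V H" if "i \<in> {..<r} - {j}" for i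
    proof -
      have "\<eta> i \<in> H" using \<eta> that j unfolding H_def bij_betw_def inj_on_def by auto
      then show ?thesis using GZ(1) x by (intro mulb_gens gens_base) (auto simp: H_def Z'_def FQ_def)
    qed
    then have "(\<Sum>i\<in>{..<r} - {j}. mulb (slot i x) (\<eta> i)) \<in> gens c V H" by (rule vsub_sum[OF vsub_gens])
    ultimately have \<eta>H: "\<eta> j \<in> gens c V H" using vsub_neg[OF vsub_gens] by simp
    have "G \<subseteq> gens c V H"
    proof
      fix g assume "g \<in> G"
      then show "g \<in> gens c V H" using \<eta>H gens_base[of H g c V] GZ(1) by (cases "g = \<eta> j") (auto simp: H_def)
    qed
    then have "Z \<subseteq> gens c V H" unfolding GZ(4) by (rule gens_trans)
    moreover have "gens c V H \<subseteq> Z" using GZ(2) by (intro gens_subset[OF Z]) (auto simp: H_def)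
    ultimately have "good H" using GZ by (auto simp: good_def H_def)
    then have "card G \<le> card H" by (rule Gmin)
    moreover have "card H < card G" unfolding H_def using GZ(1) \<eta>G[OF j] by (rule card_Diff1_less)
    ultimately show False by simp
  qed
  with cov show ?thesis by blast
qed

lemma homogeneous_part_slot:
  "f \<in> homogeneous_part (series_ring c V) d \<longleftrightarrow> f \<in> series_carrier c V \<and> (\<forall>e. f e \<noteq> 0 \<longrightarrow> int (size e) = d)"
  by (simp add: homogeneous_part_def)

lemma free_part_iff:
  "u \<in> free_part (series_ring c V) b s d \<longleftrightarrow> u \<in> {..<b} \<rightarrow>\<^sub>E series_carrier c V \<and> gr s d (flat b u) = flat b u"
proof
  assume u: "u \<in> free_part (series_ring c V) b s d"
  have *: "u l \<in> homogeneous_part (series_ring c V) (d - s l)" if "l < b" for l using u that by (auto simp: free_part_def)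
  then have "u \<in> {..<b} \<rightarrow>\<^sub>E series_carrier c V" using u by (auto simp: free_part_def homogeneous_part_slot PiE_def Pi_def)
  moreover have "gr s d (flat b u) = flat b u"
  proof (rule gr_eqI)
    fix l e assume "flat b u (l, e) \<noteq> 0"
    then have "l < b" "u l e \<noteq> 0" by (auto simp: flat_def split: if_splits)
    then show "int (size e) + s l = d" using *[of l] by (auto simp: homogeneous_part_slot)
  qed
  ultimately show "u \<in> {..<b} \<rightarrow>\<^sub>E series_carrier c V \<and> gr s d (flat b u) = flat b u" ..
next
  assume u: "u \<in> {..<b} \<rightarrow>\<^sub>E series_carrier c V \<and> gr s d (flat b u) = flat b u"
  have "int (size e) = d - s l" if "l < b" "u l e \<noteq> 0" for l e
    using gr_eqD[of s d "flat b u" l e] u that by (simp add: flat_def)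
  then show "u \<in> free_part (series_ring c V) b s d"
    using u by (auto simp: free_part_def homogeneous_part_slot PiE_def Pi_def)
qed

lemma unflat_mulb: "unflat b (mulb f w) = (\<lambda>l\<in>{..<b}. conv f (unflat b w l))"
  by (auto simp: unflat_def slot_mulb)

lemma flat_mulb: "flat b (\<lambda>l\<in>{..<b}. conv f (u l)) = mulb f (flat b u)"
  by (auto intro!: slot_eqI simp: slot_flat slot_mulb conv_0)

lemma ideal_submod:
  fixes I :: "('v multiset \<Rightarrow> 'k::field) set"
  assumes I: "ideal I (series_ring c V)" and gr: "c = Polynomials \<Longrightarrow> \<forall>f\<in>I. \<forall>d. hcomp d f \<in> I"
  shows "submod c V 1 (\<lambda>_. 0) {w \<in> FQ c V 1. slot 0 w \<in> I}"
proof -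
  note vI = ideal_vsub[OF I]
  have "vsub {w \<in> FQ c V 1. slot 0 w \<in> I}"
    by (rule vsubI) (auto simp: vsub_0[OF vsub_FQ] vsub_add[OF vsub_FQ] vsub_fsc[OF vsub_FQ] slot_simps vsub_0[OF vI] vsub_add[OF vI] vsub_fsc[OF vI])
  moreover have "conv f g \<in> I" if "f \<in> series_carrier c V" "g \<in> I" for f g
    using ideal.I_l_closed[OF I that(2), of f] that(1) by simp
  moreover have "slot 0 (gr (\<lambda>_. 0) d w) = hcomp d (slot 0 w)" for d and w :: "nat \<times> 'v multiset \<Rightarrow> 'k" by (auto simp: slot_def gr_def hcomp_def)
  ultimately show ?thesis using gr by (auto simp: submod_def mulb_FQ slot_mulb gr_FQ)
qed

text \<open>
  Minimal covers are iterated by dependent choice, starting from the ideal \<open>I\<close> inside \<open>Q\<close>.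
\<close>

theorem minimal_resolution_exists:
  fixes M :: "('v multiset \<Rightarrow> 'k::field, 'b) graded_module"
  assumes V: "finite V" and P: "presents c V I \<pi> M" and I0: "\<forall>f\<in>I. f {#} = 0"
    and grI: "c = Polynomials \<Longrightarrow> \<forall>f\<in>I. \<forall>d. hcomp d f \<in> I"
    and gr\<pi>: "c = Polynomials \<Longrightarrow> \<forall>d. \<pi> ` homogeneous_part (series_ring c V) d \<subseteq> degree_part M d"
  shows "\<exists>b p \<phi>. minimal_free_resolution c V M b p \<phi>"
proof -
  let ?C = "series_carrier c V :: ('v multiset \<Rightarrow> 'k) set"
  let ?Q = "series_ring c V :: ('v multiset \<Rightarrow> 'k) ring"
  have I: "ideal I ?Q" and onto: "\<pi> ` ?C = carrier M"
    and add: "\<And>f g. f \<in> ?C \<Longrightarrow> g \<in> ?C \<Longrightarrow> \<pi> (f + g) = \<pi> f \<oplus>\<^bsub>M\<^esub> \<pi> g"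
    and smult: "\<And>f g. f \<in> ?C \<Longrightarrow> g \<in> ?C \<Longrightarrow> \<pi> (conv f g) = f \<odot>\<^bsub>M\<^esub> \<pi> g"
    and ker: "\<And>f. f \<in> ?C \<Longrightarrow> \<pi> f = \<zero>\<^bsub>M\<^esub> \<longleftrightarrow> f \<in> I"
    using P unfolding presents_def by blast+
  define Z0 where "Z0 = {w \<in> FQ c V 1. slot 0 w \<in> I}"
  \<comment> \<open>A state consists of a rank, the degrees of the basis vectors, and the next syzygy module.\<close>
  define St where "St x \<longleftrightarrow> (case x of (b, s, Z) \<Rightarrow> submod c V b s Z \<and> const_free Z)" for x :: "nat \<times> (nat \<Rightarrow> int) \<times> (nat \<times> 'v multiset \<Rightarrow> 'k) set"
  define Step where "Step x y \<longleftrightarrow> (case x of (b, s, Z) \<Rightarrow> case y of (r, s', Z') \<Rightarrow> \<exists>\<Psi>. cover c V b s Z r s' Z' \<Psi>)"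
    for x y :: "nat \<times> (nat \<Rightarrow> int) \<times> (nat \<times> 'v multiset \<Rightarrow> 'k) set"
  have "slot l w {#} = 0" if "w \<in> Z0" for w l
    using that I0 by (cases "l = 0") (auto simp: Z0_def FQ_def pointwise)
  then have St0: "St (1, \<lambda>_. 0, Z0)" using ideal_submod[OF I grI] by (auto simp: St_def Z0_def const_free_def)
  have step: "\<exists>y. St y \<and> Step x y" if x: "St x" for x
  proof -
    obtain b s Z where bsZ: "x = (b, s, Z)" by (cases x)
    then have Z: "submod c V b s Z" using x by (simp add: St_def)
    obtain r s' Z' \<Psi> where cov: "cover c V b s Z r s' Z' \<Psi>" "const_free Z'"
      using minimal_cover[OF V Z] by (elim exE conjE)
    have "St (r, s', Z')" using submod_kernel[OF cov(1)] cov(2) by (simp add: St_def)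
    moreover have "Step x (r, s', Z')" using cov(1) by (auto simp: Step_def bsZ)
    ultimately show ?thesis by blast
  qed
  have "\<exists>x. \<forall>n. (St (x n) \<and> (n = 0 \<longrightarrow> x n = (1, \<lambda>_. 0, Z0))) \<and> Step (x n) (x (Suc n))"
  proof (rule dependent_nat_choice)
    show "\<exists>x. St x \<and> (0 = (0::nat) \<longrightarrow> x = (1, \<lambda>_. 0, Z0))" using St0 by simp
    show "\<exists>y. (St y \<and> (Suc n = 0 \<longrightarrow> y = (1, \<lambda>_. 0, Z0))) \<and> Step x y"
      if "St x \<and> (n = 0 \<longrightarrow> x = (1, \<lambda>_. 0, Z0))" for x and n :: nat using step that by simp
  qed
  then obtain x where x': "\<forall>n. (St (x n) \<and> (n = 0 \<longrightarrow> x n = (1, \<lambda>_. 0, Z0))) \<and> Step (x n) (x (Suc n))" by (rule exE)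
  then have x: "\<And>n. St (x n)" "x 0 = (1, \<lambda>_. 0, Z0)" "\<And>n. Step (x n) (x (Suc n))" by auto
  define b where "b n = fst (x n)" for n
  define s where "s n = fst (snd (x n))" for n
  define Z where "Z n = snd (snd (x n))" for n
  have b0: "b 0 = 1" and s0: "s 0 = (\<lambda>_. 0)" and Z0: "Z 0 = Z0" using x(2) by (auto simp: b_def s_def Z_def)
  have "\<forall>n. \<exists>\<Psi>. cover c V (b n) (s n) (Z n) (b (Suc n)) (s (Suc n)) (Z (Suc n)) \<Psi>"
    using x(3) by (simp add: Step_def b_def s_def Z_def case_prod_unfold)
  then have "\<exists>\<Psi>. \<forall>n. cover c V (b n) (s n) (Z n) (b (Suc n)) (s (Suc n)) (Z (Suc n)) (\<Psi> n)" by (rule choice)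
  then obtain \<Psi> where cov': "\<forall>n. cover c V (b n) (s n) (Z n) (b (Suc n)) (s (Suc n)) (Z (Suc n)) (\<Psi> n)" by (rule exE)
  have cov: "\<And>n. cover c V (b n) (s n) (Z n) (b (Suc n)) (s (Suc n)) (Z (Suc n)) (\<Psi> n)" using cov' by (rule spec)
  have \<Psi>add: "\<And>n w w'. \<Psi> n (w + w') = \<Psi> n w + \<Psi> n w'" and \<Psi>mul: "\<And>n f w. \<Psi> n (mulb f w) = mulb f (\<Psi> n w)"
    and \<Psi>im: "\<And>n. \<Psi> n ` FQ c V (b (Suc n)) = Z n" and Zker: "\<And>n. Z (Suc n) = {w \<in> FQ c V (b (Suc n)). \<Psi> n w = 0}"
    and \<Psi>gr: "\<And>n d w. c = Polynomials \<Longrightarrow> \<Psi> n (gr (s (Suc n)) d w) = gr (s n) d (\<Psi> n w)"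
    using cov unfolding cover_def by blast+
  have ZF: "Z n \<subseteq> FQ c V (b n)" and Zc: "const_free (Z n)" for n
    using x(1)[of n] by (auto simp: St_def submod_def b_def Z_def split: prod.splits)
  define p where "p u = \<pi> (u 0)" for u :: "nat \<Rightarrow> 'v multiset \<Rightarrow> 'k"
  define \<phi> where "\<phi> n u = unflat (b n) (\<Psi> n (flat (b (Suc n)) u))" for n u
  have fZ: "\<Psi> n (flat (b (Suc n)) u) \<in> Z n" if "u \<in> {..<b (Suc n)} \<rightarrow>\<^sub>E ?C" for n u
    using \<Psi>im[of n] flat_FQ[OF that] by blast
  have fF: "\<Psi> n (flat (b (Suc n)) u) \<in> FQ c V (b n)" if "u \<in> {..<b (Suc n)} \<rightarrow>\<^sub>E ?C" for n u
    using ZF fZ[OF that] by blast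
  have \<phi>C: "\<phi> n u \<in> {..<b n} \<rightarrow>\<^sub>E ?C" if "u \<in> {..<b (Suc n)} \<rightarrow>\<^sub>E ?C" for n u
    unfolding \<phi>_def by (rule unflat_carrier[OF fF[OF that]])
  have \<phi>im: "\<phi> n ` ({..<b (Suc n)} \<rightarrow>\<^sub>E ?C) = unflat (b n) ` Z n" for n
  proof -
    have flat_im: "flat (b (Suc n)) ` ({..<b (Suc n)} \<rightarrow>\<^sub>E ?C) = FQ c V (b (Suc n))"
    proof
      show "flat (b (Suc n)) ` ({..<b (Suc n)} \<rightarrow>\<^sub>E ?C) \<subseteq> FQ c V (b (Suc n))" by (rule image_subsetI) (rule flat_FQ)
      show "FQ c V (b (Suc n)) \<subseteq> flat (b (Suc n)) ` ({..<b (Suc n)} \<rightarrow>\<^sub>E ?C)"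
      proof
        fix w :: "nat \<times> 'v multiset \<Rightarrow> 'k" assume w: "w \<in> FQ c V (b (Suc n))"
        show "w \<in> flat (b (Suc n)) ` ({..<b (Suc n)} \<rightarrow>\<^sub>E ?C)"
          by (rule image_eqI[where x = "unflat (b (Suc n)) w"]) (simp_all only: flat_unflat[OF w] unflat_carrier[OF w])
      qed
    qed
    have "\<phi> n ` ({..<b (Suc n)} \<rightarrow>\<^sub>E ?C) = unflat (b n) ` \<Psi> n ` flat (b (Suc n)) ` ({..<b (Suc n)} \<rightarrow>\<^sub>E ?C)"
      by (simp add: \<phi>_def image_image)
    then show ?thesis by (simp only: flat_im \<Psi>im)
  qed
  have at0: "u 0 \<in> ?C" if "u \<in> {..<b 0} \<rightarrow>\<^sub>E ?C" for u :: "nat \<Rightarrow> 'v multiset \<Rightarrow> 'k"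
    using PiE_mem[OF that, of 0] b0 by simp
  have p_in: "p u \<in> carrier M" if "u \<in> {..<b 0} \<rightarrow>\<^sub>E ?C" for u
    unfolding onto[symmetric] p_def using at0[OF that] by (rule imageI)
  have p_add: "p (\<lambda>l\<in>{..<b 0}. u l + v l) = p u \<oplus>\<^bsub>M\<^esub> p v"
    if "u \<in> {..<b 0} \<rightarrow>\<^sub>E ?C" "v \<in> {..<b 0} \<rightarrow>\<^sub>E ?C" for u v
    using add[OF at0[OF that(1)] at0[OF that(2)]] b0 by (simp add: p_def)
  have p_mul: "p (\<lambda>l\<in>{..<b 0}. conv r (u l)) = r \<odot>\<^bsub>M\<^esub> p u"
    if "r \<in> ?C" "u \<in> {..<b 0} \<rightarrow>\<^sub>E ?C" for r u
    using smult[OF that(1) at0[OF that(2)]] b0 by (simp add: p_def)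
  have hp: "p \<in> module_homs ?Q (free_module ?Q (b 0)) M"
    unfolding module_homs_def hom_def by (simp add: p_in p_add p_mul)
  have phi_add: "\<phi> i (\<lambda>l\<in>{..<b (Suc i)}. u l + v l) = (\<lambda>l\<in>{..<b i}. \<phi> i u l + \<phi> i v l)" for i u v
    by (simp only: \<phi>_def flat_add \<Psi>add unflat_add)
  have phi_mul: "\<phi> i (\<lambda>l\<in>{..<b (Suc i)}. conv r (u l)) = (\<lambda>l\<in>{..<b i}. conv r (\<phi> i u l))" for i r u
    by (simp only: \<phi>_def flat_mulb \<Psi>mul unflat_mulb)
  have hphi: "\<phi> i \<in> module_homs ?Q (free_module ?Q (b (Suc i))) (free_module ?Q (b i))" for i
    unfolding module_homs_def hom_def by (simp add: \<phi>C phi_add phi_mul)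
  have surj: "p ` carrier (free_module ?Q (b 0)) = carrier M"
  proof -
    have "(\<lambda>u. u 0) ` ({..<1::nat} \<rightarrow>\<^sub>E ?C) = ?C"
    proof (intro equalityI subsetI)
      fix f assume "f \<in> ?C"
      then show "f \<in> (\<lambda>u. u 0) ` ({..<1::nat} \<rightarrow>\<^sub>E ?C)" by (intro image_eqI[of _ _ "\<lambda>l\<in>{..<1}. f"]) auto
    qed auto
    then have "\<pi> ` (\<lambda>u. u 0) ` ({..<1::nat} \<rightarrow>\<^sub>E ?C) = carrier M" using onto by simp
    then show ?thesis by (simp add: p_def b0 image_image)
  qed
  have ex0: "\<phi> 0 ` carrier (free_module ?Q (b 1)) = a_kernel (free_module ?Q (b 0)) M p"
  proof -
    have "\<phi> 0 ` carrier (free_module ?Q (b 1)) = unflat (b 0) ` Z 0" using \<phi>im[of 0] by simp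
    also have "\<dots> = a_kernel (free_module ?Q (b 0)) M p"
    proof (intro equalityI subsetI)
      fix u assume "u \<in> unflat (b 0) ` Z 0"
      then obtain w where w: "w \<in> FQ c V 1" "slot 0 w \<in> I" "u = unflat 1 w" by (auto simp: Z0 Z0_def b0)
      then have "u \<in> {..<1} \<rightarrow>\<^sub>E ?C" "u 0 = slot 0 w" using unflat_carrier[OF w(1)] by (auto simp: unflat_def)
      then show "u \<in> a_kernel (free_module ?Q (b 0)) M p" using w ker[of "slot 0 w"]
        by (simp add: a_kernel_def' b0 p_def FQ_def)
    next
      fix u assume "u \<in> a_kernel (free_module ?Q (b 0)) M p"
      then have u: "u \<in> {..<1} \<rightarrow>\<^sub>E ?C" "\<pi> (u 0) = \<zero>\<^bsub>M\<^esub>" by (simp_all add: a_kernel_def' b0 p_def)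
      have "u 0 \<in> ?C" using u(1) by auto
      then have "u 0 \<in> I" using u(2) ker by simp
      then have "flat 1 u \<in> Z 0" using flat_FQ[OF u(1)] by (simp add: Z0 Z0_def slot_flat)
      then show "u \<in> unflat (b 0) ` Z 0" using unflat_flat[OF u(1)] by (intro image_eqI[of _ _ "flat 1 u"]) (simp_all add: b0)
    qed
    finally show ?thesis .
  qed
  have exS: "\<phi> (Suc i) ` carrier (free_module ?Q (b (Suc (Suc i)))) = a_kernel (free_module ?Q (b (Suc i))) (free_module ?Q (b i)) (\<phi> i)" for i
  proof -
    have "\<phi> (Suc i) ` carrier (free_module ?Q (b (Suc (Suc i)))) = unflat (b (Suc i)) ` Z (Suc i)" using \<phi>im[of "Suc i"] by simp
    also have "\<dots> = a_kernel (free_module ?Q (b (Suc i))) (free_module ?Q (b i)) (\<phi> i)"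
    proof (intro equalityI subsetI)
      fix u assume "u \<in> unflat (b (Suc i)) ` Z (Suc i)"
      then obtain w where w: "w \<in> FQ c V (b (Suc i))" "\<Psi> i w = 0" "u = unflat (b (Suc i)) w" by (auto simp: Zker)
      then show "u \<in> a_kernel (free_module ?Q (b (Suc i))) (free_module ?Q (b i)) (\<phi> i)"
        using unflat_carrier[OF w(1)] by (simp add: a_kernel_def' \<phi>_def flat_unflat[OF w(1)]) (simp add: unflat_def slot_simps)
    next
      fix u assume "u \<in> a_kernel (free_module ?Q (b (Suc i))) (free_module ?Q (b i)) (\<phi> i)"
      then have u: "u \<in> {..<b (Suc i)} \<rightarrow>\<^sub>E ?C" "\<phi> i u = (\<lambda>l\<in>{..<b i}. 0)" by (simp_all add: a_kernel_def')
      have "\<Psi> i (flat (b (Suc i)) u) = flat (b i) (\<phi> i u)" using flat_unflat[OF fF[OF u(1)]] by (simp add: \<phi>_def)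
      also have "\<dots> = 0" unfolding u(2) by (intro slot_eqI) (simp add: slot_flat slot_simps)
      finally have "flat (b (Suc i)) u \<in> Z (Suc i)" using flat_FQ[OF u(1)] by (simp add: Zker)
      then show "u \<in> unflat (b (Suc i)) ` Z (Suc i)" using unflat_flat[OF u(1)] by (intro image_eqI[of _ _ "flat (b (Suc i)) u"]) simp_all
    qed
    finally show ?thesis .
  qed
  have res: "free_resolution ?Q M b p \<phi>"
    unfolding free_resolution_def using hp hphi surj ex0 exS by blast
  have "\<phi> i ` carrier (free_module ?Q (b (Suc i))) \<subseteq> {..<b i} \<rightarrow>\<^sub>E variable_ideal c V V" for i
  proof -
    have "unflat (b i) w \<in> {..<b i} \<rightarrow>\<^sub>E variable_ideal c V V" if "w \<in> Z i" for w
      unfolding maximal_ideal_eq[OF V] using that ZF[of i] Zc[of i] by (auto simp: unflat_def const_free_def FQ_def)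
    then show ?thesis using \<phi>im[of i] by auto
  qed
  then have min: "minimal_complex ?Q (variable_ideal c V V) b \<phi>" by (simp add: minimal_complex_def)
  have gradedc: "graded_complex ?Q M b s p \<phi>" if c: "c = Polynomials"
    unfolding graded_complex_def
  proof (intro conjI allI image_subsetI)
    fix d u assume "u \<in> free_part ?Q (b 0) (s 0) d"
    then have "u 0 \<in> homogeneous_part ?Q d" by (auto simp: free_part_def b0 s0)
    then show "p u \<in> degree_part M d" using gr\<pi>[OF c] by (auto simp: p_def)
  next
    fix i d u assume "u \<in> free_part ?Q (b (Suc i)) (s (Suc i)) d"
    then have u: "u \<in> {..<b (Suc i)} \<rightarrow>\<^sub>E ?C" "gr (s (Suc i)) d (flat (b (Suc i)) u) = flat (b (Suc i)) u"
      by (simp_all add: free_part_iff)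
    have "flat (b i) (\<phi> i u) = \<Psi> i (flat (b (Suc i)) u)" using flat_unflat[OF fF[OF u(1)]] by (simp add: \<phi>_def)
    then show "\<phi> i u \<in> free_part ?Q (b i) (s i) d"
      using \<phi>C[OF u(1)] \<Psi>gr[OF c, of i d "flat (b (Suc i)) u"] u(2) by (simp add: free_part_iff)
  qed
  have "minimal_free_resolution c V M b p \<phi>"
    unfolding minimal_free_resolution_def Let_def using res min gradedc by blast
  then show ?thesis by blast
qed

text \<open>
  All minimal resolutions have the same ranks, namely the dimensions of Koszul homology. This justifies the definite
  description that defines \<open>betti\<close>.
\<close>

theorem betti_koszul:
  fixes M :: "('v multiset \<Rightarrow> 'k::field, 'b) graded_module"
  assumes vs: "distinct vs" "set vs = V" and P: "presents c V I \<pi> M" and I0: "\<forall>f\<in>I. f {#} = 0"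
    and grI: "c = Polynomials \<Longrightarrow> \<forall>f\<in>I. \<forall>d. hcomp d f \<in> I"
    and gr\<pi>: "c = Polynomials \<Longrightarrow> \<forall>d. \<pi> ` homogeneous_part (series_ring c V) d \<subseteq> degree_part M d"
  shows "koszul_dim c vs V I j (betti c V M j)"
    and "minimal_free_resolution c V M b p \<phi> \<Longrightarrow> b j = betti c V M j"
proof -
  have V: "finite V" using vs by auto
  have I: "ideal I (series_ring c V)" using P by (simp add: presents_def)
  have mres: "koszul_dim c vs V I j (b j)"
    if "minimal_free_resolution c V M b p \<phi>" for b p \<phi>
    using that presented_betti_koszul[OF vs P I0] by (auto simp: minimal_free_resolution_def Let_def)
  have kb: "ksub (sh.relbnd vs (series_carrier c V) I j)"
    by (rule sh.ksub_relbnd[OF vsub_carrier ideal_vsub[OF I]])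
  have "\<exists>b p \<phi>. minimal_free_resolution c V M b p \<phi>"
    by (rule minimal_resolution_exists[OF V P I0]) (use grI gr\<pi> in auto)
  then obtain b p \<phi> where res: "minimal_free_resolution c V M b p \<phi>" by (elim exE)
  have eq: "r = b j" if "\<exists>b p \<phi>. minimal_free_resolution c V M b p \<phi> \<and> b j = r" for r
    using that qdim_unique[OF kb mres mres[OF res]] by blast
  have "betti c V M j = b j" unfolding betti_def
    by (rule the_equality) (use res eq in blast)+
  with mres[OF res] show "koszul_dim c vs V I j (betti c V M j)" by simp
  with qdim_unique[OF kb mres] show "b j = betti c V M j" if "minimal_free_resolution c V M b p \<phi>" for b p \<phi> using that by blast
qed

section \<open>Variables that act as zero\<close>

lemma kill_simps: "kill_outside U (f + g) = kill_outside U f + kill_outside U g"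
  "kill_outside U (f - g) = kill_outside U f - kill_outside U g" "kill_outside U (- f) = - kill_outside U f"
  "kill_outside U (fsc c f) = fsc c (kill_outside U f)" "kill_outside U 0 = 0"
  "kill_outside U (kill_outside W f) = kill_outside (U \<inter> W) f" "kill_outside U f {#} = f {#}"
  by (auto simp: kill_outside_def fun_eq_iff pointwise fsc_apply)

lemma kill_shift: "kill_outside U (shift v f) = (if v \<in> U then shift v (kill_outside U f) else 0)"
  by (auto simp: kill_outside_def shift_def fun_eq_iff pointwise dest: in_diffD) (metis insert_DiffM insert_subset set_mset_add_mset_insert)

lemma kill_carrier: "f \<in> series_carrier c V \<Longrightarrow> kill_outside U f \<in> series_carrier c (U \<inter> V)"
proof (rule carrierI)
  assume f: "f \<in> series_carrier c V"
  show "set_mset e \<subseteq> U \<inter> V" if "kill_outside U f e \<noteq> 0" for e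
    using that carrierD(1)[OF f, of e] by (auto simp: kill_outside_def split: if_splits)
  show "finite {e. kill_outside U f e \<noteq> 0}" if "c = Polynomials"
    by (rule finite_subset[OF _ carrierD(2)[OF f that]]) (auto simp: kill_outside_def split: if_splits)
qed

lemma kill_id: "f \<in> series_carrier c U \<Longrightarrow> kill_outside U f = f"
  using carrierD(1)[of f c U] by (auto simp: kill_outside_def fun_eq_iff)

definition killc :: "'v set \<Rightarrow> ('s \<Rightarrow> 'v multiset \<Rightarrow> 'k::field) \<Rightarrow> 's \<Rightarrow> 'v multiset \<Rightarrow> 'k" where
  "killc U z = (\<lambda>\<sigma>. kill_outside U (z \<sigma>))"

lemma killc_simps: "killc U (z + w) = killc U z + killc U w" "killc U (z - w) = killc U z - killc U w"
  "killc U (csc c z) = csc c (killc U z)"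
  by (auto simp: killc_def chain_eq_iff plus_fun_apply[of z w] minus_apply[of z w] csc_fsc kill_simps)
     (simp_all add: plus_fun_apply minus_apply csc_fsc)

lemma kd_killc: "set vs \<subseteq> U \<Longrightarrow> kill_outside U (kd shift vs z \<tau>) = kd shift vs (killc U z) \<tau>"
  by (induction vs arbitrary: z \<tau>) (auto simp: kill_simps kill_shift killc_def)

lemma chains_map:
  assumes z: "z \<in> chains vs D j" and h: "\<And>f. f \<in> D \<Longrightarrow> h f \<in> E" "h 0 = 0"
  shows "(\<lambda>\<sigma>. h (z \<sigma>)) \<in> chains vs E j"
proof (rule chainsI)
  show "h (z \<sigma>) \<in> E" for \<sigma> using h(1) chainsD(1)[OF z] .
  show "\<sigma> \<subseteq> set vs \<and> card \<sigma> = j" if "h (z \<sigma>) \<noteq> 0" for \<sigma>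
  proof -
    have "z \<sigma> \<noteq> 0" using that h(2) by metis
    then show ?thesis using chains_nonzero[OF z] by blast
  qed
qed

lemma killc_chains:
  assumes "z \<in> chains vs (series_carrier c V) j" "U \<subseteq> V"
  shows "killc U z \<in> chains vs (series_carrier c U) j"
  unfolding killc_def
proof (rule chains_map[OF assms(1)])
  show "kill_outside U f \<in> series_carrier c U" if "f \<in> series_carrier c V" for f
    using kill_carrier[OF that, of U] assms(2) by (simp add: Int_absorb2)
qed (rule kill_simps)

text \<open>
  The preimage of \<open>I\<close> under the substitution of \<open>0\<close> for the variables outside \<open>U\<close>. Its quotient is that of
  the ring on \<open>U\<close> by \<open>I\<close>, with the other variables acting as zero.
\<close>

definition pullback :: "ring_kind \<Rightarrow> 'v set \<Rightarrow> 'v set \<Rightarrow> ('v multiset \<Rightarrow> 'k::field) set \<Rightarrow> ('v multiset \<Rightarrow> 'k) set" where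
  "pullback c V U I = {f \<in> series_carrier c V. kill_outside U f \<in> I}"

lemma pullback_vsub: "vsub I \<Longrightarrow> vsub (pullback c V U I)"
  unfolding pullback_def
  by (rule vsubI) (auto simp: kill_simps vsub_0 vsub_add vsub_fsc vsub_0[OF vsub_carrier] vsub_add[OF vsub_carrier] vsub_fsc[OF vsub_carrier])

lemma pullback_sub: "pullback c V U I \<subseteq> series_carrier c V"
  by (auto simp: pullback_def)

lemma pullback_opsub:
  assumes "vsub I" "\<And>v f. v \<in> U \<Longrightarrow> f \<in> I \<Longrightarrow> shift v f \<in> I" "set vs \<subseteq> V"
  shows "sh.opsub vs (pullback c V U I)"
  using assms pullback_vsub[OF assms(1)]
  by (auto simp: sh.opsub_def pullback_def kill_shift shift_carrier vsub_0)

lemma part_simps: "part0 v (z + w) = part0 v z + part0 v w" "part1 v (z + w) = part1 v z + part1 v w"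
  "part0 v (csc c z) = csc c (part0 v z)" "part1 v (csc c z) = csc c (part1 v z)"
  by (auto simp: part0_def part1_def chain_eq_iff plus_fun_apply csc_fsc fsc_simps)

\<comment> \<open>From here on the differential on \<open>v # vs\<close> is computed by \<open>kd_join\<close>.\<close>
declare kd.simps(2) [simp del]

text \<open>
  A variable \<open>v\<close> that annihilates \<open>Q/I\<close> makes the mapping cone split: a chain on \<open>v # vs\<close> is a relative cycle or
  boundary if and only if both of its halves are so after setting \<open>v = 0\<close>. Hence the homology in degree \<open>i + 1\<close> is the sum of
  the homologies on \<open>vs\<close> in degrees \<open>i + 1\<close> and \<open>i\<close>.
\<close>

theorem add_variable:
  fixes I :: "('v multiset \<Rightarrow> 'k::field) set"
  assumes d: "distinct (v # vs)" and V: "set vs = V" and I: "vsub I" "I \<subseteq> series_carrier c V"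
    and sI: "\<And>u f. u \<in> V \<Longrightarrow> f \<in> I \<Longrightarrow> shift u f \<in> I"
    and a: "koszul_dim c vs V I (Suc i) a"
    and b: "koszul_dim c vs V I i b"
  defines "J \<equiv> pullback c (insert v V) V I"
  shows "koszul_dim c (v # vs) (insert v V) J (Suc i) (a + b)"
proof -
  let ?D = "series_carrier c V :: ('v multiset \<Rightarrow> 'k) set" and ?E = "series_carrier c (insert v V) :: ('v multiset \<Rightarrow> 'k) set"
  have v: "v \<notin> set vs" "distinct vs" "v \<notin> V" using d V by auto
  have DE: "?D \<subseteq> ?E" by (rule carrier_mono) auto
  have vJ: "vsub J" unfolding J_def by (rule pullback_vsub[OF I(1)])
  have JE: "J \<subseteq> ?E" unfolding J_def by (rule pullback_sub)
  have IJ: "I \<subseteq> J" using I(2) DE by (auto simp: J_def pullback_def kill_id[of _ c V])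
  have Iop: "sh.opsub vs I" using I(1) sI V by (simp add: sh.opsub_def)
  have Jop: "sh.opsub (v # vs) J" unfolding J_def using V by (intro pullback_opsub[OF I(1) sI]) auto
  have E0: "0 \<in> ?E" by (rule vsub_0[OF vsub_carrier])
  have Eop: "sh.opsub (v # vs) ?E" "sh.opsub vs ?E" using V by (auto intro!: opsub_carrier)
  have kE: "killc V z \<in> chains vs ?D j" if "z \<in> chains vs ?E j" for z j
    by (rule killc_chains[OF that]) auto
  have kk: "kill_outside V (kd shift vs z \<tau>) = kd shift vs (killc V z) \<tau>" for z \<tau> using V by (intro kd_killc) simp
  have sE: "(\<lambda>\<tau>. shift v (z \<tau>)) \<in> chains vs ?E j" if "z \<in> chains vs ?E j" for z j
    by (rule chains_map[OF that]) (auto simp: sh.m_0 intro!: shift_carrier)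
  have kkc: "killc V (kd shift vs z) = kd shift vs (killc V z)" for z by (auto simp: killc_def[of V "kd shift vs z"] kk)
  have ks: "killc V (\<lambda>\<tau>. shift v (z \<tau>)) = 0" for z :: "'v set \<Rightarrow> 'v multiset \<Rightarrow> 'k"
    using v by (simp add: killc_def kill_shift zero_fun_def)
  note kc = ksub_chains[OF vsub_carrier]
  have cyc: "join v x y \<in> sh.relcyc (v # vs) ?E J (Suc i) \<longleftrightarrow>
      killc V x \<in> sh.relcyc vs ?D I (Suc i) \<and> killc V y \<in> sh.relcyc vs ?D I i"
    if x: "x \<in> chains vs ?E (Suc i)" and y: "y \<in> chains vs ?E i" for x y
  proof -
    have x1: "kd shift vs x \<tau> + shift v (y \<tau>) \<in> J \<longleftrightarrow> kd shift vs (killc V x) \<tau> \<in> I" for \<tau>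
    proof -
      have "kd shift vs x \<tau> + shift v (y \<tau>) \<in> ?E"
        using sh.kd_in[OF Eop(2) chainsD(1)[OF x]] chainsD(1)[OF y] by (intro vsub_add[OF vsub_carrier] shift_carrier) auto
      then show ?thesis using v by (simp add: J_def pullback_def kill_simps kill_shift kk)
    qed
    have y1: "kd shift vs y \<tau> \<in> J \<longleftrightarrow> kd shift vs (killc V y) \<tau> \<in> I" for \<tau>
      using sh.kd_in[OF Eop(2) chainsD(1)[OF y]] by (simp add: J_def pullback_def kk)
    have sx: "kd shift vs (killc V x) \<tau> = 0" if "v \<in> \<tau>" for \<tau>
      using sh.kd_support[OF v(2) kE[OF x], of \<tau>] that v by auto
    have "join v x y \<in> sh.relcyc (v # vs) ?E J (Suc i) \<longleftrightarrow>
        (\<forall>\<tau>. join v (kd shift vs x + (\<lambda>\<tau>. shift v (y \<tau>))) (- kd shift vs y) \<tau> \<in> J)"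
      using join_chains[OF v(1) x y] by (simp add: sh.relcyc_def sh.kd_join[OF d])
    also have "\<dots> \<longleftrightarrow> (\<forall>\<tau>. v \<notin> \<tau> \<longrightarrow> kd shift vs (killc V x) \<tau> \<in> I) \<and> (\<forall>\<tau>. v \<in> \<tau> \<longrightarrow> kd shift vs (killc V y) (\<tau> - {v}) \<in> I)"
      by (auto simp: join_def plus_fun_apply uminus_apply vsub_neg_iff[OF vJ] x1 y1)
    also have "(\<forall>\<tau>. v \<notin> \<tau> \<longrightarrow> kd shift vs (killc V x) \<tau> \<in> I) \<longleftrightarrow> (\<forall>\<tau>. kd shift vs (killc V x) \<tau> \<in> I)"
      using sx vsub_0[OF I(1)] by metis
    also have "(\<forall>\<tau>. v \<in> \<tau> \<longrightarrow> kd shift vs (killc V y) (\<tau> - {v}) \<in> I) \<longleftrightarrow> (\<forall>\<tau>. kd shift vs (killc V y) \<tau> \<in> I)" (is "?A \<longleftrightarrow> ?B")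
    proof
      assume A: ?A
      show ?B
      proof
        fix \<tau> show "kd shift vs (killc V y) \<tau> \<in> I"
        proof (cases "v \<in> \<tau>")
          case True
          have "kd shift vs (killc V y) \<tau> = 0"
          proof (rule ccontr)
            assume "kd shift vs (killc V y) \<tau> \<noteq> 0"
            then obtain u where "killc V y (insert u \<tau>) \<noteq> 0" using sh.kd_nonzero[OF v(2)] by blast
            then have "insert u \<tau> \<subseteq> set vs" using chains_nonzero(1)[OF kE[OF y]] by blast
            with True v show False by auto
          qed
          then show ?thesis using vsub_0[OF I(1)] by simp
        next
          case False
          then have "insert v \<tau> - {v} = \<tau>" by auto
          with A show ?thesis by (metis insertI1)
        qed
      qed
    qed auto
    finally show ?thesis using kE[OF x] kE[OF y] by (simp add: sh.relcyc_def)
  qed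
  have bnd: "join v x y \<in> sh.relbnd (v # vs) ?E J (Suc i) \<longleftrightarrow>
      killc V x \<in> sh.relbnd vs ?D I (Suc i) \<and> killc V y \<in> sh.relbnd vs ?D I i"
    if x: "x \<in> chains vs ?E (Suc i)" and y: "y \<in> chains vs ?E i" for x y
  proof
    assume "join v x y \<in> sh.relbnd (v # vs) ?E J (Suc i)"
    then obtain u w where uw: "u \<in> chains (v # vs) J (Suc i)" "w \<in> chains (v # vs) ?E (Suc (Suc i))"
      "join v x y = u + kd shift (v # vs) w" by (auto simp: sh.relbnd_def)
    have J0: "0 \<in> J" using vsub_0[OF vJ] .
    define w0 where "w0 = part0 v w"
    define w1 where "w1 = part1 v w"
    have w: "w0 \<in> chains vs ?E (Suc (Suc i))" "w1 \<in> chains vs ?E (Suc i)" "w = join v w0 w1"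
      using part0_chains[OF E0 uw(2)] part1_chains[OF E0 uw(2)] by (simp_all add: w0_def w1_def join_parts)
    have u: "part0 v u \<in> chains vs J (Suc i)" "part1 v u \<in> chains vs J i"
      using part0_chains[OF J0 uw(1)] part1_chains[OF J0 uw(1)] by simp_all
    have kw: "kd shift (v # vs) w = join v (kd shift vs w0 + (\<lambda>\<tau>. shift v (w1 \<tau>))) (- kd shift vs w1)"
      unfolding w(3) by (rule sh.kd_join[OF d])
    have c0: "kd shift vs w0 + (\<lambda>\<tau>. shift v (w1 \<tau>)) \<in> chains vs ?E (Suc i)"
      by (intro ksub_add[OF kc] sh.kd_chains[OF v(2) Eop(2) w(1)] sE[OF w(2)])
    have c1: "- kd shift vs w1 \<in> chains vs ?E i" by (intro ksub_neg[OF kc] sh.kd_chains[OF v(2) Eop(2) w(2)])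
    have "x = part0 v u + (kd shift vs w0 + (\<lambda>\<tau>. shift v (w1 \<tau>)))" "y = part1 v u + (- kd shift vs w1)"
      using part_join[OF v(1) x y] part_join[OF v(1) c0 c1] unfolding uw(3) kw part_simps by simp_all
    then have kx: "killc V x = killc V (part0 v u) + kd shift vs (killc V w0)"
      and ky: "killc V y = killc V (part1 v u) + kd shift vs (- killc V w1)"
      by (simp_all add: killc_simps kkc ks sh.kd_neg)
    have kJ: "killc V z \<in> chains vs I j" if z: "z \<in> chains vs J j" for z j
      unfolding killc_def by (rule chains_map[OF z]) (auto simp: J_def pullback_def kill_simps)
    show "killc V x \<in> sh.relbnd vs ?D I (Suc i) \<and> killc V y \<in> sh.relbnd vs ?D I i"
      unfolding kx ky by (intro conjI sh.relbndI kJ u kE w ksub_neg[OF kc])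
  next
    assume "killc V x \<in> sh.relbnd vs ?D I (Suc i) \<and> killc V y \<in> sh.relbnd vs ?D I i"
    then obtain i0 a' i1 b' where *: "i0 \<in> chains vs I (Suc i)" "a' \<in> chains vs ?D (Suc (Suc i))" "killc V x = i0 + kd shift vs a'"
      "i1 \<in> chains vs I i" "b' \<in> chains vs ?D (Suc i)" "killc V y = i1 + kd shift vs b'" by (auto simp: sh.relbnd_def)
    have aE: "a' \<in> chains vs ?E (Suc (Suc i))" "b' \<in> chains vs ?E (Suc i)" using * chains_mono[OF DE] by blast+
    have kaa: "killc V a' = a'" "killc V b' = b'"
      using kill_id[OF chainsD(1)[OF *(2)]] kill_id[OF chainsD(1)[OF *(5)]] by (auto simp: killc_def)
    define w where "w = join v a' (- b')"
    have w: "w \<in> chains (v # vs) ?E (Suc (Suc i))" unfolding w_def by (intro join_chains[OF v(1)] aE ksub_neg[OF kc])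
    define p where "p = x - kd shift vs a' + (\<lambda>\<tau>. shift v (b' \<tau>))"
    define q where "q = y - kd shift vs b'"
    have p: "p \<in> chains vs ?E (Suc i)" unfolding p_def
      by (intro ksub_add[OF kc] ksub_diff[OF kc] x sE aE sh.kd_chains[OF v(2) Eop(2)])
    have q: "q \<in> chains vs ?E i" unfolding q_def by (intro ksub_diff[OF kc] y aE sh.kd_chains[OF v(2) Eop(2)])
    have "killc V p = i0" "killc V q = i1" unfolding p_def q_def by (simp_all add: killc_simps kkc ks kaa *)
    then have "kill_outside V (p \<sigma>) \<in> I" "kill_outside V (q \<sigma>) \<in> I" for \<sigma>
      using chainsD(1)[OF *(1), of \<sigma>] chainsD(1)[OF *(4), of \<sigma>] by (auto simp: killc_def)
    then have pJ: "p \<in> chains vs J (Suc i)" "q \<in> chains vs J i"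
      using p q by (auto simp: chains_def J_def pullback_def)
    have "kd shift (v # vs) w = join v (kd shift vs a' + (\<lambda>\<tau>. shift v ((- b') \<tau>))) (- kd shift vs (- b'))"
      unfolding w_def by (rule sh.kd_join[OF d])
    then have "join v x y = join v p q + kd shift (v # vs) w"
      by (simp add: p_def q_def join_def chain_eq_iff plus_fun_apply minus_apply uminus_apply sh.kd_neg sh.m_neg)
    then show "join v x y \<in> sh.relbnd (v # vs) ?E J (Suc i)"
      using sh.relbndI[OF join_chains[OF v(1) pJ] w] by simp
  qed
  let ?P = "sh.relcyc (v # vs) ?E J (Suc i)" and ?N = "sh.relbnd (v # vs) ?E J (Suc i)"
  have parts: "part0 v z \<in> chains vs ?E (Suc i)" "part1 v z \<in> chains vs ?E i" if "z \<in> ?P" for z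
    using that part0_chains[OF E0, of z v vs "Suc i"] part1_chains[OF E0, of z v vs i] by (auto simp: sh.relcyc_def)
  have cyc': "killc V (part0 v z) \<in> sh.relcyc vs ?D I (Suc i)" "killc V (part1 v z) \<in> sh.relcyc vs ?D I i" if "z \<in> ?P" for z
    using cyc[OF parts[OF that]] that by (simp_all add: join_parts)
  have bnd': "z \<in> ?N \<longleftrightarrow> killc V (part0 v z) \<in> sh.relbnd vs ?D I (Suc i) \<and> killc V (part1 v z) \<in> sh.relbnd vs ?D I i" if "z \<in> ?P" for z
    using bnd[OF parts[OF that]] by (simp add: join_parts)
  have kP: "ksub ?P" by (rule sh.ksub_relcyc[OF vsub_carrier vJ])
  have kN: "ksub ?N" by (rule sh.ksub_relbnd[OF vsub_carrier vJ])
  have NP: "?N \<subseteq> ?P" by (rule sh.relbnd_sub_relcyc[OF d Eop(1) Jop JE])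
  have kn: "ksub (sh.relbnd vs ?D I j)" for j by (rule sh.ksub_relbnd[OF vsub_carrier I(1)])
  have lin0: "klin A (\<lambda>z. killc V (part0 v z))" and lin1: "klin A (\<lambda>z. killc V (part1 v z))" for A :: "('v set \<Rightarrow> 'v multiset \<Rightarrow> 'k) set"
    by (simp_all add: klin_def part_simps killc_simps)
  have c0: "0 \<in> chains vs ?E j" for j using ksub_0[OF kc] .
  have k0: "killc V (0 :: 'v set \<Rightarrow> 'v multiset \<Rightarrow> 'k) = 0" by (simp add: killc_def chain_eq_iff zero_chain_apply kill_simps)
  have r0: "0 \<in> sh.relcyc vs ?D I j" for j using ksub_0[OF sh.ksub_relcyc[OF vsub_carrier I(1)]] .
  have lift: "x \<in> chains vs ?E j" "killc V x = x" if "x \<in> sh.relcyc vs ?D I j" for x j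
  proof -
    have x: "x \<in> chains vs ?D j" using that by (simp add: sh.relcyc_def)
    then show "x \<in> chains vs ?E j" using chains_mono[OF DE] by blast
    show "killc V x = x" using kill_id[OF chainsD(1)[OF x]] by (auto simp: killc_def)
  qed
  \<comment> \<open>The chains whose lower half is a boundary: dividing \<open>?P\<close> by them leaves the lower halves, and they leave the upper halves.\<close>
  define X0 where "X0 = {z \<in> ?P. killc V (part0 v z) \<in> sh.relbnd vs ?D I (Suc i)}"
  have X0: "ksub X0" "X0 \<subseteq> ?P" "?N \<subseteq> X0"
  proof -
    show "ksub X0" unfolding X0_def using kP kn[of "Suc i"] by (auto simp: ksub_def part_simps killc_simps)
      (metis csc_simps(6) killc_simps(3) part_simps(3))
    show "X0 \<subseteq> ?P" "?N \<subseteq> X0" using NP bnd' by (auto simp: X0_def)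
  qed
  have "qdim ?P X0 a"
  proof (subst qdim_image[OF lin0 kP kn[of "Suc i"]])
    show "(\<lambda>z. killc V (part0 v z)) ` ?P = sh.relcyc vs ?D I (Suc i)"
    proof
      show "(\<lambda>z. killc V (part0 v z)) ` ?P \<subseteq> sh.relcyc vs ?D I (Suc i)" using cyc' by blast
      show "sh.relcyc vs ?D I (Suc i) \<subseteq> (\<lambda>z. killc V (part0 v z)) ` ?P"
      proof
        fix x assume x: "x \<in> sh.relcyc vs ?D I (Suc i)"
        have "join v x 0 \<in> ?P" using cyc[OF lift(1)[OF x] c0] lift(2)[OF x] x r0 k0 by simp
        moreover have "killc V (part0 v (join v x 0)) = x" using part_join(1)[OF v(1) lift(1)[OF x] c0] lift(2)[OF x] by simp
        ultimately show "x \<in> (\<lambda>z. killc V (part0 v z)) ` ?P" by (metis image_eqI)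
      qed
    qed
    show "qdim (sh.relcyc vs ?D I (Suc i)) (sh.relbnd vs ?D I (Suc i)) a" by (rule a)
  qed (auto simp: X0_def)
  moreover have "qdim X0 ?N b"
  proof (subst qdim_image[OF lin1 X0(1) kn[of i]])
    show "(\<lambda>z. killc V (part1 v z)) ` X0 = sh.relcyc vs ?D I i"
    proof
      show "(\<lambda>z. killc V (part1 v z)) ` X0 \<subseteq> sh.relcyc vs ?D I i" using cyc' by (auto simp: X0_def)
      show "sh.relcyc vs ?D I i \<subseteq> (\<lambda>z. killc V (part1 v z)) ` X0"
      proof
        fix y assume y: "y \<in> sh.relcyc vs ?D I i"
        have "join v 0 y \<in> ?P" using cyc[OF c0 lift(1)[OF y]] lift(2)[OF y] y r0 k0 by simp
        moreover have "part0 v (join v 0 y) = 0" "killc V (part1 v (join v 0 y)) = y"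
          using part_join[OF v(1) c0 lift(1)[OF y]] lift(2)[OF y] by simp_all
        ultimately have "join v 0 y \<in> X0" using ksub_0[OF kn[of "Suc i"]] k0 by (simp add: X0_def)
        then show "y \<in> (\<lambda>z. killc V (part1 v z)) ` X0" using \<open>killc V (part1 v (join v 0 y)) = y\<close> by (metis image_eqI)
      qed
    qed
    show "qdim (sh.relcyc vs ?D I i) (sh.relbnd vs ?D I i) b" by (rule b)
    show "u \<in> ?N \<longleftrightarrow> killc V (part1 v u) \<in> sh.relbnd vs ?D I i" if "u \<in> X0" for u
      using that bnd' by (auto simp: X0_def)
  qed
  ultimately show ?thesis by (rule qdim_trans[OF kN X0(1) X0(3) X0(2)])
qed

section \<open>Koszul homology of a fiber product\<close>

lemma shift_at_variable: "shift v f {#u#} = (if u = v then f {#} else 0)"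
  by (simp add: shift_def)

lemma chains_restrict:
  assumes z: "z \<in> chains vs D j" and D: "0 \<in> D"
  shows "(\<lambda>\<sigma>. if Q \<sigma> then z \<sigma> else 0) \<in> chains vs D j"
proof (rule chainsI)
  show "(if Q \<sigma> then z \<sigma> else 0) \<in> D" for \<sigma> using chainsD(1)[OF z] D by simp
  show "\<sigma> \<subseteq> set vs \<and> card \<sigma> = j" if "(if Q \<sigma> then z \<sigma> else 0) \<noteq> 0" for \<sigma>
    using that chains_nonzero[OF z, of \<sigma>] by (simp split: if_splits)
qed

lemma kd_at_variable_0: "v \<notin> set vs \<Longrightarrow> kd shift vs z \<tau> {#v#} = 0"
  by (induction vs arbitrary: z \<tau>) (auto simp: kd.simps zero_fun_apply uminus_apply plus_fun_apply shift_at_variable)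

text \<open>
  The coefficient of the variable \<open>v\<close> in the entry of \<open>d z\<close> at \<open>\<tau>\<close> comes from one entry of \<open>z\<close> only, where it is the constant term
  up to a sign.
\<close>

lemma kd_at_variable:
  assumes "distinct vs" "v \<in> set vs" "v \<notin> \<tau>"
  shows "kd shift vs z \<tau> {#v#} = 0 \<longleftrightarrow> z (insert v \<tau>) {#} = 0"
  using assms
proof (induction vs arbitrary: z \<tau>)
  case (Cons u us)
  show ?case
  proof (cases "u \<in> \<tau>")
    case True
    then have "v \<in> set us" "insert u (insert v (\<tau> - {u})) = insert v \<tau>" using Cons.prems by auto
    then show ?thesis using True Cons.prems Cons.IH[of "\<tau> - {u}" "\<lambda>\<rho>. z (insert u \<rho>)"] by (simp add: kd.simps uminus_apply)
  next
    case False
    show ?thesis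
    proof (cases "u = v")
      case True
      then show ?thesis using False Cons.prems kd_at_variable_0[of v us z \<tau>] by (simp add: kd.simps plus_fun_apply shift_at_variable)
    next
      case neq: False
      then show ?thesis using False Cons.prems Cons.IH[of \<tau> z] by (simp add: kd.simps plus_fun_apply shift_at_variable)
    qed
  qed
qed simp

text \<open>
  The differential of a chain supported on sets disjoint from \<open>U\<close> has entries in the ideal of the remaining
  variables.
\<close>

lemma kill_kd_supported:
  assumes "\<And>\<sigma>. z \<sigma> \<noteq> 0 \<Longrightarrow> \<sigma> \<inter> U = {}"
  shows "kill_outside U (kd shift vs z \<tau>) = 0"
  using assms
proof (induction vs arbitrary: z \<tau>)
  case (Cons u us)
  have "kill_outside U (kd shift us (\<lambda>\<rho>. z (insert u \<rho>)) \<rho>) = 0" for \<rho>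
    using Cons.prems by (intro Cons.IH) blast
  moreover have "kill_outside U (kd shift us z \<rho>) = 0" for \<rho> using Cons.prems by (rule Cons.IH)
  moreover have "kill_outside U (shift u (z (insert u \<tau>))) = 0"
  proof (cases "u \<in> U")
    case True
    then have "z (insert u \<tau>) = 0" using Cons.prems[of "insert u \<tau>"] by auto
    then show ?thesis by (simp add: sh.m_0 kill_simps)
  qed (simp add: kill_shift)
  ultimately show ?case by (simp add: kd.simps kill_simps)
qed (simp add: kill_simps)

text \<open>
  One factor of the fiber product: \<open>IS\<close> is the ideal of \<open>R\<close> whose quotient is the factor, \<open>PS/NS\<close> its Koszul homology, and
  \<open>K0\<close> consists of the chains without constant terms.
\<close>

locale factor =
  fixes c :: ring_kind and U W V :: "'v set" and I :: "('v multiset \<Rightarrow> 'k::field) set" and vs :: "'v list"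
  assumes vs: "distinct vs" "set vs = V" and V: "V = U \<union> W" and disj: "U \<inter> W = {}"
    and I: "vsub I" and sI: "\<And>u f. u \<in> U \<Longrightarrow> f \<in> I \<Longrightarrow> shift u f \<in> I"
    and order: "\<And>f e. f \<in> I \<Longrightarrow> f e \<noteq> 0 \<Longrightarrow> 2 \<le> size e"
begin

abbreviation D :: "('v multiset \<Rightarrow> 'k) set" where "D \<equiv> series_carrier c V"
abbreviation IS :: "('v multiset \<Rightarrow> 'k) set" where "IS \<equiv> pullback c V U I"
abbreviation "PS \<equiv> sh.relcyc vs D IS"
abbreviation "NS \<equiv> sh.relbnd vs D IS"

definition K0 :: "nat \<Rightarrow> ('v set \<Rightarrow> 'v multiset \<Rightarrow> 'k) set" where
  "K0 j = {z \<in> chains vs D j. \<forall>\<sigma>. z \<sigma> {#} = 0}"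

lemma Dop: "sh.opsub vs D" using vs by (simp add: opsub_carrier)
lemma vS: "vsub IS" by (rule pullback_vsub[OF I])
lemma Sop: "sh.opsub vs IS" using vs by (intro pullback_opsub[OF I sI]) auto
lemma SD: "IS \<subseteq> D" by (rule pullback_sub)
lemma ksubs: "ksub (PS j)" "ksub (NS j)" "NS j \<subseteq> PS j"
  using sh.ksub_relcyc[OF vsub_carrier vS] sh.ksub_relbnd[OF vsub_carrier vS] sh.relbnd_sub_relcyc[OF vs(1) Dop Sop SD] by auto

lemma kc: "ksub (chains vs D j)" by (rule ksub_chains[OF vsub_carrier])

lemma const_0: "f \<in> IS \<Longrightarrow> f {#} = 0"
  using order[of "kill_outside U f" "{#}"] by (auto simp: pullback_def kill_simps)

lemma K0_sub: "ksub (K0 j)"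
  using kc[of j] by (auto simp: K0_def ksub_def plus_fun_apply zero_fun_apply csc_apply)

lemma kd_K0: "z \<in> chains vs D (Suc j) \<Longrightarrow> kd shift vs z \<in> K0 j"
proof -
  assume z: "z \<in> chains vs D (Suc j)"
  have "kd shift vs z \<tau> {#} = 0" for \<tau>
    using chainsD(1)[OF z] by (induction vs arbitrary: z \<tau>) (auto simp: kd.simps zero_fun_apply uminus_apply plus_fun_apply shift_def)
  then show ?thesis using sh.kd_chains[OF vs(1) Dop z] by (simp add: K0_def)
qed

lemma chains_IS: "z \<in> chains vs IS j \<Longrightarrow> z \<in> K0 j"
  using chains_mono[OF SD, of vs j] const_0 chainsD(1)[of z vs IS j] by (auto simp: K0_def)

lemma chains_IS_NS: "z \<in> chains vs IS j \<Longrightarrow> z \<in> NS j"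
  using sh.relbndI[of z vs IS j 0 D] ksub_0[OF kc] by (simp add: sh.kd_zero)

lemma kd_NS: "w \<in> chains vs D (Suc j) \<Longrightarrow> kd shift vs w \<in> NS j"
  using sh.relbndI[of 0 vs IS j w D] ksub_0[OF ksub_chains[OF vS, of vs j]] by simp

lemma NS_K0: "NS j \<subseteq> K0 j"
proof
  fix z assume "z \<in> NS j"
  then obtain u w where "u \<in> chains vs IS j" "w \<in> chains vs D (Suc j)" "z = u + kd shift vs w" by (auto simp: sh.relbnd_def)
  then show "z \<in> K0 j" using chains_IS kd_K0 ksub_add[OF K0_sub] by blast
qed

text \<open>
  A constant term of \<open>z\<close> at a set containing \<open>v \<in> U\<close> would put a term of degree one into \<open>d z\<close>, whose entries have
  none after killing the variables outside \<open>U\<close>.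
\<close>

lemma PS_const:
  assumes z: "z \<in> PS j" and \<sigma>: "\<sigma> \<inter> U \<noteq> {}"
  shows "z \<sigma> {#} = 0"
proof (cases "\<sigma> \<subseteq> V")
  case True
  obtain v where v: "v \<in> \<sigma>" "v \<in> U" using \<sigma> by blast
  then have "insert v (\<sigma> - {v}) = \<sigma>" by blast
  moreover have "kd shift vs z (\<sigma> - {v}) \<in> IS" using z by (simp add: sh.relcyc_def)
  then have "kill_outside U (kd shift vs z (\<sigma> - {v})) \<in> I" by (simp add: pullback_def)
  from order[OF this, of "{#v#}"] v have "kd shift vs z (\<sigma> - {v}) {#v#} = 0" by (auto simp: kill_outside_def)
  ultimately show ?thesis using kd_at_variable[OF vs(1), of v "\<sigma> - {v}" z] v True vs V by auto
next
  case False
  have "z \<in> chains vs D j" using z by (simp add: sh.relcyc_def)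
  then have "z \<sigma> = 0" using chainsD(2) False vs by metis
  then show ?thesis by (simp add: zero_fun_apply)
qed

lemma supported_PS:
  assumes z: "z \<in> chains vs D j" and supp: "\<And>\<sigma>. z \<sigma> \<noteq> 0 \<Longrightarrow> \<sigma> \<inter> U = {}"
  shows "z \<in> PS j"
  using z sh.kd_in[OF Dop chainsD(1)[OF z]] kill_kd_supported[of z U vs, OF supp] vsub_0[OF I]
  by (simp add: sh.relcyc_def pullback_def)

text \<open>
  With \<open>kill_other_IS\<close>, applied to both factors, this splits a series without constant term into a part in each of the two ideals.
\<close>

lemma minus_kill_IS: "f \<in> D \<Longrightarrow> f - kill_outside U f \<in> IS"
  using vsub_diff[OF vsub_carrier, of f c V "kill_outside U f"] kill_carrier[of f c V U] carrier_mono[of "U \<inter> V" V c] vsub_0[OF I]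
  by (auto simp: pullback_def kill_simps)

lemma kill_other_IS:
  assumes f: "f \<in> D" "f {#} = 0"
  shows "kill_outside W f \<in> IS"
proof -
  have "kill_outside U (kill_outside W f) = 0"
    using f disj by (auto simp: kill_outside_def fun_eq_iff zero_fun_apply) (metis Int_greatest set_mset_eq_empty_iff subset_empty)
  moreover have "kill_outside W f \<in> D" using kill_carrier[OF f(1), of W] carrier_mono[of "W \<inter> V" V c] by auto
  ultimately show ?thesis using vsub_0[OF I] by (simp add: pullback_def)
qed

text \<open>
  The constant terms of relative cycles are exactly those at the sets of variables outside \<open>U\<close>, where the unit chains are
  relative cycles.
\<close>

lemma qdim_PS_const: "qdim (PS j) (PS j \<inter> K0 j) (card {\<sigma>. \<sigma> \<subseteq> W \<and> card \<sigma> = j})"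
proof -
  let ?S = "{\<sigma>. \<sigma> \<subseteq> W \<and> card \<sigma> = j}"
  have fin: "finite ?S" using vs V by (intro finite_subset[of ?S "Pow W"]) (auto intro: finite_subset[of W "set vs"])
  have "unit_chain \<sigma> \<in> PS j" if "\<sigma> \<in> ?S" for \<sigma>
  proof (rule supported_PS)
    show "unit_chain \<sigma> \<in> chains vs D j" using that V vs by (intro unit_chain_chains) auto
    show "\<rho> \<inter> U = {}" if "unit_chain \<sigma> \<rho> \<noteq> (0 :: 'v multiset \<Rightarrow> 'k)" for \<rho>
      using that \<open>\<sigma> \<in> ?S\<close> disj by (auto simp: unit_chain_def split: if_splits)
  qed
  then have "qdim (PS j) {z \<in> PS j. \<forall>\<sigma>\<in>?S. z \<sigma> {#} = 0} (card ?S)"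
    by (intro qdim_constants[OF fin ksubs(1)])
  moreover have "{z \<in> PS j. \<forall>\<sigma>\<in>?S. z \<sigma> {#} = 0} = PS j \<inter> K0 j"
  proof (intro equalityI subsetI)
    fix z assume z: "z \<in> {z \<in> PS j. \<forall>\<sigma>\<in>?S. z \<sigma> {#} = 0}"
    then have zc: "z \<in> chains vs D j" by (simp add: sh.relcyc_def)
    have "z \<sigma> {#} = 0" for \<sigma>
    proof (cases "\<sigma> \<inter> U = {}")
      case True
      show ?thesis
      proof (cases "\<sigma> \<subseteq> set vs \<and> card \<sigma> = j")
        case True
        then have "\<sigma> \<in> ?S" using \<open>\<sigma> \<inter> U = {}\<close> V vs by auto
        with z show ?thesis by blast
      next
        case False
        then show ?thesis using chainsD(2)[OF zc False] by (simp add: zero_fun_apply)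
      qed
    qed (use PS_const z in blast)
    with z zc show "z \<in> PS j \<inter> K0 j" by (simp add: K0_def)
  qed (auto simp: K0_def)
  ultimately show ?thesis by simp
qed

lemma qdim_reduced:
  assumes "qdim (PS j) (NS j) s"
  shows "\<exists>a. qdim (PS j \<inter> K0 j) (NS j) a \<and> s = card {\<sigma>. \<sigma> \<subseteq> W \<and> card \<sigma> = j} + a"
proof -
  have k: "ksub (PS j \<inter> K0 j)" using ksubs K0_sub by (intro ksub_Int)
  obtain a where a: "qdim (PS j \<inter> K0 j) (NS j) a" using qdim_subspace[OF ksubs(2) k _ assms] by blast
  have "qdim (PS j) (NS j) (card {\<sigma>. \<sigma> \<subseteq> W \<and> card \<sigma> = j} + a)"
    using ksubs(3) NS_K0 by (intro qdim_trans[OF ksubs(2) k _ _ qdim_PS_const a]) auto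
  with a show ?thesis using qdim_unique[OF ksubs(2) assms] by blast
qed

end

text \<open>
  The second factor has the roles of \<open>U\<close> and \<open>W\<close> exchanged; \<open>PF/NF\<close> is the Koszul homology of the fiber product.
\<close>

locale two_factors = S: factor c U W V I vs + T: factor c W U V J vs
  for c :: ring_kind and U W V :: "'v set" and I J :: "('v multiset \<Rightarrow> 'k::field) set" and vs
begin

abbreviation "IF \<equiv> S.IS \<inter> T.IS"
abbreviation "PF \<equiv> sh.relcyc vs S.D IF"
abbreviation "NF \<equiv> sh.relbnd vs S.D IF"

lemma vF: "vsub IF" using S.vS T.vS by (auto simp: vsub_def)
lemma PF_eq: "PF j = S.PS j \<inter> T.PS j"
  by (auto simp: sh.relcyc_def)

lemma NF_sub: "NF j \<subseteq> S.NS j" "NF j \<subseteq> T.NS j"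
  using chains_mono[of IF S.IS vs j] chains_mono[of IF T.IS vs j] by (auto simp: sh.relbnd_def)

lemma kNF: "ksub (NF j)" by (rule sh.ksub_relbnd[OF vsub_carrier vF])

definition \<kappa> :: "('v set \<Rightarrow> 'v multiset \<Rightarrow> 'k) \<Rightarrow> 'v set \<Rightarrow> 'v multiset \<Rightarrow> 'k" where
  "\<kappa> z = killc U z"

text \<open>
  Chains without constant terms are sums of chains with entries in the two ideals, through the projection \<open>\<kappa>\<close>.
\<close>

lemma \<kappa>_split:
  assumes z: "z \<in> S.K0 j"
  shows "\<kappa> z \<in> chains vs T.IS j" "z - \<kappa> z \<in> chains vs S.IS j"
proof -
  have zc: "z \<in> chains vs S.D j" and z0: "\<And>\<sigma>. z \<sigma> {#} = 0" using z by (auto simp: S.K0_def)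
  show "\<kappa> z \<in> chains vs T.IS j"
  proof (rule chainsI)
    show "\<kappa> z \<sigma> \<in> T.IS" for \<sigma> using T.kill_other_IS[OF chainsD(1)[OF zc] z0] by (simp add: \<kappa>_def killc_def)
    show "\<sigma> \<subseteq> set vs \<and> card \<sigma> = j" if "\<kappa> z \<sigma> \<noteq> 0" for \<sigma>
      using that chainsD(2)[OF zc, of \<sigma>] by (metis \<kappa>_def killc_def kill_simps(5))
  qed
  show "z - \<kappa> z \<in> chains vs S.IS j"
  proof (rule chainsI)
    show "(z - \<kappa> z) \<sigma> \<in> S.IS" for \<sigma> using S.minus_kill_IS[OF chainsD(1)[OF zc]] by (simp add: \<kappa>_def killc_def minus_apply)
    show "\<sigma> \<subseteq> set vs \<and> card \<sigma> = j" if "(z - \<kappa> z) \<sigma> \<noteq> 0" for \<sigma>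
      using that chainsD(2)[OF zc, of \<sigma>] by (metis \<kappa>_def killc_def kill_simps(5) minus_apply diff_self)
  qed
qed

lemma \<kappa>_NS: "z \<in> S.K0 j \<Longrightarrow> \<kappa> z \<in> T.NS j" "z \<in> S.K0 j \<Longrightarrow> z - \<kappa> z \<in> S.NS j"
  using \<kappa>_split S.chains_IS_NS T.chains_IS_NS by blast+

lemma klin_id: "klin A (\<lambda>z. z)" by (simp add: klin_def)

text \<open>
  The upper layer. In positive degrees a chain in \<open>P\<^sub>S \<inter> P\<^sub>T\<close> has no constant terms, as these would sit at sets that
  meet neither \<open>U\<close> nor \<open>W\<close>. Conversely, \<open>\<kappa>\<close> moves classes without constant terms into the intersection: modulo \<open>N\<^sub>S\<close>
  every \<open>z\<close> equals \<open>\<kappa> z \<in> N\<^sub>T\<close>, and modulo \<open>N\<^sub>T\<close> it equals \<open>z - \<kappa> z \<in> N\<^sub>S\<close>. So the layer is the direct sum of the parts of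
  \<open>P\<^sub>S/N\<^sub>S\<close> and \<open>P\<^sub>T/N\<^sub>T\<close> without constant terms.
\<close>

lemma qdim_image_part:
  assumes a: "qdim (S.PS j \<inter> S.K0 j) (S.NS j) a" and b: "qdim (T.PS j \<inter> S.K0 j) (T.NS j) b" and j: "0 < j"
  shows "qdim (PF j) (S.NS j \<inter> T.NS j) (a + b)"
proof -
  have PK: "S.PS j \<inter> T.PS j \<subseteq> S.K0 j"
  proof
    fix z assume z: "z \<in> S.PS j \<inter> T.PS j"
    then have zc: "z \<in> chains vs S.D j" by (simp add: sh.relcyc_def)
    have "z \<sigma> {#} = 0" for \<sigma>
    proof (cases "z \<sigma> = 0")
      case False
      then have "\<sigma> \<subseteq> V" "\<sigma> \<noteq> {}" using chains_nonzero[OF zc False] j S.vs by auto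
      then have "\<sigma> \<inter> U \<noteq> {} \<or> \<sigma> \<inter> W \<noteq> {}" using S.V by auto
      then show ?thesis using S.PS_const[of z j \<sigma>] T.PS_const[of z j \<sigma>] z by blast
    qed (simp add: zero_fun_apply)
    with zc show "z \<in> S.K0 j" by (simp add: S.K0_def)
  qed
  have kF: "ksub (PF j)" unfolding PF_eq by (intro ksub_Int S.ksubs T.ksubs)
  have kX: "ksub (S.NS j \<inter> T.PS j)" by (intro ksub_Int S.ksubs T.ksubs)
  have kN: "ksub (S.NS j \<inter> T.NS j)" by (intro ksub_Int S.ksubs T.ksubs)
  have "qdim (PF j) (S.NS j \<inter> T.PS j) a"
  proof (subst qdim_image_mod[OF klin_id kF S.ksubs(2)])
    show "(\<lambda>z. z) ` PF j \<subseteq> S.PS j \<inter> S.K0 j" using PK by (auto simp: PF_eq)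
    show "\<exists>u\<in>PF j. z - u \<in> S.NS j" if z: "z \<in> S.PS j \<inter> S.K0 j" for z
    proof (intro bexI)
      show d: "z - \<kappa> z \<in> S.NS j" using \<kappa>_NS(2)[of z j] z by simp
      have "z - (z - \<kappa> z) \<in> S.PS j"
        by (rule ksub_diff[OF S.ksubs(1)]) (use z d S.ksubs(3) in auto)
      then have "\<kappa> z \<in> S.PS j" by simp
      moreover have "\<kappa> z \<in> T.PS j" using \<kappa>_NS(1)[of z j] z T.ksubs(3)[of j] by auto
      ultimately show "\<kappa> z \<in> PF j" by (simp add: PF_eq)
    qed
    show "qdim (S.PS j \<inter> S.K0 j) (S.NS j) a" by (rule a)
  qed (use S.ksubs(3) in \<open>auto simp: PF_eq\<close>)
  moreover have "qdim (S.NS j \<inter> T.PS j) (S.NS j \<inter> T.NS j) b"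
  proof (subst qdim_image_mod[OF klin_id kX T.ksubs(2)])
    show "(\<lambda>z. z) ` (S.NS j \<inter> T.PS j) \<subseteq> T.PS j \<inter> S.K0 j" using S.NS_K0 by auto
    show "\<exists>u\<in>S.NS j \<inter> T.PS j. z - u \<in> T.NS j" if z: "z \<in> T.PS j \<inter> S.K0 j" for z
    proof (intro bexI)
      have k: "\<kappa> z \<in> T.NS j" using \<kappa>_NS(1)[of z j] z by simp
      then show "z - (z - \<kappa> z) \<in> T.NS j" by simp
      have "z - \<kappa> z \<in> T.PS j" using z k T.ksubs(3) by (intro ksub_diff[OF T.ksubs(1)]) auto
      then show "z - \<kappa> z \<in> S.NS j \<inter> T.PS j" using \<kappa>_NS(2)[of z j] z by simp
    qed
    show "qdim (T.PS j \<inter> S.K0 j) (T.NS j) b" by (rule b)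
  qed (use T.ksubs(3) in auto)
  moreover have "S.NS j \<inter> T.PS j \<subseteq> PF j" using S.ksubs(3) by (auto simp: PF_eq)
  ultimately show ?thesis using T.ksubs(3) by (intro qdim_trans[OF kN kX]) auto
qed

definition both :: "nat \<Rightarrow> 'v set set" where
  "both j = {\<sigma>. \<sigma> \<subseteq> V \<and> card \<sigma> = j \<and> \<sigma> \<inter> U \<noteq> {} \<and> \<sigma> \<inter> W \<noteq> {}}"

lemma finite_V: "finite V" using S.vs by auto

lemma finite_both: "finite (both j)"
  by (rule finite_subset[of _ "Pow V"]) (use finite_V in \<open>auto simp: both_def\<close>)

definition PP :: "nat \<Rightarrow> ('v set \<Rightarrow> 'v multiset \<Rightarrow> 'k) set" where
  "PP j = {u + w |u w. u \<in> S.PS j \<and> w \<in> T.PS j}"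

text \<open>
  Entries at sets disjoint from \<open>U\<close> give a chain in \<open>P\<^sub>S\<close>, those at sets disjoint from \<open>W\<close> one in \<open>P\<^sub>T\<close>, and the remaining ones, having
  no constant terms, are split by \<open>\<kappa>\<close>.
\<close>

lemma PP_eq: "PP j = {z \<in> chains vs S.D j. \<forall>\<sigma>\<in>both j. z \<sigma> {#} = 0}"
proof (intro equalityI subsetI)
  fix z assume "z \<in> PP j"
  then obtain u w where uw: "u \<in> S.PS j" "w \<in> T.PS j" "z = u + w" by (auto simp: PP_def)
  then have "u \<in> chains vs S.D j" "w \<in> chains vs S.D j" by (auto simp: sh.relcyc_def)
  then have "z \<in> chains vs S.D j" using uw ksub_add[OF S.kc] by blast
  moreover have "z \<sigma> {#} = 0" if "\<sigma> \<in> both j" for \<sigma>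
    using S.PS_const[OF uw(1), of \<sigma>] T.PS_const[OF uw(2), of \<sigma>] that by (simp add: both_def uw(3) plus_fun_apply)
  ultimately show "z \<in> {z \<in> chains vs S.D j. \<forall>\<sigma>\<in>both j. z \<sigma> {#} = 0}" by blast
next
  fix z assume z: "z \<in> {z \<in> chains vs S.D j. \<forall>\<sigma>\<in>both j. z \<sigma> {#} = 0}"
  then have zc: "z \<in> chains vs S.D j" by blast
  define z1 where "z1 = (\<lambda>\<sigma>. if \<sigma> \<inter> U = {} then z \<sigma> else 0)"
  define z2 where "z2 = (\<lambda>\<sigma>. if \<sigma> \<inter> U \<noteq> {} \<and> \<sigma> \<inter> W = {} then z \<sigma> else 0)"
  define z3 where "z3 = (\<lambda>\<sigma>. if \<sigma> \<inter> U \<noteq> {} \<and> \<sigma> \<inter> W \<noteq> {} then z \<sigma> else 0)"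
  have D0: "0 \<in> S.D" using vsub_0[OF vsub_carrier] .
  have c: "z1 \<in> chains vs S.D j" "z2 \<in> chains vs S.D j" "z3 \<in> chains vs S.D j"
    unfolding z1_def z2_def z3_def by (rule chains_restrict[OF zc D0])+
  have "z1 \<in> S.PS j" by (rule S.supported_PS[OF c(1)]) (auto simp: z1_def split: if_splits)
  have "z2 \<in> T.PS j" by (rule T.supported_PS[OF c(2)]) (auto simp: z2_def split: if_splits)
  have "z3 \<sigma> {#} = 0" for \<sigma>
  proof (cases "z3 \<sigma> = 0")
    case False
    then have "\<sigma> \<subseteq> set vs" "card \<sigma> = j" using chains_nonzero[OF c(3)] by blast+
    moreover have "\<sigma> \<inter> U \<noteq> {}" "\<sigma> \<inter> W \<noteq> {}" using False by (auto simp: z3_def split: if_splits)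
    ultimately have "\<sigma> \<in> both j" using S.vs by (simp add: both_def)
    then have "z \<sigma> {#} = 0" using z by blast
    then show ?thesis by (simp add: z3_def zero_fun_apply)
  qed (simp add: zero_fun_apply)
  with c(3) have "z3 \<in> S.K0 j" by (simp add: S.K0_def)
  then have "\<kappa> z3 \<in> T.PS j" "z3 - \<kappa> z3 \<in> S.PS j" using \<kappa>_NS[of z3 j] S.ksubs(3)[of j] T.ksubs(3)[of j] by auto
  then have "(z1 + (z3 - \<kappa> z3)) + (z2 + \<kappa> z3) \<in> PP j"
    unfolding PP_def using \<open>z1 \<in> S.PS j\<close> \<open>z2 \<in> T.PS j\<close> ksub_add[OF S.ksubs(1)] ksub_add[OF T.ksubs(1)] by blast
  moreover have "z = (z1 + (z3 - \<kappa> z3)) + (z2 + \<kappa> z3)"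
  proof -
    have "z = z1 + z2 + z3" by (rule ext) (simp add: z1_def z2_def z3_def plus_fun_apply)
    then show ?thesis by (simp add: algebra_simps)
  qed
  ultimately show "z \<in> PP j" by simp
qed

lemma qdim_both: "qdim (chains vs S.D j) (PP j) (card (both j))"
  unfolding PP_eq
  by (rule qdim_constants[OF finite_both S.kc]) (use S.vs in \<open>auto simp: both_def intro!: unit_chain_chains\<close>)

text \<open>
  The lower layer. The map \<open>\<theta> u = \<kappa> (d u)\<close> takes chains into \<open>N\<^sub>S \<inter> N\<^sub>T\<close>, since \<open>\<kappa> (d u)\<close> is a chain with entries in
  \<open>I\<^sub>T\<close> that differs from \<open>d u\<close> by a chain with entries in \<open>I\<^sub>S\<close>. If \<open>y\<close> in \<open>N\<^sub>S \<inter> N\<^sub>T\<close> is written as \<open>a + d w\<close> and as \<open>b + d w'\<close>, then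
  \<open>\<theta> (w - w')\<close> is \<open>y\<close> modulo \<open>N\<^sub>F\<close>; and \<open>\<theta> u\<close> vanishes modulo \<open>N\<^sub>F\<close> if and only if \<open>u\<close> is in \<open>P\<^sub>S + P\<^sub>T\<close>.
\<close>

lemma qdim_kernel_part: "qdim (S.NS j \<inter> T.NS j) (NF j) (card (both (Suc j)))"
proof -
  define \<theta> where "\<theta> u = \<kappa> (kd shift vs u)" for u
  have kdK: "kd shift vs u \<in> S.K0 j" if "u \<in> chains vs S.D (Suc j)" for u by (rule S.kd_K0[OF that])
  have lin: "klin (chains vs S.D (Suc j)) \<theta>" by (simp add: klin_def \<theta>_def \<kappa>_def sh.kd_add sh.kd_csc killc_simps)
  have NFI: "f + kd shift vs w \<in> NF j" if "f \<in> chains vs S.IS j" "f \<in> chains vs T.IS j" "w \<in> chains vs S.D (Suc j)" for f w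
    by (rule sh.relbndI) (use that in \<open>auto simp: chains_def\<close>)
  show ?thesis
  proof (subst qdim_image_mod[symmetric, OF lin S.kc kNF])
    show "\<theta> ` chains vs S.D (Suc j) \<subseteq> S.NS j \<inter> T.NS j"
    proof (rule image_subsetI)
      fix u assume u: "u \<in> chains vs S.D (Suc j)"
      have "kd shift vs u - (kd shift vs u - \<theta> u) \<in> S.NS j"
        unfolding \<theta>_def by (intro ksub_diff[OF S.ksubs(2)] S.kd_NS u \<kappa>_NS(2) kdK)
      then have "\<theta> u \<in> S.NS j" by simp
      moreover have "\<theta> u \<in> T.NS j" unfolding \<theta>_def by (intro \<kappa>_NS(1) kdK u)
      ultimately show "\<theta> u \<in> S.NS j \<inter> T.NS j" by blast
    qed
    show "\<exists>u\<in>chains vs S.D (Suc j). y - \<theta> u \<in> NF j" if y: "y \<in> S.NS j \<inter> T.NS j" for y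
    proof -
      obtain a w where aw: "a \<in> chains vs S.IS j" "w \<in> chains vs S.D (Suc j)" "y = a + kd shift vs w" using y by (auto simp: sh.relbnd_def)
      obtain b w' where bw: "b \<in> chains vs T.IS j" "w' \<in> chains vs S.D (Suc j)" "y = b + kd shift vs w'" using y by (auto simp: sh.relbnd_def)
      define u where "u = w - w'"
      have u: "u \<in> chains vs S.D (Suc j)" unfolding u_def by (intro ksub_diff[OF S.kc] aw bw)
      note k = \<kappa>_split[OF kdK[OF u]]
      define f where "f = b - \<kappa> (kd shift vs u)"
      have du: "kd shift vs u = b - a" using aw(3) bw(3) by (simp add: u_def sh.kd_diff algebra_simps)
      have "f \<in> chains vs T.IS j" unfolding f_def by (intro ksub_diff[OF ksub_chains[OF T.vS]] bw k)
      moreover have "f = a + (kd shift vs u - \<kappa> (kd shift vs u))" unfolding f_def by (simp add: du algebra_simps)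
      then have "f \<in> chains vs S.IS j" using ksub_add[OF ksub_chains[OF S.vS] aw(1) k(2)] by simp
      ultimately have "f + kd shift vs w' \<in> NF j" using NFI bw(2) by blast
      moreover have "y - \<theta> u = f + kd shift vs w'" by (simp add: f_def \<theta>_def bw(3))
      ultimately show ?thesis using u by (intro bexI[of _ u]) simp_all
    qed
    show "u \<in> PP (Suc j) \<longleftrightarrow> \<theta> u \<in> NF j" if u: "u \<in> chains vs S.D (Suc j)" for u
    proof
      assume "u \<in> PP (Suc j)"
      then obtain p q where pq: "p \<in> S.PS (Suc j)" "q \<in> T.PS (Suc j)" "u = p + q" by (auto simp: PP_def)
      then have pc: "p \<in> chains vs S.D (Suc j)" and qc: "q \<in> chains vs S.D (Suc j)" by (auto simp: sh.relcyc_def)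
      have dp: "kd shift vs p \<in> chains vs S.IS j" using pq(1) by (intro sh.kd_chainsI[OF S.vs(1) pc]) (simp add: sh.relcyc_def)
      have dq: "kd shift vs q \<in> chains vs T.IS j" using pq(2) by (intro sh.kd_chainsI[OF S.vs(1) qc]) (simp add: sh.relcyc_def)
      note kp = \<kappa>_split[OF kdK[OF pc]] and kq = \<kappa>_split[OF kdK[OF qc]]
      have p1: "\<kappa> (kd shift vs p) \<in> chains vs S.IS j"
        using ksub_diff[OF ksub_chains[OF S.vS] dp kp(2)] by simp
      have q1: "kd shift vs q - \<kappa> (kd shift vs q) \<in> chains vs T.IS j"
        using ksub_diff[OF ksub_chains[OF T.vS] dq kq(1)] by simp
      define f where "f = \<kappa> (kd shift vs p) - (kd shift vs q - \<kappa> (kd shift vs q))"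
      have "f + kd shift vs q \<in> NF j"
        unfolding f_def by (intro NFI ksub_diff[OF ksub_chains[OF S.vS]] ksub_diff[OF ksub_chains[OF T.vS]] p1 q1 kp kq qc)
      moreover have "\<theta> u = f + kd shift vs q" by (simp add: \<theta>_def f_def pq(3) sh.kd_add \<kappa>_def killc_simps)
      ultimately show "\<theta> u \<in> NF j" by simp
    next
      assume "\<theta> u \<in> NF j"
      then obtain f w where fw: "f \<in> chains vs IF j" "w \<in> chains vs S.D (Suc j)" "\<theta> u = f + kd shift vs w" by (auto simp: sh.relbnd_def)
      have fS: "f \<in> chains vs S.IS j" and fT: "f \<in> chains vs T.IS j"
        using fw(1) chains_mono[of IF S.IS vs j] chains_mono[of IF T.IS vs j] by blast+
      note k = \<kappa>_split[OF kdK[OF u]]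
      have "\<theta> u - f \<in> chains vs T.IS j" unfolding \<theta>_def by (intro ksub_diff[OF ksub_chains[OF T.vS]] k fT)
      then have "kd shift vs w \<in> chains vs T.IS j" by (simp add: fw(3))
      then have wT: "w \<in> T.PS (Suc j)" using fw(2) chainsD(1) by (auto simp: sh.relcyc_def)
      have "(kd shift vs u - \<theta> u) + f \<in> chains vs S.IS j" unfolding \<theta>_def by (intro ksub_add[OF ksub_chains[OF S.vS]] k fS)
      then have "kd shift vs (u - w) \<in> chains vs S.IS j" by (simp add: fw(3) sh.kd_diff)
      then have "u - w \<in> S.PS (Suc j)" using ksub_diff[OF S.kc u fw(2)] chainsD(1) by (auto simp: sh.relcyc_def)
      then have "(u - w) + w \<in> PP (Suc j)" using wT unfolding PP_def by blast
      then show "u \<in> PP (Suc j)" by simp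
    qed
    show "qdim (chains vs S.D (Suc j)) (PP (Suc j)) (card (both (Suc j)))" by (rule qdim_both)
  qed
qed

text \<open>
  The two layers together. The binomial coefficients, counting the sets of variables of one factor, are the contributions
  of the constant terms to \<open>s\<close> and \<open>t\<close>.
\<close>

theorem qdim_fiber:
  assumes s: "qdim (S.PS j) (S.NS j) s" and t: "qdim (T.PS j) (T.NS j) t" and j: "0 < j" and f: "qdim (PF j) (NF j) f"
  shows "f + card {\<sigma>. \<sigma> \<subseteq> W \<and> card \<sigma> = j} + card {\<sigma>. \<sigma> \<subseteq> U \<and> card \<sigma> = j} = s + t + card (both (Suc j))"
proof -
  obtain a where a: "qdim (S.PS j \<inter> S.K0 j) (S.NS j) a" "s = card {\<sigma>. \<sigma> \<subseteq> W \<and> card \<sigma> = j} + a"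
    using S.qdim_reduced[OF s] by blast
  obtain b where b: "qdim (T.PS j \<inter> T.K0 j) (T.NS j) b" "t = card {\<sigma>. \<sigma> \<subseteq> U \<and> card \<sigma> = j} + b"
    using T.qdim_reduced[OF t] by blast
  have "qdim (PF j) (S.NS j \<inter> T.NS j) (a + b)"
    by (rule qdim_image_part[OF a(1) b(1) j])
  moreover have "S.NS j \<inter> T.NS j \<subseteq> PF j" using S.ksubs(3) T.ksubs(3) by (auto simp: PF_eq)
  ultimately have "qdim (PF j) (NF j) (a + b + card (both (Suc j)))"
    using NF_sub by (intro qdim_trans[OF kNF _ _ _ _ qdim_kernel_part] ksub_Int S.ksubs T.ksubs) auto
  from qdim_unique[OF kNF f this] a b show ?thesis by simp
qed

end

section \<open>Ideals of the series ring and their quotients\<close>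

lemma kill_conv: "kill_outside U (conv f g) = conv (kill_outside U f) (kill_outside U g)"
proof
  fix e
  show "kill_outside U (conv f g) e = conv (kill_outside U f) (kill_outside U g) e"
  proof (cases "set_mset e \<subseteq> U")
    case True
    have "set_mset a \<subseteq> U \<and> set_mset (e - a) \<subseteq> U" if "a \<subseteq># e" for a
      using True set_mset_mono[OF that] by (auto dest: in_diffD)
    then show ?thesis using True by (auto simp: kill_outside_def conv_def intro!: sum.cong)
  next
    case False
    have "conv (kill_outside U f) (kill_outside U g) e = 0"
    proof (rule ccontr)
      assume "conv (kill_outside U f) (kill_outside U g) e \<noteq> 0"
      then obtain a where a: "a \<subseteq># e" "kill_outside U f a \<noteq> 0" "kill_outside U g (e - a) \<noteq> 0" using conv_nonzero by blast
      then have "set_mset a \<subseteq> U" "set_mset (e - a) \<subseteq> U" by (auto simp: kill_outside_def split: if_splits)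
      moreover have "set_mset e = set_mset a \<union> set_mset (e - a)" using a(1) by (metis set_mset_union subset_mset.add_diff_inverse)
      ultimately show False using False by blast
    qed
    then show ?thesis using False by (simp add: kill_outside_def)
  qed
qed

lemma ideal_series_iff:
  fixes I :: "('v multiset \<Rightarrow> 'k::field) set"
  shows "ideal I (series_ring c V) \<longleftrightarrow> I \<subseteq> series_carrier c V \<and> vsub I \<and> (\<forall>f\<in>I. \<forall>x\<in>series_carrier c V. conv x f \<in> I)"
proof
  assume I: "ideal I (series_ring c V)"
  have "conv x f \<in> I" if "f \<in> I" "x \<in> series_carrier c V" for x f
    using ideal.I_l_closed[OF I that(1), of x] that(2) by simp
  then show "I \<subseteq> series_carrier c V \<and> vsub I \<and> (\<forall>f\<in>I. \<forall>x\<in>series_carrier c V. conv x f \<in> I)"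
    using ideal_subset[OF I] ideal_vsub[OF I] by blast
next
  let ?R = "series_ring c V :: ('v multiset \<Rightarrow> 'k) ring"
  assume *: "I \<subseteq> series_carrier c V \<and> vsub I \<and> (\<forall>f\<in>I. \<forall>x\<in>series_carrier c V. conv x f \<in> I)"
  interpret R: cring ?R by (rule cring_series)
  show "ideal I ?R"
  proof (rule idealI)
    show "subgroup I (add_monoid ?R)"
    proof (rule R.add.subgroupI)
      show "I \<noteq> {}" using * vsub_0 by blast
      fix f g assume f: "f \<in> I" and g: "g \<in> I"
      show "\<ominus>\<^bsub>?R\<^esub> f \<in> I" using vsub_neg[of I f] f * by (subst series_ring_minus) auto
      show "f \<oplus>\<^bsub>?R\<^esub> g \<in> I" using vsub_add[of I f g] f g * by simp
    qed (use * in simp)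
    fix f x assume "f \<in> I" "x \<in> carrier ?R"
    then show "x \<otimes>\<^bsub>?R\<^esub> f \<in> I" "f \<otimes>\<^bsub>?R\<^esub> x \<in> I" using * conv_comm[of f x] by auto
  qed (rule R.ring_axioms)
qed

lemma pullback_ideal:
  fixes I :: "('v multiset \<Rightarrow> 'k::field) set"
  assumes I: "ideal I (series_ring c U)" and "U \<subseteq> V"
  shows "ideal (pullback c V U I) (series_ring c V)"
proof -
  note * = I[unfolded ideal_series_iff]
  have "conv x f \<in> pullback c V U I" if "f \<in> pullback c V U I" "x \<in> series_carrier c V" for x f
    using that * kill_carrier[OF that(2), of U] assms(2) by (auto simp: pullback_def kill_conv conv_carrier Int_absorb2)
  then show ?thesis using * pullback_vsub[of I c V U] pullback_sub[of c V U I] by (auto simp: ideal_series_iff)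
qed

lemma ideal_Int: "ideal I (series_ring c V) \<Longrightarrow> ideal J (series_ring c V) \<Longrightarrow> ideal (I \<inter> J) (series_ring c V)"
  unfolding ideal_series_iff by (auto simp: vsub_def)

lemma hcomp_conv:
  assumes "hcomp d' g = g" shows "hcomp d (conv f g) = conv (hcomp (d - d') f) g"
proof -
  define w where "w = flat 1 (\<lambda>_. g)"
  have s: "slot 0 w = g" by (simp add: w_def slot_flat)
  have sg: "slot 0 (gr (\<lambda>_. 0) d w) = hcomp d (slot 0 w)" for d and w :: "nat \<times> 'a multiset \<Rightarrow> 'b"
    by (auto simp: slot_def gr_def hcomp_def)
  have "gr (\<lambda>_. 0) d' w = w"
  proof (rule slot_eqI)
    fix l show "slot l (gr (\<lambda>_. 0) d' w) = slot l w"
    proof (cases "l = 0")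
      case False
      then show ?thesis by (auto simp: slot_def gr_def w_def flat_def fun_eq_iff)
    qed (simp add: sg s assms)
  qed
  from arg_cong[OF gr_mulb[OF this, of d f], of "slot 0"] show ?thesis by (simp add: sg slot_mulb s)
qed

lemma hcomp_simps: "hcomp d (f + g) = hcomp d f + hcomp d g" "hcomp d (fsc a f) = fsc a (hcomp d f)" "hcomp d 0 = 0"
  "hcomp d (hcomp d' f) = (if d = d' then hcomp d f else 0)"
  by (auto simp: hcomp_def fun_eq_iff pointwise fsc_apply)

lemma hcomp_sum: "hcomp d (sum f S) = (\<Sum>i\<in>S. hcomp d (f i))"
  by (auto simp: hcomp_def fun_eq_iff sum_fun_apply)

lemma hcomp_decompose:
  assumes f: "f \<in> series_carrier Polynomials V"
  shows "\<exists>D. finite D \<and> f = (\<Sum>d\<in>D. hcomp d f)"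
proof -
  define D where "D = (\<lambda>e. int (size e)) ` {e. f e \<noteq> 0}"
  have D: "finite D" using carrierD(2)[OF f] by (simp add: D_def)
  have "f = (\<Sum>d\<in>D. hcomp d f)"
  proof
    fix e
    have "(\<Sum>d\<in>D. hcomp d f) e = (\<Sum>d\<in>D. if d = int (size e) then f e else 0)"
      unfolding sum_fun_apply by (intro sum.cong) (auto simp: hcomp_def)
    also have "\<dots> = f e" using D by (force simp: D_def)
    finally show "f e = (\<Sum>d\<in>D. hcomp d f) e" by simp
  qed
  with D show ?thesis by blast
qed

text \<open>
  An ideal with homogeneous generators contains the components of its elements: the elements with this property form an ideal
  that contains the generators.
\<close>

lemma homogeneous_ideal_hcomp:
  fixes I :: "('v multiset \<Rightarrow> 'k::field) set"
  assumes h: "homogeneous_ideal I (series_ring Polynomials V)" and f: "f \<in> I"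
  shows "hcomp d f \<in> I"
proof -
  let ?R = "series_ring Polynomials V :: ('v multiset \<Rightarrow> 'k) ring"
  interpret R: cring ?R by (rule cring_series)
  obtain G where G: "G \<subseteq> (\<Union>d. homogeneous_part ?R d)" "I = Idl\<^bsub>?R\<^esub> G" using h by (auto simp: homogeneous_ideal_def)
  have GC: "G \<subseteq> carrier ?R" using G(1) by (auto simp: homogeneous_part_def)
  have I: "ideal I ?R" unfolding G(2) by (rule R.genideal_ideal[OF GC])
  have GI: "G \<subseteq> I" unfolding G(2) by (rule R.genideal_self[OF GC])
  note * = I[unfolded ideal_series_iff]
  have vI: "vsub I" using * by blast
  define K where "K = {f \<in> I. \<forall>d. hcomp d f \<in> I}"
  have "vsub K" unfolding K_def
    by (rule vsubI) (auto simp: hcomp_simps vsub_0[OF vI] vsub_add[OF vI] vsub_fsc[OF vI])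
  moreover have "conv x g \<in> K" if g: "g \<in> K" and x: "x \<in> series_carrier Polynomials V" for x g
  proof -
    have gC: "g \<in> series_carrier Polynomials V" and gI: "\<And>d. hcomp d g \<in> I" "g \<in> I" using g * by (auto simp: K_def)
    obtain D where D: "g = (\<Sum>d\<in>D. hcomp d g)" using hcomp_decompose[OF gC] by blast
    have "hcomp d (conv x g) \<in> I" for d
    proof -
      have "conv x g = (\<Sum>d'\<in>D. conv x (hcomp d' g))" using D conv_sum[of x "\<lambda>d'. hcomp d' g" D] by simp
      then have "hcomp d (conv x g) = (\<Sum>d'\<in>D. conv (hcomp (d - d') x) (hcomp d' g))"
        using hcomp_conv[of d' "hcomp d' g" for d'] by (simp add: hcomp_sum hcomp_simps)
      moreover have "conv (hcomp (d - d') x) (hcomp d' g) \<in> I" for d' using * gI hcomp_carrier[OF x] by blast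
      ultimately show ?thesis by (simp only:) (rule vsub_sum[OF vI])
    qed
    moreover have "conv x g \<in> I" using * gI x by blast
    ultimately show ?thesis by (simp add: K_def)
  qed
  moreover have "K \<subseteq> series_carrier Polynomials V" using * by (auto simp: K_def)
  ultimately have K: "ideal K ?R" unfolding ideal_series_iff by blast
  have "G \<subseteq> K"
  proof
    fix g assume g: "g \<in> G"
    then obtain d where "g \<in> homogeneous_part ?R d" using G(1) by blast
    then have hd: "hcomp d g = g" by (auto simp: homogeneous_part_def hcomp_def fun_eq_iff)
    have "hcomp d' g \<in> I" for d'
    proof (cases "d' = d")
      case False
      have "hcomp d' g = hcomp d' (hcomp d g)" by (simp add: hd)
      also have "\<dots> = 0" using False by (simp add: hcomp_simps)
      finally show ?thesis using vsub_0[OF vI] by simp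
    qed (use hd g GI in auto)
    then show "g \<in> K" using g GI by (auto simp: K_def)
  qed
  then have "I \<subseteq> K" unfolding G(2) by (rule R.genideal_minimal[OF K])
  then show ?thesis using f by (auto simp: K_def)
qed

lemma hcomp_kill: "hcomp d (kill_outside U f) = kill_outside U (hcomp d f)"
  by (auto simp: hcomp_def kill_outside_def fun_eq_iff)

lemma hcomp_pullback:
  "\<forall>f\<in>I. \<forall>d. hcomp d f \<in> I \<Longrightarrow> \<forall>f\<in>pullback c V U I. \<forall>d. hcomp d f \<in> pullback c V U I"
  by (auto simp: pullback_def hcomp_carrier simp flip: hcomp_kill)

lemma coset_simps:
  assumes I: "ideal I (series_ring c V)" and f: "f \<in> series_carrier c V" and g: "g \<in> series_carrier c V"
  shows "(I +>\<^bsub>series_ring c V\<^esub> f) <+>\<^bsub>series_ring c V\<^esub> (I +>\<^bsub>series_ring c V\<^esub> g) = I +>\<^bsub>series_ring c V\<^esub> (f + g)"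
    "rcoset_mult (series_ring c V) I (I +>\<^bsub>series_ring c V\<^esub> f) (I +>\<^bsub>series_ring c V\<^esub> g) = I +>\<^bsub>series_ring c V\<^esub> conv f g"
    "I +>\<^bsub>series_ring c V\<^esub> f = I \<longleftrightarrow> f \<in> I"
proof -
  let ?R = "series_ring c V :: ('a multiset \<Rightarrow> 'b) ring"
  interpret R: cring ?R by (rule cring_series)
  have fg: "f \<in> carrier ?R" "g \<in> carrier ?R" using f g by simp_all
  show "(I +>\<^bsub>?R\<^esub> f) <+>\<^bsub>?R\<^esub> (I +>\<^bsub>?R\<^esub> g) = I +>\<^bsub>?R\<^esub> (f + g)"
    using abelian_subgroup.a_rcos_sum[OF abelian_subgroupI3[OF ideal.axioms(1)[OF I] R.abelian_group_axioms] fg] by simp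
  show "rcoset_mult ?R I (I +>\<^bsub>?R\<^esub> f) (I +>\<^bsub>?R\<^esub> g) = I +>\<^bsub>?R\<^esub> conv f g"
    using ideal.rcoset_mult_add[OF I fg] by simp
  show "I +>\<^bsub>?R\<^esub> f = I \<longleftrightarrow> f \<in> I"
    using ideal.rcos_const_imp_mem[OF I fg(1)] R.a_rcos_zero[OF I] by (intro iffI)
qed

lemma coset_carrier: "carrier (series_ring c V Quot I) = (\<lambda>f. I +>\<^bsub>series_ring c V\<^esub> f) ` series_carrier c V"
  by (auto simp: FactRing_def A_RCOSETS_def')

lemma module_via_simps [simp]:
  "carrier (module_via h N g) = carrier N" "zero (module_via h N g) = zero N" "add (module_via h N g) = add N"
  "smult (module_via h N g) = (\<lambda>r x. h r \<otimes>\<^bsub>N\<^esub> x)" "degree_part (module_via h N g) = g"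
  by (simp_all add: module_via_def)

lemma presents_quotient:
  assumes I: "ideal I (series_ring c V)"
  shows "presents c V I (\<lambda>r. I +>\<^bsub>series_ring c V\<^esub> r) (quotient_module (series_ring c V) I)"
  unfolding presents_def quotient_module_def using I coset_simps[OF I]
  by (simp add: coset_carrier) (simp add: FactRing_def)

lemma quotient_degree: "(\<lambda>r. I +>\<^bsub>Q\<^esub> r) ` homogeneous_part Q d \<subseteq> degree_part (quotient_module Q I) d"
  by (simp add: quotient_module_def quotient_part_def)

theorem betti_quotient:
  fixes I :: "('v multiset \<Rightarrow> 'k::field) set"
  assumes vs: "distinct vs" "set vs = V" and I: "ideal I (series_ring c V)" and I0: "\<forall>f\<in>I. f {#} = 0"
    and grI: "c = Polynomials \<Longrightarrow> \<forall>f\<in>I. \<forall>d. hcomp d f \<in> I"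
  shows "koszul_dim c vs V I j
           (betti c V (quotient_module (series_ring c V) I) j)"
  by (rule betti_koszul(1)[OF vs presents_quotient[OF I] I0]) (use grI in \<open>auto intro!: subsetD[OF quotient_degree]\<close>)

lemma residue_map_coset:
  assumes I: "ideal I (series_ring c V)" and I0: "\<forall>f\<in>I. f {#} = 0"
  shows "residue_map (I +>\<^bsub>series_ring c V\<^esub> f) = f {#}"
proof -
  have "(\<lambda>f. f {#}) ` (I +>\<^bsub>series_ring c V\<^esub> f) = {f {#}}"
    using I0 vsub_0[OF ideal_vsub[OF I]] by (force simp: a_r_coset_def' plus_fun_apply)
  then show ?thesis by (simp add: residue_map_def)
qed

lemma fiber_product_ring_simps:
  "carrier (fiber_product_ring S T) = {(s, t). s \<in> carrier S \<and> t \<in> carrier T \<and> residue_map s = residue_map t}"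
  "zero (fiber_product_ring S T) = (zero S, zero T)"
  "add (fiber_product_ring S T) = (\<lambda>(a, b) (a', b'). (a \<oplus>\<^bsub>S\<^esub> a', b \<oplus>\<^bsub>T\<^esub> b'))"
  "mult (fiber_product_ring S T) = (\<lambda>(a, b) (a', b'). (a \<otimes>\<^bsub>S\<^esub> a', b \<otimes>\<^bsub>T\<^esub> b'))"
  by (auto simp: fiber_product_ring_def RDirProd_def DirProd_def monoid.extend_def fun_eq_iff)

lemma kill_other: "f \<in> series_carrier c W \<Longrightarrow> U \<inter> W = {} \<Longrightarrow> kill_outside U f = cst (f {#})"
proof
  fix e assume f: "f \<in> series_carrier c W" "U \<inter> W = {}"
  show "kill_outside U f e = cst (f {#}) e"
  proof (cases "e = {#}")
    case False
    have "f e = 0" if "set_mset e \<subseteq> U"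
    proof (rule ccontr)
      assume "f e \<noteq> 0"
      then have "set_mset e \<subseteq> W" using carrierD(1)[OF f(1)] by blast
      then have "set_mset e \<subseteq> U \<inter> W" by (intro Int_greatest that)
      then show False using f(2) False by simp
    qed
    with False show ?thesis by (simp add: kill_outside_def cst_def)
  qed (simp add: kill_outside_def cst_def)
qed

lemma kill_cst: "kill_outside U (cst a) = cst a"
  by (auto simp: kill_outside_def cst_def fun_eq_iff)

text \<open>
  A pair with a common constant term \<open>a\<close>, represented by \<open>f\<close> and \<open>g\<close>, is the image of \<open>f + g - a\<close>. So the fiber product is
  cyclic, and its annihilator is the intersection of the two pullbacks.
\<close>

lemma presents_fiber:
  fixes I J :: "('v multiset \<Rightarrow> 'k::field) set"
  assumes I: "ideal I (series_ring c U)" and I0: "\<forall>f\<in>I. f {#} = 0"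
    and J: "ideal J (series_ring c W)" and J0: "\<forall>f\<in>J. f {#} = 0" and disj: "U \<inter> W = {}"
  shows "presents c (U \<union> W) (pullback c (U \<union> W) U I \<inter> pullback c (U \<union> W) W J)
     (\<lambda>r. (I +>\<^bsub>series_ring c U\<^esub> kill_outside U r, J +>\<^bsub>series_ring c W\<^esub> kill_outside W r)) (fiber_product c U W I J)"
proof -
  let ?V = "U \<union> W"
  let ?C = "series_carrier c ?V :: ('v multiset \<Rightarrow> 'k) set"
  let ?\<pi> = "\<lambda>r :: 'v multiset \<Rightarrow> 'k. (I +>\<^bsub>series_ring c U\<^esub> kill_outside U r, J +>\<^bsub>series_ring c W\<^esub> kill_outside W r)"
  let ?F = "fiber_product_ring (series_ring c U Quot I) (series_ring c W Quot J)"
  have kU: "kill_outside U f \<in> series_carrier c U" and kW: "kill_outside W f \<in> series_carrier c W" if "f \<in> ?C" for f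
    using kill_carrier[OF that, of U] kill_carrier[OF that, of W] by (simp_all add: Int_absorb2)
  have UC: "series_carrier c U \<subseteq> ?C" "series_carrier c W \<subseteq> ?C" by (auto intro!: carrier_mono)
  have onto: "?\<pi> ` ?C = carrier ?F"
  proof (intro equalityI subsetI)
    fix x assume "x \<in> ?\<pi> ` ?C"
    then show "x \<in> carrier ?F"
      using kU kW by (auto simp: fiber_product_ring_simps coset_carrier residue_map_coset[OF I I0] residue_map_coset[OF J J0] kill_simps)
  next
    fix x assume "x \<in> carrier ?F"
    then obtain a b where ab: "a \<in> series_carrier c U" "b \<in> series_carrier c W" "a {#} = b {#}"
      "x = (I +>\<^bsub>series_ring c U\<^esub> a, J +>\<^bsub>series_ring c W\<^esub> b)"
      by (auto simp: fiber_product_ring_simps coset_carrier residue_map_coset[OF I I0] residue_map_coset[OF J J0])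
    define r where "r = a + b - cst (a {#})"
    have "r \<in> ?C" unfolding r_def using ab UC by (intro vsub_diff[OF vsub_carrier] vsub_add[OF vsub_carrier] cst_carrier) auto
    moreover have "kill_outside U r = a" "kill_outside W r = b"
      using ab disj kill_other[of b c W U] kill_other[of a c U W]
      by (auto simp: r_def kill_simps kill_cst kill_id[of _ c U] kill_id[of _ c W] Int_commute)
    ultimately show "x \<in> ?\<pi> ` ?C" unfolding ab(4) by (intro image_eqI[of _ _ r]) auto
  qed
  have add: "?\<pi> (f + g) = ?\<pi> f \<oplus>\<^bsub>?F\<^esub> ?\<pi> g" and mult: "?\<pi> (conv f g) = ?\<pi> f \<otimes>\<^bsub>?F\<^esub> ?\<pi> g" if "f \<in> ?C" "g \<in> ?C" for f g
    using coset_simps[OF I kU[OF that(1)] kU[OF that(2)]] coset_simps[OF J kW[OF that(1)] kW[OF that(2)]]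
    by (simp_all add: fiber_product_ring_simps FactRing_def kill_simps kill_conv)
  have zero: "?\<pi> f = \<zero>\<^bsub>?F\<^esub> \<longleftrightarrow> f \<in> pullback c ?V U I \<inter> pullback c ?V W J" if "f \<in> ?C" for f
    using coset_simps(3)[OF I kU[OF that] kU[OF that]] coset_simps(3)[OF J kW[OF that] kW[OF that]] that
    by (simp add: fiber_product_ring_simps FactRing_def pullback_def)
  have "ideal (pullback c ?V U I \<inter> pullback c ?V W J) (series_ring c ?V)"
    by (intro ideal_Int pullback_ideal I J) auto
  then show ?thesis unfolding presents_def fiber_product_def Let_def using onto add mult zero by simp
qed

lemma kill_homogeneous: "f \<in> homogeneous_part (series_ring c V) d \<Longrightarrow> U \<subseteq> V \<Longrightarrow> kill_outside U f \<in> homogeneous_part (series_ring c U) d"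
  using kill_carrier[of f c V U] by (auto simp: homogeneous_part_def Int_absorb2 kill_outside_def split: if_splits)

theorem betti_fiber:
  fixes I J :: "('v multiset \<Rightarrow> 'k::field) set"
  assumes vs: "distinct vs" "set vs = U \<union> W" and I: "ideal I (series_ring c U)" and I0: "\<forall>f\<in>I. f {#} = 0"
    and J: "ideal J (series_ring c W)" and J0: "\<forall>f\<in>J. f {#} = 0" and disj: "U \<inter> W = {}"
    and grI: "c = Polynomials \<Longrightarrow> \<forall>f\<in>I. \<forall>d. hcomp d f \<in> I" and grJ: "c = Polynomials \<Longrightarrow> \<forall>f\<in>J. \<forall>d. hcomp d f \<in> J"
  defines "K \<equiv> pullback c (U \<union> W) U I \<inter> pullback c (U \<union> W) W J"
  shows "koszul_dim c vs (U \<union> W) K j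
           (betti c (U \<union> W) (fiber_product c U W I J) j)"
proof (rule betti_koszul(1)[OF vs])
  let ?\<pi> = "\<lambda>r :: 'v multiset \<Rightarrow> 'k. (I +>\<^bsub>series_ring c U\<^esub> kill_outside U r, J +>\<^bsub>series_ring c W\<^esub> kill_outside W r)"
  show P: "presents c (U \<union> W) K ?\<pi> (fiber_product c U W I J)"
    unfolding K_def by (rule presents_fiber[OF I I0 J J0 disj])
  show "\<forall>f\<in>K. f {#} = 0"
  proof
    fix f assume "f \<in> K"
    then have "kill_outside U f \<in> I" by (simp add: K_def pullback_def)
    then show "f {#} = 0" using I0 kill_simps(7)[of U f] by metis
  qed
  show "\<forall>f\<in>K. \<forall>d. hcomp d f \<in> K" if "c = Polynomials"
    using hcomp_pullback[OF grI[OF that], of c "U \<union> W" U] hcomp_pullback[OF grJ[OF that], of c "U \<union> W" W] by (auto simp: K_def)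
  show "\<forall>d. ?\<pi> ` homogeneous_part (series_ring c (U \<union> W)) d \<subseteq> degree_part (fiber_product c U W I J) d"
  proof (intro allI image_subsetI)
    fix d f assume f: "f \<in> homogeneous_part (series_ring c (U \<union> W) :: ('v multiset \<Rightarrow> 'k) ring) d"
    have "?\<pi> f \<in> carrier (fiber_product c U W I J)"
    proof -
      have "f \<in> series_carrier c (U \<union> W)" using f by (simp add: homogeneous_part_def)
      then show ?thesis using P unfolding presents_def by blast
    qed
    moreover have "kill_outside U f \<in> homogeneous_part (series_ring c U) d" "kill_outside W f \<in> homogeneous_part (series_ring c W) d"
      using kill_homogeneous[OF f] by auto
    ultimately show "?\<pi> f \<in> degree_part (fiber_product c U W I J) d"
      unfolding fiber_product_def Let_def by (simp add: quotient_part_def)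
  qed
qed

section \<open>Poincare series of pullbacks\<close>

definition gen_fun :: "(nat \<Rightarrow> nat) \<Rightarrow> rat fps" where "gen_fun \<beta> = Abs_fps (\<lambda>i. of_nat (\<beta> i))"

lemma gen_fun_nth [simp]: "fps_nth (gen_fun \<beta>) j = of_nat (\<beta> j)"
  by (simp add: gen_fun_def)

lemma gen_fun_bump: "(1 + fps_X) * gen_fun \<beta> = gen_fun (\<lambda>j. \<beta> j + (case j of 0 \<Rightarrow> 0 | Suc i \<Rightarrow> \<beta> i))"
  by (rule fps_ext) (simp add: distrib_right split: nat.split)

lemma pullback_pullback:
  assumes "U \<subseteq> V" "V \<subseteq> V'"
  shows "pullback c V' V (pullback c V U I) = pullback c V' U I"
proof (intro Set.set_eqI iffI)
  fix f assume "f \<in> pullback c V' V (pullback c V U I)"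
  then show "f \<in> pullback c V' U I" using assms by (simp add: pullback_def kill_simps Int_absorb2)
next
  fix f assume f: "f \<in> pullback c V' U I"
  then have "kill_outside V f \<in> series_carrier c V" using assms kill_carrier[of f c V' V] by (simp add: pullback_def Int_absorb2)
  then show "f \<in> pullback c V' V (pullback c V U I)" using f assms by (simp add: pullback_def kill_simps Int_absorb2)
qed

lemma pullback_constant_term: "\<forall>f\<in>I. f {#} = 0 \<Longrightarrow> \<forall>f\<in>pullback c V U I. f {#} = 0"
proof
  fix f assume "\<forall>f\<in>I. f {#} = 0" "f \<in> pullback c V U I"
  then have "kill_outside U f {#} = 0" by (simp add: pullback_def)
  then show "f {#} = 0" by (simp add: kill_simps)
qed

lemma pullback_self: "I \<subseteq> series_carrier c U \<Longrightarrow> pullback c U U I = I"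
  by (auto simp: pullback_def subset_iff kill_id)

lemma ideal_shift:
  assumes "ideal I (series_ring c V)" "u \<in> V" "f \<in> I" shows "shift u f \<in> I"
proof -
  have "conv (variable u) f \<in> I" using assms variable_carrier[of u V c] unfolding ideal_series_iff by blast
  then show ?thesis by (simp add: conv_variable)
qed

lemma qdim_add_variables:
  fixes I :: "('v multiset \<Rightarrow> 'k::field) set"
  assumes d: "distinct (ws @ us)" "set us = U" and I: "ideal I (series_ring c U)" and I0: "\<forall>f\<in>I. f {#} = 0"
    and \<beta>: "\<And>j. koszul_dim c us U I j (\<beta> j)"
  shows "\<exists>\<beta>'. (\<forall>j. koszul_dim c (ws @ us) (set ws \<union> U) (pullback c (set ws \<union> U) U I) j (\<beta>' j))
           \<and> gen_fun \<beta>' = (1 + fps_X) ^ length ws * gen_fun \<beta>"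
  using d(1)
proof (induction ws)
  case Nil
  show ?case using \<beta> by (intro exI[of _ \<beta>]) (simp add: pullback_self[OF ideal_subset[OF I]])
next
  case (Cons w ws)
  let ?V = "set ws \<union> U"
  let ?J = "pullback c ?V U I" and ?J' = "pullback c (insert w ?V) U I"
  have d': "distinct (ws @ us)" "distinct (w # ws @ us)" using Cons.prems by auto
  obtain \<beta>' where \<beta>'_all: "\<forall>j. koszul_dim c (ws @ us) ?V ?J j (\<beta>' j)"
    and gen_fun: "gen_fun \<beta>' = (1 + fps_X) ^ length ws * gen_fun \<beta>" using Cons.IH[OF d'(1)] by (elim exE conjE) simp
  note \<beta>' = \<beta>'_all[rule_format]
  define \<beta>'' where "\<beta>'' j = \<beta>' j + (case j of 0 \<Rightarrow> 0 | Suc i \<Rightarrow> \<beta>' i)" for j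
  have J: "ideal ?J (series_ring c ?V)" by (rule pullback_ideal[OF I]) auto
  have J': "ideal ?J' (series_ring c (insert w ?V))" by (rule pullback_ideal[OF I]) auto
  note J0 = pullback_constant_term[OF I0, of c ?V U] pullback_constant_term[OF I0, of c "insert w ?V" U]
  have eq: "pullback c (insert w ?V) ?V ?J = ?J'" by (rule pullback_pullback) auto
  have sV: "set (ws @ us) = ?V" "set (w # ws @ us) = insert w ?V" using d by auto
  have "koszul_dim c (w # ws @ us) (insert w ?V) ?J' j (\<beta>'' j)" for j
  proof (cases j)
    case 0
    have "\<beta>' 0 = 1"
      by (rule qdim_unique[OF sh.ksub_relbnd[OF vsub_carrier ideal_vsub[OF J]] \<beta>'
          qdim_rel_0[OF d'(1) sV(1) ideal_subset[OF J] J0(1) ideal_vsub[OF J]]])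
    then show ?thesis using qdim_rel_0[OF d'(2) sV(2) ideal_subset[OF J'] J0(2) ideal_vsub[OF J']] 0
      by (simp add: \<beta>''_def)
  next
    case (Suc i)
    show ?thesis
      using add_variable[OF d'(2) sV(1) ideal_vsub[OF J] ideal_subset[OF J] ideal_shift[OF J] \<beta>' \<beta>', of i] Suc
      unfolding eq by (simp add: \<beta>''_def)
  qed
  moreover have "gen_fun \<beta>'' = (1 + fps_X) ^ length (w # ws) * gen_fun \<beta>"
    unfolding \<beta>''_def gen_fun_bump[symmetric] gen_fun by (simp add: mult.assoc)
  ultimately show ?case by (intro exI[of _ \<beta>'']) simp
qed

text \<open>
  Each of the variables that act as zero multiplies the Poincare series by \<open>1 + t\<close>.
\<close>

theorem poincare_pullback:
  fixes I :: "('v multiset \<Rightarrow> 'k::field) set"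
  assumes V: "finite V" "U \<subseteq> V" and I: "ideal I (series_ring c U)" and I0: "\<forall>f\<in>I. f {#} = 0"
    and grI: "c = Polynomials \<Longrightarrow> \<forall>f\<in>I. \<forall>d. hcomp d f \<in> I"
  shows "gen_fun (betti c V (quotient_module (series_ring c V) (pullback c V U I)))
       = (1 + fps_X) ^ card (V - U) * gen_fun (betti c U (quotient_module (series_ring c U) I))"
proof -
  obtain us where us: "distinct us" "set us = U" using finite_distinct_list V finite_subset by metis
  obtain ws where ws: "distinct ws" "set ws = V - U" using finite_distinct_list[of "V - U"] V by auto
  have d: "distinct (ws @ us)" "set (ws @ us) = V" "set ws \<union> U = V" using us ws V by auto
  have J: "ideal (pullback c V U I) (series_ring c V)" by (rule pullback_ideal[OF I V(2)])
  have b: "koszul_dim c us U I j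
      (betti c U (quotient_module (series_ring c U) I) j)" for j
    by (rule betti_quotient[OF us I I0 grI])
  obtain \<beta> where \<beta>: "\<forall>j. koszul_dim c (ws @ us) V (pullback c V U I) j (\<beta> j)"
    and gen_fun: "gen_fun \<beta> = (1 + fps_X) ^ length ws * gen_fun (betti c U (quotient_module (series_ring c U) I))"
    using qdim_add_variables[OF d(1) us(2) I I0 b] unfolding d(3) by (elim exE conjE) simp
  have "\<beta> = betti c V (quotient_module (series_ring c V) (pullback c V U I))"
  proof
    fix j
    show "\<beta> j = betti c V (quotient_module (series_ring c V) (pullback c V U I)) j"
      by (rule qdim_unique[OF sh.ksub_relbnd[OF vsub_carrier ideal_vsub[OF J]] \<beta>[rule_format]
          betti_quotient[OF d(1,2) J pullback_constant_term[OF I0] hcomp_pullback[OF grI]]])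
  qed
  then show ?thesis using gen_fun ws distinct_card[OF ws(1)] by simp
qed

lemma zero_ideal: "ideal {0} (series_ring c V)"
proof -
  interpret cring "series_ring c V :: ('a multiset \<Rightarrow> 'b) ring" by (rule cring_series)
  show ?thesis using zeroideal by simp
qed

lemma hcomp_zero_ideal: "\<forall>f\<in>{0}. \<forall>d. hcomp d f \<in> {0}"
  by (simp add: hcomp_simps)

text \<open>
  The Koszul complex of the ring itself is acyclic.
\<close>

lemma poincare_zero_ideal:
  assumes U: "finite U"
  shows "gen_fun (betti c U (quotient_module (series_ring c U) {0 :: 'v multiset \<Rightarrow> 'k::field})) = 1"
proof -
  let ?C = "series_carrier c U :: ('v multiset \<Rightarrow> 'k) set"
  let ?b = "betti c U (quotient_module (series_ring c U) {0 :: 'v multiset \<Rightarrow> 'k})"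
  obtain us where us: "distinct us" "set us = U" using finite_distinct_list[OF U] by blast
  note I = zero_ideal[of c U, where ?'b = 'k]
  have I0: "\<forall>f\<in>{0 :: 'v multiset \<Rightarrow> 'k}. f {#} = 0" by (simp add: zero_fun_apply)
  have b: "qdim (sh.relcyc us ?C {0} j) (sh.relbnd us ?C {0} j) (?b j)" for j
    by (rule betti_quotient[OF us I I0 hcomp_zero_ideal])
  have k: "ksub (sh.relbnd us ?C {0} j)" for j by (rule sh.ksub_relbnd[OF vsub_carrier ideal_vsub[OF I]])
  have 0: "?b 0 = 1" by (rule qdim_unique[OF k b qdim_rel_0[OF us ideal_subset[OF I] I0 ideal_vsub[OF I]]])
  have S: "?b (Suc j) = 0" for j
  proof -
    have "sh.relcyc us ?C {0} (Suc j) \<subseteq> sh.relbnd us ?C {0} (Suc j)"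
    proof
      fix z assume z: "z \<in> sh.relcyc us ?C {0} (Suc j)"
      then have "z \<in> chains us ?C (Suc j)" "kd shift us z = 0" by (auto simp: sh.relcyc_def chain_eq_iff zero_chain_apply)
      with acyclic_carrier[OF us(1), of U] us(2) obtain w where w: "w \<in> chains us ?C (Suc (Suc j))" "kd shift us w = z"
        using sh.acyclicD[of us ?C z j] by auto
      have "0 + kd shift us w \<in> sh.relbnd us ?C {0} (Suc j)"
        by (rule sh.relbndI[OF _ w(1)]) (simp add: chains_def zero_chain_apply)
      then show "z \<in> sh.relbnd us ?C {0} (Suc j)" using w(2) by simp
    qed
    moreover have "sh.relbnd us ?C {0} (Suc j) \<subseteq> sh.relcyc us ?C {0} (Suc j)"
      by (rule sh.relbnd_sub_relcyc[OF us(1)]) (use us I in \<open>auto intro!: opsub_carrier ideal_opsub simp: vsub_0[OF vsub_carrier]\<close>)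
    ultimately have "sh.relcyc us ?C {0} (Suc j) = sh.relbnd us ?C {0} (Suc j)" by blast
    then show ?thesis using qdim_unique[OF k b, of "Suc j" 0] qdim_refl[OF k] by simp
  qed
  show ?thesis
  proof (rule fps_ext)
    fix j show "fps_nth (gen_fun ?b) j = fps_nth 1 j" using 0 S by (cases j) auto
  qed
qed

section \<open>Poincare series of fiber products\<close>

lemma one_plus_X_power_nth: "fps_nth ((1 + fps_X) ^ n) k = (of_nat (n choose k) :: rat)"
  using fps_binomial_of_nat[of n, where ?'a = rat] by (simp flip: fps_binomial_of_nat add: binomial_gbinomial)

text \<open>
  A nonempty set of variables lies in \<open>U\<close>, or in \<open>W\<close>, or meets both.
\<close>

lemma subsets_meeting_both:
  fixes U W :: "'v set"
  assumes U: "finite U" and W: "finite W" and disj: "U \<inter> W = {}"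
  defines "q \<equiv> \<lambda>j. card {\<sigma>. \<sigma> \<subseteq> U \<union> W \<and> card \<sigma> = j \<and> \<sigma> \<inter> U \<noteq> {} \<and> \<sigma> \<inter> W \<noteq> {}}"
  shows "gen_fun q = ((1 + fps_X) ^ card U - 1) * ((1 + fps_X) ^ card W - 1)" and "q 0 = 0" and "q (Suc 0) = 0"
    and "0 < j \<Longrightarrow> q j + (card U choose j) + (card W choose j) = (card U + card W) choose j"
proof -
  define B where "B j = {\<sigma>. \<sigma> \<subseteq> U \<union> W \<and> card \<sigma> = j \<and> \<sigma> \<inter> U \<noteq> {} \<and> \<sigma> \<inter> W \<noteq> {}}" for j
  have q: "q j = card (B j)" for j by (simp add: q_def B_def)
  have fin: "finite \<sigma>" if "\<sigma> \<subseteq> U \<union> W" for \<sigma> using that U W finite_subset by blast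
  have "B 0 = {}" using fin by (auto simp: B_def)
  then show q0: "q 0 = 0" by (simp add: q)
  have "B (Suc 0) = {}" using disj by (auto simp: B_def card_Suc_eq)
  then show "q (Suc 0) = 0" by (simp add: q)
  have split: "q j + (card U choose j) + (card W choose j) = (card U + card W) choose j" if j: "0 < j" for j
  proof -
    let ?all = "{\<sigma>. \<sigma> \<subseteq> U \<union> W \<and> card \<sigma> = j}" and ?U = "{\<sigma>. \<sigma> \<subseteq> U \<and> card \<sigma> = j}" and ?W = "{\<sigma>. \<sigma> \<subseteq> W \<and> card \<sigma> = j}"
    have fa: "finite ?all" using U W by (intro finite_subset[of ?all "Pow (U \<union> W)"]) auto
    have BUW: "B j \<subseteq> ?all" "?U \<subseteq> ?all" "?W \<subseteq> ?all" by (auto simp: B_def)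
    have dU: "?U \<inter> ?W = {}"
    proof -
      have False if "\<sigma> \<subseteq> U" "\<sigma> \<subseteq> W" "card \<sigma> = j" for \<sigma>
      proof -
        have "\<sigma> \<subseteq> U \<inter> W" using that by blast
        then show False using that j disj by simp
      qed
      then show ?thesis by blast
    qed
    have dB: "B j \<inter> (?U \<union> ?W) = {}" using disj by (auto simp: B_def)
    have "?all = B j \<union> (?U \<union> ?W)" by (auto simp: B_def)
    moreover have "finite (B j)" "finite ?U" "finite ?W" using finite_subset[OF _ fa] BUW by blast+
    ultimately have "card ?all = card (B j) + (card ?U + card ?W)"
      using dU dB by (metis (no_types, lifting) card_Un_disjoint finite_Un)
    then show ?thesis using U W disj by (simp add: q n_subsets card_Un_disjoint)
  qed
  then show "0 < j \<Longrightarrow> q j + (card U choose j) + (card W choose j) = (card U + card W) choose j" .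
  show "gen_fun q = ((1 + fps_X) ^ card U - 1) * ((1 + fps_X) ^ card W - 1)"
  proof (rule fps_ext)
    fix j
    have e: "((1 + fps_X) ^ card U - 1) * ((1 + fps_X) ^ card W - 1) =
        ((1 + fps_X) ^ (card U + card W) - (1 + fps_X) ^ card U - (1 + fps_X) ^ card W + 1 :: rat fps)"
      by (simp add: algebra_simps power_add)
    show "fps_nth (gen_fun q) j = fps_nth (((1 + fps_X) ^ card U - 1) * ((1 + fps_X) ^ card W - 1)) j"
    proof (cases "j = 0")
      case False
      then have "of_nat (q j) + of_nat (card U choose j) + of_nat (card W choose j) = (of_nat ((card U + card W) choose j) :: rat)"
        using split[of j] by (simp flip: of_nat_add)
      then show ?thesis using False unfolding e by (simp add: one_plus_X_power_nth)
    qed (simp add: e one_plus_X_power_nth q0)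
  qed
qed

text \<open>
  With \<open>q\<close> as in \<open>subsets_meeting_both\<close>, the series in parentheses has coefficients \<open>q\<^sub>j\<^sub>+\<^sub>1 + q\<^sub>j\<close>: for \<open>j > 0\<close> this combines \<open>qdim_fiber\<close> with
  the count of subsets, and for \<open>j = 0\<close> both sides vanish. The statement speaks of \<open>f\<close> rather than of the fiber product, since it is also
  applied to the ring modulo the mixed products.
\<close>

theorem poincare_fiber:
  fixes I J :: "('v multiset \<Rightarrow> 'k::field) set"
  assumes U: "finite U" and W: "finite W" and disj: "U \<inter> W = {}"
    and I: "ideal I (series_ring c U)" and ordI: "\<And>f e. f \<in> I \<Longrightarrow> f e \<noteq> 0 \<Longrightarrow> 2 \<le> size e"
    and J: "ideal J (series_ring c W)" and ordJ: "\<And>f e. f \<in> J \<Longrightarrow> f e \<noteq> 0 \<Longrightarrow> 2 \<le> size e"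
    and vs: "distinct vs" "set vs = U \<union> W"
    and s: "\<And>j. koszul_dim c vs (U \<union> W) (pullback c (U \<union> W) U I) j (s j)"
    and t: "\<And>j. koszul_dim c vs (U \<union> W) (pullback c (U \<union> W) W J) j (t j)"
    and f: "\<And>j. koszul_dim c vs (U \<union> W) (pullback c (U \<union> W) U I \<inter> pullback c (U \<union> W) W J) j (f j)"
  shows "fps_X * (gen_fun f - gen_fun s - gen_fun t + (1 + fps_X) ^ (card U + card W))
       = (1 + fps_X) * (((1 + fps_X) ^ card U - 1) * ((1 + fps_X) ^ card W - 1))"
proof -
  interpret two_factors c U W "U \<union> W" I J vs
    by unfold_locales (use vs disj I J ordI ordJ in \<open>auto intro: ideal_vsub ideal_shift\<close>)
  define q where "q j = card {\<sigma>. \<sigma> \<subseteq> U \<union> W \<and> card \<sigma> = j \<and> \<sigma> \<inter> U \<noteq> {} \<and> \<sigma> \<inter> W \<noteq> {}}" for j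
  note qq = subsets_meeting_both[OF U W disj, folded q_def]
  have I0: "\<forall>f\<in>I. f {#} = 0" and J0: "\<forall>f\<in>J. f {#} = 0" using ordI ordJ by force+
  have iS: "ideal (pullback c (U \<union> W) U I) (series_ring c (U \<union> W))" and iT: "ideal (pullback c (U \<union> W) W J) (series_ring c (U \<union> W))"
    by (rule pullback_ideal[OF I] pullback_ideal[OF J], simp)+
  note iF = ideal_Int[OF iS iT]
  note S0 = pullback_constant_term[OF I0, of c "U \<union> W" U] and T0 = pullback_constant_term[OF J0, of c "U \<union> W" W]
  have F0: "\<forall>f\<in>pullback c (U \<union> W) U I \<inter> pullback c (U \<union> W) W J. f {#} = 0" using S0 by blast
  have one: "s 0 = 1" "t 0 = 1" "f 0 = 1"
    by (rule qdim_unique[OF sh.ksub_relbnd[OF vsub_carrier ideal_vsub[OF iS]] s qdim_rel_0[OF vs ideal_subset[OF iS] S0 ideal_vsub[OF iS]]]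
      qdim_unique[OF sh.ksub_relbnd[OF vsub_carrier ideal_vsub[OF iT]] t qdim_rel_0[OF vs ideal_subset[OF iT] T0 ideal_vsub[OF iT]]]
      qdim_unique[OF sh.ksub_relbnd[OF vsub_carrier ideal_vsub[OF iF]] f qdim_rel_0[OF vs ideal_subset[OF iF] F0 ideal_vsub[OF iF]]])+
  have pos: "f j + (card W choose j) + (card U choose j) = s j + t j + q (Suc j)" if "0 < j" for j
    using qdim_fiber[OF s t that f] U W by (simp add: n_subsets both_def q_def)
  have "gen_fun f - gen_fun s - gen_fun t + (1 + fps_X) ^ (card U + card W) = gen_fun (\<lambda>j. q (Suc j)) + gen_fun q"
  proof (rule fps_ext)
    fix j
    show "fps_nth (gen_fun f - gen_fun s - gen_fun t + (1 + fps_X) ^ (card U + card W)) j = fps_nth (gen_fun (\<lambda>j. q (Suc j)) + gen_fun q) j"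
    proof (cases "j = 0")
      case False
      then have "of_nat (q j) + of_nat (card U choose j) + of_nat (card W choose j) = (of_nat ((card U + card W) choose j) :: rat)"
        "of_nat (f j) + of_nat (card W choose j) + of_nat (card U choose j) = of_nat (s j) + of_nat (t j) + (of_nat (q (Suc j)) :: rat)"
        using qq(4)[of j] pos[of j] by (simp_all flip: of_nat_add)
      then show ?thesis by (simp add: one_plus_X_power_nth)
    qed (simp add: one one_plus_X_power_nth qq(2,3))
  qed
  moreover have "fps_X * gen_fun (\<lambda>j. q (Suc j)) = gen_fun q"
  proof (rule fps_ext)
    fix j show "fps_nth (fps_X * gen_fun (\<lambda>j. q (Suc j))) j = fps_nth (gen_fun q) j" by (cases j) (simp_all add: qq(2))
  qed
  ultimately have "fps_X * (gen_fun f - gen_fun s - gen_fun t + (1 + fps_X) ^ (card U + card W)) = (1 + fps_X) * gen_fun q"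
    by (simp add: algebra_simps)
  then show ?thesis unfolding qq(1) .
qed

section \<open>Resolutions of ideals\<close>

lemma module_homs_free_iff:
  "f \<in> module_homs Q (free_module Q b) N \<longleftrightarrow>
     (\<forall>u\<in>{..<b} \<rightarrow>\<^sub>E carrier Q. f u \<in> carrier N) \<and>
     (\<forall>u\<in>{..<b} \<rightarrow>\<^sub>E carrier Q. \<forall>v\<in>{..<b} \<rightarrow>\<^sub>E carrier Q. f (\<lambda>l\<in>{..<b}. u l \<oplus>\<^bsub>Q\<^esub> v l) = f u \<oplus>\<^bsub>N\<^esub> f v) \<and>
     (\<forall>r\<in>carrier Q. \<forall>u\<in>{..<b} \<rightarrow>\<^sub>E carrier Q. f (\<lambda>l\<in>{..<b}. r \<otimes>\<^bsub>Q\<^esub> u l) = r \<odot>\<^bsub>N\<^esub> f u)"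
  by (auto simp: module_homs_def hom_def)

lemma ideal_module_simps [simp]:
  "carrier (ideal_module Q I) = I" "zero (ideal_module Q I) = zero Q" "add (ideal_module Q I) = add Q"
  "smult (ideal_module Q I) = mult Q" "degree_part (ideal_module Q I) = (\<lambda>d. I \<inter> homogeneous_part Q d)"
  by (simp_all add: ideal_module_def)

text \<open>
  A resolution of an ideal is spliced with \<open>I \<rightarrow> Q \<rightarrow> Q/I\<close>; minimality at the splice is the absence of constant terms in \<open>I\<close>.
\<close>

lemma resolution_of_quotient:
  fixes I :: "('v multiset \<Rightarrow> 'k::field) set"
  assumes V: "finite V" and I: "ideal I (series_ring c V)" and I0: "\<forall>f\<in>I. f {#} = 0"
    and res: "minimal_free_resolution c V (ideal_module (series_ring c V) I) b p \<phi>"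
  shows "minimal_free_resolution c V (quotient_module (series_ring c V) I) (case_nat 1 b)
     (\<lambda>u. I +>\<^bsub>series_ring c V\<^esub> u 0) (case_nat (\<lambda>u. \<lambda>l\<in>{..<1}. p u) \<phi>)"
proof -
  let ?R = "series_ring c V :: ('v multiset \<Rightarrow> 'k) ring" and ?C = "series_carrier c V :: ('v multiset \<Rightarrow> 'k) set"
  let ?\<psi> = "case_nat (\<lambda>u. \<lambda>l\<in>{..<1}. p u) \<phi>" and ?b = "case_nat 1 b :: nat \<Rightarrow> nat"
  note P = presents_quotient[OF I, unfolded presents_def]
  have IC: "I \<subseteq> ?C" by (rule ideal_subset[OF I])
  have fr: "free_resolution ?R (ideal_module ?R I) b p \<phi>" and min: "minimal_complex ?R (variable_ideal c V V) b \<phi>"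
    and gr: "c = Polynomials \<Longrightarrow> \<exists>s. graded_complex ?R (ideal_module ?R I) b s p \<phi>"
    using res by (auto simp: minimal_free_resolution_def Let_def)
  note ex = free_resolution_exact[OF fr]
  note p = module_homs_free[OF ex(1)]
  have p_im: "p ` ({..<b 0} \<rightarrow>\<^sub>E ?C) = I" using ex(3) by simp
  have ker: "a_kernel (free_module ?R 1) (quotient_module ?R I) (\<lambda>u. I +>\<^bsub>?R\<^esub> u 0) = {u \<in> {..<1::nat} \<rightarrow>\<^sub>E ?C. u 0 \<in> I}"
    using P by (auto simp: a_kernel_def' PiE_iff)
  have "free_resolution ?R (quotient_module ?R I) ?b (\<lambda>u. I +>\<^bsub>?R\<^esub> u 0) ?\<psi>"
    unfolding free_resolution_def
  proof (intro conjI allI)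
    show "(\<lambda>u. I +>\<^bsub>?R\<^esub> u 0) \<in> module_homs ?R (free_module ?R (?b 0)) (quotient_module ?R I)"
      using P by (auto simp: module_homs_free_iff PiE_iff)
    show "?\<psi> i \<in> module_homs ?R (free_module ?R (?b (Suc i))) (free_module ?R (?b i))" for i
    proof (cases i)
      case 0
      have "p u \<in> ?C" if "u \<in> {..<b 0} \<rightarrow>\<^sub>E ?C" for u using p(1)[of u] that IC by auto
      then show ?thesis using 0 p(2,3) by (auto simp: module_homs_free_iff restrict_def fun_eq_iff)
    qed (use ex(2) in simp)
    show "(\<lambda>u. I +>\<^bsub>?R\<^esub> u 0) ` carrier (free_module ?R (?b 0)) = carrier (quotient_module ?R I)"
    proof -
      have "(\<lambda>u. u 0) ` ({..<1::nat} \<rightarrow>\<^sub>E ?C) = ?C"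
        by (auto simp: PiE_iff intro!: image_eqI[of _ "\<lambda>u. u 0" "\<lambda>l\<in>{..<1}. _"])
      then have "(\<lambda>u. I +>\<^bsub>?R\<^esub> u 0) ` ({..<1::nat} \<rightarrow>\<^sub>E ?C) = (\<lambda>r. I +>\<^bsub>?R\<^esub> r) ` ?C"
        by (subst image_image[of "\<lambda>r. I +>\<^bsub>?R\<^esub> r" "\<lambda>u. u 0", symmetric]) (rule arg_cong)
      then show ?thesis using P by simp
    qed
    show "?\<psi> 0 ` carrier (free_module ?R (?b 1)) = a_kernel (free_module ?R (?b 0)) (quotient_module ?R I) (\<lambda>u. I +>\<^bsub>?R\<^esub> u 0)"
    proof -
      have "(\<lambda>f. \<lambda>l\<in>{..<1::nat}. f) ` I = {u \<in> {..<1::nat} \<rightarrow>\<^sub>E ?C. u 0 \<in> I}"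
      proof (intro Set.set_eqI iffI)
        fix u assume u: "u \<in> {u \<in> {..<1::nat} \<rightarrow>\<^sub>E ?C. u 0 \<in> I}"
        then have "u = (\<lambda>l\<in>{..<1}. u 0)" by (auto simp: PiE_iff extensional_def fun_eq_iff)
        then show "u \<in> (\<lambda>f. \<lambda>l\<in>{..<1::nat}. f) ` I" using u by blast
      qed (use IC in auto)
      then have "(\<lambda>u. \<lambda>l\<in>{..<1}. p u) ` ({..<b 0} \<rightarrow>\<^sub>E ?C) = {u \<in> {..<1::nat} \<rightarrow>\<^sub>E ?C. u 0 \<in> I}"
        unfolding p_im[symmetric] by (simp add: image_image)
      then show ?thesis by (simp add: ker[simplified])
    qed
    show "?\<psi> (Suc i) ` carrier (free_module ?R (?b (Suc (Suc i)))) = a_kernel (free_module ?R (?b (Suc i))) (free_module ?R (?b i)) (?\<psi> i)" for i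
    proof (cases i)
      case 0
      have "a_kernel (free_module ?R (b 0)) (ideal_module ?R I) p = a_kernel (free_module ?R (b 0)) (free_module ?R 1) (\<lambda>u. \<lambda>l\<in>{..<1}. p u)"
        by (auto simp: a_kernel_def' fun_eq_iff restrict_def)
      then show ?thesis using ex(4) 0 by simp
    qed (use ex(5) in simp)
  qed
  moreover have "minimal_complex ?R (variable_ideal c V V) ?b ?\<psi>"
    unfolding minimal_complex_def
  proof
    show "?\<psi> i ` carrier (free_module ?R (?b (Suc i))) \<subseteq> {..<?b i} \<rightarrow>\<^sub>E variable_ideal c V V" for i
    proof (cases i)
      case 0
      have "I \<subseteq> variable_ideal c V V" using IC I0 by (auto simp: maximal_ideal_eq[OF V])
      then show ?thesis using 0 p_im by auto
    qed (use min in \<open>simp add: minimal_complex_def\<close>)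
  qed
  moreover have "\<exists>s. graded_complex ?R (quotient_module ?R I) ?b s (\<lambda>u. I +>\<^bsub>?R\<^esub> u 0) ?\<psi>" if c: "c = Polynomials"
  proof -
    obtain s where s: "graded_complex ?R (ideal_module ?R I) b s p \<phi>" using gr[OF c] by blast
    have "graded_complex ?R (quotient_module ?R I) ?b (case_nat (\<lambda>_. 0) s) (\<lambda>u. I +>\<^bsub>?R\<^esub> u 0) ?\<psi>"
      unfolding graded_complex_def
    proof (intro conjI allI)
      fix d
      show "(\<lambda>u. I +>\<^bsub>?R\<^esub> u 0) ` free_part ?R (?b 0) (case_nat (\<lambda>_. 0) s 0) d \<subseteq> degree_part (quotient_module ?R I) d"
        by (auto simp: free_part_def PiE_iff intro!: subsetD[OF quotient_degree])
      show "?\<psi> i ` free_part ?R (?b (Suc i)) (case_nat (\<lambda>_. 0) s (Suc i)) d \<subseteq> free_part ?R (?b i) (case_nat (\<lambda>_. 0) s i) d" for i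
      proof (cases i)
        case 0
        have "p ` free_part ?R (b 0) (s 0) d \<subseteq> homogeneous_part ?R d" using s by (simp add: graded_complex_def)
        then have "p u \<in> homogeneous_part ?R d" if "u \<in> free_part ?R (b 0) (s 0) d" for u using that by blast
        then have "(\<lambda>l\<in>{..<1}. p u) \<in> free_part ?R 1 (\<lambda>_. 0) d" if "u \<in> free_part ?R (b 0) (s 0) d" for u
          using that unfolding free_part_def[of ?R 1] by simp
        then show ?thesis using 0 by auto
      qed (use s in \<open>simp add: graded_complex_def\<close>)
    qed
    then show ?thesis by (rule exI[of _ "case_nat (\<lambda>_. 0) s"])
  qed
  ultimately show ?thesis by (simp add: minimal_free_resolution_def Let_def)
qed

text \<open>
  Conversely the first term is removed. The rank there is \<open>1\<close>, but its basis vector may have any degree \<open>s 0 0\<close>, which is subtracted from the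
  other degrees.
\<close>

lemma resolution_of_ideal:
  fixes I :: "('v multiset \<Rightarrow> 'k::field) set"
  assumes V: "finite V" and I: "ideal I (series_ring c V)" and I0: "\<forall>f\<in>I. f {#} = 0"
    and res: "minimal_free_resolution c V (quotient_module (series_ring c V) I) b p \<phi>"
  shows "minimal_free_resolution c V (ideal_module (series_ring c V) I) (\<lambda>i. b (Suc i)) (\<lambda>u. \<phi> 0 u 0) (\<lambda>i. \<phi> (Suc i))"
proof -
  let ?R = "series_ring c V :: ('v multiset \<Rightarrow> 'k) ring" and ?C = "series_carrier c V :: ('v multiset \<Rightarrow> 'k) set"
  have fr: "free_resolution ?R (quotient_module ?R I) b p \<phi>" and min: "minimal_complex ?R (variable_ideal c V V) b \<phi>"
    and gr: "c = Polynomials \<Longrightarrow> \<exists>s. graded_complex ?R (quotient_module ?R I) b s p \<phi>"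
    using res by (auto simp: minimal_free_resolution_def Let_def)
  note ex = free_resolution_exact[OF fr]
  note start = presented_resolution_start[OF V presents_quotient[OF I] I0 fr min]
  have im: "\<phi> 0 ` ({..<b 1} \<rightarrow>\<^sub>E ?C) = {u \<in> {..<1::nat} \<rightarrow>\<^sub>E ?C. u 0 \<in> I}" using ex(4) start(2) by simp
  have h: "\<phi> 0 \<in> module_homs ?R (free_module ?R (b 1)) (free_module ?R 1)" using ex(2)[of 0] start(1) by simp
  have "(\<lambda>u. u 0) ` {u \<in> {..<1::nat} \<rightarrow>\<^sub>E ?C. u 0 \<in> I} = I"
    using ideal_subset[OF I] by (auto simp: PiE_iff intro!: image_eqI[of _ "\<lambda>u. u 0" "\<lambda>l\<in>{..<1}. _"])
  then have imI: "(\<lambda>u. \<phi> 0 u 0) ` ({..<b 1} \<rightarrow>\<^sub>E ?C) = I" unfolding im[symmetric] image_image .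
  have "free_resolution ?R (ideal_module ?R I) (\<lambda>i. b (Suc i)) (\<lambda>u. \<phi> 0 u 0) (\<lambda>i. \<phi> (Suc i))"
    unfolding free_resolution_def
  proof (intro conjI allI)
    have "\<phi> 0 u 0 \<in> I" if "u \<in> {..<b 1} \<rightarrow>\<^sub>E ?C" for u using imI that by blast
    then show "(\<lambda>u. \<phi> 0 u 0) \<in> module_homs ?R (free_module ?R (b (Suc 0))) (ideal_module ?R I)"
      using h unfolding module_homs_free_iff by simp
    show "(\<lambda>u. \<phi> 0 u 0) ` carrier (free_module ?R (b (Suc 0))) = carrier (ideal_module ?R I)" using imI by simp
    show "\<phi> (Suc 0) ` carrier (free_module ?R (b (Suc 1))) = a_kernel (free_module ?R (b (Suc 0))) (ideal_module ?R I) (\<lambda>u. \<phi> 0 u 0)"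
    proof -
      have "\<phi> 0 u = (\<lambda>l\<in>{..<1}. 0) \<longleftrightarrow> \<phi> 0 u 0 = 0" if "u \<in> {..<b 1} \<rightarrow>\<^sub>E ?C" for u
      proof -
        have "\<phi> 0 u \<in> {..<1} \<rightarrow>\<^sub>E ?C" using im that by blast
        then show ?thesis by (auto simp: PiE_iff extensional_def fun_eq_iff)
      qed
      then have "a_kernel (free_module ?R (b 1)) (free_module ?R (b 0)) (\<phi> 0) = a_kernel (free_module ?R (b 1)) (ideal_module ?R I) (\<lambda>u. \<phi> 0 u 0)"
        by (auto simp: a_kernel_def' start(1))
      then show ?thesis using ex(5)[of 0] by simp
    qed
  qed (use ex(2,5) in auto)
  moreover have "minimal_complex ?R (variable_ideal c V V) (\<lambda>i. b (Suc i)) (\<lambda>i. \<phi> (Suc i))"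
    using min by (simp add: minimal_complex_def)
  moreover have "\<exists>s. graded_complex ?R (ideal_module ?R I) (\<lambda>i. b (Suc i)) s (\<lambda>u. \<phi> 0 u 0) (\<lambda>i. \<phi> (Suc i))" if c: "c = Polynomials"
  proof -
    obtain s where s: "graded_complex ?R (quotient_module ?R I) b s p \<phi>" using gr[OF c] by blast
    let ?s = "\<lambda>i l. s (Suc i) l - s 0 0"
    have fp: "free_part ?R (b (Suc i)) (?s i) d = free_part ?R (b (Suc i)) (s (Suc i)) (d + s 0 0)" for i d
      by (simp add: free_part_def algebra_simps)
    have "graded_complex ?R (ideal_module ?R I) (\<lambda>i. b (Suc i)) ?s (\<lambda>u. \<phi> 0 u 0) (\<lambda>i. \<phi> (Suc i))"
      unfolding graded_complex_def
    proof (intro conjI allI)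
      fix d
      show "(\<lambda>u. \<phi> 0 u 0) ` free_part ?R (b (Suc 0)) (?s 0) d \<subseteq> degree_part (ideal_module ?R I) d"
      proof (rule image_subsetI)
        fix u assume u: "u \<in> free_part ?R (b (Suc 0)) (?s 0) d"
        then have "u \<in> {..<b 1} \<rightarrow>\<^sub>E ?C" by (auto simp: free_part_def homogeneous_part_def PiE_iff)
        then have "\<phi> 0 u 0 \<in> I" using imI by blast
        moreover have "\<phi> 0 u \<in> free_part ?R (b 0) (s 0) (d + s 0 0)"
          using s u unfolding fp graded_complex_def by blast
        ultimately show "\<phi> 0 u 0 \<in> degree_part (ideal_module ?R I) d" by (auto simp: free_part_def start(1) PiE_iff)
      qed
      show "\<phi> (Suc i) ` free_part ?R (b (Suc (Suc i))) (?s (Suc i)) d \<subseteq> free_part ?R (b (Suc i)) (?s i) d" for i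
        using s unfolding fp graded_complex_def by blast
    qed
    then show ?thesis by (rule exI[of _ ?s])
  qed
  ultimately show ?thesis by (simp add: minimal_free_resolution_def Let_def)
qed

theorem betti_ideal_module:
  fixes I :: "('v multiset \<Rightarrow> 'k::field) set"
  assumes V: "finite V" and I: "ideal I (series_ring c V)" and I0: "\<forall>f\<in>I. f {#} = 0"
    and grI: "c = Polynomials \<Longrightarrow> \<forall>f\<in>I. \<forall>d. hcomp d f \<in> I"
  shows "betti c V (ideal_module (series_ring c V) I) i = betti c V (quotient_module (series_ring c V) I) (Suc i)"
proof -
  let ?M = "quotient_module (series_ring c V) I" and ?N = "ideal_module (series_ring c V) I"
  obtain vs where vs: "distinct vs" "set vs = V" using finite_distinct_list[OF V] by blast
  have gr: "c = Polynomials \<Longrightarrow> \<forall>d. (\<lambda>r. I +>\<^bsub>series_ring c V\<^esub> r) ` homogeneous_part (series_ring c V) d \<subseteq> degree_part ?M d"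
    using quotient_degree by blast
  have Q: "b j = betti c V ?M j" if "minimal_free_resolution c V ?M b p \<phi>" for b p \<phi> j
    by (rule betti_koszul(2)[OF vs presents_quotient[OF I] I0 grI gr that])
  obtain b p \<phi> where res: "minimal_free_resolution c V ?M b p \<phi>"
  proof -
    have "\<exists>b p \<phi>. minimal_free_resolution c V ?M b p \<phi>"
      by (rule minimal_resolution_exists[OF V presents_quotient[OF I] I0 grI gr])
    then show thesis by (elim exE) (rule that)
  qed
  show ?thesis unfolding betti_def[of c V ?N]
  proof (rule the_equality)
    have "minimal_free_resolution c V ?N (\<lambda>i. b (Suc i)) (\<lambda>u. \<phi> 0 u 0) (\<lambda>i. \<phi> (Suc i))"
      by (rule resolution_of_ideal[OF V I I0 res])
    then show "\<exists>b p \<phi>. minimal_free_resolution c V ?N b p \<phi> \<and> b i = betti c V ?M (Suc i)"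
      using Q[OF res, of "Suc i"] by (intro exI conjI)
    fix r assume "\<exists>b p \<phi>. minimal_free_resolution c V ?N b p \<phi> \<and> b i = r"
    then obtain b' p' \<phi>' where r: "minimal_free_resolution c V ?N b' p' \<phi>'" "b' i = r" by (elim exE conjE)
    from Q[OF resolution_of_quotient[OF V I I0 r(1)], of "Suc i"] r(2) show "r = betti c V ?M (Suc i)" by simp
  qed
qed

section \<open>The ideals of the two factors\<close>

text \<open>
  Setting the variables in \<open>W\<close> to zero changes a series by an element of the ideal they generate.
\<close>

lemma extended_ideal_plus_variables:
  fixes I :: "('v multiset \<Rightarrow> 'k::field) set"
  assumes I: "ideal I (series_ring c U)" and W: "finite W" and disj: "U \<inter> W = {}" and V: "V = U \<union> W"
  shows "(Idl\<^bsub>series_ring c V\<^esub> I) <+>\<^bsub>series_ring c V\<^esub> variable_ideal c V W = pullback c V U I"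
proof -
  let ?R = "series_ring c V :: ('v multiset \<Rightarrow> 'k) ring" and ?C = "series_carrier c V :: ('v multiset \<Rightarrow> 'k) set"
  interpret R: cring ?R by (rule cring_series)
  have UV: "U \<subseteq> V" "W \<subseteq> V" using V by auto
  have IC: "I \<subseteq> ?C" using ideal_subset[OF I] carrier_mono[OF UV(1), of c] by (rule subset_trans)
  have vI: "vsub I" by (rule ideal_vsub[OF I])
  have J: "ideal (pullback c V U I) ?R" by (rule pullback_ideal[OF I UV(1)])
  have IJ: "I \<subseteq> pullback c V U I" using IC kill_id[OF subsetD[OF ideal_subset[OF I]]] by (auto simp: pullback_def)
  have 1: "Idl\<^bsub>?R\<^esub> I \<subseteq> pullback c V U I" by (rule R.genideal_minimal[OF J IJ])
  have II: "I \<subseteq> Idl\<^bsub>?R\<^esub> I" by (rule R.genideal_self) (use IC in simp)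
  note M = variable_ideal_eq[OF W UV(2), of c, where ?'k = 'k]
  have 2: "variable_ideal c V W \<subseteq> pullback c V U I"
  proof
    fix f :: "'v multiset \<Rightarrow> 'k" assume f: "f \<in> variable_ideal c V W"
    have "kill_outside U f e = 0" for e using f disj by (auto simp: M kill_outside_def)
    then have "kill_outside U f = 0" by (simp add: fun_eq_iff zero_fun_apply)
    then show "f \<in> pullback c V U I" using f vsub_0[OF vI] by (simp add: M pullback_def)
  qed
  show ?thesis
  proof (intro equalityI subsetI)
    fix f assume "f \<in> (Idl\<^bsub>?R\<^esub> I) <+>\<^bsub>?R\<^esub> variable_ideal c V W"
    then obtain a b where "a \<in> Idl\<^bsub>?R\<^esub> I" "b \<in> variable_ideal c V W" "f = a + b" by (auto simp: set_add_def')
    then show "f \<in> pullback c V U I" using 1 2 vsub_add[OF ideal_vsub[OF J]] by blast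
  next
    fix f assume f: "f \<in> pullback c V U I"
    let ?g = "f - kill_outside U f"
    have kI: "kill_outside U f \<in> I" and fC: "f \<in> ?C" using f by (simp_all add: pullback_def)
    have "set_mset e \<inter> W \<noteq> {}" if "?g e \<noteq> 0" for e
    proof -
      have "\<not> set_mset e \<subseteq> U" "f e \<noteq> 0" using that by (auto simp: kill_outside_def minus_apply split: if_splits)
      then show ?thesis using carrierD(1)[OF fC, of e] V by blast
    qed
    moreover have "?g \<in> ?C" using vsub_diff[OF vsub_carrier fC, of "kill_outside U f"] IC kI by blast
    ultimately have "?g \<in> variable_ideal c V W" by (simp add: M)
    moreover have "f = kill_outside U f + ?g" by simp
    ultimately show "f \<in> (Idl\<^bsub>?R\<^esub> I) <+>\<^bsub>?R\<^esub> variable_ideal c V W" using kI II unfolding set_add_def' by force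
  qed
qed

lemma set_add_series_commute: "A <+>\<^bsub>series_ring c V\<^esub> B = B <+>\<^bsub>series_ring c V\<^esub> A"
  by (auto simp: set_add_def' add.commute)

lemma maximal_ideal_pullback:
  assumes "finite V" shows "variable_ideal c V V = pullback c V {} {0}"
  unfolding maximal_ideal_eq[OF assms] by (auto simp: pullback_def kill_outside_def fun_eq_iff zero_fun_apply)

text \<open>
  Both ideals consist of the series all of whose monomials involve variables from \<open>U\<close> and from \<open>W\<close>. To write such a series in terms of the
  generators, variables from \<open>U\<close> are split off first, and then from the cofactors variables from \<open>W\<close>.
\<close>

lemma mixed_products_ideal:
  fixes U W :: "'v set"
  assumes U: "finite U" and W: "finite W" and disj: "U \<inter> W = {}" and V: "V = U \<union> W"
  shows "Idl\<^bsub>series_ring c V\<^esub> {variable v \<otimes>\<^bsub>series_ring c V\<^esub> variable w | v w. v \<in> U \<and> w \<in> W}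
       = pullback c V U {0} \<inter> pullback c V W {0 :: 'v multiset \<Rightarrow> 'k::field}" (is "Idl\<^bsub>_\<^esub> ?G = ?K")
proof -
  let ?R = "series_ring c V :: ('v multiset \<Rightarrow> 'k) ring" and ?C = "series_carrier c V :: ('v multiset \<Rightarrow> 'k) set"
  interpret R: cring ?R by (rule cring_series)
  have UV: "U \<subseteq> V" "W \<subseteq> V" using V by auto
  have K: "ideal ?K ?R" by (intro ideal_Int pullback_ideal zero_ideal UV)
  have GC: "?G \<subseteq> ?C" using UV by (auto intro!: conv_carrier variable_carrier)
  have G: "?G \<subseteq> ?K"
  proof
    fix g assume g: "g \<in> ?G"
    then obtain v w where vw: "v \<in> U" "w \<in> W" "g = shift v (variable w)" by (auto simp: conv_variable)
    have "kill_outside U (variable w :: 'v multiset \<Rightarrow> 'k) = 0"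
      using vw disj by (auto simp: kill_outside_def variable_def fun_eq_iff zero_fun_apply)
    moreover have "v \<notin> W" using vw disj by blast
    moreover have "shift v 0 = (0 :: 'v multiset \<Rightarrow> 'k)" by (simp add: shift_def fun_eq_iff zero_fun_apply)
    ultimately show "g \<in> ?K" using g GC vw by (auto simp: pullback_def kill_shift)
  qed
  have I: "ideal (Idl\<^bsub>?R\<^esub> ?G) ?R" by (rule R.genideal_ideal) (use GC in simp)
  have GI: "?G \<subseteq> Idl\<^bsub>?R\<^esub> ?G" by (rule R.genideal_self) (use GC in simp)
  show ?thesis
  proof (intro equalityI R.genideal_minimal[OF K G])
    show "?K \<subseteq> Idl\<^bsub>?R\<^esub> ?G"
    proof
      fix f assume f: "f \<in> ?K"
      have fC: "f \<in> ?C" using f by (simp add: pullback_def)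
      have meet: "set_mset e \<inter> U \<noteq> {} \<and> set_mset e \<inter> W \<noteq> {}" if e: "f e \<noteq> 0" for e
      proof -
        have "kill_outside U f e = 0" "kill_outside W f e = 0" using f by (auto simp: pullback_def zero_fun_apply)
        then have "\<not> set_mset e \<subseteq> U" "\<not> set_mset e \<subseteq> W" using e by (auto simp: kill_outside_def split: if_splits)
        then show ?thesis using carrierD(1)[OF fC e] V by blast
      qed
      obtain g where g: "\<And>u. u \<in> U \<Longrightarrow> g u \<in> ?C" "\<And>u e. u \<in> U \<Longrightarrow> g u e \<noteq> 0 \<Longrightarrow> f (add_mset u e) \<noteq> 0"
        "f = (\<Sum>u\<in>U. shift u (g u))"
        using decompose_support[OF U UV(1) fC] meet by metis
      have "shift u (g u) \<in> Idl\<^bsub>?R\<^esub> ?G" if u: "u \<in> U" for u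
      proof -
        have mW: "set_mset e \<inter> W \<noteq> {}" if "g u e \<noteq> 0" for e
          using meet[OF g(2)[OF u that]] u disj by auto
        obtain h where h: "\<And>w. w \<in> W \<Longrightarrow> h w \<in> ?C" "g u = (\<Sum>w\<in>W. shift w (h w))"
          using decompose_support[OF W UV(2) g(1)[OF u] mW] by metis
        have "shift u (g u) = conv (variable u) (g u)" by (simp add: conv_variable)
        also have "\<dots> = (\<Sum>w\<in>W. conv (variable u) (shift w (h w)))" by (simp only: h(2) conv_sum)
        also have "\<dots> \<in> Idl\<^bsub>?R\<^esub> ?G"
        proof (rule vsub_sum[OF ideal_vsub[OF I]])
          fix w assume w: "w \<in> W"
          have C: "variable u \<in> ?C" "variable w \<in> ?C" using u w UV by (auto intro!: variable_carrier)
          have "conv (variable u) (variable w) \<in> Idl\<^bsub>?R\<^esub> ?G" using u w GI by auto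
          then have "conv (h w) (conv (variable u) (variable w)) \<in> Idl\<^bsub>?R\<^esub> ?G" using I h(1)[OF w] unfolding ideal_series_iff by blast
          moreover have "conv (h w) (conv (variable u) (variable w)) = conv (variable u) (shift w (h w))"
            using R.m_comm[of "h w" "conv (variable u) (variable w)"] R.m_assoc[of "variable u" "variable w" "h w"] C h(1)[OF w]
            by (simp add: conv_carrier flip: conv_variable)
          ultimately show "conv (variable u) (shift w (h w)) \<in> Idl\<^bsub>?R\<^esub> ?G" by simp
        qed
        finally show ?thesis .
      qed
      then show "f \<in> Idl\<^bsub>?R\<^esub> ?G" unfolding g(3) by (rule vsub_sum[OF ideal_vsub[OF I]])
    qed
  qed
qed

text \<open>
  An element of the ideal of the variables in \<open>U\<close> has terms of positive degree only.
\<close>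

lemma square_order:
  fixes f :: "'v multiset \<Rightarrow> 'k::field"
  assumes U: "finite U" "U \<subseteq> V" and f: "f \<in> variable_ideal c V U \<cdot>\<^bsub>series_ring c V\<^esub> variable_ideal c V U" and e: "f e \<noteq> 0"
  shows "2 \<le> size e"
  using f e
proof (induction f arbitrary: e rule: ideal_prod.induct)
  case (prod f g)
  have s: "0 < size a" if "h \<in> variable_ideal c V U" "h a \<noteq> 0" for h :: "'v multiset \<Rightarrow> 'k" and a
    using that by (auto simp: variable_ideal_eq[OF U])
  obtain a where a: "a \<subseteq># e" "f a \<noteq> 0" "g (e - a) \<noteq> 0" using prod.prems conv_nonzero by fastforce
  then have "0 < size a" "0 < size (e - a)" using s prod.hyps by blast+
  moreover have "size e = size a + size (e - a)" using a(1) by (metis size_union subset_mset.add_diff_inverse)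
  ultimately show ?case by simp
next
  case (sum f g)
  then have "f e \<noteq> 0 \<or> g e \<noteq> 0" by (auto simp: plus_fun_apply)
  then show ?case using sum.IH by blast
qed

section \<open>The two identities\<close>

lemma poincare_series_gen_fun: "poincare_series c V M = fps_to_fls (gen_fun (betti c V M))"
  by (simp add: poincare_series_def gen_fun_def)

lemma gen_fun_betti_ideal:
  fixes I :: "('v multiset \<Rightarrow> 'k::field) set"
  assumes V: "finite V" and I: "ideal I (series_ring c V)" and I0: "\<forall>f\<in>I. f {#} = 0"
    and grI: "c = Polynomials \<Longrightarrow> \<forall>f\<in>I. \<forall>d. hcomp d f \<in> I"
  shows "gen_fun (betti c V (quotient_module (series_ring c V) I)) = 1 + fps_X * gen_fun (betti c V (ideal_module (series_ring c V) I))"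
proof -
  let ?b = "betti c V (quotient_module (series_ring c V) I)"
  obtain vs where vs: "distinct vs" "set vs = V" using finite_distinct_list[OF V] by blast
  have "?b 0 = 1"
    by (rule qdim_unique[OF sh.ksub_relbnd[OF vsub_carrier ideal_vsub[OF I]] betti_quotient[OF vs I I0 grI]
          qdim_rel_0[OF vs ideal_subset[OF I] I0 ideal_vsub[OF I]]])
  moreover have "betti c V (ideal_module (series_ring c V) I) i = ?b (Suc i)" for i
    by (rule betti_ideal_module[OF V I I0 grI])
  ultimately show ?thesis by (intro fps_ext) (simp split: nat.split add: fps_X_mult_nth gr0_conv_Suc)
qed

text \<open>
  For \<open>I = J = {0}\<close> the second equation determines the Betti numbers of the ring modulo the mixed products.
\<close>

theorem poincare_fiber_product:
  fixes I J :: "('v multiset \<Rightarrow> 'k::field) set"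
  assumes U: "finite U" and W: "finite W" and disj: "U \<inter> W = {}" and V: "V = U \<union> W"
    and I: "ideal I (series_ring c U)" and ordI: "\<And>f e. f \<in> I \<Longrightarrow> f e \<noteq> 0 \<Longrightarrow> 2 \<le> size e"
    and J: "ideal J (series_ring c W)" and ordJ: "\<And>f e. f \<in> J \<Longrightarrow> f e \<noteq> 0 \<Longrightarrow> 2 \<le> size e"
    and grI: "c = Polynomials \<Longrightarrow> \<forall>f\<in>I. \<forall>d. hcomp d f \<in> I" and grJ: "c = Polynomials \<Longrightarrow> \<forall>f\<in>J. \<forall>d. hcomp d f \<in> J"
  defines "K \<equiv> pullback c V U I \<inter> pullback c V W J"
  defines "rhs \<equiv> (1 + fps_X) * (((1 + fps_X) ^ card U - 1) * ((1 + fps_X) ^ card W - 1))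
      - fps_X * ((1 + fps_X) ^ (card U + card W) - gen_fun (betti c V (quotient_module (series_ring c V) (pullback c V U I)))
        - gen_fun (betti c V (quotient_module (series_ring c V) (pullback c V W J))))"
  shows "fps_X * gen_fun (betti c V (fiber_product c U W I J)) = rhs"
    and "fps_X * gen_fun (betti c V (quotient_module (series_ring c V) K)) = rhs"
proof -
  have fin: "finite V" and UV: "U \<subseteq> V" "W \<subseteq> V" using U W V by auto
  obtain vs where vs: "distinct vs" "set vs = V" using finite_distinct_list[OF fin] by blast
  have I0: "\<forall>f\<in>I. f {#} = 0" and J0: "\<forall>f\<in>J. f {#} = 0" using ordI ordJ by force+
  have iS: "ideal (pullback c V U I) (series_ring c V)" and iT: "ideal (pullback c V W J) (series_ring c V)"
    by (rule pullback_ideal[OF I UV(1)] pullback_ideal[OF J UV(2)])+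
  have iK: "ideal K (series_ring c V)" unfolding K_def by (rule ideal_Int[OF iS iT])
  have K0: "\<forall>f\<in>K. f {#} = 0" using pullback_constant_term[OF I0, of c V U] by (auto simp: K_def)
  have hK: "\<forall>f\<in>K. \<forall>d. hcomp d f \<in> K" if "c = Polynomials"
    using hcomp_pullback[OF grI[OF that], of c V U] hcomp_pullback[OF grJ[OF that], of c V W] by (auto simp: K_def)
  note s = betti_quotient[OF vs iS pullback_constant_term[OF I0] hcomp_pullback[OF grI]]
  note t = betti_quotient[OF vs iT pullback_constant_term[OF J0] hcomp_pullback[OF grJ]]
  note main = poincare_fiber[OF U W disj I ordI J ordJ, folded V, OF _ _ _ _ vs s t]
  have f: "koszul_dim c vs V K j (betti c V (fiber_product c U W I J) j)" for j
    using betti_fiber[OF vs(1) vs(2)[unfolded V] I I0 J J0 disj grI grJ] unfolding K_def V by simp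
  have q: "koszul_dim c vs V K j (betti c V (quotient_module (series_ring c V) K) j)" for j
    by (rule betti_quotient[OF vs iK K0 hK])
  show "fps_X * gen_fun (betti c V (fiber_product c U W I J)) = rhs"
    using main[OF _ _ _ _ _ _ f[unfolded K_def]] ordI ordJ unfolding rhs_def by (simp add: algebra_simps)
  show "fps_X * gen_fun (betti c V (quotient_module (series_ring c V) K)) = rhs"
    using main[OF _ _ _ _ _ _ q[unfolded K_def]] ordI ordJ unfolding rhs_def by (simp add: K_def algebra_simps)
qed

theorem theorem1p1:
  fixes c :: ring_kind and m n :: nat
    and I' J' :: "(var multiset \<Rightarrow> 'k::field) set"
    and t :: "rat fls"
  assumes m: "m \<ge> 1" and n: "n \<ge> 1"
    and xs: "xs = X ` {1..m}" and ys: "ys = Y ` {1..n}"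
    and A: "A = series_ring c xs" and B: "B = series_ring c ys"
    and R: "R = series_ring c (xs \<union> ys)"
    and I': "ideal I' A" and J': "ideal J' B"
    and homogeneous:
      "c = Polynomials \<Longrightarrow> homogeneous_ideal I' A \<and> homogeneous_ideal J' B"
    and II: "II = Idl\<^bsub>R\<^esub> I'" and JJ: "JJ = Idl\<^bsub>R\<^esub> J'"
    and MA: "MA = variable_ideal c (xs \<union> ys) xs"
    and MB: "MB = variable_ideal c (xs \<union> ys) ys"
    and MR: "MR = variable_ideal c (xs \<union> ys) (xs \<union> ys)"
    and XY: "XY = Idl\<^bsub>R\<^esub> {variable v \<otimes>\<^bsub>R\<^esub> variable w | v w. v \<in> xs \<and> w \<in> ys}"
    and II_sq: "II \<subseteq> MA \<cdot>\<^bsub>R\<^esub> MA" and JJ_sq: "JJ \<subseteq> MB \<cdot>\<^bsub>R\<^esub> MB"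
    and F: "F = fiber_product c xs ys I' J'"
    and t: "t = fls_X"
  shows
    "(poincare_series c (xs \<union> ys) F
        - poincare_series c (xs \<union> ys) (quotient_module R (II <+>\<^bsub>R\<^esub> MB))
        - poincare_series c (xs \<union> ys) (quotient_module R (MA <+>\<^bsub>R\<^esub> JJ))
        + poincare_series c (xs \<union> ys) (quotient_module R MR))
       / poincare_series c (xs \<union> ys) (ideal_module R XY)
     = t * (1 + t)
     \<and>
     (poincare_series c (xs \<union> ys) F
        - (1 + t) ^ n * poincare_series c xs (quotient_module A I')
        - (1 + t) ^ m * poincare_series c ys (quotient_module B J')
        + (1 + t) ^ (m + n))
       / (((1 + t) ^ m - 1) * ((1 + t) ^ n - 1))
     = (t + 1) / t"
proof -
  let ?V = "xs \<union> ys"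
  let ?P = "(1 + fps_X) :: rat fps"
  define Q where "Q = (?P ^ m - 1) * (?P ^ n - 1)"
  define f where "f = gen_fun (betti c ?V F)"
  define s where "s = gen_fun (betti c xs (quotient_module A I'))"
  define s' where "s' = gen_fun (betti c ys (quotient_module B J'))"
  define p where "p = gen_fun (betti c ?V (ideal_module R XY))"
  let ?Z = "{0 :: var multiset \<Rightarrow> 'k}"
  have fin: "finite xs" "finite ys" "finite ?V" and disj: "xs \<inter> ys = {}" and sub: "xs \<subseteq> ?V" "ys \<subseteq> ?V"
    by (auto simp: xs ys)
  have card: "card xs = m" "card ys = n" by (simp_all add: xs ys card_image inj_on_def)
  have diff: "?V - xs = ys" "?V - ys = xs" using disj by auto
  note I = I'[unfolded A] and J = J'[unfolded B]
  have gens: "I' \<subseteq> II" "J' \<subseteq> JJ"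
  proof -
    interpret R: cring R unfolding R by (rule cring_series)
    show "I' \<subseteq> II" unfolding II using ideal_subset[OF I] carrier_mono[OF sub(1), of c]
      by (intro R.genideal_self) (auto simp: R)
    show "J' \<subseteq> JJ" unfolding JJ using ideal_subset[OF J] carrier_mono[OF sub(2), of c]
      by (intro R.genideal_self) (auto simp: R)
  qed
  have ordI: "2 \<le> size e" if "g \<in> I'" "g e \<noteq> 0" for g e
    by (rule square_order[OF fin(1) sub(1), of g c]) (use that gens II_sq in \<open>auto simp: MA R\<close>)
  have ordJ: "2 \<le> size e" if "g \<in> J'" "g e \<noteq> 0" for g e
    by (rule square_order[OF fin(2) sub(2), of g c]) (use that gens JJ_sq in \<open>auto simp: MB R\<close>)
  have I0: "\<forall>g\<in>I'. g {#} = 0" and J0: "\<forall>g\<in>J'. g {#} = 0" using ordI ordJ by force+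
  have Z0: "\<forall>g\<in>?Z. g {#} = 0" by (simp add: zero_fun_apply)
  have grI: "\<forall>g\<in>I'. \<forall>d. hcomp d g \<in> I'" and grJ: "\<forall>g\<in>J'. \<forall>d. hcomp d g \<in> J'" if "c = Polynomials"
    using homogeneous[OF that] homogeneous_ideal_hcomp[of I' xs] homogeneous_ideal_hcomp[of J' ys] that by (auto simp: A B)
  have SS: "gen_fun (betti c ?V (quotient_module R (II <+>\<^bsub>R\<^esub> MB))) = ?P ^ n * s"
    unfolding II R MB extended_ideal_plus_variables[OF I fin(2) disj refl] s_def A
    by (simp add: poincare_pullback[OF fin(3) sub(1) I I0 grI] diff card)
  have TT: "gen_fun (betti c ?V (quotient_module R (MA <+>\<^bsub>R\<^esub> JJ))) = ?P ^ m * s'"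
    unfolding JJ R MA set_add_series_commute[of c ?V "variable_ideal c ?V xs"]
      extended_ideal_plus_variables[OF J fin(1) disj[unfolded Int_commute[of xs]] Un_commute] s'_def B
    by (simp add: poincare_pullback[OF fin(3) sub(2) J J0 grJ] diff card)
  have KK: "gen_fun (betti c ?V (quotient_module R MR)) = ?P ^ (m + n)"
    unfolding MR R maximal_ideal_pullback[OF fin(3)]
    using poincare_pullback[OF fin(3) empty_subsetI zero_ideal Z0 hcomp_zero_ideal, of c] poincare_zero_ideal[of "{}" c, where ?'k = 'k]
    by (simp add: card_Un_disjoint fin disj card)
  have ZZ: "gen_fun (betti c ?V (quotient_module R (pullback c ?V xs ?Z))) = ?P ^ n" "gen_fun (betti c ?V (quotient_module R (pullback c ?V ys ?Z))) = ?P ^ m"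
    using poincare_pullback[OF fin(3) sub(1) zero_ideal Z0 hcomp_zero_ideal, of c] poincare_zero_ideal[OF fin(1), of c, where ?'k = 'k]
      poincare_pullback[OF fin(3) sub(2) zero_ideal Z0 hcomp_zero_ideal, of c] poincare_zero_ideal[OF fin(2), of c, where ?'k = 'k]
    by (simp_all add: R diff card)
  have XY_eq: "XY = pullback c ?V xs ?Z \<inter> pullback c ?V ys ?Z"
    unfolding XY R by (rule mixed_products_ideal[OF fin(1,2) disj refl])
  have iXY: "ideal XY (series_ring c ?V)" unfolding XY_eq by (intro ideal_Int pullback_ideal zero_ideal sub)
  have XY0: "\<forall>g\<in>XY. g {#} = 0" using pullback_constant_term[OF Z0, of c ?V xs] by (auto simp: XY_eq)
  have hXY: "\<forall>g\<in>XY. \<forall>d. hcomp d g \<in> XY"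
    using hcomp_pullback[OF hcomp_zero_ideal, of c ?V xs] hcomp_pullback[OF hcomp_zero_ideal, of c ?V ys] unfolding XY_eq by blast
  have Fpb: "gen_fun (betti c ?V (quotient_module R (pullback c ?V xs I'))) = ?P ^ n * s" "gen_fun (betti c ?V (quotient_module R (pullback c ?V ys J'))) = ?P ^ m * s'"
    by (simp_all add: R s_def s'_def A B poincare_pullback[OF fin(3) sub(1) I I0 grI] poincare_pullback[OF fin(3) sub(2) J J0 grJ] diff card)
  \<comment> \<open>Below, \<open>Q\<close> counts the sets of variables that meet both \<open>xs\<close> and \<open>ys\<close>.\<close>
  have f_eq: "fps_X * (f - ?P ^ n * s - ?P ^ m * s' + ?P ^ (m + n)) = ?P * Q"
    using poincare_fiber_product(1)[OF fin(1,2) disj refl I ordI J ordJ grI grJ]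
    unfolding R[symmetric] F[symmetric] Fpb f_def[symmetric] card Q_def by (simp add: algebra_simps)
  \<comment> \<open>The case of zero ideals.\<close>
  have p_eq: "fps_X ^ 2 * p = Q"
  proof -
    have "fps_X * (1 + fps_X * p) = ?P * Q - fps_X * (?P ^ (m + n) - ?P ^ n - ?P ^ m)"
      using poincare_fiber_product(2)[OF fin(1,2) disj refl zero_ideal _ zero_ideal _ hcomp_zero_ideal hcomp_zero_ideal, of c, where ?'k = 'k]
      gen_fun_betti_ideal[OF fin(3) iXY XY0 hXY]
      unfolding R[symmetric] XY_eq[symmetric] ZZ p_def[symmetric] card Q_def by (simp add: zero_fun_apply)
    moreover have "?P ^ (m + n) - ?P ^ n - ?P ^ m = Q - 1" by (simp add: Q_def algebra_simps power_add)
    ultimately have "fps_X * (1 + fps_X * p) = ?P * Q - fps_X * (Q - 1)" by simp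
    then show ?thesis by (simp add: algebra_simps power2_eq_square)
  qed
  have "?P ^ k \<noteq> 1" if "1 \<le> k" for k
  proof
    assume "?P ^ k = 1"
    then have "fps_nth (?P ^ k) 1 = fps_nth 1 1" by (rule arg_cong)
    then show False using that by (simp add: one_plus_X_power_nth)
  qed
  then have Q0: "Q \<noteq> 0" using m n by (simp add: Q_def)
  have t0: "t \<noteq> 0" by (simp add: t)
  have hom: "fps_to_fls ?P = 1 + t" by (simp add: t)
  have Qt: "fps_to_fls Q = ((1 + t) ^ m - 1) * ((1 + t) ^ n - 1)"
    by (simp add: Q_def fls_times_fps_to_fls fps_to_fls_power hom flip: hom)
  then have Qt0: "((1 + t) ^ m - 1) * ((1 + t) ^ n - 1) \<noteq> 0" using Q0 by (metis fps_to_fls_eq_0_iff)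
  have ft: "t * (fps_to_fls f - (1 + t) ^ n * fps_to_fls s - (1 + t) ^ m * fps_to_fls s' + (1 + t) ^ (m + n)) = (1 + t) * fps_to_fls Q"
    using arg_cong[OF f_eq, of fps_to_fls]
    by (simp add: fls_times_fps_to_fls fps_to_fls_power hom t)
  have pt: "t ^ 2 * fps_to_fls p = fps_to_fls Q"
    using arg_cong[OF p_eq, of fps_to_fls] by (simp add: fls_times_fps_to_fls fps_to_fls_power t)
  define D where "D = fps_to_fls f - (1 + t) ^ n * fps_to_fls s - (1 + t) ^ m * fps_to_fls s' + (1 + t) ^ (m + n)"
  have D: "t * D = (1 + t) * fps_to_fls Q" using ft by (simp add: D_def)
  then have "t * D = t * (t * (1 + t) * fps_to_fls p)" unfolding pt[symmetric] by (simp add: power2_eq_square mult_ac)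
  then have "D = t * (1 + t) * fps_to_fls p" using t0 by simp
  moreover have "fps_to_fls p \<noteq> 0" using pt Qt Qt0 by auto
  ultimately have 1: "D / fps_to_fls p = t * (1 + t)" by simp
  have 2: "D / (((1 + t) ^ m - 1) * ((1 + t) ^ n - 1)) = (t + 1) / t"
    using D Qt0 t0 unfolding Qt by (simp add: frac_eq_eq mult_ac add.commute)
  have "fps_to_fls (?P ^ k * g) = (1 + t) ^ k * fps_to_fls g" "fps_to_fls (?P ^ k) = (1 + t) ^ k" for k g
    by (simp_all add: fls_times_fps_to_fls fps_to_fls_power t)
  then show ?thesis
    using 1 2 unfolding poincare_series_gen_fun SS TT KK f_def[symmetric] s_def[symmetric] s'_def[symmetric] p_def[symmetric] D_def
    by simp
qed

end
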